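(* Let $k$ be an even positive integer, let $p\geq 5$ be a prime, and let $\Gamma$ be a congruence subgroup of $\Gamma_2=Sp_2(\mathbb{Z})$ of level $N$. Let $F\in M_k(\Gamma)$ be a Siegel modular form of degree $2$ and weight $k$ on $\Gamma$ whose Fourier coefficients are $p$-integral rational numbers, with Fourier expansion $$F(\tau,z,\tau')=\sum_{\substack{n,r,m\in\frac{1}{N}\mathbb{Z}\\ n,m,\,4nm-r^2\geq 0}}A(n,r,m)\,q^n\xi^r q'^m,\qquad q=e^{2\pi i\tau},\ \xi=e^{2\pi i z},\ q'=e^{2\pi i\tau'}.$$ If $A(n,r,m)\equiv 0\pmod p$ for all $n,r,m$ with $$0\leq n\leq \frac{k}{10}[\Gamma_2:\Gamma]\quad\text{and}\quad 0\leq m\leq \frac{k}{10}[\Gamma_2:\Gamma],$$ then $F\equiv 0\pmod p$, i.e. $A(n,r,m)\equiv 0\pmod p$ for all $n,r,m$.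
   Context: A Siegel modular form on $\Gamma$ is evaluated at $Z=\begin{pmatrix}\tau&z\\ z&\tau'\end{pmatrix}$ in the Siegel upper half-space of degree 2. "$p$-integral rational" means an element of $\mathbb{Z}_{(p)}=\mathbb{Z}_p\cap\mathbb{Q}$, and a congruence $a\equiv 0\pmod p$ for such $a$ means $a\in p\mathbb{Z}_{(p)}$. $[\Gamma_2:\Gamma]$ is the index of $\Gamma$ in $\Gamma_2$. *)

theory Defs
  imports "HOL-Analysis.Analysis" "HOL-Algebra.Coset"
begin

section \<open>The symplectic group of degree 2 over the integers\<close>

text \<open>
  Rows and columns of \<open>4 \<times> 4\<close> matrices are indexed by the sum type \<open>2 + 2\<close>, so that the
  \<open>2 \<times> 2\<close> blocks of \<open>(A, B; C, D)\<close> are selected by \<open>Inl\<close> and \<open>Inr\<close>.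
\<close>

type_synonym mat4 = "int ^ (2 + 2) ^ (2 + 2)"

definition block_A :: "mat4 \<Rightarrow> complex ^ 2 ^ 2"
  where "block_A M = (\<chi> i j. of_int (M $ Inl i $ Inl j))"

definition block_B :: "mat4 \<Rightarrow> complex ^ 2 ^ 2"
  where "block_B M = (\<chi> i j. of_int (M $ Inl i $ Inr j))"

definition block_C :: "mat4 \<Rightarrow> complex ^ 2 ^ 2"
  where "block_C M = (\<chi> i j. of_int (M $ Inr i $ Inl j))"

definition block_D :: "mat4 \<Rightarrow> complex ^ 2 ^ 2"
  where "block_D M = (\<chi> i j. of_int (M $ Inr i $ Inr j))"

definition symp_J :: mat4
  where "symp_J = (\<chi> i j. case (i, j) of
      (Inl a, Inr b) \<Rightarrow> if a = b then 1 else 0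
    | (Inr a, Inl b) \<Rightarrow> if a = b then - 1 else 0
    | _ \<Rightarrow> 0)"

definition Sp2Z :: "mat4 monoid"
  where "Sp2Z = \<lparr> carrier = {M. transpose M ** symp_J ** M = symp_J}, mult = (**), one = mat 1 \<rparr>"

lemma sum_UNIV_Plus:
  fixes f :: "'a::finite + 'b::finite \<Rightarrow> 'c::comm_monoid_add"
  shows "sum f UNIV = (\<Sum>a\<in>UNIV. f (Inl a)) + (\<Sum>b\<in>UNIV. f (Inr b))"
  by (subst UNIV_Plus_UNIV[symmetric], subst sum.Plus) auto

lemma symp_J_nth:
  "symp_J $ Inl a $ Inl b = 0"
  "symp_J $ Inl a $ Inr b = (if a = b then 1 else 0)"
  "symp_J $ Inr a $ Inl b = (if a = b then - 1 else 0)"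
  "symp_J $ Inr a $ Inr b = 0"
  by (simp_all add: symp_J_def)

lemma symp_J_square: "symp_J ** symp_J = - mat 1"
proof -
  have "(symp_J ** symp_J) $ i $ j = (- mat 1 :: mat4) $ i $ j" for i j
  proof (cases i; cases j)
  qed (simp_all add: matrix_matrix_mult_def mat_def sum_UNIV_Plus symp_J_nth if_distrib
      if_distribR cong: if_cong)
  then show ?thesis
    by (simp add: vec_eq_iff)
qed

lemma int_matrix_left_right_inverse:
  fixes A B :: "int ^ 'n ^ 'n"
  assumes "A ** B = mat 1"
  shows "B ** A = mat 1"
proof -
  let ?r = "map_matrix real_of_int :: int ^ 'n ^ 'n \<Rightarrow> _"
  have hom: "?r (X ** Y) = ?r X ** ?r Y" for X Y
    by (simp add: vec_eq_iff matrix_matrix_mult_def)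
  have one: "?r (mat 1) = mat 1"
    by (simp add: vec_eq_iff mat_def)
  have "?r A ** ?r B = mat 1"
    using assms hom one by metis
  then have "?r (B ** A) = ?r (mat 1)"
    unfolding hom one using matrix_left_right_inverse by blast
  then show ?thesis
    by (simp add: vec_eq_iff)
qed

lemma mat_minus_mult:
  fixes X Y :: "int ^ 'n ^ 'n"
  shows "(- X) ** Y = - (X ** Y)" and "X ** (- Y) = - (X ** Y)"
  by (simp_all add: vec_eq_iff matrix_matrix_mult_def sum_negf)

lemma group_Sp2Z: "group Sp2Z"
proof (rule groupI)
  fix M L assume "M \<in> carrier Sp2Z" "L \<in> carrier Sp2Z"
  then have M: "transpose M ** symp_J ** M = symp_J"
    and L: "transpose L ** symp_J ** L = symp_J"
    by (simp_all add: Sp2Z_def)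
  have "transpose (M ** L) ** symp_J ** (M ** L)
      = transpose L ** (transpose M ** symp_J ** M) ** L"
    by (simp add: matrix_transpose_mul matrix_mul_assoc)
  then show "M \<otimes>\<^bsub>Sp2Z\<^esub> L \<in> carrier Sp2Z"
    using M L by (simp add: Sp2Z_def)
next
  fix M assume "M \<in> carrier Sp2Z"
  then have M: "transpose M ** symp_J ** M = symp_J"
    by (simp add: Sp2Z_def)
  define L where "L = - (symp_J ** transpose M ** symp_J)"
  have "L ** M = - (symp_J ** (transpose M ** symp_J ** M))"
    by (simp add: L_def mat_minus_mult matrix_mul_assoc)
  then have inv_left: "L ** M = mat 1"
    by (simp add: M symp_J_square)
  then have inv_right: "M ** L = mat 1"
    by (rule int_matrix_left_right_inverse)
  have "transpose L ** symp_J ** L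
      = transpose L ** (transpose M ** symp_J ** M) ** L"
    by (simp add: M)
  also have "\<dots> = transpose (M ** L) ** symp_J ** (M ** L)"
    by (simp add: matrix_transpose_mul matrix_mul_assoc)
  finally have "transpose L ** symp_J ** L = symp_J"
    by (simp add: inv_right)
  with inv_left show "\<exists>y\<in>carrier Sp2Z. y \<otimes>\<^bsub>Sp2Z\<^esub> M = \<one>\<^bsub>Sp2Z\<^esub>"
    by (auto simp: Sp2Z_def)
qed (auto simp: Sp2Z_def matrix_mul_assoc)

definition principal_congruence_subgroup :: "nat \<Rightarrow> mat4 set"
  where "principal_congruence_subgroup N =
    {M \<in> carrier Sp2Z. \<forall>i j. int N dvd M $ i $ j - mat 1 $ i $ j}"

definition congruence_subgroup :: "mat4 set \<Rightarrow> nat \<Rightarrow> bool"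
  where "congruence_subgroup \<Gamma> N \<longleftrightarrow>
    N > 0 \<and> subgroup \<Gamma> Sp2Z \<and> principal_congruence_subgroup N \<subseteq> \<Gamma>"

definition Sp2Z_index :: "mat4 set \<Rightarrow> nat"
  where "Sp2Z_index \<Gamma> = card (rcosets\<^bsub>Sp2Z\<^esub> \<Gamma>)"


section \<open>Siegel modular forms of degree 2\<close>

definition siegel_point :: "complex \<Rightarrow> complex \<Rightarrow> complex \<Rightarrow> complex ^ 2 ^ 2"
  where "siegel_point \<tau> z \<tau>' = vector [vector [\<tau>, z], vector [z, \<tau>']]"

definition siegel_upper_half_space :: "(complex ^ 2 ^ 2) set"
  where "siegel_upper_half_space =
    {Z. transpose Z = Z \<and> (\<forall>v :: real ^ 2. v \<noteq> 0 \<longrightarrow> v \<bullet> (map_matrix Im Z *v v) > 0)}"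

definition siegel_action :: "mat4 \<Rightarrow> complex ^ 2 ^ 2 \<Rightarrow> complex ^ 2 ^ 2"
  where "siegel_action M Z =
    (block_A M ** Z + block_B M) ** matrix_inv (block_C M ** Z + block_D M)"

text \<open>
  Holomorphy in the three variables \<open>\<tau>\<close>, \<open>z\<close>, \<open>\<tau>'\<close>: the Frechet derivative exists at every point
  and is complex linear.
\<close>

definition siegel_holomorphic :: "(complex ^ 2 ^ 2 \<Rightarrow> complex) \<Rightarrow> bool"
  where "siegel_holomorphic F \<longleftrightarrow>
    (\<forall>\<tau> z \<tau>'. siegel_point \<tau> z \<tau>' \<in> siegel_upper_half_space \<longrightarrow>
      (\<exists>a b c. ((\<lambda>(\<tau>, z, \<tau>'). F (siegel_point \<tau> z \<tau>')) has_derivative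
         (\<lambda>(u, v, w). a * u + b * v + c * w)) (at (\<tau>, z, \<tau>'))))"

text \<open>
  In degree 2 no growth condition at the cusps is imposed: it is automatic by the Koecher
  principle.  Values of \<open>F\<close> outside the upper half-space are irrelevant.
\<close>

definition siegel_modular_form :: "nat \<Rightarrow> mat4 set \<Rightarrow> (complex ^ 2 ^ 2 \<Rightarrow> complex) \<Rightarrow> bool"
  where "siegel_modular_form k \<Gamma> F \<longleftrightarrow>
    siegel_holomorphic F \<and>
    (\<forall>M\<in>\<Gamma>. \<forall>Z\<in>siegel_upper_half_space.
      F (siegel_action M Z) = det (block_C M ** Z + block_D M) ^ k * F Z)"

definition fourier_index :: "nat \<Rightarrow> (real \<times> real \<times> real) set"
  where "fourier_index N = {(n, r, m).
    real N * n \<in> \<int> \<and> real N * r \<in> \<int> \<and> real N * m \<in> \<int> \<and>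
    n \<ge> 0 \<and> m \<ge> 0 \<and> 4 * n * m - r\<^sup>2 \<ge> 0}"

definition has_fourier_expansion ::
    "(complex ^ 2 ^ 2 \<Rightarrow> complex) \<Rightarrow> nat \<Rightarrow> (real \<Rightarrow> real \<Rightarrow> real \<Rightarrow> complex) \<Rightarrow> bool"
  where "has_fourier_expansion F N A \<longleftrightarrow>
    (\<forall>\<tau> z \<tau>'. siegel_point \<tau> z \<tau>' \<in> siegel_upper_half_space \<longrightarrow>
      ((\<lambda>(n, r, m). A n r m *
          exp (2 * of_real pi * \<i> * (of_real n * \<tau> + of_real r * z + of_real m * \<tau>')))
        has_sum F (siegel_point \<tau> z \<tau>')) (fourier_index N))"


section \<open>Rational numbers integral at \<open>p\<close>\<close>

definition p_integral :: "nat \<Rightarrow> complex set"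
  where "p_integral p = {of_int a / of_int b | a b. \<not> int p dvd b}"

definition cong_zero_mod :: "complex \<Rightarrow> nat \<Rightarrow> bool"
  where "cong_zero_mod x p \<longleftrightarrow> (\<exists>y\<in>p_integral p. x = of_nat p * y)"

end

theory Submission
  imports Defs "HOL-Complex_Analysis.Complex_Analysis"
begin

text \<open>
  Let \<open>F\<^sub>c\<close> run over the conjugates \<open>F | c\<close> of \<open>F\<close> along the cosets of \<open>\<Gamma>\<close>, and let \<open>\<nu>\<close> be the index.
  The coefficients \<open>G\<^sub>i\<close> of \<open>\<Prod>\<^sub>c (X - F\<^sub>c)\<close> are forms of level one and weight \<open>i k\<close>, and
  \<open>\<Sum>\<^sub>i G\<^sub>i F^(\<nu> - i) = 0\<close>.  After a \<open>\<rat>\<close>-linear projection \<open>\<complex> \<rightarrow> \<rat>\<close> and scaling by a power of \<open>p\<close>, the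
  coefficients of all \<open>G\<^sub>i\<close> are \<open>p\<close>-integral but not all of them vanish modulo \<open>p\<close>.  Let \<open>j\<close> be the last
  index with \<open>G\<^sub>j\<close> nonzero modulo \<open>p\<close>.  If \<open>F\<close> is nonzero modulo \<open>p\<close>, a power of \<open>F\<close> can be cancelled and
  \<open>G\<^sub>j \<equiv> - F (\<dots>)\<close>; so \<open>G\<^sub>j\<close> vanishes modulo \<open>p\<close> on the box of the Sturm bound of level one, hence vanishes.

  The bound in level one, valid for coefficients in an arbitrary \<open>\<int>\<^sub>(\<^sub>p\<^sub>)\<close>-submodule \<open>L\<close> of \<open>\<complex>\<close>, comes from the
  Fourier-Jacobi expansion.  A Jacobi form of weight \<open>w\<close> and index \<open>m\<close> is \<open>\<Sum>\<^sub>j\<^sub>\<le>\<^sub>m f\<^sub>j a^j b^(m - j)\<close> with the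
  generators \<open>a\<close>, \<open>b\<close> of index \<open>1\<close> and weights \<open>-2\<close>, \<open>0\<close> and elliptic modular forms \<open>f\<^sub>j\<close> of weight \<open>w + 2 j\<close>,
  so it has all its coefficients in \<open>L\<close> as soon as those with \<open>12 n \<le> w + 2 m\<close> are.  If \<open>m\<close> is minimal
  such that the \<open>m\<close>-th Fourier-Jacobi coefficient is not in \<open>L\<close>, the symmetry in \<open>(n, m)\<close> gives \<open>n \<ge> m\<close> for
  every coefficient outside \<open>L\<close>, whence \<open>12 m \<le> w + 2 m\<close>, that is \<open>10 m \<le> w\<close>.
\<close>

section \<open>Fourier coefficients of periodic holomorphic functions\<close>

text \<open>The conjugates of F carry no arithmetic: a priori their coefficients are arbitrary
  complex numbers. Hence the freedom in L. If f is the projection, the L of all x with p^e f(x) in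
  Z_(p) turns the level one bound into bounded denominators, since finitely many coefficients supply
  e; the L of all x with p^e f(x) in p Z_(p) turns it into the congruence. As F has rational
  coefficients, f commutes with multiplication by F and keeps the relation between the G_i intact.
  The bound k/10 times the index is the level one bound for the largest weight k \<nu>. Evenness of
  k gives the symmetries under exchange of \<tau> and \<tau>' and under z -> -z. The condition p >=
  5 pays for denominators made of 2 and 3: 1728 in Delta, 12 in b, 4 in the value of a at a half
  period. All elliptic input flows from one infinite product for a. The coefficients of log a at z =
  0 give E_4 and E_6, the values of a at the points of order 2 give 1/Delta up to a constant, and
  uniqueness of functions of given index with prescribed zeros gives the behaviour of a and b under
  inversion.\<close>

definition ee :: "complex \<Rightarrow> complex"
  where "ee x = exp (2 * of_real pi * \<i> * x)"

lemma ee_add: "ee (x + y) = ee x * ee y"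
  by (simp add: ee_def exp_add[symmetric] algebra_simps)

lemma ee_diff: "ee (x - y) = ee x / ee y"
  by (simp add: ee_def exp_diff[symmetric] algebra_simps)

lemma ee_minus: "ee (- x) = inverse (ee x)"
  by (simp add: ee_def exp_minus[symmetric] algebra_simps)

lemma ee_0 [simp]: "ee 0 = 1"
  by (simp add: ee_def)

lemma ee_nonzero [simp]: "ee x \<noteq> 0"
  by (simp add: ee_def)

lemma norm_ee: "norm (ee x) = exp (- 2 * pi * Im x)"
  by (simp add: ee_def)

lemma ee_of_int [simp]: "ee (of_int n) = 1"
  by (simp add: ee_def exp_eq_1)

lemma ee_1 [simp]: "ee 1 = 1"
  using ee_of_int[of 1] by simp

lemma ee_of_nat [simp]: "ee (of_nat n) = 1"
  using ee_of_int[of "int n"] by simp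

lemma ee_of_nat_mult: "ee (of_nat n * x) = ee x ^ n"
  by (simp add: ee_def exp_of_nat_mult[symmetric] algebra_simps)

lemma ee_eq_1_iff: "ee x = 1 \<longleftrightarrow> (\<exists>n::int. x = of_int n)"
proof
  assume "ee x = 1"
  then obtain n :: int where "Re (2 * of_real pi * \<i> * x) = 0"
    "Im (2 * of_real pi * \<i> * x) = of_int (2 * n) * pi"
    by (auto simp: ee_def exp_eq_1)
  then have "x = of_int n"
    by (simp add: complex_eq_iff)
  then show "\<exists>n::int. x = of_int n" by blast
qed auto

lemma ee_half: "ee (1 / 2) = - 1"
  by (simp add: ee_def mult.commute)

lemma holomorphic_ee [holomorphic_intros]: "f holomorphic_on S \<Longrightarrow> (\<lambda>x. ee (f x)) holomorphic_on S"
  unfolding ee_def by (intro holomorphic_intros)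

lemma continuous_on_ee [continuous_intros]: "continuous_on S f \<Longrightarrow> continuous_on S (\<lambda>x. ee (f x))"
  unfolding ee_def by (intro continuous_intros)

lemma has_field_derivative_ee: "(ee has_field_derivative (2 * of_real pi * \<i> * ee x)) (at x within S)"
  unfolding ee_def by (auto intro!: derivative_eq_intros)

lemma ee_surj:
  assumes "q \<noteq> 0" obtains x where "ee x = q" "Im x = - ln (norm q) / (2 * pi)"
proof
  show "ee (Ln q / (2 * of_real pi * \<i>)) = q"
    using assms by (simp add: ee_def)
  have "Im (Ln q / (2 * of_real pi * \<i>)) = - Re (Ln q) / (2 * pi)"
    by (simp add: Im_divide power2_eq_square)
  then show "Im (Ln q / (2 * of_real pi * \<i>)) = - ln (norm q) / (2 * pi)"
    using assms by simp
qed

text \<open>The base point \<open>w\<close> stays a parameter: coefficients of a holomorphic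
  periodic function do not depend on it, so it can be raised, lowered or translated to obtain bounds
  and symmetries.\<close>

definition fc :: "complex \<Rightarrow> int \<Rightarrow> (complex \<Rightarrow> complex) \<Rightarrow> complex"
  where "fc w n f = integral {0..1} (\<lambda>x::real. f (w + of_real x) * ee (- of_int n * (w + of_real x)))"

lemma continuous_on_hline:
  assumes "continuous_on {t. Im t > h} f" "Im w > h"
  shows "continuous_on {0..1} (\<lambda>x::real. f (w + of_real x))"
  by (rule continuous_on_compose2[OF assms(1)]) (use assms(2) in \<open>auto intro!: continuous_intros\<close>)

lemma open_upper [simp]: "open {t. Im t > h}"
  using open_halfspace_Im_gt[of h] by simp

lemma convex_upper [simp]: "convex {t. Im t > h}"
  using convex_halfspace_Im_gt[of h] by simp

lemma has_vector_derivative_hline: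
  assumes "(f has_field_derivative D) (at (w + of_real x))"
  shows "((\<lambda>x. f (w + of_real x)) has_vector_derivative D) (at x within S)"
proof -
  have "((\<lambda>x. w + of_real x) has_vector_derivative 1) (at x)"
    by (auto intro!: derivative_eq_intros)
  from field_vector_diff_chain_at[OF this assms] show ?thesis
    by (simp add: o_def has_vector_derivative_at_within)
qed

text \<open>Differentiating under the integral sign in the base point gives the integral of f' over
  a period, which is 0, and the half-plane is connected.\<close>

lemma period_integral_const:
  assumes hol: "f holomorphic_on {t. Im t > h}"
    and per: "\<And>t. Im t > h \<Longrightarrow> f (t + 1) = f t"
    and w: "Im w > h" "Im w' > h"
  shows "integral {0..1} (\<lambda>x::real. f (w + of_real x)) = integral {0..1} (\<lambda>x::real. f (w' + of_real x))"
proof -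
  let ?U = "{t. Im t > h}"
  have hol': "deriv f holomorphic_on ?U"
    by (rule holomorphic_deriv[OF hol]) simp
  have der: "(f has_field_derivative deriv f t) (at t)" if "t \<in> ?U" for t
    using holomorphic_derivI[OF hol _ that] by simp
  have D: "((\<lambda>w. integral (cbox 0 1) (\<lambda>x::real. f (w + of_real x))) has_field_derivative 0) (at w within ?U)"
    if "w \<in> ?U" for w
  proof -
    have 1: "((\<lambda>w. integral (cbox 0 1) (\<lambda>x::real. f (w + of_real x))) has_field_derivative
        integral (cbox 0 1) (\<lambda>x::real. deriv f (w + of_real x))) (at w within ?U)"
    proof (rule leibniz_rule_field_derivative)
      fix x :: complex and t :: real assume "x \<in> ?U" "t \<in> cbox 0 1"
      then show "((\<lambda>x. f (x + of_real t)) has_field_derivative deriv f (x + of_real t)) (at x within ?U)"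
        using der[of "x + of_real t"]
        by (auto intro!: has_field_derivative_at_within simp: DERIV_shift)
    next
      fix x assume "x \<in> ?U"
      then show "(\<lambda>t::real. f (x + of_real t)) integrable_on cbox 0 1"
        using integrable_continuous_interval[OF continuous_on_hline[OF holomorphic_on_imp_continuous_on[OF hol], of x]]
        by simp
    next
      show "continuous_on (?U \<times> cbox 0 1) (\<lambda>(x, t::real). deriv f (x + of_real t))"
        unfolding split_beta
        by (rule continuous_on_compose2[OF holomorphic_on_imp_continuous_on[OF hol']])
           (auto intro!: continuous_intros)
    qed (use that in auto)
    have "((\<lambda>x::real. deriv f (w + of_real x)) has_integral (f (w + of_real 1) - f (w + of_real 0))) {0..1}"
    proof (rule fundamental_theorem_of_calculus)
      fix x :: real assume "x \<in> {0..1}"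
      show "((\<lambda>x. f (w + of_real x)) has_vector_derivative deriv f (w + of_real x)) (at x within {0..1})"
        by (rule has_vector_derivative_hline) (use der that in simp)
    qed simp
    then have "integral (cbox 0 1) (\<lambda>x::real. deriv f (w + of_real x)) = 0"
      using per[of w] that by (simp add: integral_unique)
    with 1 show ?thesis by simp
  qed
  obtain c where "\<forall>w\<in>?U. integral (cbox 0 1) (\<lambda>x::real. f (w + of_real x)) = c"
    using has_field_derivative_zero_constant[of ?U "\<lambda>w. integral (cbox 0 1) (\<lambda>x::real. f (w + of_real x))"] D
    by auto
  then show ?thesis using w by simp
qed

lemma fc_indep:
  assumes hol: "f holomorphic_on {t. Im t > h}"
    and per: "\<And>t. Im t > h \<Longrightarrow> f (t + 1) = f t"
    and w: "Im w > h" "Im w' > h"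
  shows "fc w n f = fc w' n f"
  unfolding fc_def
proof (rule period_integral_const[where h=h, OF _ _ w])
  show "(\<lambda>a. f a * ee (- of_int n * a)) holomorphic_on {t. h < Im t}"
    by (intro holomorphic_intros hol)
  show "f (t + 1) * ee (- of_int n * (t + 1)) = f t * ee (- of_int n * t)" if "Im t > h" for t
    using per[OF that] by (simp add: ring_distribs ee_diff)
qed

lemma fc_bound:
  assumes "continuous_on {0..1} (\<lambda>x::real. f (w + of_real x))"
    and "\<And>x::real. x \<in> {0..1} \<Longrightarrow> norm (f (w + of_real x)) \<le> B"
  shows "norm (fc w n f) \<le> B * exp (2 * pi * of_int n * Im w)"
proof -
  have "norm (fc w n f) \<le> (B * exp (2 * pi * of_int n * Im w)) * (1 - 0)"
    unfolding fc_def
  proof (rule integral_bound)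
    show "continuous_on {0..1} (\<lambda>x::real. f (w + of_real x) * ee (- of_int n * (w + of_real x)))"
      by (intro continuous_intros assms(1))
    fix x :: real assume "x \<in> {0..1}"
    then show "norm (f (w + of_real x) * ee (- of_int n * (w + of_real x))) \<le> B * exp (2 * pi * of_int n * Im w)"
      using assms(2)[of x] by (simp add: norm_mult norm_ee mult.assoc)
  qed simp
  then show ?thesis by simp
qed

lemma fc_const: "fc w n (\<lambda>_. c) = (if n = 0 then c else 0)"
proof (cases "n = 0")
  case True then show ?thesis by (simp add: fc_def)
next
  case False
  let ?k = "2 * of_real pi * \<i> * (- of_int n) :: complex"
  have k: "?k \<noteq> 0" using False by simp
  let ?F = "\<lambda>t. c * ee (- of_int n * t) / ?k"
  have F: "(?F has_field_derivative c * ee (- of_int n * t)) (at t)" for t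
    unfolding ee_def by (rule derivative_eq_intros refl | use k in simp)+
  have "((\<lambda>x::real. c * ee (- of_int n * (w + of_real x))) has_integral
      (?F (w + of_real 1) - ?F (w + of_real 0))) {0..1}"
  proof (rule fundamental_theorem_of_calculus)
    fix x :: real assume "x \<in> {0..1}"
    show "((\<lambda>x. ?F (w + of_real x)) has_vector_derivative (c * ee (- of_int n * (w + of_real x)))) (at x within {0..1})"
      by (rule has_vector_derivative_hline[OF F])
  qed simp
  moreover have "?F (w + of_real 1) = ?F (w + of_real 0)"
    by (simp add: ring_distribs ee_diff)
  ultimately have "((\<lambda>x::real. c * ee (- of_int n * (w + of_real x))) has_integral 0) {0..1}"
    by (simp only: diff_self)
  from integral_unique[OF this] show ?thesis
    using False by (simp add: fc_def)
qed

lemma integral_sums_uniform: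
  fixes g :: "nat \<Rightarrow> real \<Rightarrow> complex"
  assumes "\<And>n. continuous_on {0..1} (g n)"
    and "uniform_limit {0..1} (\<lambda>N x. \<Sum>n<N. g n x) G sequentially"
  shows "(\<lambda>n. integral {0..1} (g n)) sums integral {0..1} G"
proof -
  obtain I J where I: "\<And>N. ((\<lambda>x. \<Sum>n<N. g n x) has_integral I N) {0..1}"
    and J: "(G has_integral J) {0..1}" and lim: "I \<longlonglongrightarrow> J"
    by (rule uniform_limit_integral[OF assms(2)]) (auto intro!: continuous_on_sum assms(1))
  have "I N = (\<Sum>n<N. integral {0..1} (g n))" for N
    using I[of N] integral_sum[of "{..<N}" g "{0..1}"] assms(1)
    by (simp add: integrable_continuous_interval integral_unique)
  then have "I = (\<lambda>N. \<Sum>n<N. integral {0..1} (g n))" by blast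
  then show ?thesis using lim J by (simp add: sums_def integral_unique)
qed

text \<open>Termwise integration of a geometric series. It serves for the Cauchy kernel on a line
  below \<tau>, expanded in e(\<tau> - t), and on a line above, expanded in e(t - \<tau>).\<close>

lemma integral_geometric_kernel:
  fixes f :: "real \<Rightarrow> complex"
  assumes f: "continuous_on {0..1} f" and g: "continuous_on {0..1} g"
    and r: "\<And>x. x \<in> {0..1} \<Longrightarrow> norm (g x) \<le> r" "r < 1"
  shows "(\<lambda>n. integral {0..1} (\<lambda>x. f x * g x ^ n)) sums integral {0..1} (\<lambda>x. f x / (1 - g x))"
proof (rule integral_sums_uniform)
  show "continuous_on {0..1} (\<lambda>x. f x * g x ^ n)" for n
    by (intro continuous_intros f g)
  obtain B where B: "\<And>x. x \<in> {0..1} \<Longrightarrow> norm (f x) \<le> B"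
    using compact_imp_bounded[OF compact_continuous_image[OF f]] by (force simp: bounded_iff)
  have r0: "r \<ge> 0" using r(1)[of 0] norm_ge_zero[of "g 0"] by (metis atLeastAtMost_iff order_trans zero_le_one order_refl)
  have "uniform_limit {0..1} (\<lambda>N x. \<Sum>n<N. f x * g x ^ n) (\<lambda>x. suminf (\<lambda>n. f x * g x ^ n)) sequentially"
  proof (rule Weierstrass_m_test)
    show "summable (\<lambda>n. B * r ^ n)" using r r0 by (intro summable_mult summable_geometric) auto
    fix n x assume "x \<in> {0..1::real}"
    then show "norm (f x * g x ^ n) \<le> B * r ^ n"
      using r(1)[of x] B[of x] r0 order_trans[OF norm_ge_zero B[of x]]
      unfolding norm_mult norm_power by (intro mult_mono power_mono) auto
  qed
  also have "?this \<longleftrightarrow> uniform_limit {0..1} (\<lambda>N x. \<Sum>n<N. f x * g x ^ n) (\<lambda>x. f x / (1 - g x)) sequentially"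
  proof (rule uniform_limit_cong')
    fix x assume "x \<in> {0..1::real}"
    then have "norm (g x) < 1" using r by (meson le_less_trans)
    then show "suminf (\<lambda>n. f x * g x ^ n) = f x / (1 - g x)"
      by (simp add: suminf_mult suminf_geometric summable_geometric)
  qed auto
  finally show "uniform_limit {0..1} (\<lambda>N x. \<Sum>n<N. f x * g x ^ n) (\<lambda>x. f x / (1 - g x)) sequentially" .
qed

text \<open>Cauchy's formula on a horizontal strip, with the periodic kernel \<open>1 / (1 - e(\<tau> - t))\<close>.\<close>

lemma periodic_strip_integrals:
  assumes hol: "f holomorphic_on {t. Im t > h}"
    and per: "\<And>t. Im t > h \<Longrightarrow> f (t + 1) = f t"
    and w: "h < Im w" "Im w < Im \<tau>" "Im \<tau> < Im w'"
  defines "I \<equiv> \<lambda>w g. integral {0..1} (\<lambda>x::real. g (w + of_real x) / (1 - ee (\<tau> - (w + of_real x))))"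
  shows "I w f - f \<tau> * I w (\<lambda>_. 1) = I w' f - f \<tau> * I w' (\<lambda>_. 1)"
proof -
  \<comment> \<open>The quotient \<open>K\<close> has removable singularities at the points \<tau> +
    n: numerator and denominator vanish there with slopes f'(\<tau>) and 2 \<pi> i.\<close>
  define d where "d = deriv f \<tau> / (2 * of_real pi * \<i>)"
  define K where "K = (\<lambda>t. if ee (\<tau> - t) = 1 then d else (f t - f \<tau>) / (1 - ee (\<tau> - t)))"
  let ?U = "{t. Im t > h}"
  have \<tau>: "\<tau> \<in> ?U" using w by simp
  have perK: "K (t + 1) = K t" if "t \<in> ?U" for t
    using that per[of t] by (simp add: K_def diff_add_eq_diff_diff_swap[symmetric] ee_diff ee_add)
  have perK_int: "K (t + of_int n) = K t" if "t \<in> ?U" for t n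
  proof (induction n rule: int_induct[of _ 0])
    case (step1 i)
    then show ?case using perK[of "t + of_int i"] that by (simp add: add.assoc)
  next
    case (step2 i)
    then show ?case using perK[of "t + of_int (i - 1)"] that by (simp add: algebra_simps)
  qed simp
  have lim: "(K \<longlongrightarrow> K \<tau>) (at \<tau>)"
  proof -
    have 1: "((\<lambda>t. (f t - f \<tau>) / (t - \<tau>)) \<longlongrightarrow> deriv f \<tau>) (at \<tau>)"
      using holomorphic_derivI[OF hol _ \<tau>] by (simp add: has_field_derivative_iff)
    have "((\<lambda>t. 1 - ee (\<tau> - t)) has_field_derivative 2 * of_real pi * \<i>) (at \<tau>)"
      unfolding ee_def by (auto intro!: derivative_eq_intros)
    then have 2: "((\<lambda>t. (1 - ee (\<tau> - t)) / (t - \<tau>)) \<longlongrightarrow> 2 * of_real pi * \<i>) (at \<tau>)"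
      by (simp add: has_field_derivative_iff)
    have 3: "((\<lambda>t. ((f t - f \<tau>) / (t - \<tau>)) / ((1 - ee (\<tau> - t)) / (t - \<tau>))) \<longlongrightarrow> d) (at \<tau>)"
      unfolding d_def by (rule tendsto_divide[OF 1 2]) simp
    have ev: "eventually (\<lambda>t. ((f t - f \<tau>) / (t - \<tau>)) / ((1 - ee (\<tau> - t)) / (t - \<tau>)) = K t) (at \<tau>)"
    proof -
      have "eventually (\<lambda>t. t \<in> ball \<tau> 1 - {\<tau>}) (at \<tau>)"
        using eventually_at_ball'[of 1 \<tau> UNIV] by (auto elim: eventually_mono)
      then show ?thesis
      proof (rule eventually_mono)
        fix t assume t: "t \<in> ball \<tau> 1 - {\<tau>}"
        have "ee (\<tau> - t) \<noteq> 1"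
        proof
          assume "ee (\<tau> - t) = 1"
          then obtain n :: int where n: "\<tau> - t = of_int n" using ee_eq_1_iff by blast
          have "norm (\<tau> - t) < 1" using t by (simp add: dist_norm)
          then have "n = 0" using n by simp
          then show False using n t by simp
        qed
        then show "((f t - f \<tau>) / (t - \<tau>)) / ((1 - ee (\<tau> - t)) / (t - \<tau>)) = K t"
          using t by (simp add: K_def)
      qed
    qed
    have "K \<tau> = d" by (simp add: K_def)
    then show ?thesis using Lim_transform_eventually[OF 3 ev] by simp
  qed
  have loc: "K holomorphic_on (?U - {t. ee (\<tau> - t) = 1})"
  proof -
    have "(\<lambda>t. (f t - f \<tau>) / (1 - ee (\<tau> - t))) holomorphic_on (?U - {t. ee (\<tau> - t) = 1})"
      by (intro holomorphic_intros holomorphic_on_subset[OF hol]) auto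
    then show ?thesis
      by (rule holomorphic_transform) (auto simp: K_def)
  qed
  have op: "open (?U - {t. ee (\<tau> - t) = 1})"
  proof (rule open_Diff)
    show "closed {t. ee (\<tau> - t) = 1}"
      by (intro closed_Collect_eq continuous_intros)
  qed simp
  have diff\<tau>: "K field_differentiable at \<tau>"
  proof -
    obtain e where e: "e > 0" "ball \<tau> e \<subseteq> ?U" "e < 1"
    proof -
      obtain e where "e > 0" "ball \<tau> e \<subseteq> ?U" using \<tau> open_upper openE by blast
      then show ?thesis using that[of "min e (1/2)"] by (auto simp: subset_iff)
    qed
    have sub: "ball \<tau> e - {\<tau>} \<subseteq> ?U - {t. ee (\<tau> - t) = 1}"
    proof
      fix t assume t: "t \<in> ball \<tau> e - {\<tau>}"
      have "ee (\<tau> - t) \<noteq> 1"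
      proof
        assume "ee (\<tau> - t) = 1"
        then obtain n :: int where n: "\<tau> - t = of_int n" using ee_eq_1_iff by blast
        have "norm (\<tau> - t) < 1" using t e by (simp add: dist_norm)
        then have "n = 0" using n by simp
        then show False using n t by simp
      qed
      then show "t \<in> ?U - {t. ee (\<tau> - t) = 1}" using t e by auto
    qed
    have "continuous_on (ball \<tau> e) K"
    proof (rule continuous_at_imp_continuous_on, rule ballI)
      fix t assume t: "t \<in> ball \<tau> e"
      show "isCont K t"
      proof (cases "t = \<tau>")
        case True then show ?thesis using lim by (simp add: isCont_def)
      next
        case False
        then have "t \<in> ?U - {t. ee (\<tau> - t) = 1}" using sub t by auto
        then show ?thesis
          using holomorphic_on_imp_continuous_on[OF loc] op continuous_on_eq_continuous_at by blast
      qed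
    qed
    then have "K holomorphic_on ball \<tau> e"
      by (rule no_isolated_singularity[where K="{\<tau>}"])
         (use holomorphic_on_subset[OF loc sub] in auto)
    then show ?thesis using e(1) by (simp add: holomorphic_on_imp_differentiable_at)
  qed
  have holK: "K holomorphic_on ?U"
    unfolding holomorphic_on_def
  proof
    fix t assume t: "t \<in> ?U"
    have "K field_differentiable at t"
    proof (cases "ee (\<tau> - t) = 1")
      case False
      then have "t \<in> ?U - {t. ee (\<tau> - t) = 1}" using t by simp
      then show ?thesis using loc op holomorphic_on_imp_differentiable_at by blast
    next
      case True
      then obtain n :: int where n: "\<tau> = t + of_int n" using ee_eq_1_iff[of "\<tau> - t"] by (auto simp: algebra_simps)
      have "(K has_field_derivative deriv K \<tau>) (at (t + of_int n))"
        using diff\<tau> n by (simp add: DERIV_deriv_iff_field_differentiable)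
      then have "((\<lambda>t. K (t + of_int n)) has_field_derivative deriv K \<tau>) (at t)"
        by (simp add: DERIV_shift)
      then have "(K has_field_derivative deriv K \<tau>) (at t)"
        by (rule has_field_derivative_transform_within_open[where S="?U"])
           (use t perK_int in auto)
      then show ?thesis by (auto simp: field_differentiable_def)
    qed
    then show "K field_differentiable at t within ?U"
      by (rule field_differentiable_at_within)
  qed
  have line: "integral {0..1} (\<lambda>x::real. K (v + of_real x)) = I v f - f \<tau> * I v (\<lambda>_. 1)"
    if v: "Im v > h" "Im v \<noteq> Im \<tau>" for v
  proof -
    have ne: "ee (\<tau> - (v + of_real x)) \<noteq> 1" for x :: real
    proof
      assume "ee (\<tau> - (v + of_real x)) = 1"
      then obtain n :: int where "\<tau> - (v + of_real x) = of_int n" using ee_eq_1_iff by blast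
      then have "Im (\<tau> - (v + of_real x)) = 0" by simp
      then show False using v by simp
    qed
    have c1: "continuous_on {0..1} (\<lambda>x::real. f (v + of_real x) / (1 - ee (\<tau> - (v + of_real x))))"
      by (intro continuous_intros continuous_on_hline[OF holomorphic_on_imp_continuous_on[OF hol] v(1)]) (use ne in auto)
    have c2: "continuous_on {0..1} (\<lambda>x::real. 1 / (1 - ee (\<tau> - (v + of_real x))))"
      by (intro continuous_intros) (use ne in auto)
    have "integral {0..1} (\<lambda>x::real. K (v + of_real x)) =
       integral {0..1} (\<lambda>x::real. f (v + of_real x) / (1 - ee (\<tau> - (v + of_real x)))
         - f \<tau> * (1 / (1 - ee (\<tau> - (v + of_real x)))))"
      using ne by (simp add: K_def diff_divide_distrib)
    also have "\<dots> = I v f - f \<tau> * I v (\<lambda>_. 1)"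
      unfolding I_def integral_mult_right[symmetric]
      by (rule integral_diff)
         (auto intro!: integrable_continuous_interval c1 continuous_on_mult_left[OF c2] simp del: times_divide_eq_right)
    finally show ?thesis .
  qed
  have "integral {0..1} (\<lambda>x::real. K (w + of_real x)) = integral {0..1} (\<lambda>x::real. K (w' + of_real x))"
    by (rule period_integral_const[OF holK]) (use perK w in auto)
  then show ?thesis using line[of w] line[of w'] w by simp
qed

text \<open>On a line below \<tau> the Cauchy kernel expands in nonnegative powers of e(\<tau>),
  above it in negative ones, and there \<open>neg\<close> makes every term vanish. The level
  \<open>h\<close> may be negative, so that entire functions are covered too.\<close>

lemma periodic_power_series:
  assumes hol: "f holomorphic_on {t. Im t > h}"
    and per: "\<And>t. Im t > h \<Longrightarrow> f (t + 1) = f t"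
    and neg: "\<And>n. n < 0 \<Longrightarrow> fc w0 n f = 0" and w0: "Im w0 > h" and \<tau>: "Im \<tau> > h"
  shows "(\<lambda>n. fc w0 (int n) f * ee (of_nat n * \<tau>)) sums f \<tau>"
proof -
  define w where "w = Complex 0 ((h + Im \<tau>) / 2)"
  define w' where "w' = Complex 0 (Im \<tau> + 1)"
  have w: "h < Im w" "Im w < Im \<tau>" "Im \<tau> < Im w'" using \<tau> by (auto simp: w_def w'_def)
  define I where "I = (\<lambda>w g. integral {0..1} (\<lambda>x::real. g (w + of_real x) / (1 - ee (\<tau> - (w + of_real x)))))"
  have main: "I w f - f \<tau> * I w (\<lambda>_. 1) = I w' f - f \<tau> * I w' (\<lambda>_. 1)"
    unfolding I_def by (rule periodic_strip_integrals[OF hol per w])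
  have low: "(\<lambda>n. fc w (int n) g * ee (of_nat n * \<tau>)) sums I w g"
    if g: "continuous_on {0..1} (\<lambda>x::real. g (w + of_real x))" for g
  proof -
    have "(\<lambda>n. integral {0..1} (\<lambda>x::real. g (w + of_real x) * ee (\<tau> - (w + of_real x)) ^ n)) sums I w g"
      unfolding I_def
      by (rule integral_geometric_kernel[where r="exp (- 2 * pi * (Im \<tau> - Im w))"])
         (use w in \<open>auto intro!: continuous_intros g simp: norm_ee\<close>)
    moreover have "integral {0..1} (\<lambda>x::real. g (w + of_real x) * ee (\<tau> - (w + of_real x)) ^ n)
        = fc w (int n) g * ee (of_nat n * \<tau>)" for n
      unfolding fc_def integral_mult_left[symmetric]
      by (intro integral_cong) (simp add: ee_of_nat_mult[symmetric] mult.assoc ee_add[symmetric] algebra_simps)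
    ultimately show ?thesis by simp
  qed
  have high: "I w' g = 0"
    if g: "continuous_on {0..1} (\<lambda>x::real. g (w' + of_real x))" and z: "\<And>n. n < 0 \<Longrightarrow> fc w' n g = 0" for g
  proof -
    have "(\<lambda>n. integral {0..1} (\<lambda>x::real. g (w' + of_real x) * ee ((w' + of_real x) - \<tau>) * ee ((w' + of_real x) - \<tau>) ^ n))
        sums integral {0..1} (\<lambda>x::real. g (w' + of_real x) * ee ((w' + of_real x) - \<tau>) / (1 - ee ((w' + of_real x) - \<tau>)))"
      by (rule integral_geometric_kernel[where r="exp (- 2 * pi * (Im w' - Im \<tau>))"])
         (use w in \<open>auto intro!: continuous_intros g simp: norm_ee\<close>)
    moreover have "integral {0..1} (\<lambda>x::real. g (w' + of_real x) * ee ((w' + of_real x) - \<tau>) * ee ((w' + of_real x) - \<tau>) ^ n)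
        = fc w' (- int (Suc n)) g * ee (- of_nat (Suc n) * \<tau>)" for n
      unfolding fc_def integral_mult_left[symmetric]
      by (intro integral_cong) (simp add: ee_of_nat_mult[symmetric] mult.assoc ee_add[symmetric] algebra_simps)
    ultimately have "(\<lambda>n::nat. 0::complex) sums integral {0..1} (\<lambda>x::real. g (w' + of_real x) * ee ((w' + of_real x) - \<tau>) / (1 - ee ((w' + of_real x) - \<tau>)))"
      using z by simp
    then have "integral {0..1} (\<lambda>x::real. g (w' + of_real x) * ee ((w' + of_real x) - \<tau>) / (1 - ee ((w' + of_real x) - \<tau>))) = 0"
      using sums_unique2 sums_zero by blast
    moreover have "g (w' + of_real x) * ee ((w' + of_real x) - \<tau>) / (1 - ee ((w' + of_real x) - \<tau>))
      = - (g (w' + of_real x) / (1 - ee (\<tau> - (w' + of_real x))))" for x :: real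
    proof -
      have "norm (ee ((w' + of_real x) - \<tau>)) < 1" using w by (simp add: norm_ee)
      then have 1: "ee ((w' + of_real x) - \<tau>) \<noteq> 1" by auto
      have 2: "ee (\<tau> - (w' + of_real x)) = inverse (ee ((w' + of_real x) - \<tau>))"
        using ee_minus[of "(w' + of_real x) - \<tau>"] by simp
      show ?thesis unfolding 2 using 1 by (simp add: field_simps)
    qed
    ultimately show ?thesis by (simp add: I_def)
  qed
  have cf: "continuous_on {0..1} (\<lambda>x::real. f (v + of_real x))" if "Im v > h" for v
    using continuous_on_hline[OF holomorphic_on_imp_continuous_on[OF hol] that] .
  have "I w' f = 0"
    by (rule high) (use cf[of w'] w neg fc_indep[OF hol per, of w' w0] w0 in auto)
  \<comment> \<open>The same two expansions, applied to the constant function 1, normalise the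
    kernel.\<close>
  moreover have "I w' (\<lambda>_. 1) = 0"
    by (rule high) (auto simp: fc_const)
  moreover have "I w (\<lambda>_. 1) = 1"
  proof -
    have "(\<lambda>n. fc w (int n) (\<lambda>_. 1) * ee (of_nat n * \<tau>)) sums I w (\<lambda>_. 1)"
      by (rule low) auto
    moreover have "(\<lambda>n. fc w (int n) (\<lambda>_. 1) * ee (of_nat n * \<tau>)) = (\<lambda>n. if n = 0 then 1 else 0)"
      by (auto simp: fc_const fun_eq_iff)
    ultimately show ?thesis using sums_unique2 sums_single[of 0 "\<lambda>_. 1::complex"] by auto
  qed
  ultimately have "I w f = f \<tau>" using main by simp
  then show ?thesis using low[of f] cf[of w] w fc_indep[OF hol per, of w w0] w0 by simp
qed

section \<open>Integrals depending on a complex parameter\<close>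

abbreviation uhp :: "complex set"
  where "uhp \<equiv> {t. Im t > 0}"

lemma deriv_circle_integral:
  assumes hol: "f holomorphic_on cball x0 r" and x: "x \<in> ball x0 r"
  shows "(f has_field_derivative
     integral {0..1} (\<lambda>s. of_real r * ee (of_real s) * f (x0 + of_real r * ee (of_real s)) / (x0 + of_real r * ee (of_real s) - x)\<^sup>2)) (at x)"
proof -
  have "(f has_field_derivative (1 / (2 * of_real pi * \<i>) * contour_integral (circlepath x0 r) (\<lambda>u. f u / (u - x)^2))) (at x)"
    by (rule Cauchy_derivative_integral_circlepath(2)[OF holomorphic_on_imp_continuous_on[OF hol] _ x])
       (rule holomorphic_on_subset[OF hol], auto)
  moreover have "1 / (2 * of_real pi * \<i>) * contour_integral (circlepath x0 r) (\<lambda>u. f u / (u - x)^2) =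
     integral {0..1} (\<lambda>s. of_real r * ee (of_real s) * f (x0 + of_real r * ee (of_real s)) / (x0 + of_real r * ee (of_real s) - x)\<^sup>2)"
    unfolding contour_integral_integral vector_derivative_circlepath integral_mult_right[symmetric]
    by (intro integral_cong) (simp add: circlepath_def part_circlepath_def linepath_def ee_def field_simps)
  ultimately show ?thesis by simp
qed

text \<open>Leibniz's rule wants a jointly continuous derivative. Cauchy's formula on a small circle
  writes the derivative as an integral of f itself, so joint continuity of f is enough.\<close>

lemma holomorphic_integral:
  fixes f :: "complex \<Rightarrow> real \<Rightarrow> complex"
  assumes U: "open U" and cont: "continuous_on (U \<times> {0..1}) (\<lambda>(x, t). f x t)"
    and hol: "\<And>t. t \<in> {0..1} \<Longrightarrow> (\<lambda>x. f x t) holomorphic_on U"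
  shows "(\<lambda>x. integral {0..1} (f x)) holomorphic_on U"
proof -
  have "\<exists>T. open T \<and> x0 \<in> T \<and> (\<lambda>x. integral {0..1} (f x)) holomorphic_on T" if x0: "x0 \<in> U" for x0
  proof -
    obtain r where r: "r > 0" "cball x0 r \<subseteq> U" using U x0 open_contains_cball by blast
    define fx where "fx = (\<lambda>x t. integral {0..1} (\<lambda>s. of_real r * ee (of_real s) * f (x0 + of_real r * ee (of_real s)) t / (x0 + of_real r * ee (of_real s) - x)\<^sup>2))"
    have "(\<lambda>x. integral (cbox 0 1) (f x)) holomorphic_on ball x0 r"
    proof (rule leibniz_rule_holomorphic)
      fix x t assume x: "x \<in> ball x0 r" and t: "t \<in> cbox 0 (1::real)"
      have "((\<lambda>x. f x t) has_field_derivative fx x t) (at x)"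
        unfolding fx_def by (rule deriv_circle_integral[OF holomorphic_on_subset[OF hol] x]) (use t r in auto)
      then show "((\<lambda>x. f x t) has_field_derivative fx x t) (at x within ball x0 r)"
        by (rule has_field_derivative_at_within)
    next
      fix x assume "x \<in> ball x0 r"
      then have "x \<in> U" using r by auto
      then have "continuous_on {0..1} (f x)"
        by (intro continuous_on_compose2[OF cont, where f="\<lambda>t. (x, t)", simplified]) (auto intro!: continuous_intros)
      then show "f x integrable_on cbox 0 1" by (simp add: integrable_continuous_interval)
    next
      have sph: "x0 + of_real r * ee (of_real s) \<in> U" for s :: real
        using r by (intro subsetD[OF r(2)]) (auto simp: dist_norm norm_mult norm_ee)
      have ne: "x0 + of_real r * ee (of_real s) - x \<noteq> 0" if "x \<in> ball x0 r" for s :: real and x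
      proof
        assume "x0 + of_real r * ee (of_real s) - x = 0"
        then have "x = x0 + of_real r * ee (of_real s)" by (simp add: algebra_simps)
        then have "dist x0 x = r" using r by (simp add: dist_norm norm_mult norm_ee)
        then show False using that by simp
      qed
      have "continuous_on ((ball x0 r \<times> cbox 0 1) \<times> cbox 0 1)
         (\<lambda>(y, s::real). of_real r * ee (of_real s) * f (x0 + of_real r * ee (of_real s)) (snd y) / (x0 + of_real r * ee (of_real s) - fst y)\<^sup>2)"
        unfolding split_beta
        by (intro continuous_intros
             continuous_on_compose2[OF cont, where f="\<lambda>y. (x0 + of_real r * ee (of_real (snd y)), snd (fst y))", simplified])
           (use sph ne in \<open>auto simp del: right_minus_eq\<close>)
      from integral_continuous_on_param[OF this]
      show "continuous_on (ball x0 r \<times> cbox 0 1) (\<lambda>(x, t). fx x t)"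
        by (simp add: fx_def split_beta)
    qed simp
    then show ?thesis using r by (intro exI[of _ "ball x0 r"]) auto
  qed
  then have "\<forall>x\<in>U. \<exists>T. open T \<and> x \<in> T \<and> (\<lambda>x. integral {0..1} (f x)) holomorphic_on T" by blast
  then have "(\<lambda>x. integral {0..1} (f x)) analytic_on U"
    unfolding analytic_on_def
    by (metis (no_types, lifting) holomorphic_on_subset openE)
  then show ?thesis by (rule analytic_imp_holomorphic)
qed

lemma continuous_on_integral_param:
  fixes f :: "'a::topological_space \<Rightarrow> real \<Rightarrow> complex"
  assumes "continuous_on (U \<times> {0..1}) (\<lambda>(x, t). f x t)"
  shows "continuous_on U (\<lambda>x. integral {0..1} (f x))"
  using integral_continuous_on_param[of U 0 1 f] assms by simp

section \<open>Expansions in the nome\<close>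

text \<open>Convergence in the whole unit disc, centre included, encodes holomorphy at the cusp; the
  values of \<open>f\<close> outside the upper half-plane stay free.\<close>

definition qexp :: "(complex \<Rightarrow> complex) \<Rightarrow> complex fps \<Rightarrow> bool"
  where "qexp f C \<longleftrightarrow> fps_conv_radius C \<ge> 1 \<and> (\<forall>\<tau>. Im \<tau> > 0 \<longrightarrow> f \<tau> = eval_fps C (ee \<tau>))"

lemma norm_ee_less_1: "Im \<tau> > 0 \<Longrightarrow> norm (ee \<tau>) < 1"
  by (simp add: norm_ee)

lemma less_fps_conv_radius: "fps_conv_radius C \<ge> 1 \<Longrightarrow> norm z < 1 \<Longrightarrow> ereal (norm z) < fps_conv_radius C"
  by (rule less_le_trans[of _ 1]) (auto simp: one_ereal_def)

lemma qexpD: "qexp f C \<Longrightarrow> Im \<tau> > 0 \<Longrightarrow> f \<tau> = eval_fps C (ee \<tau>)"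
  by (simp add: qexp_def)

lemma qexp_sums:
  assumes "qexp f C" "Im \<tau> > 0"
  shows "(\<lambda>n. fps_nth C n * ee (of_nat n * \<tau>)) sums f \<tau>"
  using assms sums_eval_fps[of "ee \<tau>" C] less_fps_conv_radius[of C "ee \<tau>"] norm_ee_less_1[of \<tau>]
  by (simp add: qexp_def ee_of_nat_mult)

lemma qexpI_sums:
  assumes "\<And>\<tau>. Im \<tau> > 0 \<Longrightarrow> (\<lambda>n. fps_nth C n * ee (of_nat n * \<tau>)) sums f \<tau>"
  shows "qexp f C"
proof -
  have r: "fps_conv_radius C \<ge> 1"
    unfolding fps_conv_radius_def
  proof (rule conv_radius_geI_ex)
    fix r :: real assume r: "0 < r" "ereal r < 1"
    then have r1: "r < 1" by (simp add: one_ereal_def)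
    obtain \<tau> where \<tau>: "ee \<tau> = of_real r" "Im \<tau> = - ln (norm (of_real r :: complex)) / (2 * pi)"
      using ee_surj[of "of_real r"] r by auto
    have "Im \<tau> > 0" using \<tau>(2) r(1) r1 by (simp add: divide_neg_pos)
    from assms[OF this] have "summable (\<lambda>n. fps_nth C n * (of_real r) ^ n)"
      unfolding ee_of_nat_mult \<tau>(1) by (simp add: sums_iff)
    then show "\<exists>z. norm z = r \<and> summable (\<lambda>n. fps_nth C n * z ^ n)"
      using r by (intro exI[of _ "of_real r"]) auto
  qed
  moreover have "f \<tau> = eval_fps C (ee \<tau>)" if "Im \<tau> > 0" for \<tau>
    using assms[OF that] sums_unique by (simp add: eval_fps_def ee_of_nat_mult sums_iff)
  ultimately show ?thesis by (simp add: qexp_def)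
qed

lemma qexp_const: "qexp (\<lambda>_. c) (fps_const c)"
  by (simp add: qexp_def)

lemma qexp_1: "qexp (\<lambda>_. 1) 1"
  by (simp add: qexp_def)

lemma qexp_eval_less: "qexp f C \<Longrightarrow> Im \<tau> > 0 \<Longrightarrow> ereal (norm (ee \<tau>)) < fps_conv_radius C"
  by (simp add: qexp_def less_fps_conv_radius norm_ee_less_1)

lemma qexp_binop:
  assumes "qexp f C" "qexp g D" and r: "min (fps_conv_radius C) (fps_conv_radius D) \<le> fps_conv_radius E"
    and e: "\<And>z. ereal (norm z) < fps_conv_radius C \<Longrightarrow> ereal (norm z) < fps_conv_radius D \<Longrightarrow>
        eval_fps E z = h (eval_fps C z) (eval_fps D z)"
  shows "qexp (\<lambda>\<tau>. h (f \<tau>) (g \<tau>)) E"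
  unfolding qexp_def
proof (intro conjI allI impI)
  have "1 \<le> min (fps_conv_radius C) (fps_conv_radius D)" using assms(1,2) by (simp add: qexp_def)
  then show "1 \<le> fps_conv_radius E" using r by (rule order_trans)
  fix \<tau> assume \<tau>: "Im \<tau> > 0"
  show "h (f \<tau>) (g \<tau>) = eval_fps E (ee \<tau>)"
    unfolding qexpD[OF assms(1) \<tau>] qexpD[OF assms(2) \<tau>]
    by (rule e[symmetric]) (rule qexp_eval_less[OF assms(1) \<tau>], rule qexp_eval_less[OF assms(2) \<tau>])
qed

lemma qexp_add: "qexp f C \<Longrightarrow> qexp g D \<Longrightarrow> qexp (\<lambda>\<tau>. f \<tau> + g \<tau>) (C + D)"
  by (erule (1) qexp_binop) (auto simp: eval_fps_add fps_conv_radius_add)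

lemma qexp_diff: "qexp f C \<Longrightarrow> qexp g D \<Longrightarrow> qexp (\<lambda>\<tau>. f \<tau> - g \<tau>) (C - D)"
  by (erule (1) qexp_binop) (auto simp: eval_fps_diff fps_conv_radius_diff)

lemma qexp_mult: "qexp f C \<Longrightarrow> qexp g D \<Longrightarrow> qexp (\<lambda>\<tau>. f \<tau> * g \<tau>) (C * D)"
  by (erule (1) qexp_binop) (auto simp: eval_fps_mult fps_conv_radius_mult)

lemma qexp_power: "qexp f C \<Longrightarrow> qexp (\<lambda>\<tau>. f \<tau> ^ n) (C ^ n)"
  by (induction n) (auto intro: qexp_mult qexp_1)

lemma qexp_sum: "(\<And>i. i \<in> I \<Longrightarrow> qexp (f i) (C i)) \<Longrightarrow> qexp (\<lambda>\<tau>. \<Sum>i\<in>I. f i \<tau>) (\<Sum>i\<in>I. C i)"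
  using qexp_const[of 0] by (induction I rule: infinite_finite_induct) (auto intro: qexp_add)

lemma qexp_cmult: "qexp f C \<Longrightarrow> qexp (\<lambda>\<tau>. c * f \<tau>) (fps_const c * C)"
  using qexp_mult[OF qexp_const] .

lemma qexp_cong: "(\<And>\<tau>. Im \<tau> > 0 \<Longrightarrow> f \<tau> = g \<tau>) \<Longrightarrow> qexp f C \<longleftrightarrow> qexp g C"
  by (auto simp: qexp_def)

text \<open>Every nonzero q in the disc is some e(\<tau>), so the two sums agree on the punctured
  disc, and continuity adds q = 0.\<close>

lemma qexp_unique:
  assumes "qexp f C" "qexp f D" shows "C = D"
proof (rule eval_fps_eqD)
  have eq: "eval_fps C q = eval_fps D q" if q: "q \<in> ball 0 1 - {0}" for q
  proof -
    obtain \<tau> where \<tau>: "ee \<tau> = q" "Im \<tau> = - ln (norm q) / (2 * pi)"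
      using ee_surj[of q] q by auto
    have "Im \<tau> > 0" using \<tau>(2) q by (simp add: divide_neg_pos)
    then show ?thesis using qexpD[OF assms(1), of \<tau>] qexpD[OF assms(2), of \<tau>] \<tau>(1) by simp
  qed
  have c: "continuous (at 0) (eval_fps E)" if "fps_conv_radius E \<ge> 1" for E :: "complex fps"
    using that less_fps_conv_radius[of E 0] by (intro continuous_eval_fps) auto
  have C: "fps_conv_radius C \<ge> 1" "fps_conv_radius D \<ge> 1" using assms by (auto simp: qexp_def)
  have ev: "eventually (\<lambda>q. eval_fps C q = eval_fps D q) (at 0)"
    using eventually_at_ball'[of 1 0 UNIV] eq by (auto elim!: eventually_mono)
  have "(eval_fps C \<longlongrightarrow> eval_fps C 0) (at 0)" "(eval_fps D \<longlongrightarrow> eval_fps D 0) (at 0)"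
    using c[OF C(1)] c[OF C(2)] by (auto simp: continuous_at)
  then have "eval_fps C 0 = eval_fps D 0"
    using Lim_transform_eventually[OF _ ev] tendsto_unique trivial_limit_at by metis
  then have "eval_fps C q = eval_fps D q" if "q \<in> ball 0 1" for q
    using eq that by (cases "q = 0") auto
  then show "eventually (\<lambda>q. eval_fps C q = eval_fps D q) (nhds 0)"
    using eventually_nhds_in_open[of "ball 0 1" 0] by (auto elim!: eventually_mono)
qed (use assms in \<open>auto simp: qexp_def intro: less_le_trans[of 0 1]\<close>)

lemma qexp_holomorphic: assumes "qexp f C" shows "f holomorphic_on uhp"
proof -
  have "(\<lambda>\<tau>. eval_fps C (ee \<tau>)) holomorphic_on uhp"
  proof (rule holomorphic_on_compose_gen[of ee uhp "eval_fps C" "eball 0 (fps_conv_radius C)", unfolded o_def])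
    show "ee holomorphic_on uhp" by (intro holomorphic_intros)
    show "eval_fps C holomorphic_on eball 0 (fps_conv_radius C)" by (rule holomorphic_on_eval_fps) simp
    show "ee ` uhp \<subseteq> eball 0 (fps_conv_radius C)" using qexp_eval_less[OF assms] by auto
  qed
  then show ?thesis by (rule holomorphic_transform) (use assms in \<open>auto simp: qexp_def\<close>)
qed

lemma qexp_periodic: "qexp f C \<Longrightarrow> Im \<tau> > 0 \<Longrightarrow> f (\<tau> + 1) = f \<tau>"
  by (simp add: qexp_def ee_add)

lemma qexp_bounded:
  assumes "qexp f C" "h > 0" shows "\<exists>B. \<forall>\<tau>. Im \<tau> \<ge> h \<longrightarrow> norm (f \<tau>) \<le> B"
proof -
  define r where "r = exp (- 2 * pi * h)"
  have r: "r < 1" using assms(2) by (simp add: r_def)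
  have "continuous_on (cball 0 r) (eval_fps C)"
    by (intro continuous_on_eval_fps continuous_on_subset[OF continuous_on_eval_fps])
       (use assms(1) r in \<open>auto simp: qexp_def intro!: less_fps_conv_radius\<close>)
  then have "bounded (eval_fps C ` cball 0 r)"
    by (intro compact_imp_bounded compact_continuous_image) auto
  then obtain B where B: "\<And>q. q \<in> cball 0 r \<Longrightarrow> norm (eval_fps C q) \<le> B"
    by (force simp: bounded_iff)
  have "norm (f \<tau>) \<le> B" if "Im \<tau> \<ge> h" for \<tau>
  proof -
    have "norm (ee \<tau>) \<le> r" using that by (simp add: norm_ee r_def)
    then show ?thesis using B[of "ee \<tau>"] assms that by (simp add: qexp_def)
  qed
  then show ?thesis by blast
qed

text \<open>A coefficient of index n < 0 is at most B exp(2 \<pi> n y) at every height y >= 1, and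
  this tends to 0 as y grows.\<close>

lemma qexp_of_bounded:
  assumes hol: "f holomorphic_on uhp" and per: "\<And>t. Im t > 0 \<Longrightarrow> f (t + 1) = f t"
    and bd: "\<And>t. Im t \<ge> 1 \<Longrightarrow> norm (f t) \<le> B"
  shows "qexp f (Abs_fps (\<lambda>n. fc \<i> (int n) f))"
proof (rule qexpI_sums)
  have neg: "fc \<i> n f = 0" if n: "n < 0" for n
  proof -
    have le: "norm (fc \<i> n f) \<le> B * exp (2 * pi * of_int n) ^ Suc m" for m
    proof -
      let ?w = "Complex 0 (real (Suc m))"
      have "fc \<i> n f = fc ?w n f" by (rule fc_indep[OF hol per]) auto
      moreover have "norm (fc ?w n f) \<le> B * exp (2 * pi * of_int n * Im ?w)"
        by (rule fc_bound) (use continuous_on_hline[OF holomorphic_on_imp_continuous_on[OF hol], of ?w] bd in auto)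
      moreover have "exp (2 * pi * of_int n * Im ?w) = exp (2 * pi * of_int n) ^ Suc m"
        by (subst exp_of_nat_mult[symmetric]) (simp add: algebra_simps)
      ultimately show ?thesis by simp
    qed
    have "(\<lambda>m. B * exp (2 * pi * of_int n) ^ Suc m) \<longlonglongrightarrow> B * 0"
      by (intro tendsto_intros filterlim_compose[OF LIMSEQ_realpow_zero filterlim_Suc])
         (use n in \<open>auto simp: mult_pos_neg\<close>)
    then have "norm (fc \<i> n f) \<le> 0"
      by (intro tendsto_lowerbound[of "\<lambda>m. B * exp (2 * pi * of_int n) ^ Suc m" 0 sequentially])
         (use le in auto)
    then show ?thesis by simp
  qed
  fix \<tau> :: complex assume "Im \<tau> > 0"
  from periodic_power_series[OF hol per neg _ this]
  show "(\<lambda>n. fps_nth (Abs_fps (\<lambda>n. fc \<i> (int n) f)) n * ee (of_nat n * \<tau>)) sums f \<tau>" by simp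
qed

lemma fc_qexp:
  assumes "qexp f C" "Im w > 0" shows "fc w (int n) f = fps_nth C n"
proof -
  obtain B where B: "\<And>t. Im t \<ge> 1 \<Longrightarrow> norm (f t) \<le> B" using qexp_bounded[OF assms(1), of 1] by auto
  have "qexp f (Abs_fps (\<lambda>n. fc \<i> (int n) f))"
    by (rule qexp_of_bounded[OF qexp_holomorphic[OF assms(1)] qexp_periodic[OF assms(1)] B])
  then have "C = Abs_fps (\<lambda>n. fc \<i> (int n) f)" using assms(1) qexp_unique by blast
  moreover have "fc w (int n) f = fc \<i> (int n) f"
    by (rule fc_indep[OF qexp_holomorphic[OF assms(1)] qexp_periodic[OF assms(1)]]) (use assms in auto)
  ultimately show ?thesis by simp
qed

section \<open>Modular forms of level one\<close>

text \<open>Translation and inversion generate the modular group, and boundedness on Im t >= 1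
  stands for holomorphy at the cusp. The weight is an integer because forms of negative weight occur
  in the arguments and have to be shown to vanish.\<close>

definition MF :: "int \<Rightarrow> (complex \<Rightarrow> complex) \<Rightarrow> bool"
  where "MF w f \<longleftrightarrow> f holomorphic_on uhp \<and> (\<forall>t. Im t > 0 \<longrightarrow> f (t + 1) = f t) \<and>
    (\<forall>t. Im t > 0 \<longrightarrow> f (- 1 / t) = t powi w * f t) \<and> (\<exists>B. \<forall>t. Im t \<ge> 1 \<longrightarrow> norm (f t) \<le> B)"

lemma Im_neg_inverse: "Im (- 1 / t) = Im t / (norm t)\<^sup>2"
  by (simp add: Im_divide cmod_power2)

lemma Im_neg_inverse_pos: "Im t > 0 \<Longrightarrow> Im (- 1 / t) > 0"
  unfolding Im_neg_inverse by (intro divide_pos_pos) auto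

lemma MF_qexp: assumes "MF w f" obtains C where "qexp f C"
  using assms qexp_of_bounded[of f] unfolding MF_def by blast

lemma MF_shift_int:
  assumes "MF w f" "Im t > 0" shows "f (t + of_int n) = f t"
proof (induction n rule: int_induct[of _ 0])
  case (step1 i)
  then show ?case using assms unfolding MF_def by (simp add: add.assoc[symmetric])
next
  case (step2 i)
  have "Im (t + of_int (i - 1)) > 0" using assms by simp
  then have "f ((t + of_int (i - 1)) + 1) = f (t + of_int (i - 1))" using assms unfolding MF_def by blast
  then show ?case using step2 by (simp add: algebra_simps)
qed simp

text \<open>The invariant function \<open>|f| y^{w/2}\<close> is bounded: among the points of height at least
  \<open>\<epsilon>\<close> where it is large, one of maximal height would be moved up by the inversion.\<close>

lemma MF_neg_bound:
  assumes f: "MF w f" and w: "w < 0"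
  obtains M where "\<And>t. Im t > 0 \<Longrightarrow> norm (f t) * Im t powr (w / 2) \<le> M"
proof -
  define h where "h = (\<lambda>t. norm (f t) * Im t powr (w / 2))"
  have hol: "f holomorphic_on uhp" using f by (simp add: MF_def)
  have hcont: "continuous_on uhp h"
    unfolding h_def by (intro continuous_intros holomorphic_on_imp_continuous_on hol) auto
  have hshift: "h (t + of_int n) = h t" if "Im t > 0" for t n
    using MF_shift_int[OF f that] by (simp add: h_def)
  have hinv: "h (- 1 / t) = h t" if t: "Im t > 0" for t
  proof -
    have nt: "norm t > 0" using t by auto
    have "norm (f (- 1 / t)) = norm t powr w * norm (f t)"
      using f t nt by (simp add: MF_def norm_mult norm_power_int powr_real_of_int')
    moreover have "(Im t / (norm t)\<^sup>2) powr (w / 2) = Im t powr (w / 2) / norm t powr w"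
    proof -
      have "((norm t)\<^sup>2) powr (w / 2) = norm t powr w"
        using nt powr_powr[of "norm t" 2 "w / 2"] by (simp add: powr_numeral)
      then show ?thesis using t nt by (simp add: powr_divide)
    qed
    ultimately show ?thesis using nt unfolding h_def Im_neg_inverse by simp
  qed
  obtain B where B: "\<And>t. Im t \<ge> 1 \<Longrightarrow> norm (f t) \<le> B" using f by (auto simp: MF_def)
  \<comment> \<open>Height 1/2 is the threshold: a point with |Re| <= 1/2 and Im <= 1/2 has squared
    modulus at most 1/2, so the inversion at least doubles its height.\<close>
  let ?K = "cbox (Complex (- 1/2) (1/2)) (Complex (1/2) 1)"
  have "compact (h ` ?K)"
    by (intro compact_continuous_image continuous_on_subset[OF hcont]) (auto simp: in_cbox_complex_iff)
  then obtain B' where B': "\<And>t. t \<in> ?K \<Longrightarrow> norm (h t) \<le> B'"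
    using compact_imp_bounded[of "h ` ?K"] unfolding bounded_iff by blast
  define M where "M = max (max B 0) B'"
  have red: "\<exists>n::int. \<bar>Re (t + of_int n)\<bar> \<le> 1/2" for t
    by (rule exI[of _ "- round (Re t)"]) (use of_int_round_abs_le[of "Re t"] in \<open>auto simp: abs_minus_commute algebra_simps\<close>)
  have high: "h t \<le> M" if t: "Im t \<ge> 1/2" for t
  proof (cases "Im t \<ge> 1")
    case True
    have "Im t powr (w / 2) \<le> Im t powr 0" by (rule powr_mono) (use True w in auto)
    then have "Im t powr (w / 2) \<le> 1" using True by simp
    then have "h t \<le> B * 1" unfolding h_def using B[OF True] by (intro mult_mono) (auto intro: order_trans[OF norm_ge_zero])
    then show ?thesis by (simp add: M_def)
  next
    case False
    obtain n :: int where n: "\<bar>Re (t + of_int n)\<bar> \<le> 1/2" using red by blast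
    have "- (1/2) \<le> Re (t + of_int n)" "Re (t + of_int n) \<le> 1/2" using n unfolding abs_le_iff by linarith+
    then have "t + of_int n \<in> ?K" using t False unfolding in_cbox_complex_iff by auto
    from B'[OF this] have "h (t + of_int n) \<le> B'" by simp
    then show ?thesis using hshift[of t n] t by (simp add: M_def)
  qed
  have "h t0 \<le> M" if t0: "Im t0 > 0" for t0
  proof (rule ccontr)
    assume big: "\<not> h t0 \<le> M"
    define S where "S = {t \<in> cbox (Complex (- 1/2) (Im t0)) (Complex (1/2) (1/2)). h t0 \<le> h t}"
    have S: "\<And>t. t \<in> S \<longleftrightarrow> \<bar>Re t\<bar> \<le> 1/2 \<and> Im t0 \<le> Im t \<and> Im t \<le> 1/2 \<and> h t0 \<le> h t"
      by (auto simp: S_def in_cbox_complex_iff abs_le_iff)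
    have "compact S"
    proof -
      let ?B = "cbox (Complex (- 1/2) (Im t0)) (Complex (1/2) (1/2))"
      have "continuous_on ?B h"
        by (rule continuous_on_subset[OF hcont]) (use t0 in \<open>auto simp: in_cbox_complex_iff\<close>)
      then have "closedin (top_of_set ?B) (?B \<inter> h -` {h t0..})"
        by (rule continuous_closedin_preimage) simp
      moreover have "?B \<inter> h -` {h t0..} = S" by (auto simp: S_def)
      ultimately show ?thesis using closedin_compact compact_cbox by metis
    qed
    moreover obtain n :: int where n: "\<bar>Re (t0 + of_int n)\<bar> \<le> 1/2" using red by blast
    have "Im t0 < 1/2" using high[of t0] big by linarith
    then have "t0 + of_int n \<in> S" using n hshift[OF t0, of n] by (simp add: S)
    ultimately obtain t1 where t1: "t1 \<in> S" and max: "\<And>t. t \<in> S \<Longrightarrow> Im t \<le> Im t1"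
      using continuous_attains_sup[of S Im] continuous_on_Im[OF continuous_on_id, of S]
      by (metis empty_iff id_apply)
    have t1p: "Im t1 > 0" using t1 t0 by (simp add: S)
    have "(Re t1)\<^sup>2 \<le> (1/2)\<^sup>2" "(Im t1)\<^sup>2 \<le> (1/2)\<^sup>2"
      using t1 t1p by (auto simp: S abs_le_square_iff[symmetric])
    then have n1: "(norm t1)\<^sup>2 \<le> 1/2" unfolding cmod_power2 by (simp add: power2_eq_square)
    define t2 where "t2 = - 1 / t1"
    have n1p: "(norm t1)\<^sup>2 > 0" using t1p by auto
    have "Im t2 = Im t1 / (norm t1)\<^sup>2" by (simp only: t2_def Im_neg_inverse)
    moreover have "Im t1 / (norm t1)\<^sup>2 \<ge> Im t1 / (1/2)"
      using n1 n1p t1p by (intro divide_left_mono) auto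
    ultimately have up: "Im t2 > Im t1" using t1p by simp
    have h2: "h t2 = h t1" using hinv[OF t1p] by (simp add: t2_def)
    obtain k :: int where k: "\<bar>Re (t2 + of_int k)\<bar> \<le> 1/2" using red by blast
    show False
    proof (cases "Im t2 \<le> 1/2")
      case True
      have "t2 + of_int k \<in> S" using k True up t1 h2 hshift[of t2 k] t1p by (simp add: S)
      from max[OF this] up show False by simp
    next
      case False
      then have "h t2 \<le> M" by (intro high) simp
      then show False using h2 t1 big by (simp add: S)
    qed
  qed
  then show ?thesis using that[of M] by (simp add: h_def)
qed

text \<open>Hecke's estimate on the line of height y bounds the n-th coefficient by M exp(2 \<pi> n
  y) y^(-w/2); as -w/2 > 0, this tends to 0 with y.\<close>

lemma MF_neg:
  assumes f: "MF w f" and w: "w < 0" and t: "Im t > 0"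
  shows "f t = 0"
proof -
  obtain M where M: "\<And>t. Im t > 0 \<Longrightarrow> norm (f t) * Im t powr (w / 2) \<le> M"
    using MF_neg_bound[OF f w] by blast
  obtain C where C: "qexp f C" using MF_qexp[OF f] .
  have hol: "f holomorphic_on uhp" using f by (simp add: MF_def)
  have M0: "M \<ge> 0" using order_trans[OF mult_nonneg_nonneg[OF norm_ge_zero powr_ge_zero] M[of \<i>]] by simp
  have "fps_nth C n = 0" for n
  proof -
    have le: "norm (fps_nth C n) \<le> M * exp (2 * pi * n) * (inverse (real (Suc m))) powr (- w / 2)" for m
    proof -
      define y where "y = inverse (real (Suc m))"
      have y: "y > 0" "y \<le> 1" by (auto simp: y_def inverse_le_1_iff)
      have "norm (fc (Complex 0 y) (int n) f) \<le> (M * y powr (- w / 2)) * exp (2 * pi * of_int (int n) * Im (Complex 0 y))"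
      proof (rule fc_bound)
        show "continuous_on {0..1} (\<lambda>x::real. f (Complex 0 y + of_real x))"
          by (rule continuous_on_hline[OF holomorphic_on_imp_continuous_on[OF hol]]) (use y in auto)
        fix x :: real
        have "norm (f (Complex 0 y + of_real x)) * y powr (w / 2) \<le> M"
          using M[of "Complex 0 y + of_real x"] y by simp
        then have "norm (f (Complex 0 y + of_real x)) \<le> M / y powr (w / 2)"
          using y by (simp add: pos_le_divide_eq)
        then show "norm (f (Complex 0 y + of_real x)) \<le> M * y powr (- w / 2)"
          using y by (simp add: powr_minus_divide)
      qed
      moreover have "exp (2 * pi * real n * y) \<le> exp (2 * pi * n)"
        using y by (simp add: mult_left_le)
      ultimately show ?thesis
        using fc_qexp[OF C, of "Complex 0 y" n] y M0 mult_left_mono[of "exp (2 * pi * real n * y)" "exp (2 * pi * n)" "M * y powr (- w / 2)"]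
        unfolding y_def[symmetric] by (simp add: algebra_simps)
    qed
    have "(\<lambda>m. (inverse (real (Suc m))) powr (- w / 2)) \<longlonglongrightarrow> 0"
      by (rule tendsto_zero_powrI[OF LIMSEQ_inverse_real_of_nat tendsto_const]) (use w in auto)
    from tendsto_mult_left[OF this, of "M * exp (2 * pi * n)"]
    have "(\<lambda>m. M * exp (2 * pi * n) * (inverse (real (Suc m))) powr (- w / 2)) \<longlonglongrightarrow> 0" by simp
    then have "norm (fps_nth C n) \<le> 0"
      by (rule tendsto_lowerbound) (use le in auto)
    then show ?thesis by simp
  qed
  then have "C = 0" by (simp add: fps_eq_iff)
  then show ?thesis using qexpD[OF C t] by simp
qed

section \<open>The basic Jacobi form of weight -2 and index 1\<close>

text \<open>This is -4 sin^2(\<pi> z). Even functions of period 1 become functions of \<sigma> =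
  \<open>ss z\<close>, so that the even Laurent polynomials in e(z) that occur turn into ordinary
  polynomials.\<close>

definition ss :: "complex \<Rightarrow> complex"
  where "ss z = ee z - 2 + ee (- z)"

lemma ss_alt: "ss z = (ee z - 1)\<^sup>2 / ee z"
  by (simp add: ss_def ee_minus field_simps power2_eq_square)

lemma ss_0 [simp]: "ss 0 = 0"
  by (simp add: ss_def)

lemma ss_minus [simp]: "ss (- z) = ss z"
  by (simp add: ss_def)

lemma ss_periodic [simp]: "ss (z + 1) = ss z"
  by (simp add: ss_def ee_add ee_diff)

lemma ss_half: "ss (z + 1 / 2) = - 4 - ss z"
proof -
  have "ee (- (z + 1 / 2)) = ee (- z) * ee (- (1 / 2))" by (simp add: ee_add[symmetric])
  also have "ee (- (1 / 2)) = - 1" by (simp add: ee_minus ee_half)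
  finally show ?thesis by (simp add: ss_def ee_add ee_half)
qed

lemma holomorphic_ss [holomorphic_intros]: "f holomorphic_on S \<Longrightarrow> (\<lambda>x. ss (f x)) holomorphic_on S"
  unfolding ss_def by (intro holomorphic_intros)

lemma continuous_on_ss [continuous_intros]: "continuous_on S f \<Longrightarrow> continuous_on S (\<lambda>x. ss (f x))"
  unfolding ss_def by (intro continuous_intros)

text \<open>Solve x + 1/x = \<sigma> + 2 with x = e(z). Consequently an identity valid at every
  \<open>ss z\<close> holds at every \<sigma> and can be read off polynomial coefficients.\<close>

lemma ss_surj: obtains z where "ss z = \<sigma>"
proof -
  define r where "r = csqrt ((\<sigma> + 2)\<^sup>2 - 4)"
  define x where "x = (\<sigma> + 2 + r) / 2"
  have r2: "r\<^sup>2 = (\<sigma> + 2)\<^sup>2 - 4" by (simp add: r_def)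
  have x: "x * x + 1 = (\<sigma> + 2) * x"
    using r2 by (simp add: x_def power2_eq_square field_simps)
  then have "x \<noteq> 0" by auto
  then obtain z where "ee z = x" using ee_surj by blast
  then have "ss z = \<sigma>" using x \<open>x \<noteq> 0\<close> by (simp add: ss_def ee_minus field_simps)
  then show ?thesis by (rule that)
qed

section \<open>Power series in q whose coefficients are polynomials in \<sigma>\<close>

definition ev :: "complex \<Rightarrow> complex poly fps \<Rightarrow> complex fps"
  where "ev \<sigma> Q = Abs_fps (\<lambda>n. poly (fps_nth Q n) \<sigma>)"

definition cp :: "complex fps \<Rightarrow> complex poly fps"
  where "cp C = Abs_fps (\<lambda>n. [:fps_nth C n:])"

lemma ev_nth [simp]: "fps_nth (ev \<sigma> Q) n = poly (fps_nth Q n) \<sigma>"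
  by (simp add: ev_def)

lemma cp_nth [simp]: "fps_nth (cp C) n = [:fps_nth C n:]"
  by (simp add: cp_def)

lemma ev_add: "ev \<sigma> (P + Q) = ev \<sigma> P + ev \<sigma> Q"
  and ev_diff: "ev \<sigma> (P - Q) = ev \<sigma> P - ev \<sigma> Q"
  and ev_1 [simp]: "ev \<sigma> 1 = 1"
  and ev_0 [simp]: "ev \<sigma> 0 = 0"
  and ev_const [simp]: "ev \<sigma> (fps_const p) = fps_const (poly p \<sigma>)"
  and ev_cp [simp]: "ev \<sigma> (cp C) = C"
  by (auto simp: fps_eq_iff)

lemma ev_mult: "ev \<sigma> (P * Q) = ev \<sigma> P * ev \<sigma> Q"
  by (auto simp: fps_eq_iff fps_mult_nth poly_sum)

lemma ev_power: "ev \<sigma> (P ^ n) = ev \<sigma> P ^ n"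
  by (induction n) (auto simp: ev_mult)

lemma ev_sum: "ev \<sigma> (\<Sum>i\<in>I. P i) = (\<Sum>i\<in>I. ev \<sigma> (P i))"
  by (induction I rule: infinite_finite_induct) (auto simp: ev_add)

lemma ev_prod: "ev \<sigma> (\<Prod>i\<in>I. P i) = (\<Prod>i\<in>I. ev \<sigma> (P i))"
  by (induction I rule: infinite_finite_induct) (auto simp: ev_mult)

lemma ev_eqD: "(\<And>\<sigma>. ev \<sigma> P = ev \<sigma> Q) \<Longrightarrow> P = Q"
  by (auto simp: fps_eq_iff poly_eq_poly_eq_iff[symmetric] fun_eq_iff)

section \<open>The infinite product\<close>

definition xq :: "nat \<Rightarrow> complex \<Rightarrow> complex"
  where "xq n q = q ^ Suc n / (1 - q ^ Suc n)\<^sup>2"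

text \<open>At \<sigma> = \<open>ss z\<close> the factors are (1 - q^n e(z)) (1 - q^n e(-z)) / (1 -
  q^n)^2 with n >= 1: Jacobi's product for the odd theta function, without its factor sin(\<pi> z)
  and normalised to 1 at z = 0.\<close>

definition kap :: "complex \<Rightarrow> complex \<Rightarrow> complex"
  where "kap q \<sigma> = (\<Prod>n. 1 - \<sigma> * xq n q)"

lemma one_minus_power_ge:
  assumes "norm (q::complex) \<le> r" "r < 1"
  shows "norm (1 - q ^ Suc n) \<ge> 1 - r"
proof -
  have "norm (q ^ Suc n) \<le> r ^ Suc n" using assms by (simp only: norm_power power_mono norm_ge_zero)
  also have "\<dots> \<le> r" using assms order_trans[OF norm_ge_zero assms(1)]
    by (simp add: mult_left_le power_le_one)
  finally show ?thesis using norm_triangle_ineq2[of 1 "q ^ Suc n"] by simp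
qed

lemma one_minus_power_nz: "norm (q::complex) < 1 \<Longrightarrow> 1 - q ^ Suc n \<noteq> 0"
  using one_minus_power_ge[of q "norm q" n] by auto

lemma norm_xq_le:
  assumes "norm q \<le> r" "r < 1"
  shows "norm (xq n q) \<le> r ^ Suc n / (1 - r)\<^sup>2"
proof -
  have "norm (q ^ Suc n) \<le> r ^ Suc n" using assms by (simp only: norm_power power_mono norm_ge_zero)
  moreover have "norm ((1 - q ^ Suc n)\<^sup>2) \<ge> (1 - r)\<^sup>2"
    using one_minus_power_ge[OF assms, of n] assms by (simp add: norm_power power_mono del: power_Suc)
  ultimately show ?thesis
    using assms order_trans[OF norm_ge_zero assms(1)] unfolding xq_def norm_divide
    by (intro frac_le zero_le_power) (auto simp del: power_Suc)
qed

lemma continuous_on_xq: "continuous_on (ball 0 1) (xq n)"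
  unfolding xq_def by (intro continuous_intros) (use one_minus_power_nz in \<open>auto simp del: power_Suc\<close>)

lemma holomorphic_xq: "xq n holomorphic_on ball 0 1"
  unfolding xq_def by (intro holomorphic_intros) (use one_minus_power_nz in \<open>auto simp del: power_Suc\<close>)

lemma kap_convergent:
  assumes "norm q < 1" shows "convergent_prod (\<lambda>n. 1 - \<sigma> * xq n q)"
proof -
  have "summable (\<lambda>n. norm ((1 - \<sigma> * xq n q) - 1))"
  proof (rule summable_comparison_test')
    show "summable (\<lambda>n. norm \<sigma> * (norm q ^ Suc n / (1 - norm q)\<^sup>2))"
      by (intro summable_mult summable_divide summable_ignore_initial_segment[of _ 1, simplified] summable_geometric)
         (use assms in auto)
    fix n show "norm (norm ((1 - \<sigma> * xq n q) - 1)) \<le> norm \<sigma> * (norm q ^ Suc n / (1 - norm q)\<^sup>2)"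
      using mult_left_mono[OF norm_xq_le[of q "norm q" n] norm_ge_zero[of \<sigma>]] assms
      by (simp add: norm_mult del: power_Suc)
  qed
  then have "abs_convergent_prod (\<lambda>n. 1 - \<sigma> * xq n q)"
    by (simp add: abs_convergent_prod_conv_summable)
  then show ?thesis by (rule abs_convergent_prod_imp_convergent_prod)
qed

lemma kap_LIMSEQ:
  assumes "norm q < 1" shows "(\<lambda>N. \<Prod>n<N. 1 - \<sigma> * xq n q) \<longlonglongrightarrow> kap q \<sigma>"
  using convergent_prod_LIMSEQ[OF kap_convergent[OF assms, of \<sigma>]]
  unfolding kap_def by (simp add: LIMSEQ_lessThan_iff_atMost)

lemma kap_nonzero:
  assumes "norm q < 1" "\<And>n. 1 - \<sigma> * xq n q \<noteq> 0" shows "kap q \<sigma> \<noteq> 0"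
  unfolding kap_def by (rule prodinf_nonzero[OF kap_convergent[OF assms(1)] assms(2)])

lemma kap_0 [simp]: "kap q 0 = 1"
  by (simp add: kap_def)

lemma norm_kap_le:
  assumes "norm q < 1"
  shows "norm (kap q \<sigma>) \<le> exp (norm \<sigma> * norm q / (1 - norm q) ^ 3)"
proof (rule Lim_bounded[OF tendsto_norm[OF kap_LIMSEQ[OF assms]]], intro allI impI)
  fix N :: nat
  have "norm (\<Prod>n<N. 1 - \<sigma> * xq n q) \<le> (\<Prod>n<N. exp (norm \<sigma> * norm q / (1 - norm q)\<^sup>2 * norm q ^ n))"
    unfolding prod_norm[symmetric]
  proof (rule prod_mono)
    fix n
    have "norm (1 - \<sigma> * xq n q) \<le> 1 + norm \<sigma> * norm (xq n q)"
      using norm_triangle_ineq4[of 1 "\<sigma> * xq n q"] by (simp add: norm_mult)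
    also have "\<dots> \<le> 1 + norm \<sigma> * (norm q ^ Suc n / (1 - norm q)\<^sup>2)"
      using norm_xq_le[of q "norm q" n] assms by (intro add_left_mono mult_left_mono) auto
    also have "\<dots> = 1 + norm \<sigma> * norm q / (1 - norm q)\<^sup>2 * norm q ^ n" by simp
    also have "\<dots> \<le> exp (norm \<sigma> * norm q / (1 - norm q)\<^sup>2 * norm q ^ n)" by (rule exp_ge_add_one_self)
    finally show "0 \<le> norm (1 - \<sigma> * xq n q) \<and> norm (1 - \<sigma> * xq n q) \<le> exp (norm \<sigma> * norm q / (1 - norm q)\<^sup>2 * norm q ^ n)" by simp
  qed
  also have "\<dots> = exp (norm \<sigma> * norm q / (1 - norm q)\<^sup>2 * (\<Sum>n<N. norm q ^ n))"
    by (simp add: exp_sum[symmetric] sum_distrib_left)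
  also have "\<dots> \<le> exp (norm \<sigma> * norm q / (1 - norm q)\<^sup>2 * (1 / (1 - norm q)))"
  proof -
    have "(\<Sum>n<N. norm q ^ n) \<le> (\<Sum>n. norm q ^ n)"
      using assms by (intro sum_le_suminf summable_geometric) auto
    also have "\<dots> = 1 / (1 - norm q)" using assms by (intro suminf_geometric) auto
    finally have "(\<Sum>n<N. norm q ^ n) \<le> 1 / (1 - norm q)" .
    then show ?thesis using assms unfolding exp_le_cancel_iff by (intro mult_left_mono) auto
  qed
  also have "\<dots> = exp (norm \<sigma> * norm q / (1 - norm q) ^ 3)" by (simp add: power3_eq_cube power2_eq_square)
  finally show "norm (\<Prod>n<N. 1 - \<sigma> * xq n q) \<le> exp (norm \<sigma> * norm q / (1 - norm q) ^ 3)" .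
qed

text \<open>Weierstrass's test with the maxima of |f| and |g| over the compact set; the former is
  below 1. Holomorphy and joint continuity of the product both follow from this.\<close>

lemma kap_uniform_limit:
  fixes f g :: "'a::t2_space \<Rightarrow> complex"
  assumes A: "compact A" and f: "continuous_on A f" and g: "continuous_on A g"
    and fA: "\<And>x. x \<in> A \<Longrightarrow> norm (f x) < 1"
  shows "uniform_limit A (\<lambda>N x. \<Prod>n<N. 1 - g x * xq n (f x)) (\<lambda>x. kap (f x) (g x)) sequentially"
proof (cases "A = {}")
  case False
  obtain x0 where x0: "x0 \<in> A" "\<And>x. x \<in> A \<Longrightarrow> norm (f x) \<le> norm (f x0)"
    using continuous_attains_sup[OF A False continuous_on_norm[OF f]] by blast
  obtain x1 where x1: "\<And>x. x \<in> A \<Longrightarrow> norm (g x) \<le> norm (g x1)"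
    using continuous_attains_sup[OF A False continuous_on_norm[OF g]] by blast
  define r where "r = norm (f x0)"
  have r: "r < 1" "r \<ge> 0" using fA[OF x0(1)] by (auto simp: r_def)
  have cx: "continuous_on A (\<lambda>x. xq n (f x))" for n
    by (rule continuous_on_compose2[OF continuous_on_xq f]) (use fA in auto)
  have "uniformly_convergent_on A (\<lambda>N x. \<Sum>n<N. norm (- (g x * xq n (f x))))"
  proof (rule Weierstrass_m_test'_ev[OF always_eventually])
    show "summable (\<lambda>n. norm (g x1) * (r ^ Suc n / (1 - r)\<^sup>2))"
      by (intro summable_mult summable_divide summable_ignore_initial_segment[of _ 1, simplified] summable_geometric)
         (use r in auto)
    show "\<forall>n. \<forall>x\<in>A. norm (norm (- (g x * xq n (f x)))) \<le> norm (g x1) * (r ^ Suc n / (1 - r)\<^sup>2)"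
    proof (intro allI ballI)
      fix n x assume x: "x \<in> A"
      show "norm (norm (- (g x * xq n (f x)))) \<le> norm (g x1) * (r ^ Suc n / (1 - r)\<^sup>2)"
        using mult_mono[OF x1[OF x] norm_xq_le[of "f x" r n]] x0(2)[OF x] r
        by (simp add: norm_mult r_def[symmetric])
    qed
  qed
  then have "uniformly_convergent_on A (\<lambda>N x. \<Prod>n<N. 1 + - (g x * xq n (f x)))"
    by (intro uniformly_convergent_on_prod A continuous_intros g cx) auto
  then have "uniform_limit A (\<lambda>N x. \<Prod>n<N. 1 - g x * xq n (f x)) (\<lambda>x. lim (\<lambda>N. \<Prod>n<N. 1 - g x * xq n (f x))) sequentially"
    by (simp add: uniformly_convergent_uniform_limit_iff)
  also have "?this \<longleftrightarrow> ?thesis"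
    by (rule uniform_limit_cong') (use limI[OF kap_LIMSEQ[OF fA]] in auto)
  finally show ?thesis .
qed simp

lemma kap_holomorphic:
  assumes U: "open U" and f: "f holomorphic_on U" and g: "g holomorphic_on U"
    and fU: "\<And>x. x \<in> U \<Longrightarrow> norm (f x) < 1"
  shows "(\<lambda>x. kap (f x) (g x)) holomorphic_on U"
proof (rule holomorphic_uniform_sequence[OF U])
  show "(\<lambda>x. \<Prod>n<N. 1 - g x * xq n (f x)) holomorphic_on U" for N
  proof -
    have "(\<lambda>x. xq n (f x)) holomorphic_on U" for n
      using holomorphic_on_compose_gen[OF f holomorphic_xq[of n]] fU by (force simp: o_def)
    then show ?thesis by (intro holomorphic_intros g)
  qed
  fix x assume "x \<in> U"
  then obtain d where d: "d > 0" "cball x d \<subseteq> U" using U open_contains_cball by blast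
  have "uniform_limit (cball x d) (\<lambda>N x. \<Prod>n<N. 1 - g x * xq n (f x)) (\<lambda>x. kap (f x) (g x)) sequentially"
    by (rule kap_uniform_limit)
       (use d fU in \<open>auto intro!: holomorphic_on_imp_continuous_on holomorphic_on_subset[OF f] holomorphic_on_subset[OF g]\<close>)
  then show "\<exists>d>0. cball x d \<subseteq> U \<and> uniform_limit (cball x d) (\<lambda>N x. \<Prod>n<N. 1 - g x * xq n (f x)) (\<lambda>x. kap (f x) (g x)) sequentially"
    using d by blast
qed

lemma kap_continuous: "continuous_on (ball 0 1 \<times> UNIV) (\<lambda>x. kap (fst x) (snd x))"
proof (rule continuous_at_imp_continuous_on, rule ballI)
  fix x :: "complex \<times> complex" assume "x \<in> ball 0 1 \<times> UNIV"
  then have x: "x \<in> ball 0 1 \<times> UNIV" "open (ball (0::complex) 1 \<times> (UNIV :: complex set))" by (auto simp: open_Times)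
  then obtain d where d: "d > 0" "cball x d \<subseteq> ball 0 1 \<times> UNIV" using open_contains_cball by metis
  have "continuous_on (cball x d) (\<lambda>x. kap (fst x) (snd x))"
  proof (rule uniform_limit_theorem)
    show "uniform_limit (cball x d) (\<lambda>N x. \<Prod>n<N. 1 - snd x * xq n (fst x)) (\<lambda>x. kap (fst x) (snd x)) sequentially"
      by (rule kap_uniform_limit) (use d in \<open>auto intro!: continuous_intros\<close>)
    have "continuous_on (cball x d) (\<lambda>x. xq n (fst x))" for n
      by (rule continuous_on_compose2[OF continuous_on_xq]) (use d in \<open>auto intro!: continuous_intros\<close>)
    then show "\<forall>\<^sub>F N in sequentially. continuous_on (cball x d) (\<lambda>x. \<Prod>n<N. 1 - snd x * xq n (fst x))"
      by (intro always_eventually allI continuous_intros)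
  qed simp
  then show "isCont (\<lambda>x. kap (fst x) (snd x)) x"
    by (rule continuous_on_interior) (use d(1) in simp)
qed

text \<open>With \<sigma> = \<open>ss z\<close> this is the weak Jacobi form phi_{-2,1}, up to sign
  the square of theta_1 / eta^3. It is kept as a function of \<sigma> so that its q-coefficients are
  polynomials.\<close>

definition ah :: "complex \<Rightarrow> complex \<Rightarrow> complex"
  where "ah \<tau> \<sigma> = \<sigma> * (kap (ee \<tau>) \<sigma>)\<^sup>2"

definition aa :: "complex \<Rightarrow> complex \<Rightarrow> complex"
  where "aa \<tau> z = ah \<tau> (ss z)"

lemma holomorphic_ah:
  assumes U: "open U" and f: "f holomorphic_on U" and g: "g holomorphic_on U"
    and fU: "\<And>x. x \<in> U \<Longrightarrow> Im (f x) > 0"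
  shows "(\<lambda>x. ah (f x) (g x)) holomorphic_on U"
  unfolding ah_def
  by (intro holomorphic_intros kap_holomorphic f g U) (use fU norm_ee_less_1 in auto)

lemma continuous_ah: "continuous_on (uhp \<times> UNIV) (\<lambda>(\<tau>, \<sigma>). ah \<tau> \<sigma>)"
  unfolding ah_def split_beta
  by (intro continuous_intros continuous_on_compose2[OF kap_continuous, where f="\<lambda>x. (ee (fst x), snd x)", simplified])
     (auto simp: norm_ee_less_1)

lemma aa_minus [simp]: "aa \<tau> (- z) = aa \<tau> z"
  by (simp add: aa_def)

lemma aa_periodic [simp]: "aa \<tau> (z + 1) = aa \<tau> z"
  by (simp add: aa_def)

lemma aa_tau_periodic [simp]: "aa (\<tau> + 1) z = aa \<tau> z"
  by (simp add: aa_def ah_def ee_add)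

lemma kap_factor:
  assumes "norm q < 1"
  shows "1 - ss z * xq n q = (1 - q ^ Suc n * ee z) * (1 - q ^ Suc n / ee z) / (1 - q ^ Suc n)\<^sup>2"
proof -
  have "(1 - Q)\<^sup>2 - (x - 2 + inverse x) * Q = (1 - Q * x) * (1 - Q / x)" if "x \<noteq> 0" for x Q :: complex
    using that by (simp add: field_simps power2_eq_square)
  from this[of "ee z" "q ^ Suc n"] show ?thesis
    using one_minus_power_nz[OF assms, of n] unfolding ss_def xq_def ee_minus
    by (simp add: field_simps del: power_Suc)
qed

text \<open>Replacing z by z + \<tau> multiplies e(z) by q and so moves each linear factor by one
  place. The finite products telescope up to the boundary factors displayed here.\<close>

lemma kap_partial_shift:
  fixes \<tau> z :: complex
  defines "q \<equiv> ee \<tau>" and "x \<equiv> ee z"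
  assumes q: "norm q < 1"
  shows "(\<Prod>n<N. 1 - ss (z + \<tau>) * xq n q) * (1 - q * x) * (1 - q ^ N / x) =
         (\<Prod>n<N. 1 - ss z * xq n q) * (1 - q ^ Suc N * x) * (1 - 1 / x)"
proof (induction N)
  case (Suc N)
  let ?P = "\<Prod>n<N. 1 - ss (z + \<tau>) * xq n q" and ?R = "\<Prod>n<N. 1 - ss z * xq n q"
  let ?d = "(1 - q ^ Suc N)\<^sup>2"
  have x: "x \<noteq> 0" and q0: "q \<noteq> 0" by (auto simp: x_def q_def)
  have e: "ee (z + \<tau>) = q * x" by (simp add: ee_add x_def q_def)
  have f1: "1 - ss (z + \<tau>) * xq N q = (1 - q ^ Suc (Suc N) * x) * (1 - q ^ N / x) / ?d"
    unfolding kap_factor[OF q] e using x q0 by (simp add: mult_ac)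
  have f2: "1 - ss z * xq N q = (1 - q ^ Suc N * x) * (1 - q ^ Suc N / x) / ?d"
    unfolding kap_factor[OF q] x_def ..
  have "(\<Prod>n<Suc N. 1 - ss (z + \<tau>) * xq n q) * (1 - q * x) * (1 - q ^ Suc N / x) =
    (?P * (1 - q * x) * (1 - q ^ N / x)) * ((1 - q ^ Suc (Suc N) * x) * (1 - q ^ Suc N / x) / ?d)"
    unfolding prod.lessThan_Suc f1 by (simp only: times_divide_eq_right times_divide_eq_left mult_ac)
  also have "\<dots> = (?R * (1 - q ^ Suc N * x) * (1 - 1 / x)) * ((1 - q ^ Suc (Suc N) * x) * (1 - q ^ Suc N / x) / ?d)"
    by (simp only: Suc.IH)
  also have "\<dots> = (\<Prod>n<Suc N. 1 - ss z * xq n q) * (1 - q ^ Suc (Suc N) * x) * (1 - 1 / x)"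
    unfolding prod.lessThan_Suc f2 by (simp only: times_divide_eq_right times_divide_eq_left mult_ac)
  finally show ?case .
qed simp

lemma aa_shift:
  assumes \<tau>: "Im \<tau> > 0" shows "aa \<tau> (z + \<tau>) = ee (- (2 * z + \<tau>)) * aa \<tau> z"
proof -
  define q x where "q = ee \<tau>" and "x = ee z"
  have q: "norm q < 1" using norm_ee_less_1[OF \<tau>] by (simp add: q_def)
  have x: "x \<noteq> 0" and q0: "q \<noteq> 0" by (auto simp: x_def q_def)
  have "(\<lambda>N. (\<Prod>n<N. 1 - ss (z + \<tau>) * xq n q) * (1 - q * x) * (1 - q ^ N / x)) \<longlonglongrightarrow> kap q (ss (z + \<tau>)) * (1 - q * x) * (1 - 0 / x)"
    by (intro tendsto_intros kap_LIMSEQ q LIMSEQ_power_zero x)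
  moreover have "(\<lambda>N. (\<Prod>n<N. 1 - ss z * xq n q) * (1 - q ^ Suc N * x) * (1 - 1 / x)) \<longlonglongrightarrow> kap q (ss z) * (1 - 0 * x) * (1 - 1 / x)"
    by (intro tendsto_intros kap_LIMSEQ q filterlim_compose[OF LIMSEQ_power_zero[OF q] filterlim_Suc])
  ultimately have k: "kap q (ss (z + \<tau>)) * (1 - q * x) = kap q (ss z) * (1 - 1 / x)"
    using kap_partial_shift[of \<tau> z] q LIMSEQ_unique by (simp add: q_def x_def del: power_Suc)
  have s1: "ss (z + \<tau>) = (1 - q * x)\<^sup>2 / (q * x)"
    by (simp add: ss_alt ee_add q_def x_def power2_commute mult.commute)
  have s2: "ss z = x * (1 - 1 / x)\<^sup>2"
    using x by (simp add: ss_alt x_def[symmetric] field_simps power2_eq_square)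
  have "aa \<tau> (z + \<tau>) = (kap q (ss (z + \<tau>)) * (1 - q * x))\<^sup>2 / (q * x)"
    by (simp add: aa_def ah_def s1[symmetric] q_def[symmetric] power_mult_distrib) (simp add: s1 power_mult_distrib)
  also have "\<dots> = (kap q (ss z) * (1 - 1 / x))\<^sup>2 / (q * x)" by (simp only: k)
  also have "\<dots> = inverse (q * x * x) * aa \<tau> z"
  proof -
    have "(k * e)\<^sup>2 / (q * x) = inverse (q * x * x) * ((x * e\<^sup>2) * k\<^sup>2)" for k e
      using x q0 by (simp add: field_simps power2_eq_square)
    from this[of "kap q (ss z)" "1 - 1 / x"] show ?thesis
      unfolding aa_def ah_def q_def[symmetric] s2[symmetric] .
  qed
  also have "inverse (q * x * x) = ee (- (2 * z + \<tau>))"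
  proof -
    have "ee (2 * z + \<tau>) = q * x * x" unfolding mult_2 ee_add q_def x_def by (simp add: mult_ac)
    then show ?thesis by (simp only: ee_minus)
  qed
  finally show ?thesis .
qed

text \<open>A factor vanishes only where q^n e(z) or q^n e(-z) equals 1 for some n >= 1, and
  \<open>ss z\<close> only where e(z) = 1; all such z are lattice points. A convergent product of
  nonzero factors is nonzero.\<close>

lemma aa_nonzero:
  assumes \<tau>: "Im \<tau> > 0" and z: "\<And>m n :: int. z \<noteq> of_int m * \<tau> + of_int n"
  shows "aa \<tau> z \<noteq> 0"
proof -
  have q: "norm (ee \<tau>) < 1" using norm_ee_less_1[OF \<tau>] .
  have "ee z \<noteq> 1" using z[of 0] ee_eq_1_iff by auto
  then have s: "ss z \<noteq> 0" by (simp add: ss_alt)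
  have "1 - ss z * xq n (ee \<tau>) \<noteq> 0" for n
  proof -
    have "ee (of_nat (Suc n) * \<tau> + z) \<noteq> 1"
    proof
      assume "ee (of_nat (Suc n) * \<tau> + z) = 1"
      then obtain m :: int where "of_nat (Suc n) * \<tau> + z = of_int m" using ee_eq_1_iff by blast
      then have "z = of_int (- int (Suc n)) * \<tau> + of_int m" by (simp add: algebra_simps)
      then show False using z by blast
    qed
    moreover have "ee (of_nat (Suc n) * \<tau> - z) \<noteq> 1"
    proof
      assume "ee (of_nat (Suc n) * \<tau> - z) = 1"
      then obtain m :: int where "of_nat (Suc n) * \<tau> - z = of_int m" using ee_eq_1_iff by blast
      then have "z = of_int (int (Suc n)) * \<tau> + of_int (- m)" by (simp add: algebra_simps)
      then show False using z by blast
    qed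
    ultimately show ?thesis
      using one_minus_power_nz[OF q, of n]
      unfolding kap_factor[OF q] ee_of_nat_mult[symmetric] by (simp add: ee_add ee_diff del: of_nat_Suc)
  qed
  then show ?thesis using kap_nonzero[OF q] s by (simp add: aa_def ah_def)
qed

section \<open>Entire functions with the transformation law of an index\<close>

lemma entire_div:
  assumes f: "f holomorphic_on UNIV" and f0: "f 0 = 0"
  obtains h where "h holomorphic_on UNIV" "\<And>z. f z = z * h z" "h 0 = deriv f 0"
proof
  define h where "h = (\<lambda>z. if z = 0 then deriv f 0 else (f z - f 0) / (z - 0))"
  show "h holomorphic_on UNIV" unfolding h_def by (rule pole_lemma[OF f]) simp
  show "\<And>z. f z = z * h z" "h 0 = deriv f 0" by (auto simp: h_def f0)
qed

text \<open>Cancel z^n away from 0 and use continuity at 0. Leading Taylor coefficients are compared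
  with this below.\<close>

lemma entire_eq_of_mult_power:
  assumes "h1 holomorphic_on UNIV" "h2 holomorphic_on UNIV" "\<And>z::complex. z ^ n * h1 z = z ^ n * h2 z"
  shows "h1 z = h2 z"
proof (cases "z = 0")
  case True
  have eq: "h1 z = h2 z" if "z \<noteq> 0" for z using assms(3)[of z] that by simp
  have "(h1 \<longlongrightarrow> h1 0) (at 0)" "(h2 \<longlongrightarrow> h2 0) (at 0)"
    using assms(1,2) holomorphic_on_imp_continuous_on continuous_on_eq_continuous_at[OF open_UNIV]
    by (auto simp: isCont_def)
  moreover have "\<forall>\<^sub>F z in at 0. h1 z = h2 z" using eq by (auto simp: eventually_at intro: exI[of _ 1])
  ultimately have "h1 0 = h2 0"
    using Lim_transform_eventually[of h1 "h1 0" "at 0" h2] tendsto_unique[of "at (0::complex)" h2] by auto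
  then show ?thesis using True by simp
qed (use assms(3)[of z] in simp)

text \<open>Dividing an even function by z leaves an odd one, which vanishes at 0 again: zeros of
  even functions at 0 come off in pairs.\<close>

lemma entire_even_div:
  assumes f: "f holomorphic_on UNIV" and f0: "f 0 = 0" and even: "\<And>z. f (- z) = f z"
  obtains h where "h holomorphic_on UNIV" "\<And>z. f z = z\<^sup>2 * h z" "\<And>z. h (- z) = h z"
proof -
  obtain h where h: "h holomorphic_on UNIV" "\<And>z. f z = z * h z" using entire_div[OF f f0] by metis
  have neg: "(\<lambda>z. u (- z)) holomorphic_on UNIV" if "u holomorphic_on UNIV" for u :: "complex \<Rightarrow> complex"
    using holomorphic_on_compose_gen[OF holomorphic_on_minus[OF holomorphic_on_ident] that, of UNIV] by (simp add: o_def)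
  have "z ^ 1 * h (- z) = z ^ 1 * (- h z)" for z
    using even[of z] h(2)[of z] h(2)[of "- z"] by (simp add: equation_minus_iff minus_equation_iff)
  then have odd: "h (- z) = - h z" for z
    by (rule entire_eq_of_mult_power[rotated 2]) (intro holomorphic_intros h(1) neg)+
  then have "h 0 = 0" using odd[of 0] by simp
  then obtain k where k: "k holomorphic_on UNIV" "\<And>z. h z = z * k z" using entire_div[OF h(1)] by metis
  have "z ^ 1 * k (- z) = z ^ 1 * k z" for z using odd[of z] k(2)[of z] k(2)[of "- z"] by simp
  then have "k (- z) = k z" for z
    by (rule entire_eq_of_mult_power[rotated 2]) (intro k(1) neg)+
  then show ?thesis using that[of k] k h by (simp add: power2_eq_square)
qed

text \<open>Order of vanishing at 0 as divisibility among entire functions, which includes the zero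
  function and keeps the cofactor at hand.\<close>

definition vo :: "nat \<Rightarrow> (complex \<Rightarrow> complex) \<Rightarrow> bool"
  where "vo j g \<longleftrightarrow> (\<exists>h. h holomorphic_on UNIV \<and> (\<forall>z. g z = z ^ j * h z))"

text \<open>The law in z for one fixed \<tau>: theta functions of degree 2m on the elliptic curve
  with periods 1 and \<tau>.\<close>

definition idx :: "complex \<Rightarrow> nat \<Rightarrow> (complex \<Rightarrow> complex) \<Rightarrow> bool"
  where "idx \<tau> m g \<longleftrightarrow> g holomorphic_on UNIV \<and> (\<forall>z. g (z + 1) = g z) \<and>
     (\<forall>z. g (z + \<tau>) = ee (- of_nat m * (2 * z + \<tau>)) * g z)"

lemma aa_factor:
  assumes \<tau>: "Im \<tau> > 0"
  obtains A where "A holomorphic_on UNIV" "A 0 = (2 * of_real pi * \<i>)\<^sup>2" "\<And>z. aa \<tau> z = z\<^sup>2 * A z"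
proof -
  have d: "deriv (\<lambda>z. ee z - 1) 0 = 2 * of_real pi * \<i>"
    by (rule DERIV_imp_deriv) (auto intro!: derivative_eq_intros has_field_derivative_ee)
  obtain E where E: "E holomorphic_on UNIV" "\<And>z. ee z - 1 = z * E z" "E 0 = deriv (\<lambda>z. ee z - 1) 0"
    by (rule entire_div[of "\<lambda>z. ee z - 1"]) (auto intro!: holomorphic_intros)
  define A where "A = (\<lambda>z. (E z)\<^sup>2 / ee z * (kap (ee \<tau>) (ss z))\<^sup>2)"
  have "(\<lambda>z. kap (ee \<tau>) (ss z)) holomorphic_on UNIV"
    by (rule kap_holomorphic) (use norm_ee_less_1[OF \<tau>] in \<open>auto intro!: holomorphic_intros\<close>)
  then have "A holomorphic_on UNIV" unfolding A_def by (intro holomorphic_intros E) auto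
  moreover have "A 0 = (2 * of_real pi * \<i>)\<^sup>2" unfolding A_def by (simp add: E(3) d)
  moreover have "aa \<tau> z = z\<^sup>2 * A z" for z
    unfolding aa_def ah_def A_def by (simp add: E(2)[of z] ss_alt power_mult_distrib)
  ultimately show ?thesis using that by blast
qed

lemma aa_idx: assumes "Im \<tau> > 0" shows "idx \<tau> 1 (aa \<tau>)"
proof -
  have "aa \<tau> holomorphic_on UNIV"
    unfolding aa_def[abs_def] by (rule holomorphic_ah) (use assms in \<open>auto intro!: holomorphic_intros\<close>)
  then show ?thesis using aa_shift[OF assms] by (simp add: idx_def)
qed

lemma idx_mult:
  assumes "idx \<tau> m f" "idx \<tau> n g" shows "idx \<tau> (m + n) (\<lambda>z. f z * g z)"
proof -
  have "ee (- of_nat (m + n) * (2 * z + \<tau>)) = ee (- of_nat m * (2 * z + \<tau>)) * ee (- of_nat n * (2 * z + \<tau>))" for z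
    unfolding ee_add[symmetric] by (intro arg_cong[of _ _ ee]) (simp add: algebra_simps)
  then show ?thesis using assms unfolding idx_def by (auto intro!: holomorphic_intros)
qed

lemma idx_diff: "idx \<tau> m f \<Longrightarrow> idx \<tau> m g \<Longrightarrow> idx \<tau> m (\<lambda>z. f z - g z)"
  unfolding idx_def by (auto intro!: holomorphic_intros simp: algebra_simps)

lemma lattice_reduce:
  assumes "Im \<tau> > 0" obtains m n :: int and x y :: real
  where "z = of_int m * \<tau> + of_int n + (of_real x * \<tau> + of_real y)" "0 \<le> x" "x \<le> 1" "0 \<le> y" "y \<le> 1"
proof -
  define a where "a = Im z / Im \<tau>"
  define b where "b = Re z - a * Re \<tau>"
  have z: "z = of_real a * \<tau> + of_real b"
    using assms by (simp add: complex_eq_iff a_def b_def)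
  have "of_real a = (of_int \<lfloor>a\<rfloor> + of_real (frac a) :: complex)" for a :: real
    by (simp add: frac_def)
  then have "of_real a * \<tau> + of_real b = (of_int \<lfloor>a\<rfloor> + of_real (frac a)) * \<tau> + (of_int \<lfloor>b\<rfloor> + of_real (frac b))"
    by metis
  then have "z = of_int \<lfloor>a\<rfloor> * \<tau> + of_int \<lfloor>b\<rfloor> + (of_real (frac a) * \<tau> + of_real (frac b))"
    unfolding z by (simp add: ring_distribs)
  then show ?thesis using that[of "\<lfloor>a\<rfloor>" "\<lfloor>b\<rfloor>" "frac a" "frac b"] by (simp add: frac_ge_0 less_imp_le frac_lt_1)
qed

text \<open>All values are taken on a compact parallelogram, so Liouville's theorem applies.\<close>

lemma doubly_periodic_const:
  assumes \<tau>: "Im \<tau> > 0" and g: "g holomorphic_on UNIV" and p: "\<And>z. g (z + 1) = g z" "\<And>z. g (z + \<tau>) = g z"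
  shows "g z = g 0"
proof -
  have pn: "g (z + of_int n * c) = g z" if "\<And>z. g (z + c) = g z" for n c z
  proof (induction n arbitrary: z rule: int_induct[of _ 0])
    case (step1 i)
    show ?case using step1.IH[of "z + c"] that[of z] by (simp add: algebra_simps)
  next
    case (step2 i)
    show ?case using step2.IH[of "z - c"] that[of "z - c"] by (simp add: algebra_simps)
  qed simp
  define K where "K = (\<lambda>(x, y). of_real x * \<tau> + of_real y) ` (cbox (0, 0) (1, 1 :: real))"
  have "compact K" unfolding K_def split_beta
    by (intro compact_continuous_image continuous_intros) simp
  then have "bounded (g ` K)"
    using g by (intro compact_imp_bounded compact_continuous_image holomorphic_on_imp_continuous_on[OF holomorphic_on_subset[OF g]]) auto
  moreover have "range g \<subseteq> g ` K"
  proof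
    fix w assume "w \<in> range g"
    then obtain z where w: "w = g z" by blast
    obtain m n :: int and x y :: real where
      z: "z = of_int m * \<tau> + of_int n + (of_real x * \<tau> + of_real y)" "0 \<le> x" "x \<le> 1" "0 \<le> y" "y \<le> 1"
      using lattice_reduce[OF \<tau>] by metis
    have "g z = g ((of_real x * \<tau> + of_real y) + of_int n * 1 + of_int m * \<tau>)" by (simp add: z(1) add_ac)
    also have "\<dots> = g (of_real x * \<tau> + of_real y)" by (simp only: pn[OF p(1)] pn[OF p(2)])
    finally show "w \<in> g ` K" using z w by (auto simp: K_def image_iff intro!: bexI[of _ "(x, y)"])
  qed
  ultimately have "bounded (range g)" using bounded_subset by blast
  then have "g constant_on UNIV" by (rule Liouville_theorem[OF g])
  then show ?thesis by (auto simp: constant_on_def)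
qed

section \<open>Forms of given index with a zero of maximal order\<close>

definition lat :: "complex \<Rightarrow> complex set"
  where "lat \<tau> = {z. \<exists>m n :: int. z = of_int m * \<tau> + of_int n}"

lemma lat_discrete:
  assumes \<tau>: "Im \<tau> > 0" and "x \<in> lat \<tau>" "y \<in> lat \<tau>" and d: "dist y x < min 1 (Im \<tau>)"
  shows "y = x"
proof -
  obtain m n m' n' :: int where xy: "x = of_int m * \<tau> + of_int n" "y = of_int m' * \<tau> + of_int n'"
    using assms by (auto simp: lat_def)
  have "\<bar>Im (y - x)\<bar> < Im \<tau>" using d abs_Im_le_cmod[of "y - x"] by (simp add: dist_norm)
  moreover have "Im (y - x) = of_int (m' - m) * Im \<tau>" by (simp add: xy algebra_simps)
  ultimately have "\<bar>of_int (m' - m)\<bar> * Im \<tau> < 1 * Im \<tau>" using \<tau> by (simp add: abs_mult)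
  then have "\<bar>of_int (m' - m) :: real\<bar> < 1" using \<tau> by (simp only: mult_less_cancel_right_pos)
  then have "m' = m" by linarith
  moreover from this have "norm (of_int (n' - n) :: complex) < 1" using d by (simp add: xy dist_norm)
  then have "\<bar>of_int (n' - n) :: real\<bar> < 1" by (simp only: norm_of_int)
  then have "n' = n" by linarith
  ultimately show "y = x" by (simp add: xy)
qed

lemma closed_subset_lat: "Im \<tau> > 0 \<Longrightarrow> S \<subseteq> lat \<tau> \<Longrightarrow> closed S"
  by (rule discrete_imp_closed[of "min 1 (Im \<tau>)"]) (use lat_discrete[of \<tau>] in \<open>auto simp: subset_iff dist_norm\<close>)

text \<open>The quotient by \<open>aa\<^sup>m\<close> is an elliptic function without poles.\<close>

lemma idx_vanishing:
  assumes \<tau>: "Im \<tau> > 0" and g: "idx \<tau> m g" and v: "vo (2 * m) g"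
  obtains c where "\<And>z. g z = c * aa \<tau> z ^ m"
proof -
  obtain h where h: "h holomorphic_on UNIV" "\<And>z. g z = z ^ (2 * m) * h z" using v by (auto simp: vo_def)
  obtain A where A: "A holomorphic_on UNIV" "A 0 = (2 * of_real pi * \<i>)\<^sup>2" "\<And>z. aa \<tau> z = z\<^sup>2 * A z"
    using aa_factor[OF \<tau>] by metis
  define \<Lambda> where "\<Lambda> = lat \<tau>"
  \<comment> \<open>The limit of the quotient at 0, where g is z^(2m) h and \<open>aa\<close> is z^2
    A. The periods carry the same value and differentiability to the other lattice points.\<close>
  define C where "C = h 0 / A 0 ^ m"
  define G where "G = (\<lambda>z. if z \<in> \<Lambda> then C else g z / aa \<tau> z ^ m)"
  have nz: "aa \<tau> z \<noteq> 0" if "z \<notin> \<Lambda>" for z using aa_nonzero[OF \<tau>, of z] that by (auto simp: \<Lambda>_def lat_def)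
  have pm: "z ^ (2 * m) = (z\<^sup>2) ^ m" for z :: complex by (rule power_mult)
  have ga: "g z = G z * aa \<tau> z ^ m" if "z \<notin> \<Lambda>" for z using nz[OF that] that by (simp add: G_def)
  have L1: "z + 1 \<in> \<Lambda> \<longleftrightarrow> z \<in> \<Lambda>" for z
  proof -
    have "z = of_int m * \<tau> + of_int (n - 1)" if "z + 1 = of_int m * \<tau> + of_int n" for m n
      using that by (simp add: algebra_simps)
    moreover have "z + 1 = of_int m * \<tau> + of_int (n + 1)" if "z = of_int m * \<tau> + of_int n" for m n
      using that by simp
    ultimately show ?thesis unfolding \<Lambda>_def lat_def by blast
  qed
  have L2: "z + \<tau> \<in> \<Lambda> \<longleftrightarrow> z \<in> \<Lambda>" for z
  proof -
    have "z = of_int (m - 1) * \<tau> + of_int n" if "z + \<tau> = of_int m * \<tau> + of_int n" for m n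
      using that by (simp add: algebra_simps)
    moreover have "z + \<tau> = of_int (m + 1) * \<tau> + of_int n" if "z = of_int m * \<tau> + of_int n" for m n
      using that by (simp add: algebra_simps)
    ultimately show ?thesis unfolding \<Lambda>_def lat_def by blast
  qed
  have G1: "G (z + 1) = G z" for z
    using g L1[of z] by (simp add: G_def idx_def)
  have G2: "G (z + \<tau>) = G z" for z
  proof -
    have "(ee (- (2 * z + \<tau>)) * aa \<tau> z) ^ m = ee (- of_nat m * (2 * z + \<tau>)) * aa \<tau> z ^ m"
      unfolding power_mult_distrib ee_of_nat_mult[symmetric] by (simp only: mult_minus_left mult_minus_right)
    then show ?thesis using g L2[of z] aa_shift[OF \<tau>, of z] by (simp add: G_def idx_def)
  qed
  have isoc: "open (- \<Lambda>)" using closed_subset_lat[OF \<tau>, of \<Lambda>] by (simp add: \<Lambda>_def open_Compl)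
  have Gh: "G holomorphic_on - \<Lambda>"
  proof -
    have "(\<lambda>z. g z / aa \<tau> z ^ m) holomorphic_on - \<Lambda>"
      using g aa_idx[OF \<tau>] nz unfolding idx_def
      by (intro holomorphic_intros) (auto intro: holomorphic_on_subset)
    then show ?thesis by (rule holomorphic_transform) (auto simp: G_def)
  qed
  have d0: "G field_differentiable at 0"
  proof -
    have "open (- (\<Lambda> - {0}) \<inter> {z. A z \<noteq> 0})"
    proof -
      have "open (- (\<Lambda> - {0}))"
        by (rule open_Compl, rule closed_subset_lat[OF \<tau>]) (auto simp: \<Lambda>_def)
      moreover have "open {z. A z \<noteq> 0}"
        by (intro open_Collect_neq holomorphic_on_imp_continuous_on A) simp
      ultimately show ?thesis by (simp add: open_Int)
    qed
    moreover have "0 \<in> - (\<Lambda> - {0}) \<inter> {z. A z \<noteq> 0}" using A(2) by simp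
    moreover have "(\<lambda>z. h z / A z ^ m) field_differentiable at 0"
    proof -
      have "(\<lambda>z. h z / A z ^ m) holomorphic_on {z. A z \<noteq> 0}"
        by (intro holomorphic_intros) (auto intro: holomorphic_on_subset[OF h(1)] holomorphic_on_subset[OF A(1)])
      moreover have "open {z. A z \<noteq> 0}"
        by (intro open_Collect_neq holomorphic_on_imp_continuous_on A) simp
      ultimately show ?thesis using A(2) by (intro holomorphic_on_imp_differentiable_at[of _ "{z. A z \<noteq> 0}"]) auto
    qed
    moreover have "h z / A z ^ m = G z" if "z \<in> - (\<Lambda> - {0}) \<inter> {z. A z \<noteq> 0}" for z
    proof (cases "z = 0")
      case True
      have "(0::complex) \<in> \<Lambda>" unfolding \<Lambda>_def lat_def by (auto intro!: exI[of _ 0])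
      then show ?thesis using True by (simp add: G_def C_def)
    next
      case False
      then have "z \<notin> \<Lambda>" using that by auto
      then show ?thesis using False by (simp add: G_def h(2) A(3) power_mult_distrib pm)
    qed
    ultimately show ?thesis
      unfolding field_differentiable_def
      using has_field_derivative_transform_within_open[of "\<lambda>z. h z / A z ^ m" _ 0 "- (\<Lambda> - {0}) \<inter> {z. A z \<noteq> 0}" G] by blast
  qed
  have "G holomorphic_on UNIV"
    unfolding holomorphic_on_def
  proof
    fix z
    show "G field_differentiable at z within UNIV"
    proof (cases "z \<in> \<Lambda>")
      case False
      then show ?thesis using Gh isoc holomorphic_on_imp_differentiable_at[of G "- \<Lambda>" z] by auto
    next
      case True
      then obtain k l :: int where z: "z = of_int k * \<tau> + of_int l" by (auto simp: \<Lambda>_def lat_def)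
      have pn: "G (z + of_int n * c) = G z" if "\<And>z. G (z + c) = G z" for n c z
      proof (induction n arbitrary: z rule: int_induct[of _ 0])
        case (step1 i)
        show ?case using step1.IH[of "z + c"] that[of z] by (simp add: algebra_simps)
      next
        case (step2 i)
        show ?case using step2.IH[of "z - c"] that[of "z - c"] by (simp add: algebra_simps)
      qed simp
      have "G w = G (w + of_int (- k) * \<tau> + of_int (- l) * 1)" for w
        by (simp only: pn[OF G1] pn[OF G2])
      then have "G = (\<lambda>w. G (w + (- z)))" unfolding z by (simp add: fun_eq_iff algebra_simps)
      moreover obtain D where "(G has_field_derivative D) (at (z + (- z)))"
        using d0 by (auto simp: field_differentiable_def)
      then have "((\<lambda>w. G (w + (- z))) has_field_derivative D) (at z)" by (simp only: DERIV_shift)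
      ultimately show ?thesis by (metis field_differentiable_def)
    qed
  qed
  then have const: "G z = G 0" for z by (rule doubly_periodic_const[OF \<tau> _ G1 G2])
  have "g z = G 0 * aa \<tau> z ^ m" for z
  proof (cases "z \<in> \<Lambda>")
    case False
    then show ?thesis using ga[OF False] const[of z] by simp
  next
    case True
    have cg: "isCont g z" "isCont (aa \<tau>) z"
      using g aa_idx[OF \<tau>] holomorphic_on_imp_continuous_on continuous_on_eq_continuous_at[OF open_UNIV]
      unfolding idx_def by blast+
    have l: "((\<lambda>w. g w - G 0 * aa \<tau> w ^ m) \<longlongrightarrow> g z - G 0 * aa \<tau> z ^ m) (at z)"
      using cg by (intro tendsto_intros) (auto simp: isCont_def)
    have "y = z" if "y \<in> \<Lambda>" "dist y z < min 1 (Im \<tau>)" for y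
      using lat_discrete[OF \<tau>, of z y] True that by (simp add: \<Lambda>_def)
    then have "\<forall>\<^sub>F w in at z. w \<notin> \<Lambda>"
      unfolding eventually_at using \<tau> by (intro exI[of _ "min 1 (Im \<tau>)"]) auto
    then have "\<forall>\<^sub>F w in at z. g w - G 0 * aa \<tau> w ^ m = 0"
      by (rule eventually_mono) (metis ga const eq_iff_diff_eq_0)
    from Lim_transform_eventually[OF l this] have "((\<lambda>w. 0) \<longlongrightarrow> g z - G 0 * aa \<tau> z ^ m) (at z)" .
    then have "g z - G 0 * aa \<tau> z ^ m = 0" by (simp add: tendsto_const_iff)
    then show ?thesis by simp
  qed
  then show ?thesis by (rule that)
qed

text \<open>Such a g is c times the m-th power of \<open>aa\<close>, and that power vanishes at 0 to
  order exactly 2m, so one more zero forces c = 0. In effect a form of index m is determined by its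
  Taylor coefficients up to z^(2m).\<close>

lemma idx_vanishing_0:
  assumes \<tau>: "Im \<tau> > 0" and g: "idx \<tau> m g" and v: "vo (2 * m + 1) g"
  shows "g z = 0"
proof -
  obtain h where h: "h holomorphic_on UNIV" "\<And>z. g z = z ^ (2 * m + 1) * h z" using v by (auto simp: vo_def)
  have "vo (2 * m) g" unfolding vo_def
    by (rule exI[of _ "\<lambda>z. z * h z"]) (use h in \<open>auto intro!: holomorphic_intros\<close>)
  then obtain c where c: "\<And>z. g z = c * aa \<tau> z ^ m" using idx_vanishing[OF \<tau> g] by blast
  obtain A where A: "A holomorphic_on UNIV" "A 0 = (2 * of_real pi * \<i>)\<^sup>2" "\<And>z. aa \<tau> z = z\<^sup>2 * A z"
    using aa_factor[OF \<tau>] by metis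
  have "z ^ (2 * m) * (z * h z) = z ^ (2 * m) * (c * A z ^ m)" for z
    using c[of z] h(2)[of z] power_mult[of z 2 m] by (simp add: A(3) power_mult_distrib mult_ac)
  then have "(0::complex) * h 0 = c * A 0 ^ m"
    by (rule entire_eq_of_mult_power[rotated 2]) (auto intro!: holomorphic_intros h A)
  then have "c = 0" using A(2) by simp
  then show ?thesis using c by simp
qed

text \<open>Scaling by 1/\<tau> exchanges the roles of the two periods, and the Gaussian factor
  absorbs the resulting automorphy factors.\<close>

lemma idx_S:
  assumes \<tau>: "Im \<tau> > 0" and g: "idx (- 1 / \<tau>) m g"
  shows "idx \<tau> m (\<lambda>z. g (z / \<tau>) * ee (- of_nat m * z\<^sup>2 / \<tau>))"
proof -
  define t where "t = - 1 / \<tau>"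
  have \<tau>0: "\<tau> \<noteq> 0" using \<tau> by auto
  have gh: "g holomorphic_on UNIV" and g1: "\<And>z. g (z + 1) = g z"
    and g2: "\<And>z. g (z + t) = ee (- of_nat m * (2 * z + t)) * g z"
    using g by (auto simp: idx_def t_def)
  have g3: "g (z + 1 / \<tau>) = ee (of_nat m * (2 * (z + 1 / \<tau>) + t)) * g z" for z
  proof -
    have "g z = ee (- of_nat m * (2 * (z + 1 / \<tau>) + t)) * g (z + 1 / \<tau>)"
      using g2[of "z + 1 / \<tau>"] by (simp add: t_def)
    then have "ee (of_nat m * (2 * (z + 1 / \<tau>) + t)) * g z =
      (ee (of_nat m * (2 * (z + 1 / \<tau>) + t)) * ee (- of_nat m * (2 * (z + 1 / \<tau>) + t))) * g (z + 1 / \<tau>)" by simp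
    also have "ee (of_nat m * (2 * (z + 1 / \<tau>) + t)) * ee (- of_nat m * (2 * (z + 1 / \<tau>) + t)) = 1"
      by (simp add: ee_minus)
    finally show ?thesis by simp
  qed
  have "(\<lambda>z. g (z / \<tau>) * ee (- of_nat m * z\<^sup>2 / \<tau>)) holomorphic_on UNIV"
  proof -
    have "(\<lambda>z. g (z / \<tau>)) holomorphic_on UNIV"
      by (rule holomorphic_on_compose_gen[OF _ gh, of "\<lambda>z. z / \<tau>" UNIV, unfolded o_def])
         (use \<tau>0 in \<open>auto intro!: holomorphic_intros\<close>)
    then show ?thesis using \<tau>0 by (intro holomorphic_intros) auto
  qed
  moreover have "g ((z + 1) / \<tau>) * ee (- of_nat m * (z + 1)\<^sup>2 / \<tau>) = g (z / \<tau>) * ee (- of_nat m * z\<^sup>2 / \<tau>)" for z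
  proof -
    have "g ((z + 1) / \<tau>) * ee (- of_nat m * (z + 1)\<^sup>2 / \<tau>) =
       g (z / \<tau>) * (ee (of_nat m * (2 * (z / \<tau> + 1 / \<tau>) + t)) * ee (- of_nat m * (z + 1)\<^sup>2 / \<tau>))"
      using g3[of "z / \<tau>"] by (simp add: add_divide_distrib mult_ac)
    also have "ee (of_nat m * (2 * (z / \<tau> + 1 / \<tau>) + t)) * ee (- of_nat m * (z + 1)\<^sup>2 / \<tau>) = ee (- of_nat m * z\<^sup>2 / \<tau>)"
      unfolding ee_add[symmetric] using \<tau>0
      by (intro arg_cong[of _ _ ee]) (simp add: t_def field_simps power2_eq_square)
    finally show ?thesis .
  qed
  moreover have "g ((z + \<tau>) / \<tau>) * ee (- of_nat m * (z + \<tau>)\<^sup>2 / \<tau>) =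
      ee (- of_nat m * (2 * z + \<tau>)) * (g (z / \<tau>) * ee (- of_nat m * z\<^sup>2 / \<tau>))" for z
  proof -
    have "g ((z + \<tau>) / \<tau>) = g (z / \<tau>)" using g1[of "z / \<tau>"] \<tau>0 by (simp add: add_divide_distrib)
    moreover have "ee (- of_nat m * (z + \<tau>)\<^sup>2 / \<tau>) = ee (- of_nat m * (2 * z + \<tau>)) * ee (- of_nat m * z\<^sup>2 / \<tau>)"
      unfolding ee_add[symmetric] using \<tau>0
      by (intro arg_cong[of _ _ ee]) (simp add: field_simps power2_eq_square)
    ultimately show ?thesis by simp
  qed
  ultimately show ?thesis by (simp add: idx_def)
qed

text \<open>After moving the Gaussian to the left, both sides have index 1 and a double zero at 0,
  hence are proportional; the coefficients of z^2 fix the constant.\<close>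

lemma aa_S:
  assumes \<tau>: "Im \<tau> > 0"
  shows "aa (- 1 / \<tau>) (z / \<tau>) = ee (z\<^sup>2 / \<tau>) * aa \<tau> z / \<tau>\<^sup>2"
proof -
  have \<tau>': "Im (- 1 / \<tau>) > 0" by (rule Im_neg_inverse_pos[OF \<tau>])
  have \<tau>0: "\<tau> \<noteq> 0" using \<tau> by auto
  obtain A where A: "A holomorphic_on UNIV" "A 0 = (2 * of_real pi * \<i>)\<^sup>2" "\<And>z. aa \<tau> z = z\<^sup>2 * A z"
    using aa_factor[OF \<tau>] by metis
  obtain B where B: "B holomorphic_on UNIV" "B 0 = (2 * of_real pi * \<i>)\<^sup>2" "\<And>z. aa (- 1 / \<tau>) z = z\<^sup>2 * B z"
    using aa_factor[OF \<tau>'] by metis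
  define h where "h = (\<lambda>z. B (z / \<tau>) * ee (- z\<^sup>2 / \<tau>) / \<tau>\<^sup>2)"
  have hh: "h holomorphic_on UNIV"
  proof -
    have "(\<lambda>z. B (z / \<tau>)) holomorphic_on UNIV"
      by (rule holomorphic_on_compose_gen[OF _ B(1), of "\<lambda>z. z / \<tau>" UNIV, unfolded o_def])
         (use \<tau>0 in \<open>auto intro!: holomorphic_intros\<close>)
    then show ?thesis unfolding h_def using \<tau>0 by (intro holomorphic_intros) auto
  qed
  have g: "idx \<tau> 1 (\<lambda>z. aa (- 1 / \<tau>) (z / \<tau>) * ee (- of_nat 1 * z\<^sup>2 / \<tau>))"
    by (rule idx_S[OF \<tau> aa_idx[OF \<tau>']])
  have gz: "aa (- 1 / \<tau>) (z / \<tau>) * ee (- of_nat 1 * z\<^sup>2 / \<tau>) = z ^ 2 * h z" for z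
    unfolding B(3) h_def by (simp add: power_divide)
  have "vo (2 * 1) (\<lambda>z. aa (- 1 / \<tau>) (z / \<tau>) * ee (- of_nat 1 * z\<^sup>2 / \<tau>))"
    unfolding vo_def using hh gz by (intro exI[of _ h]) simp
  then obtain c where c: "\<And>z. aa (- 1 / \<tau>) (z / \<tau>) * ee (- of_nat 1 * z\<^sup>2 / \<tau>) = c * aa \<tau> z ^ 1"
    using idx_vanishing[OF \<tau> g] by blast
  have "z ^ 2 * h z = z ^ 2 * (c * A z)" for z using c[of z] unfolding gz A(3) by (simp only: power_one_right mult_ac)
  then have "h 0 = c * A 0"
    by (rule entire_eq_of_mult_power[rotated 2]) (auto intro!: holomorphic_intros hh A)
  then have "c = 1 / \<tau>\<^sup>2" using \<tau>0 by (simp add: h_def A(2) B(2) field_simps)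
  then have "aa (- 1 / \<tau>) (z / \<tau>) * ee (- z\<^sup>2 / \<tau>) = aa \<tau> z / \<tau>\<^sup>2" using c[of z] by simp
  moreover have "ee (- z\<^sup>2 / \<tau>) = inverse (ee (z\<^sup>2 / \<tau>))" by (simp add: ee_minus[symmetric])
  ultimately have "aa (- 1 / \<tau>) (z / \<tau>) / ee (z\<^sup>2 / \<tau>) = aa \<tau> z / \<tau>\<^sup>2" by (simp only: divide_inverse)
  then show ?thesis by (simp add: divide_eq_eq mult_ac)
qed

section \<open>Integrality at a prime\<close>

lemma p_integralE:
  assumes "x \<in> p_integral p" obtains a b :: int where "x = of_int a / of_int b" "\<not> int p dvd b"
  using assms by (auto simp: p_integral_def)

lemma p_integral_frac: "\<not> int p dvd b \<Longrightarrow> of_int a / of_int b \<in> p_integral p"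
  by (auto simp: p_integral_def)

context
  fixes p :: nat
  assumes p: "prime p"
begin

lemma p_integral_of_int: "of_int a \<in> p_integral p"
  using p_integral_frac[of p 1 a] p by (simp add: prime_nat_iff)

lemma p_integral_0: "0 \<in> p_integral p"
  and p_integral_1: "1 \<in> p_integral p"
  and p_integral_numeral: "numeral k \<in> p_integral p"
  using p_integral_of_int[of 0] p_integral_of_int[of 1] p_integral_of_int[of "numeral k"] by simp_all

lemma p_integral_mult:
  assumes "x \<in> p_integral p" "y \<in> p_integral p" shows "x * y \<in> p_integral p"
proof -
  obtain a b where x: "x = of_int a / of_int b" "\<not> int p dvd b" using assms(1) by (rule p_integralE)
  obtain c d where y: "y = of_int c / of_int d" "\<not> int p dvd d" using assms(2) by (rule p_integralE)
  have "\<not> int p dvd b * d" using x y p by (simp add: prime_dvd_mult_iff)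
  moreover have "x * y = of_int (a * c) / of_int (b * d)" by (simp add: x y)
  ultimately show ?thesis using p_integral_frac by metis
qed

lemma p_integral_add:
  assumes "x \<in> p_integral p" "y \<in> p_integral p" shows "x + y \<in> p_integral p"
proof -
  obtain a b where x: "x = of_int a / of_int b" "\<not> int p dvd b" using assms(1) by (rule p_integralE)
  obtain c d where y: "y = of_int c / of_int d" "\<not> int p dvd d" using assms(2) by (rule p_integralE)
  have "\<not> int p dvd b * d" using x y p by (simp add: prime_dvd_mult_iff)
  moreover have "b \<noteq> 0" "d \<noteq> 0" using x y by auto
  then have "x + y = of_int (a * d + c * b) / of_int (b * d)" by (simp add: x y field_simps)
  ultimately show ?thesis using p_integral_frac by metis
qed

lemma p_integral_minus: "x \<in> p_integral p \<Longrightarrow> - x \<in> p_integral p"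
  using p_integral_mult[OF p_integral_of_int[of "-1"], of x] by simp

lemma p_integral_sum: "(\<And>i. i \<in> I \<Longrightarrow> f i \<in> p_integral p) \<Longrightarrow> (\<Sum>i\<in>I. f i) \<in> p_integral p"
  by (induction I rule: infinite_finite_induct) (auto intro: p_integral_add p_integral_0)

end

definition zpmod :: "nat \<Rightarrow> complex set \<Rightarrow> bool"
  where "zpmod p L \<longleftrightarrow> 0 \<in> L \<and> (\<forall>x\<in>L. \<forall>y\<in>L. x + y \<in> L) \<and> (\<forall>c\<in>p_integral p. \<forall>x\<in>L. c * x \<in> L)"

lemma zpmod_p_integral: "prime p \<Longrightarrow> zpmod p (p_integral p)"
  by (auto simp: zpmod_def p_integral_0 p_integral_add p_integral_mult)

lemma zpmod_sum:
  assumes "zpmod p L" "\<And>i. i \<in> I \<Longrightarrow> f i \<in> L" shows "(\<Sum>i\<in>I. f i) \<in> L"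
  using assms(2) by (induction I rule: infinite_finite_induct) (use assms(1) in \<open>auto simp: zpmod_def\<close>)

lemma zpmod_diff:
  assumes "prime p" "zpmod p L" "x \<in> L" "y \<in> L" shows "x - y \<in> L"
proof -
  have "(- 1) * y \<in> L" using assms p_integral_of_int[of p "-1"] by (auto simp: zpmod_def)
  then have "x + (- 1) * y \<in> L" using assms by (auto simp: zpmod_def)
  then show ?thesis by simp
qed

section \<open>Series with coefficients in a module over the p-integral rationals\<close>

definition cin :: "complex set \<Rightarrow> complex fps \<Rightarrow> bool"
  where "cin L C \<longleftrightarrow> (\<forall>n. fps_nth C n \<in> L)"

definition pin :: "complex set \<Rightarrow> complex poly fps \<Rightarrow> bool"
  where "pin L Q \<longleftrightarrow> (\<forall>n j. coeff (fps_nth Q n) j \<in> L)"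

lemma cin_add: "zpmod p L \<Longrightarrow> cin L C \<Longrightarrow> cin L D \<Longrightarrow> cin L (C + D)"
  by (auto simp: cin_def zpmod_def)

lemma cin_diff: "prime p \<Longrightarrow> zpmod p L \<Longrightarrow> cin L C \<Longrightarrow> cin L D \<Longrightarrow> cin L (C - D)"
  by (auto simp: cin_def zpmod_diff)

lemma cin_mult: "zpmod p L \<Longrightarrow> cin (p_integral p) C \<Longrightarrow> cin L D \<Longrightarrow> cin L (C * D)"
  unfolding cin_def fps_mult_nth by (auto intro!: zpmod_sum simp: zpmod_def)

lemma cin_const: "zpmod p L \<Longrightarrow> c \<in> L \<Longrightarrow> cin L (fps_const c)"
  by (auto simp: cin_def zpmod_def)

lemma cin_1: "prime p \<Longrightarrow> cin (p_integral p) 1"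
  by (auto simp: cin_def p_integral_0 p_integral_1)

lemma cin_power: "prime p \<Longrightarrow> cin (p_integral p) C \<Longrightarrow> cin (p_integral p) (C ^ n)"
  by (induction n) (auto intro: cin_1 cin_mult zpmod_p_integral)

lemma pin_add: "zpmod p L \<Longrightarrow> pin L C \<Longrightarrow> pin L D \<Longrightarrow> pin L (C + D)"
  by (auto simp: pin_def zpmod_def)

lemma pin_diff: "prime p \<Longrightarrow> zpmod p L \<Longrightarrow> pin L C \<Longrightarrow> pin L D \<Longrightarrow> pin L (C - D)"
  by (auto simp: pin_def zpmod_diff)

lemma coeff_mult_in:
  assumes "zpmod p L" "\<And>j. coeff f j \<in> p_integral p" "\<And>j. coeff g j \<in> L"
  shows "coeff (f * g) j \<in> L"
  unfolding coeff_mult using assms by (auto intro!: zpmod_sum simp: zpmod_def)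

lemma pin_mult: "zpmod p L \<Longrightarrow> pin (p_integral p) C \<Longrightarrow> pin L D \<Longrightarrow> pin L (C * D)"
  unfolding pin_def fps_mult_nth by (auto intro!: zpmod_sum coeff_mult_in simp: coeff_sum)

lemma pin_1: "prime p \<Longrightarrow> pin (p_integral p) 1"
  by (auto simp: pin_def p_integral_0 p_integral_1)

lemma pin_power: "prime p \<Longrightarrow> pin (p_integral p) C \<Longrightarrow> pin (p_integral p) (C ^ n)"
  by (induction n) (auto intro: pin_1 pin_mult zpmod_p_integral)

lemma pin_cp: "zpmod p L \<Longrightarrow> cin L C \<Longrightarrow> pin L (cp C)"
  by (auto simp: pin_def cin_def zpmod_def coeff_pCons split: nat.splits)

lemma pin_const: "zpmod p L \<Longrightarrow> (\<And>j. coeff f j \<in> L) \<Longrightarrow> pin L (fps_const f)"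
  by (auto simp: pin_def zpmod_def)

text \<open>The recursion for the reciprocal divides only by the constant term.\<close>

lemma cin_inverse:
  assumes p: "prime p" and C: "cin (p_integral p) C" and i: "inverse (fps_nth C 0) \<in> p_integral p" "fps_nth C 0 \<noteq> 0"
  shows "cin (p_integral p) (inverse C)"
proof -
  have "fps_nth (inverse C) n \<in> p_integral p" for n
  proof (induction n rule: less_induct)
    case (less n)
    show ?case
    proof (cases n)
      case 0 then show ?thesis using i by simp
    next
      case (Suc m)
      have "(\<Sum>k=1..n. fps_nth C k * fps_nth (inverse C) (n - k)) \<in> p_integral p"
        by (intro p_integral_sum p_integral_mult p less.IH) (use C in \<open>auto simp: cin_def\<close>)
      moreover have "fps_nth (inverse C) n = - inverse (fps_nth C 0) * (\<Sum>k=1..n. fps_nth C k * fps_nth (inverse C) (n - k))"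
      proof -
        have "0 = fps_nth (C * inverse C) n" using i Suc by (simp add: inverse_mult_eq_1')
        also have "\<dots> = fps_nth C 0 * fps_nth (inverse C) n + (\<Sum>k=1..n. fps_nth C k * fps_nth (inverse C) (n - k))"
          by (simp add: fps_mult_nth sum.atLeast_Suc_atMost)
        finally show ?thesis using i(2) by (simp add: field_simps add_eq_0_iff)
      qed
      ultimately show ?thesis using i p by (auto intro: p_integral_mult p_integral_minus)
    qed
  qed
  then show ?thesis by (simp add: cin_def)
qed

section \<open>Expansion of the basic form\<close>

lemma qexp_X: "qexp ee fps_X"
  by (simp add: qexp_def)

lemma qexp_prod: "(\<And>i. i \<in> I \<Longrightarrow> qexp (f i) (C i)) \<Longrightarrow> qexp (\<lambda>\<tau>. \<Prod>i\<in>I. f i \<tau>) (\<Prod>i\<in>I. C i)"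
  using qexp_1 by (induction I rule: infinite_finite_induct) (auto intro: qexp_mult)

text \<open>The sum of C has no zero in the disc, so 1/f is bounded near the cusp and has some
  expansion; its product with C is 1, which identifies it with the formal reciprocal.\<close>

lemma qexp_inverse:
  assumes f: "qexp f C" and nz: "\<And>\<tau>. Im \<tau> > 0 \<Longrightarrow> f \<tau> \<noteq> 0" and C0: "fps_nth C 0 \<noteq> 0"
  shows "qexp (\<lambda>\<tau>. inverse (f \<tau>)) (inverse C)"
proof -
  have nz': "eval_fps C q \<noteq> 0" if "norm q < 1" for q
  proof (cases "q = 0")
    case True then show ?thesis using C0 by (simp add: eval_fps_at_0)
  next
    case False
    then obtain \<tau> where \<tau>: "ee \<tau> = q" "Im \<tau> = - ln (norm q) / (2 * pi)" using ee_surj by metis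
    then have "Im \<tau> > 0" using that False by (simp add: divide_neg_pos)
    then show ?thesis using nz[of \<tau>] qexpD[OF f, of \<tau>] \<tau> by simp
  qed
  have cont: "continuous_on (cball 0 (exp (- 2 * pi))) (\<lambda>q. inverse (eval_fps C q))"
  proof (rule continuous_on_inverse)
    show "continuous_on (cball 0 (exp (- 2 * pi))) (eval_fps C)"
      by (rule continuous_on_eval_fps[THEN continuous_on_subset])
         (use f in \<open>auto simp: qexp_def intro!: less_fps_conv_radius elim!: le_less_trans\<close>)
    have "norm q < 1" if "q \<in> cball 0 (exp (- 2 * pi))" for q :: complex
      using that by (auto intro: le_less_trans)
    then show "\<forall>q\<in>cball 0 (exp (- 2 * pi)). eval_fps C q \<noteq> 0" using nz' by blast
  qed
  obtain B where B: "\<And>q. q \<in> cball 0 (exp (- 2 * pi)) \<Longrightarrow> norm (inverse (eval_fps C q)) \<le> B"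
    using compact_imp_bounded[OF compact_continuous_image[OF cont compact_cball]] unfolding bounded_iff by blast
  have hol: "(\<lambda>\<tau>. inverse (f \<tau>)) holomorphic_on uhp"
    using nz by (intro holomorphic_intros qexp_holomorphic[OF f]) auto
  have "qexp (\<lambda>\<tau>. inverse (f \<tau>)) (Abs_fps (\<lambda>n. fc \<i> (int n) (\<lambda>\<tau>. inverse (f \<tau>))))"
  proof (rule qexp_of_bounded[OF hol])
    fix t :: complex assume t: "Im t \<ge> 1"
    have "ee t \<in> cball 0 (exp (- 2 * pi))" using t by (simp add: norm_ee)
    then show "norm (inverse (f t)) \<le> B" using B[of "ee t"] qexpD[OF f, of t] t by simp
  qed (use qexp_periodic[OF f] in auto)
  then obtain D where D: "qexp (\<lambda>\<tau>. inverse (f \<tau>)) D" by blast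
  have "qexp (\<lambda>\<tau>. f \<tau> * inverse (f \<tau>)) (C * D)" by (rule qexp_mult[OF f D])
  also have "?this \<longleftrightarrow> qexp (\<lambda>\<tau>. 1) (C * D)" by (rule qexp_cong) (use nz in auto)
  finally have "C * D = 1" using qexp_1 qexp_unique by blast
  then have "D = inverse C" by (simp add: fps_inverse_unique)
  then show ?thesis using D by simp
qed

section \<open>The q-expansion of the product and its integrality\<close>

definition Xc :: "nat \<Rightarrow> complex fps"
  where "Xc i = fps_X ^ Suc i * inverse ((1 - fps_X ^ Suc i)\<^sup>2)"

lemma qexp_xq: "qexp (\<lambda>\<tau>. xq i (ee \<tau>)) (Xc i)"
proof -
  have "qexp (\<lambda>\<tau>. (1 - ee \<tau> ^ Suc i)\<^sup>2) ((1 - fps_X ^ Suc i)\<^sup>2)"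
    by (intro qexp_power qexp_diff qexp_1 qexp_X)
  then have "qexp (\<lambda>\<tau>. inverse ((1 - ee \<tau> ^ Suc i)\<^sup>2)) (inverse ((1 - fps_X ^ Suc i)\<^sup>2))"
    by (rule qexp_inverse)
       (use one_minus_power_nz[OF norm_ee_less_1] in \<open>simp_all add: power2_eq_square del: power_Suc\<close>)
  from qexp_mult[OF qexp_power[OF qexp_X, of "Suc i"] this] show ?thesis
    unfolding Xc_def xq_def divide_inverse .
qed

lemma Xc_nth_low: "n \<le> i \<Longrightarrow> fps_nth (Xc i) n = 0"
  unfolding Xc_def by (subst fps_X_power_mult_nth) simp

lemma cin_Xc: assumes p: "prime p" shows "cin (p_integral p) (Xc i)"
proof -
  have X: "cin (p_integral p) (fps_X ^ Suc i)"
    by (auto simp: cin_def fps_X_power_nth p_integral_0[OF p] p_integral_1[OF p] simp del: power_Suc)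
  have 1: "cin (p_integral p) ((1 - fps_X ^ Suc i)\<^sup>2)"
    by (intro cin_power[OF p] cin_diff[OF p zpmod_p_integral[OF p]] cin_1[OF p] X)
  have "cin (p_integral p) (inverse ((1 - fps_X ^ Suc i)\<^sup>2))"
    by (rule cin_inverse[OF p 1]) (auto simp: power2_eq_square p_integral_1[OF p])
  then show ?thesis unfolding Xc_def by (intro cin_mult[OF zpmod_p_integral[OF p]] X)
qed

definition RP :: "nat \<Rightarrow> complex poly fps"
  where "RP N = (\<Prod>i<N. 1 - fps_const [:0, 1:] * cp (Xc i))"

text \<open>The factor with index i is 1 modulo q^(i + 1), so later factors leave the lower
  coefficients alone.\<close>

lemma RP_stable: "n \<le> N \<Longrightarrow> fps_nth (RP N) n = fps_nth (RP n) n"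
proof (induction N)
  case (Suc N)
  show ?case
  proof (cases "n = Suc N")
    case False
    then have n: "n \<le> N" using Suc by simp
    have "RP (Suc N) = RP N - RP N * (fps_const [:0, 1:] * cp (Xc N))" by (simp add: RP_def ring_distribs)
    moreover have z: "fps_nth (fps_const [:0, 1:] * cp (Xc N)) j = 0" if "j \<le> N" for j
      using Xc_nth_low[OF that] by simp
    have "fps_nth (RP N * (fps_const [:0, 1:] * cp (Xc N))) n = 0"
      unfolding fps_mult_nth[of "RP N"] by (intro sum.neutral ballI) (use n z in auto)
    ultimately show ?thesis using Suc.IH[OF n] by simp
  qed simp
qed simp

text \<open>By stability the n-th coefficient of the infinite product can be read off the n-th
  partial product.\<close>

definition kapQ :: "complex poly fps"
  where "kapQ = Abs_fps (\<lambda>n. fps_nth (RP n) n)"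

lemma pin_kapQ: assumes p: "prime p" shows "pin (p_integral p) kapQ"
proof -
  note z = zpmod_p_integral[OF p]
  have c: "coeff [:0, 1::complex:] j \<in> p_integral p" for j
    by (auto simp: coeff_pCons p_integral_0[OF p] p_integral_1[OF p] split: nat.splits)
  have "pin (p_integral p) (1 - fps_const [:0, 1:] * cp (Xc i))" for i
    by (intro pin_diff[OF p z] pin_1[OF p] pin_mult[OF z] pin_const[OF z] pin_cp[OF z] cin_Xc[OF p] c)
  then have "pin (p_integral p) (RP N)" for N
    unfolding RP_def by (induction N) (auto intro: pin_1[OF p] pin_mult[OF z])
  then show ?thesis by (simp add: pin_def kapQ_def)
qed

lemma fc_uniform_limit:
  assumes c: "\<And>N. continuous_on {0..1} (\<lambda>x::real. g N (w + of_real x))"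
    and u: "uniform_limit {0..1} (\<lambda>N x::real. g N (w + of_real x)) (\<lambda>x. G (w + of_real x)) sequentially"
  shows "(\<lambda>N. fc w n (g N)) \<longlonglongrightarrow> fc w n G"
proof -
  have cG: "continuous_on {0..1} (\<lambda>x::real. G (w + of_real x))"
    by (rule uniform_limit_theorem[OF always_eventually u]) (use c in auto)
  have ce: "continuous_on {0..1} (\<lambda>x::real. ee (- of_int n * (w + of_real x)))" by (intro continuous_intros)
  have "uniform_limit {0..1} (\<lambda>N x::real. g N (w + of_real x) * ee (- of_int n * (w + of_real x)))
      (\<lambda>x. G (w + of_real x) * ee (- of_int n * (w + of_real x))) sequentially"
    by (rule uniform_lim_mult[OF u uniform_limit_const])
       (intro compact_imp_bounded compact_continuous_image cG ce compact_Icc)+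
  then obtain I J where "\<And>N. ((\<lambda>x::real. g N (w + of_real x) * ee (- of_int n * (w + of_real x))) has_integral I N) {0..1}"
    "((\<lambda>x::real. G (w + of_real x) * ee (- of_int n * (w + of_real x))) has_integral J) {0..1}" "I \<longlonglongrightarrow> J"
    by (rule uniform_limit_integral) (use c ce in \<open>auto intro!: continuous_intros\<close>)
  then have "(\<lambda>N. fc w n (g N)) = I" "fc w n G = J" unfolding fc_def by (auto intro!: ext integral_unique)
  then show ?thesis using \<open>I \<longlonglongrightarrow> J\<close> by simp
qed

text \<open>Fourier coefficients pass to uniform limits, and those of the partial products are
  eventually constant. The explicit bound on the product supplies holomorphy at the cusp.\<close>

lemma qexp_kap: "qexp (\<lambda>\<tau>. kap (ee \<tau>) \<sigma>) (ev \<sigma> kapQ)"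
proof -
  let ?f = "\<lambda>\<tau>. kap (ee \<tau>) \<sigma>"
  let ?P = "\<lambda>N \<tau>. \<Prod>i<N. 1 - \<sigma> * xq i (ee \<tau>)"
  have P: "qexp (?P N) (ev \<sigma> (RP N))" for N
    unfolding RP_def ev_prod ev_diff ev_mult ev_const ev_cp ev_1
    by (intro qexp_prod qexp_diff qexp_1 qexp_mult qexp_xq) (simp add: qexp_const)
  have hol: "?f holomorphic_on uhp"
    by (rule kap_holomorphic) (auto intro!: holomorphic_intros norm_ee_less_1)
  have bd: "norm (?f t) \<le> exp (norm \<sigma> * 1 / (1 - exp (- 2 * pi)) ^ 3)" if "Im t \<ge> 1" for t
  proof -
    have q: "norm (ee t) \<le> exp (- 2 * pi)" using that by (simp add: norm_ee)
    have e: "exp (- 2 * pi) < (1::real)" by simp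
    have "norm (?f t) \<le> exp (norm \<sigma> * norm (ee t) / (1 - norm (ee t)) ^ 3)"
      by (rule norm_kap_le) (use q e in linarith)
    also have "\<dots> \<le> exp (norm \<sigma> * 1 / (1 - exp (- 2 * pi)) ^ 3)"
      unfolding exp_le_cancel_iff
      by (intro frac_le mult_left_mono power_mono zero_less_power) (use q e order_trans[OF q less_imp_le[OF e]] in auto)
    finally show ?thesis .
  qed
  have "qexp ?f (Abs_fps (\<lambda>n. fc \<i> (int n) ?f))"
    by (rule qexp_of_bounded[OF hol _ bd]) (auto simp: ee_add)
  moreover have "fc \<i> (int n) ?f = fps_nth (ev \<sigma> kapQ) n" for n
  proof -
    have "uniform_limit {0..1} (\<lambda>N x::real. ?P N (\<i> + of_real x)) (\<lambda>x. ?f (\<i> + of_real x)) sequentially"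
      by (rule kap_uniform_limit[where g="\<lambda>_. \<sigma>"]) (auto intro!: continuous_intros norm_ee_less_1)
    then have "(\<lambda>N. fc \<i> (int n) (?P N)) \<longlonglongrightarrow> fc \<i> (int n) ?f"
      by (rule fc_uniform_limit[rotated])
         (rule continuous_on_hline[OF holomorphic_on_imp_continuous_on[OF qexp_holomorphic[OF P]]], simp)
    moreover have "(\<lambda>N. fc \<i> (int n) (?P N)) \<longlonglongrightarrow> fps_nth (ev \<sigma> kapQ) n"
    proof (rule tendsto_eventually, rule eventually_mono[OF eventually_ge_at_top[of n]])
      fix N assume "n \<le> N"
      then show "fc \<i> (int n) (?P N) = fps_nth (ev \<sigma> kapQ) n"
        using fc_qexp[OF P[of N], of \<i> n] RP_stable[of n N] by (simp add: kapQ_def)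
    qed
    ultimately show ?thesis using LIMSEQ_unique by blast
  qed
  ultimately show ?thesis by (simp add: ev_def)
qed

section \<open>Families of expansions and their Taylor coefficients\<close>

text \<open>Compactness at height 1/2 bounds the n-th coefficient by B exp(\<pi> n), uniformly in y;
  from height 1 on the series is then dominated by a geometric one of ratio exp(-\<pi>).\<close>

lemma qexp_family_bounded:
  fixes \<Phi> :: "complex \<Rightarrow> complex \<Rightarrow> complex"
  assumes cont: "continuous_on (uhp \<times> UNIV) (\<lambda>(\<tau>, y). \<Phi> \<tau> y)"
    and q: "\<And>y. qexp (\<lambda>\<tau>. \<Phi> \<tau> y) (C y)" and K: "compact K"
  obtains B where "\<And>\<tau> y. Im \<tau> \<ge> 1 \<Longrightarrow> y \<in> K \<Longrightarrow> norm (\<Phi> \<tau> y) \<le> B"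
proof -
  let ?w = "Complex 0 (1/2)"
  have "continuous_on ({0..1} \<times> K) (\<lambda>(x::real, y). \<Phi> (?w + of_real x) y)"
    unfolding split_beta
    by (rule continuous_on_compose2[OF cont, where f="\<lambda>u. (?w + of_real (fst u), snd u)", simplified])
       (auto intro!: continuous_intros)
  then have "bounded ((\<lambda>(x::real, y). \<Phi> (?w + of_real x) y) ` ({0..1} \<times> K))"
    by (intro compact_imp_bounded compact_continuous_image compact_Times K) auto
  then obtain B where B: "\<And>x y. x \<in> {0..1::real} \<Longrightarrow> y \<in> K \<Longrightarrow> norm (\<Phi> (?w + of_real x) y) \<le> B"
    unfolding bounded_iff by force
  have c: "norm (fps_nth (C y) n) \<le> B * exp pi ^ n" if "y \<in> K" for y n
  proof -
    have "norm (fc ?w (int n) (\<lambda>\<tau>. \<Phi> \<tau> y)) \<le> B * exp (2 * pi * of_int (int n) * Im ?w)"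
      by (rule fc_bound)
         (use B that in \<open>auto intro!: continuous_on_hline[OF holomorphic_on_imp_continuous_on[OF qexp_holomorphic[OF q]]]\<close>)
    then show ?thesis using fc_qexp[OF q, of ?w n y] by (simp add: exp_of_nat_mult[symmetric] mult.commute)
  qed
  have "norm (\<Phi> \<tau> y) \<le> (\<Sum>n. B * exp (- pi) ^ n)" if \<tau>: "Im \<tau> \<ge> 1" and y: "y \<in> K" for \<tau> y
  proof -
    have s: "(\<lambda>n. fps_nth (C y) n * ee (of_nat n * \<tau>)) sums \<Phi> \<tau> y"
      using qexp_sums[OF q] \<tau> by simp
    have B0: "B \<ge> 0" using order_trans[OF norm_ge_zero B[of 0 y]] y by simp
    have "norm (suminf (\<lambda>n. fps_nth (C y) n * ee (of_nat n * \<tau>))) \<le> (\<Sum>n. B * exp (- pi) ^ n)"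
    proof (rule norm_suminf_le)
      fix n
      have "norm (ee (of_nat n * \<tau>)) \<le> exp (- 2 * pi) ^ n"
        unfolding ee_of_nat_mult norm_power using \<tau> by (intro power_mono) (auto simp: norm_ee)
      then have "norm (fps_nth (C y) n * ee (of_nat n * \<tau>)) \<le> (B * exp pi ^ n) * exp (- 2 * pi) ^ n"
        unfolding norm_mult using c[OF y, of n] B0 by (intro mult_mono) auto
      also have "\<dots> = B * (exp pi * exp (- 2 * pi)) ^ n" by (simp add: power_mult_distrib)
      also have "exp pi * exp (- 2 * pi) = exp (- pi)" by (simp add: exp_add[symmetric])
      finally show "norm (fps_nth (C y) n * ee (of_nat n * \<tau>)) \<le> B * exp (- pi) ^ n" .
    qed (auto intro!: summable_mult summable_geometric)
    then show ?thesis using sums_unique[OF s] by simp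
  qed
  then show ?thesis by (rule that)
qed

section \<open>Taylor series at 0 of entire functions\<close>

abbreviation ex :: "(complex \<Rightarrow> complex) \<Rightarrow> complex fps"
  where "ex g \<equiv> fps_expansion g 0"

lemma ex_has: "g holomorphic_on UNIV \<Longrightarrow> g has_fps_expansion ex g"
  by (rule has_fps_expansion_fps_expansion[of UNIV]) auto

lemma ex_unique: "g holomorphic_on UNIV \<Longrightarrow> g has_fps_expansion G \<Longrightarrow> ex g = G"
  by (rule fps_expansion_eqI)

lemma ex_mult: "f holomorphic_on UNIV \<Longrightarrow> g holomorphic_on UNIV \<Longrightarrow> ex (\<lambda>z. f z * g z) = ex f * ex g"
  by (intro ex_unique holomorphic_intros has_fps_expansion_mult ex_has)

lemma ex_add: "f holomorphic_on UNIV \<Longrightarrow> g holomorphic_on UNIV \<Longrightarrow> ex (\<lambda>z. f z + g z) = ex f + ex g"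
  by (intro ex_unique holomorphic_intros has_fps_expansion_add ex_has)

lemma ex_diff: "f holomorphic_on UNIV \<Longrightarrow> g holomorphic_on UNIV \<Longrightarrow> ex (\<lambda>z. f z - g z) = ex f - ex g"
  by (intro ex_unique holomorphic_intros has_fps_expansion_diff ex_has)

lemma ex_const: "ex (\<lambda>z. c) = fps_const c"
  by (intro ex_unique holomorphic_intros has_fps_expansion_const)

lemma ex_power: "f holomorphic_on UNIV \<Longrightarrow> ex (\<lambda>z. f z ^ n) = ex f ^ n"
proof (induction n)
  case 0 show ?case using ex_const[of 1] by simp
next
  case (Suc n)
  then show ?case using ex_mult[of f "\<lambda>z. f z ^ n"] by (simp add: holomorphic_intros)
qed

lemma ex_ident: "ex (\<lambda>z. z) = fps_X"
  by (intro ex_unique holomorphic_intros has_fps_expansion_fps_X)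

lemma ex_poly: "ex (poly p) = fps_of_poly p"
proof (rule ex_unique)
  have "eval_fps (fps_of_poly p) has_fps_expansion fps_of_poly p"
    by (rule eval_fps_has_fps_expansion) simp
  moreover have "eval_fps (fps_of_poly p) = poly p" by (simp add: fun_eq_iff)
  ultimately show "poly p has_fps_expansion fps_of_poly p" by simp
qed (intro holomorphic_intros)

lemma ex_scale:
  assumes "g holomorphic_on UNIV"
  shows "fps_nth (ex (\<lambda>z. g (c * z))) n = c ^ n * fps_nth (ex g) n"
  using higher_deriv_compose_linear[OF assms open_UNIV open_UNIV, of 0 c n] by (simp add: fps_expansion_def)

lemma ex_0: "fps_nth (ex g) 0 = g 0"
  by (simp add: fps_expansion_def)

lemma entire_taylor:
  assumes "g holomorphic_on UNIV"
  obtains \<rho> where "\<rho> holomorphic_on UNIV" "\<And>z. g z = (\<Sum>j<n. fps_nth (ex g) j * z ^ j) + z ^ n * \<rho> z"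
  using assms
proof (induction n arbitrary: g thesis)
  case 0
  then show ?case by simp
next
  case (Suc n)
  have "(\<lambda>z. g z - g 0) holomorphic_on UNIV" by (intro holomorphic_intros Suc.prems(2))
  then obtain h where h: "h holomorphic_on UNIV" "\<And>z. g z - g 0 = z * h z"
    using entire_div[of "\<lambda>z. g z - g 0"] by auto
  obtain \<rho> where \<rho>: "\<rho> holomorphic_on UNIV" "\<And>z. h z = (\<Sum>j<n. fps_nth (ex h) j * z ^ j) + z ^ n * \<rho> z"
    using Suc.IH h(1) by metis
  have g: "g = (\<lambda>z. g 0 + z * h z)"
  proof
    show "g z = g 0 + z * h z" for z using h(2)[of z] by (simp add: algebra_simps)
  qed
  have "ex g = fps_const (g 0) + fps_X * ex h"
  proof -
    have "ex (\<lambda>z. g 0 + z * h z) = fps_const (g 0) + fps_X * ex h"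
      by (simp add: ex_add ex_mult ex_const ex_ident h(1) holomorphic_intros)
    then show ?thesis using arg_cong[OF g, of ex] by (rule trans[rotated])
  qed
  then have e: "fps_nth (ex g) (Suc j) = fps_nth (ex h) j" for j by simp
  have "g z = (\<Sum>j<Suc n. fps_nth (ex g) j * z ^ j) + z ^ Suc n * \<rho> z" for z
  proof -
    have "g z = g 0 + z * h z" using h(2)[of z] by (simp add: algebra_simps)
    also have "\<dots> = g 0 + (\<Sum>j<n. fps_nth (ex g) (Suc j) * z ^ Suc j) + z ^ Suc n * \<rho> z"
      by (simp add: \<rho>(2)[of z] e ring_distribs sum_distrib_left mult_ac)
    also have "g 0 + (\<Sum>j<n. fps_nth (ex g) (Suc j) * z ^ Suc j) = (\<Sum>j<Suc n. fps_nth (ex g) j * z ^ j)"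
      by (simp only: sum.lessThan_Suc_shift ex_0 power_0 mult_1_right)
    finally show ?thesis .
  qed
  then show ?case using Suc.prems(1) \<rho>(1) by blast
qed

lemma vo_ex:
  assumes "g holomorphic_on UNIV" "\<And>i. i < n \<Longrightarrow> fps_nth (ex g) i = 0" shows "vo n g"
  using entire_taylor[OF assms(1), of n] assms(2) unfolding vo_def by (metis (no_types, lifting) add_0 lessThan_iff mult_zero_left sum.neutral)

text \<open>The function g(e(\<tau> - i)) has a rescaled Taylor series of g as its nome expansion,
  and on the segment at height 1 its argument runs through the unit circle. Taylor coefficients thus
  become Fourier coefficients.\<close>

lemma ex_integral:
  assumes "g holomorphic_on UNIV"
  shows "fps_nth (ex g) j = integral {0..1} (\<lambda>t::real. g (ee (of_real t)) * ee (- of_nat j * of_real t))"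
proof -
  let ?c = "exp (2 * pi) :: real"
  let ?f = "\<lambda>\<tau>. g (ee (\<tau> - \<i>))"
  let ?C = "Abs_fps (\<lambda>n. fps_nth (ex g) n * of_real ?c ^ n)"
  have e: "ee (\<tau> - \<i>) = of_real ?c * ee \<tau>" for \<tau>
    unfolding ee_def by (simp add: exp_of_real[symmetric] exp_add[symmetric] algebra_simps)
  have "qexp ?f ?C"
  proof (rule qexpI_sums)
    fix \<tau> :: complex assume "Im \<tau> > 0"
    have "(\<lambda>n. (deriv ^^ n) g 0 / fact n * (ee (\<tau> - \<i>) - 0) ^ n) sums g (ee (\<tau> - \<i>))"
      by (rule holomorphic_power_series[where r="norm (ee (\<tau> - \<i>)) + 1"]) (auto intro: holomorphic_on_subset[OF assms])
    then show "(\<lambda>n. fps_nth ?C n * ee (of_nat n * \<tau>)) sums ?f \<tau>"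
      unfolding ee_of_nat_mult e by (simp add: fps_expansion_def power_mult_distrib mult_ac)
  qed
  from fc_qexp[OF this, of \<i> j] have "fps_nth (ex g) j * of_real ?c ^ j = fc \<i> (int j) ?f" by simp
  also have "\<dots> = integral {0..1} (\<lambda>t::real. g (ee (of_real t)) * ee (- of_nat j * of_real t) * of_real ?c ^ j)"
    unfolding fc_def
  proof (rule integral_cong)
    fix x :: real
    have "ee (- of_nat j * \<i>) = of_real ?c ^ j"
      unfolding ee_def by (simp add: exp_of_real[symmetric] exp_of_nat_mult[symmetric] algebra_simps)
    moreover have "ee (- of_int (int j) * (\<i> + of_real x)) = ee (- of_nat j * of_real x) * ee (- of_nat j * \<i>)"
      unfolding ee_add[symmetric] by (simp add: algebra_simps)
    ultimately show "?f (\<i> + of_real x) * ee (- of_int (int j) * (\<i> + of_real x)) = g (ee (of_real x)) * ee (- of_nat j * of_real x) * of_real ?c ^ j"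
      by simp
  qed
  finally show ?thesis by (simp add: integral_mult_left)
qed

definition jh :: "(complex \<Rightarrow> complex \<Rightarrow> complex) \<Rightarrow> complex poly fps \<Rightarrow> bool"
  where "jh \<Phi> Q \<longleftrightarrow> continuous_on (uhp \<times> UNIV) (\<lambda>(\<tau>, \<sigma>). \<Phi> \<tau> \<sigma>) \<and>
    (\<forall>\<tau>. Im \<tau> > 0 \<longrightarrow> \<Phi> \<tau> holomorphic_on UNIV) \<and> (\<forall>\<sigma>. qexp (\<lambda>\<tau>. \<Phi> \<tau> \<sigma>) (ev \<sigma> Q))"

text \<open>The Taylor coefficient in \<sigma> and the q-coefficient are both integrals over a
  circle. Exchanging them shows that the double expansion may be read in either order.\<close>

lemma jh_taylor:
  assumes "jh \<Phi> Q"
  shows "qexp (\<lambda>\<tau>. fps_nth (ex (\<Phi> \<tau>)) j) (Abs_fps (\<lambda>n. coeff (fps_nth Q n) j))"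
proof -
  have cont: "continuous_on (uhp \<times> UNIV) (\<lambda>(\<tau>, \<sigma>). \<Phi> \<tau> \<sigma>)"
    and ent: "\<And>\<tau>. Im \<tau> > 0 \<Longrightarrow> \<Phi> \<tau> holomorphic_on UNIV" and q: "\<And>\<sigma>. qexp (\<lambda>\<tau>. \<Phi> \<tau> \<sigma>) (ev \<sigma> Q)"
    using assms by (auto simp: jh_def)
  define f where "f = (\<lambda>\<tau>. integral {0..1} (\<lambda>t::real. \<Phi> \<tau> (ee (of_real t)) * ee (- of_nat j * of_real t)))"
  have fe: "fps_nth (ex (\<Phi> \<tau>)) j = f \<tau>" if "Im \<tau> > 0" for \<tau>
    unfolding f_def by (rule ex_integral[OF ent[OF that]])
  have c2: "continuous_on (uhp \<times> {0..1}) (\<lambda>(\<tau>, t::real). \<Phi> \<tau> (ee (of_real t)) * ee (- of_nat j * of_real t))"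
    unfolding split_beta
    by (intro continuous_intros continuous_on_compose2[OF cont, where f="\<lambda>u. (fst u, ee (of_real (snd u)))", simplified]) auto
  have hol: "f holomorphic_on uhp"
    unfolding f_def
    by (rule holomorphic_integral[OF open_upper c2]) (intro holomorphic_intros qexp_holomorphic[OF q])
  obtain B where B: "\<And>\<tau> y. Im \<tau> \<ge> 1 \<Longrightarrow> y \<in> cball 0 1 \<Longrightarrow> norm (\<Phi> \<tau> y) \<le> B"
    using qexp_family_bounded[OF cont q compact_cball[of 0 1]] by blast
  have bd: "norm (f \<tau>) \<le> B" if "Im \<tau> \<ge> 1" for \<tau>
  proof -
    have "norm (f \<tau>) \<le> B * (1 - 0)"
      unfolding f_def
    proof (rule integral_bound)
      show "continuous_on {0..1} (\<lambda>t::real. \<Phi> \<tau> (ee (of_real t)) * ee (- of_nat j * of_real t))"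
      proof -
        have "continuous_on {0..1} (\<lambda>x. case (\<tau>, x) of (\<tau>, t) \<Rightarrow> \<Phi> \<tau> (ee (of_real t)) * ee (- of_nat j * of_real t))"
          by (rule continuous_on_compose2[OF c2]) (use that in \<open>auto intro!: continuous_intros\<close>)
        then show ?thesis by simp
      qed
      fix t :: real
      show "norm (\<Phi> \<tau> (ee (of_real t)) * ee (- of_nat j * of_real t)) \<le> B"
        using B[OF that, of "ee (of_real t)"] by (simp add: norm_mult norm_ee)
    qed simp
    then show ?thesis by simp
  qed
  have "qexp f (Abs_fps (\<lambda>n. fc \<i> (int n) f))"
    by (rule qexp_of_bounded[OF hol _ bd]) (use qexp_periodic[OF q] in \<open>auto simp: f_def\<close>)
  moreover have "fc \<i> (int n) f = coeff (fps_nth Q n) j" for n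
  proof -
    have c3: "continuous_on (cbox (0, 0) (1, 1))
       (\<lambda>(x::real, t::real). \<Phi> (\<i> + of_real x) (ee (of_real t)) * ee (- of_nat j * of_real t) * ee (- of_int (int n) * (\<i> + of_real x)))"
      unfolding split_beta
      by (intro continuous_intros continuous_on_compose2[OF cont, where f="\<lambda>u. (\<i> + of_real (fst u), ee (of_real (snd u)))", simplified]) auto
    have "fc \<i> (int n) f = integral (cbox 0 1) (\<lambda>x::real. integral (cbox 0 1) (\<lambda>t::real.
        \<Phi> (\<i> + of_real x) (ee (of_real t)) * ee (- of_nat j * of_real t) * ee (- of_int (int n) * (\<i> + of_real x))))"
      unfolding fc_def f_def by (simp add: integral_mult_left)
    also have "\<dots> = integral (cbox 0 1) (\<lambda>t::real. integral (cbox 0 1) (\<lambda>x::real.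
        \<Phi> (\<i> + of_real x) (ee (of_real t)) * ee (- of_nat j * of_real t) * ee (- of_int (int n) * (\<i> + of_real x))))"
      by (rule integral_swap_continuous[OF c3])
    also have "\<dots> = integral {0..1} (\<lambda>t::real. poly (fps_nth Q n) (ee (of_real t)) * ee (- of_nat j * of_real t))"
    proof -
      have "integral (cbox 0 1) (\<lambda>x::real. \<Phi> (\<i> + of_real x) (ee (of_real t)) * ee (- of_nat j * of_real t) * ee (- of_int (int n) * (\<i> + of_real x)))
          = fc \<i> (int n) (\<lambda>\<tau>. \<Phi> \<tau> (ee (of_real t))) * ee (- of_nat j * of_real t)" for t :: real
        unfolding fc_def integral_mult_left[symmetric] by (simp add: mult_ac)
      then show ?thesis using fc_qexp[OF q, of \<i>] by simp
    qed
    also have "\<dots> = fps_nth (ex (poly (fps_nth Q n))) j"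
      by (rule ex_integral[symmetric]) (intro holomorphic_intros)
    finally show ?thesis by (simp add: ex_poly)
  qed
  ultimately have "qexp f (Abs_fps (\<lambda>n. coeff (fps_nth Q n) j))" by simp
  then show ?thesis using qexp_cong[of "\<lambda>\<tau>. fps_nth (ex (\<Phi> \<tau>)) j" f] fe by simp
qed

section \<open>The generators of the rings of elliptic modular and Jacobi forms\<close>

definition AQ :: "complex poly fps"
  where "AQ = fps_const [:0, 1:] * kapQ\<^sup>2"

lemma qexp_ah: "qexp (\<lambda>\<tau>. ah \<tau> \<sigma>) (ev \<sigma> AQ)"
  unfolding AQ_def ah_def ev_mult ev_power ev_const
  by (intro qexp_mult qexp_power qexp_kap) (simp add: qexp_const)

lemma entire_ah: "Im \<tau> > 0 \<Longrightarrow> ah \<tau> holomorphic_on UNIV"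
  using holomorphic_ah[of UNIV "\<lambda>_. \<tau>" "\<lambda>x. x"] by (auto intro: holomorphic_intros)

lemma jh_ah: "jh ah AQ"
  unfolding jh_def using continuous_ah entire_ah qexp_ah by blast

lemma pin_AQ: assumes p: "prime p" shows "pin (p_integral p) AQ"
proof -
  note z = zpmod_p_integral[OF p]
  have c: "coeff [:0, 1::complex:] j \<in> p_integral p" for j
    by (auto simp: coeff_pCons p_integral_0[OF p] p_integral_1[OF p] split: nat.splits)
  show ?thesis unfolding AQ_def by (intro pin_mult[OF z] pin_const[OF z] c pin_power[OF p] pin_kapQ[OF p])
qed

lemma kapQ_0: "fps_nth kapQ 0 = 1"
  by (simp add: kapQ_def RP_def)

lemma kapQ_1: "fps_nth kapQ 1 = [:0, -1:]"
proof -
  have "fps_nth (Xc 0) 1 = 1" unfolding Xc_def by (simp add: power2_eq_square)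
  then show ?thesis by (simp add: kapQ_def RP_def)
qed

lemma AQ_0: "fps_nth AQ 0 = [:0, 1:]"
  by (simp add: AQ_def power2_eq_square kapQ_0)

lemma AQ_1: "fps_nth AQ 1 = [:0, 0, -2:]"
  using kapQ_0 kapQ_1 by (simp add: AQ_def power2_eq_square fps_mult_nth)

definition al :: "nat \<Rightarrow> complex \<Rightarrow> complex"
  where "al j \<tau> = fps_nth (ex (ah \<tau>)) j"

definition alC :: "nat \<Rightarrow> complex fps"
  where "alC j = Abs_fps (\<lambda>n. coeff (fps_nth AQ n) j)"

lemma qexp_al: "qexp (al j) (alC j)"
  using jh_taylor[OF jh_ah, of j] by (simp add: al_def[abs_def] alC_def)

lemma al_0: "al 0 \<tau> = 0"
  by (simp add: al_def ex_0 ah_def)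

lemma al_1: assumes "Im \<tau> > 0" shows "al 1 \<tau> = 1"
proof -
  have k: "(\<lambda>\<sigma>. (kap (ee \<tau>) \<sigma>)\<^sup>2) holomorphic_on UNIV"
    by (intro holomorphic_intros kap_holomorphic) (auto simp: norm_ee_less_1 assms)
  have "ex (ah \<tau>) = fps_X * ex (\<lambda>\<sigma>. (kap (ee \<tau>) \<sigma>)\<^sup>2)"
    unfolding ah_def[abs_def] by (simp add: ex_mult ex_ident k holomorphic_intros)
  then show ?thesis by (simp add: al_def ex_0)
qed

lemma alC_values:
  "fps_nth (alC j) 0 = (if j = 1 then 1 else 0)" "fps_nth (alC j) (Suc 0) = (if j = 2 then - 2 else 0)"
  using AQ_0 AQ_1 by (auto simp: alC_def coeff_pCons numeral_2_eq_2 split: nat.splits)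

lemma cin_alC: "prime p \<Longrightarrow> cin (p_integral p) (alC j)"
  using pin_AQ[of p] by (simp add: cin_def pin_def alC_def)

abbreviation cc :: complex
  where "cc \<equiv> 2 * of_real pi * \<i>"

lemma cc_nz: "cc \<noteq> 0" by simp

lemma ex_ee: "ex ee = fps_exp cc"
proof (rule ex_unique)
  have "(\<lambda>z. exp (cc * z)) has_fps_expansion fps_exp cc" by (rule has_fps_expansion_exp)
  then show "ee has_fps_expansion fps_exp cc" by (simp add: ee_def[abs_def])
qed (intro holomorphic_intros)

section \<open>Taylor expansion in z of functions of \<open>ss z\<close>\<close>

definition Sf :: "complex fps"
  where "Sf = ex ss"

lemma Sf_nth: "fps_nth Sf n = cc ^ n * (1 + (- 1) ^ n) / fact n - (if n = 0 then 2 else 0)"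
proof -
  have e: "(\<lambda>z. ee (- z)) holomorphic_on UNIV" "ee holomorphic_on UNIV" by (intro holomorphic_intros)+
  have "ss = (\<lambda>z. (ee z - 2) + ee (- z))" by (simp add: fun_eq_iff ss_def)
  from arg_cong[OF this, of ex] have "ex ss = ex ee - fps_const 2 + ex (\<lambda>z. ee (- z))"
    by (simp only: ex_add[OF holomorphic_on_diff[OF e(2) holomorphic_on_const] e(1)] ex_diff[OF e(2) holomorphic_on_const] ex_const)
  moreover have "fps_nth (ex (\<lambda>z. ee (- z))) n = (- 1) ^ n * fps_nth (ex ee) n"
    using ex_scale[OF e(2), of "- 1" n] by simp
  ultimately show ?thesis
    unfolding Sf_def by (simp add: ex_ee ring_distribs add_divide_distrib)
qed

lemma Sf_values:
  "fps_nth Sf 0 = 0" "fps_nth Sf 1 = 0" "fps_nth Sf 2 = cc ^ 2" "fps_nth Sf 3 = 0" "fps_nth Sf 4 = cc ^ 4 / 12"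
  "fps_nth Sf 5 = 0" "fps_nth Sf 6 = cc ^ 6 / 360" "fps_nth Sf 7 = 0" "fps_nth Sf 8 = cc ^ 8 / 20160"
  unfolding Sf_nth by (simp_all add: fact_numeral)

lemma fps_mult_nths:
  fixes f g :: "complex fps"
  shows "fps_nth (f * g) 1 = fps_nth f 0 * fps_nth g 1 + fps_nth f 1 * fps_nth g 0"
    "fps_nth (f * g) 2 = fps_nth f 0 * fps_nth g 2 + fps_nth f 1 * fps_nth g 1 + fps_nth f 2 * fps_nth g 0"
    "fps_nth (f * g) 3 = fps_nth f 0 * fps_nth g 3 + fps_nth f 1 * fps_nth g 2 + fps_nth f 2 * fps_nth g 1 + fps_nth f 3 * fps_nth g 0"
    "fps_nth (f * g) 4 = fps_nth f 0 * fps_nth g 4 + fps_nth f 1 * fps_nth g 3 + fps_nth f 2 * fps_nth g 2 + fps_nth f 3 * fps_nth g 1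
       + fps_nth f 4 * fps_nth g 0"
    "fps_nth (f * g) 5 = fps_nth f 0 * fps_nth g 5 + fps_nth f 1 * fps_nth g 4 + fps_nth f 2 * fps_nth g 3 + fps_nth f 3 * fps_nth g 2
       + fps_nth f 4 * fps_nth g 1 + fps_nth f 5 * fps_nth g 0"
    "fps_nth (f * g) 6 = fps_nth f 0 * fps_nth g 6 + fps_nth f 1 * fps_nth g 5 + fps_nth f 2 * fps_nth g 4 + fps_nth f 3 * fps_nth g 3
       + fps_nth f 4 * fps_nth g 2 + fps_nth f 5 * fps_nth g 1 + fps_nth f 6 * fps_nth g 0"
    "fps_nth (f * g) 7 = fps_nth f 0 * fps_nth g 7 + fps_nth f 1 * fps_nth g 6 + fps_nth f 2 * fps_nth g 5 + fps_nth f 3 * fps_nth g 4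
       + fps_nth f 4 * fps_nth g 3 + fps_nth f 5 * fps_nth g 2 + fps_nth f 6 * fps_nth g 1 + fps_nth f 7 * fps_nth g 0"
    "fps_nth (f * g) 8 = fps_nth f 0 * fps_nth g 8 + fps_nth f 1 * fps_nth g 7 + fps_nth f 2 * fps_nth g 6 + fps_nth f 3 * fps_nth g 5
       + fps_nth f 4 * fps_nth g 4 + fps_nth f 5 * fps_nth g 3 + fps_nth f 6 * fps_nth g 2 + fps_nth f 7 * fps_nth g 1 + fps_nth f 8 * fps_nth g 0"
  by (simp_all add: fps_mult_nth eval_nat_numeral)

lemma Sf2_values:
  "fps_nth (Sf * Sf) 0 = 0" "fps_nth (Sf * Sf) 1 = 0" "fps_nth (Sf * Sf) 2 = 0" "fps_nth (Sf * Sf) 3 = 0"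
  "fps_nth (Sf * Sf) 4 = cc ^ 4" "fps_nth (Sf * Sf) 5 = 0" "fps_nth (Sf * Sf) 6 = cc ^ 6 / 6"
  "fps_nth (Sf * Sf) 7 = 0" "fps_nth (Sf * Sf) 8 = cc ^ 8 / 80"
  by (simp_all only: fps_mult_nths fps_mult_nth_0 Sf_values) (simp_all add: field_simps eval_nat_numeral)

lemma Sf3_values:
  "fps_nth (Sf * (Sf * Sf)) 0 = 0" "fps_nth (Sf * (Sf * Sf)) 1 = 0" "fps_nth (Sf * (Sf * Sf)) 2 = 0"
  "fps_nth (Sf * (Sf * Sf)) 3 = 0" "fps_nth (Sf * (Sf * Sf)) 4 = 0" "fps_nth (Sf * (Sf * Sf)) 5 = 0"
  "fps_nth (Sf * (Sf * Sf)) 6 = cc ^ 6" "fps_nth (Sf * (Sf * Sf)) 7 = 0" "fps_nth (Sf * (Sf * Sf)) 8 = cc ^ 8 / 4"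
  by (simp_all only: fps_mult_nths fps_mult_nth_0 Sf_values Sf2_values) (simp_all add: field_simps eval_nat_numeral)

lemma Sf4_values:
  "fps_nth (Sf * (Sf * (Sf * Sf))) 0 = 0" "fps_nth (Sf * (Sf * (Sf * Sf))) 1 = 0" "fps_nth (Sf * (Sf * (Sf * Sf))) 2 = 0"
  "fps_nth (Sf * (Sf * (Sf * Sf))) 3 = 0" "fps_nth (Sf * (Sf * (Sf * Sf))) 4 = 0" "fps_nth (Sf * (Sf * (Sf * Sf))) 5 = 0"
  "fps_nth (Sf * (Sf * (Sf * Sf))) 6 = 0" "fps_nth (Sf * (Sf * (Sf * Sf))) 7 = 0" "fps_nth (Sf * (Sf * (Sf * Sf))) 8 = cc ^ 8"
  by (simp_all only: fps_mult_nths fps_mult_nth_0 Sf_values Sf2_values Sf3_values) (simp_all add: field_simps eval_nat_numeral)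

lemma Sf5_values:
  "fps_nth (Sf * (Sf * (Sf * (Sf * Sf))) * R) 0 = 0" "fps_nth (Sf * (Sf * (Sf * (Sf * Sf))) * R) 1 = 0"
  "fps_nth (Sf * (Sf * (Sf * (Sf * Sf))) * R) 2 = 0" "fps_nth (Sf * (Sf * (Sf * (Sf * Sf))) * R) 3 = 0"
  "fps_nth (Sf * (Sf * (Sf * (Sf * Sf))) * R) 4 = 0" "fps_nth (Sf * (Sf * (Sf * (Sf * Sf))) * R) 6 = 0"
  "fps_nth (Sf * (Sf * (Sf * (Sf * Sf))) * R) 8 = 0"
  by (simp_all only: fps_mult_nths fps_mult_nth_0 Sf_values Sf4_values mult_zero_left mult_zero_right add_0_left)

text \<open>Normalised Taylor coefficients: with u = 2 \<pi> i z, \<open>aa\<close> is u^2 (1 + A2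
  u^2 + A4 u^4 + A6 u^6 + ...). The constants come from the powers of \<open>ss z\<close> = u^2 +
  u^4/12 + u^6/360 + u^8/20160 + .... \<open>A2\<close> is the quasimodular E_2/12.\<close>

definition A2 :: "complex \<Rightarrow> complex" where "A2 \<tau> = 1/12 + al 2 \<tau>"
definition A4 :: "complex \<Rightarrow> complex" where "A4 \<tau> = 1/360 + al 2 \<tau> / 6 + al 3 \<tau>"
definition A6 :: "complex \<Rightarrow> complex" where "A6 \<tau> = 1/20160 + al 2 \<tau> / 80 + al 3 \<tau> / 4 + al 4 \<tau>"

text \<open>As \<open>ss\<close> has a double zero at 0, the terms beyond \<sigma>^4 start at z^10
  and do not reach the coefficients listed.\<close>

lemma ex_comp_ss:
  assumes "g holomorphic_on UNIV"
  shows "(\<lambda>z. g (ss z)) holomorphic_on UNIV"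
    and "fps_nth (ex (\<lambda>z. g (ss z))) 0 = fps_nth (ex g) 0"
    and "fps_nth (ex (\<lambda>z. g (ss z))) 1 = 0"
    and "fps_nth (ex (\<lambda>z. g (ss z))) 2 = cc ^ 2 * fps_nth (ex g) 1"
    and "fps_nth (ex (\<lambda>z. g (ss z))) 3 = 0"
    and "fps_nth (ex (\<lambda>z. g (ss z))) 4 = cc ^ 4 * (fps_nth (ex g) 1 / 12 + fps_nth (ex g) 2)"
    and "fps_nth (ex (\<lambda>z. g (ss z))) 6 = cc ^ 6 * (fps_nth (ex g) 1 / 360 + fps_nth (ex g) 2 / 6 + fps_nth (ex g) 3)"
    and "fps_nth (ex (\<lambda>z. g (ss z))) 8 = cc ^ 8 * (fps_nth (ex g) 1 / 20160 + fps_nth (ex g) 2 / 80 + fps_nth (ex g) 3 / 4 + fps_nth (ex g) 4)"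
proof -
  have hol: "(\<lambda>z. u (ss z)) holomorphic_on UNIV" if "u holomorphic_on UNIV" for u
    using holomorphic_on_compose_gen[OF holomorphic_ss[OF holomorphic_on_ident] that, of UNIV] by (simp add: o_def)
  then show "(\<lambda>z. g (ss z)) holomorphic_on UNIV" using assms .
  obtain \<rho> where \<rho>: "\<rho> holomorphic_on UNIV" "\<And>z. g z = (\<Sum>j<5. fps_nth (ex g) j * z ^ j) + z ^ 5 * \<rho> z"
    using entire_taylor[OF assms] by blast
  let ?g = "fps_nth (ex g)"
  have hs: "ss holomorphic_on UNIV" by (intro holomorphic_intros)
  have "(\<lambda>z. g (ss z)) = (\<lambda>z. ?g 0 + ?g 1 * ss z + ?g 2 * (ss z * ss z) + ?g 3 * (ss z * (ss z * ss z)) + ?g 4 * (ss z * (ss z * (ss z * ss z)))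
     + (ss z * (ss z * (ss z * (ss z * ss z)))) * \<rho> (ss z))"
    by (rule ext, subst \<rho>(2)) (simp add: eval_nat_numeral mult_ac)
  then have e: "ex (\<lambda>z. g (ss z)) = fps_const (?g 0) + fps_const (?g 1) * Sf + fps_const (?g 2) * (Sf * Sf) + fps_const (?g 3) * (Sf * (Sf * Sf))
      + fps_const (?g 4) * (Sf * (Sf * (Sf * Sf))) + Sf * (Sf * (Sf * (Sf * Sf))) * ex (\<lambda>z. \<rho> (ss z))"
    unfolding Sf_def by (simp only: ex_add ex_mult ex_const hs hol[OF \<rho>(1)] holomorphic_on_add holomorphic_on_mult holomorphic_on_const)
  show "fps_nth (ex (\<lambda>z. g (ss z))) 0 = ?g 0"
    by (simp add: ex_0)
  show "fps_nth (ex (\<lambda>z. g (ss z))) 1 = 0"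
    unfolding e fps_add_nth fps_mult_left_const_nth Sf_values Sf2_values Sf3_values Sf4_values Sf5_values by simp
  show "fps_nth (ex (\<lambda>z. g (ss z))) 2 = cc ^ 2 * ?g 1"
    unfolding e fps_add_nth fps_mult_left_const_nth Sf_values Sf2_values Sf3_values Sf4_values Sf5_values by simp
  show "fps_nth (ex (\<lambda>z. g (ss z))) 3 = 0"
    unfolding e fps_add_nth fps_mult_left_const_nth Sf_values Sf2_values Sf3_values Sf4_values Sf5_values by simp
  show "fps_nth (ex (\<lambda>z. g (ss z))) 4 = cc ^ 4 * (?g 1 / 12 + ?g 2)"
    unfolding e fps_add_nth fps_mult_left_const_nth Sf_values Sf2_values Sf3_values Sf4_values Sf5_values by (simp add: algebra_simps)
  show "fps_nth (ex (\<lambda>z. g (ss z))) 6 = cc ^ 6 * (?g 1 / 360 + ?g 2 / 6 + ?g 3)"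
    unfolding e fps_add_nth fps_mult_left_const_nth Sf_values Sf2_values Sf3_values Sf4_values Sf5_values by (simp add: algebra_simps)
  show "fps_nth (ex (\<lambda>z. g (ss z))) 8 = cc ^ 8 * (?g 1 / 20160 + ?g 2 / 80 + ?g 3 / 4 + ?g 4)"
    unfolding e fps_add_nth fps_mult_left_const_nth Sf_values Sf2_values Sf3_values Sf4_values Sf5_values by (simp add: algebra_simps)
qed

lemma ex_aa:
  assumes "Im \<tau> > 0"
  shows "aa \<tau> holomorphic_on UNIV" "fps_nth (ex (aa \<tau>)) 0 = 0" "fps_nth (ex (aa \<tau>)) 1 = 0" "fps_nth (ex (aa \<tau>)) 2 = cc ^ 2"
    "fps_nth (ex (aa \<tau>)) 3 = 0" "fps_nth (ex (aa \<tau>)) 4 = cc ^ 4 * A2 \<tau>" "fps_nth (ex (aa \<tau>)) 6 = cc ^ 6 * A4 \<tau>"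
    "fps_nth (ex (aa \<tau>)) 8 = cc ^ 8 * A6 \<tau>"
proof -
  note E = ex_comp_ss[OF entire_ah[OF assms]]
  have 1: "fps_nth (ex (ah \<tau>)) 1 = 1" using al_1[OF assms] by (simp only: al_def)
  have 0: "fps_nth (ex (ah \<tau>)) 0 = 0" using al_0[of \<tau>] by (simp only: al_def)
  show "aa \<tau> holomorphic_on UNIV" "fps_nth (ex (aa \<tau>)) 0 = 0" "fps_nth (ex (aa \<tau>)) 1 = 0" "fps_nth (ex (aa \<tau>)) 2 = cc ^ 2"
    "fps_nth (ex (aa \<tau>)) 3 = 0" "fps_nth (ex (aa \<tau>)) 4 = cc ^ 4 * A2 \<tau>" "fps_nth (ex (aa \<tau>)) 6 = cc ^ 6 * A4 \<tau>"
    "fps_nth (ex (aa \<tau>)) 8 = cc ^ 8 * A6 \<tau>"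
    unfolding aa_def[abs_def] A2_def A4_def A6_def al_def using E 0 1 by simp_all
qed

lemma ex_gauss:
  fixes g :: complex
  shows "(\<lambda>z. exp (g * z\<^sup>2)) holomorphic_on UNIV"
    "fps_nth (ex (\<lambda>z. exp (g * z\<^sup>2))) 0 = 1" "fps_nth (ex (\<lambda>z. exp (g * z\<^sup>2))) 1 = 0"
    "fps_nth (ex (\<lambda>z. exp (g * z\<^sup>2))) 2 = g" "fps_nth (ex (\<lambda>z. exp (g * z\<^sup>2))) 3 = 0"
    "fps_nth (ex (\<lambda>z. exp (g * z\<^sup>2))) 4 = g\<^sup>2 / 2"
    "fps_nth (ex (\<lambda>z. exp (g * z\<^sup>2))) 5 = 0" "fps_nth (ex (\<lambda>z. exp (g * z\<^sup>2))) 6 = g ^ 3 / 6"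
proof -
  have h: "(\<lambda>w. exp (g * w)) holomorphic_on UNIV" by (intro holomorphic_intros)
  have e1: "ex (\<lambda>w. exp (g * w)) = fps_exp g" by (rule ex_unique[OF h has_fps_expansion_exp])
  obtain \<rho> where \<rho>: "\<rho> holomorphic_on UNIV" "\<And>z. exp (g * z) = (\<Sum>j<4. fps_nth (ex (\<lambda>w. exp (g * w))) j * z ^ j) + z ^ 4 * \<rho> z"
    using entire_taylor[OF h] by blast
  have h2: "(\<lambda>z. \<rho> (z\<^sup>2)) holomorphic_on UNIV"
    using holomorphic_on_compose_gen[OF _ \<rho>(1), of "\<lambda>z. z\<^sup>2" UNIV] by (simp add: o_def holomorphic_intros)
  show "(\<lambda>z. exp (g * z\<^sup>2)) holomorphic_on UNIV" by (intro holomorphic_intros)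
  have "(\<lambda>z. exp (g * z\<^sup>2)) = (\<lambda>z. 1 + g * z ^ 2 + (g\<^sup>2 / 2) * z ^ 4 + (g ^ 3 / 6) * z ^ 6 + z ^ 8 * \<rho> (z\<^sup>2))"
    by (rule ext, subst \<rho>(2), unfold e1) (simp add: eval_nat_numeral mult_ac)
  then have e: "ex (\<lambda>z. exp (g * z\<^sup>2)) = fps_const 1 + fps_const g * fps_X ^ 2 + fps_const (g\<^sup>2 / 2) * fps_X ^ 4 + fps_const (g ^ 3 / 6) * fps_X ^ 6
      + fps_X ^ 8 * ex (\<lambda>z. \<rho> (z\<^sup>2))"
    by (simp only: ex_add ex_mult ex_const ex_power ex_ident h2 holomorphic_on_add holomorphic_on_mult holomorphic_on_const holomorphic_on_power holomorphic_on_ident)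
  show "fps_nth (ex (\<lambda>z. exp (g * z\<^sup>2))) 0 = 1" "fps_nth (ex (\<lambda>z. exp (g * z\<^sup>2))) 1 = 0"
    "fps_nth (ex (\<lambda>z. exp (g * z\<^sup>2))) 2 = g" "fps_nth (ex (\<lambda>z. exp (g * z\<^sup>2))) 3 = 0"
    "fps_nth (ex (\<lambda>z. exp (g * z\<^sup>2))) 4 = g\<^sup>2 / 2"
    "fps_nth (ex (\<lambda>z. exp (g * z\<^sup>2))) 5 = 0" "fps_nth (ex (\<lambda>z. exp (g * z\<^sup>2))) 6 = g ^ 3 / 6"
    unfolding e fps_add_nth fps_mult_left_const_nth fps_X_power_mult_nth fps_X_power_nth by simp_all
qed

text \<open>Compare Taylor coefficients in the inversion formula for \<open>aa\<close>. In the
  variable u = 2 \<pi> i z its Gaussian factor is exp(\<gamma> u^2), whence the truncated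
  exponentials in \<gamma>.\<close>

lemma A_S:
  assumes \<tau>: "Im \<tau> > 0"
  defines "\<gamma> \<equiv> 1 / (cc * \<tau>)"
  shows "A2 (- 1 / \<tau>) = \<tau> ^ 2 * (A2 \<tau> + \<gamma>)"
    and "A4 (- 1 / \<tau>) = \<tau> ^ 4 * (A4 \<tau> + \<gamma> * A2 \<tau> + \<gamma>\<^sup>2 / 2)"
    and "A6 (- 1 / \<tau>) = \<tau> ^ 6 * (A6 \<tau> + \<gamma> * A4 \<tau> + \<gamma>\<^sup>2 * A2 \<tau> / 2 + \<gamma> ^ 3 / 6)"
proof -
  have \<tau>': "Im (- 1 / \<tau>) > 0" by (rule Im_neg_inverse_pos[OF \<tau>])
  have \<tau>0: "\<tau> \<noteq> 0" using \<tau> by auto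
  define g where "g = \<gamma> * cc\<^sup>2"
  have g: "ee (z\<^sup>2 / \<tau>) = exp (g * z\<^sup>2)" for z
    using \<tau>0 cc_nz unfolding ee_def g_def \<gamma>_def by (intro arg_cong[of _ _ exp]) (simp add: field_simps power2_eq_square)
  have eq: "\<tau>\<^sup>2 * ((1 / \<tau>) ^ n * fps_nth (ex (aa (- 1 / \<tau>))) n) = fps_nth (ex (\<lambda>z. exp (g * z\<^sup>2)) * ex (aa \<tau>)) n" for n
  proof -
    have "(\<lambda>z. \<tau>\<^sup>2 * aa (- 1 / \<tau>) (1 / \<tau> * z)) = (\<lambda>z. exp (g * z\<^sup>2) * aa \<tau> z)"
      using aa_S[OF \<tau>] g \<tau>0 by (simp add: fun_eq_iff)
    moreover have "(\<lambda>z. aa (- 1 / \<tau>) (1 / \<tau> * z)) holomorphic_on UNIV"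
      by (rule holomorphic_on_compose_gen[OF _ ex_aa(1)[OF \<tau>'], of "\<lambda>z. 1 / \<tau> * z" UNIV, unfolded o_def]) (auto intro!: holomorphic_intros)
    ultimately have "fps_const (\<tau>\<^sup>2) * ex (\<lambda>z. aa (- 1 / \<tau>) (1 / \<tau> * z)) = ex (\<lambda>z. exp (g * z\<^sup>2)) * ex (aa \<tau>)"
      using ex_mult[of "\<lambda>_. \<tau>\<^sup>2" "\<lambda>z. aa (- 1 / \<tau>) (1 / \<tau> * z)"] ex_mult[OF ex_gauss(1)[of g] ex_aa(1)[OF \<tau>]]
      by (simp only: ex_const holomorphic_on_const)
    then have "\<tau>\<^sup>2 * fps_nth (ex (\<lambda>z. aa (- 1 / \<tau>) (1 / \<tau> * z))) n = fps_nth (ex (\<lambda>z. exp (g * z\<^sup>2)) * ex (aa \<tau>)) n"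
      by (metis fps_mult_left_const_nth)
    then show ?thesis unfolding ex_scale[OF ex_aa(1)[OF \<tau>']] .
  qed
  have cancel: "A = \<tau> ^ k * V" if "\<tau>\<^sup>2 * ((1 / \<tau>) ^ (2 + k) * (x * A)) = x * V" "x \<noteq> 0" for A V x k
  proof -
    have "\<tau>\<^sup>2 * ((1 / \<tau>) ^ (2 + k) * (x * A)) = x * (A / \<tau> ^ k)"
      using \<tau>0 by (simp add: power_add power_divide power2_eq_square)
    then have "x * (A / \<tau> ^ k) = x * V" using that(1) by (simp only:)
    then have "A / \<tau> ^ k = V" using that(2) mult_left_cancel by blast
    then show ?thesis using \<tau>0 by (simp add: field_simps)
  qed
  note vals = fps_mult_nths ex_aa[OF \<tau>] ex_aa[OF \<tau>'] ex_gauss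
  show "A2 (- 1 / \<tau>) = \<tau> ^ 2 * (A2 \<tau> + \<gamma>)"
  proof (rule cancel[where x="cc ^ 4"])
    have "\<tau>\<^sup>2 * ((1 / \<tau>) ^ 4 * (cc ^ 4 * A2 (- 1 / \<tau>))) = cc ^ 4 * A2 \<tau> + g * cc ^ 2"
      using eq[of 4] unfolding vals by simp
    also have "\<dots> = cc ^ 4 * (A2 \<tau> + \<gamma>)" unfolding g_def by algebra
    finally show "\<tau>\<^sup>2 * ((1 / \<tau>) ^ (2 + 2) * (cc ^ 4 * A2 (- 1 / \<tau>))) = cc ^ 4 * (A2 \<tau> + \<gamma>)" by simp
  qed simp
  show "A4 (- 1 / \<tau>) = \<tau> ^ 4 * (A4 \<tau> + \<gamma> * A2 \<tau> + \<gamma>\<^sup>2 / 2)"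
  proof (rule cancel[where x="cc ^ 6"])
    have "\<tau>\<^sup>2 * ((1 / \<tau>) ^ 6 * (cc ^ 6 * A4 (- 1 / \<tau>))) = cc ^ 6 * A4 \<tau> + g * (cc ^ 4 * A2 \<tau>) + g\<^sup>2 / 2 * cc ^ 2"
      using eq[of 6] unfolding vals by simp
    also have "\<dots> = cc ^ 6 * (A4 \<tau> + \<gamma> * A2 \<tau> + \<gamma>\<^sup>2 / 2)"
    proof -
      have "c ^ 6 * x + \<gamma> * c\<^sup>2 * (c ^ 4 * y) + (\<gamma> * c\<^sup>2)\<^sup>2 / 2 * c ^ 2 = c ^ 6 * (x + \<gamma> * y + \<gamma>\<^sup>2 / 2)" for c x y :: complex
        by (simp add: eval_nat_numeral algebra_simps)
      then show ?thesis unfolding g_def .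
    qed
    finally show "\<tau>\<^sup>2 * ((1 / \<tau>) ^ (2 + 4) * (cc ^ 6 * A4 (- 1 / \<tau>))) = cc ^ 6 * (A4 \<tau> + \<gamma> * A2 \<tau> + \<gamma>\<^sup>2 / 2)" by simp
  qed simp
  show "A6 (- 1 / \<tau>) = \<tau> ^ 6 * (A6 \<tau> + \<gamma> * A4 \<tau> + \<gamma>\<^sup>2 * A2 \<tau> / 2 + \<gamma> ^ 3 / 6)"
  proof (rule cancel[where x="cc ^ 8"])
    have "\<tau>\<^sup>2 * ((1 / \<tau>) ^ 8 * (cc ^ 8 * A6 (- 1 / \<tau>))) = cc ^ 8 * A6 \<tau> + g * (cc ^ 6 * A4 \<tau>) + g\<^sup>2 / 2 * (cc ^ 4 * A2 \<tau>) + g ^ 3 / 6 * cc ^ 2"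
      using eq[of 8] unfolding vals by simp
    also have "\<dots> = cc ^ 8 * (A6 \<tau> + \<gamma> * A4 \<tau> + \<gamma>\<^sup>2 * A2 \<tau> / 2 + \<gamma> ^ 3 / 6)"
    proof -
      have "c ^ 8 * x + \<gamma> * c\<^sup>2 * (c ^ 6 * y) + (\<gamma> * c\<^sup>2)\<^sup>2 / 2 * (c ^ 4 * z) + (\<gamma> * c\<^sup>2) ^ 3 / 6 * c ^ 2
        = c ^ 8 * (x + \<gamma> * y + \<gamma>\<^sup>2 * z / 2 + \<gamma> ^ 3 / 6)" for c x y z :: complex
        by (simp add: eval_nat_numeral algebra_simps)
      then show ?thesis unfolding g_def .
    qed
    finally show "\<tau>\<^sup>2 * ((1 / \<tau>) ^ (2 + 6) * (cc ^ 8 * A6 (- 1 / \<tau>))) = cc ^ 8 * (A6 \<tau> + \<gamma> * A4 \<tau> + \<gamma>\<^sup>2 * A2 \<tau> / 2 + \<gamma> ^ 3 / 6)" by simp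
  qed simp
qed

section \<open>Eisenstein series of weights 4 and 6\<close>

lemma MF_of_qexp:
  assumes "qexp f C" "\<And>t. Im t > 0 \<Longrightarrow> f (- 1 / t) = t powi w * f t" shows "MF w f"
  unfolding MF_def using qexp_holomorphic[OF assms(1)] qexp_periodic[OF assms(1)] qexp_bounded[OF assms(1), of 1] assms(2) by auto

text \<open>Integer coefficients in the \<open>al j\<close> make p-integrality of the expansion
  visible. Modularity is seen in another form, through \<open>A2\<close> and
  \<open>A4\<close>.\<close>

definition E4 :: "complex \<Rightarrow> complex"
  where "E4 \<tau> = 1 - 120 * al 2 \<tau> - 1440 * al 3 \<tau> + 720 * (al 2 \<tau>)\<^sup>2"

definition E6 :: "complex \<Rightarrow> complex"
  where "E6 \<tau> = 1 + 252 * al 2 \<tau> + 15120 * al 3 \<tau> + 90720 * al 4 \<tau> - 7560 * (al 2 \<tau>)\<^sup>2 - 90720 * (al 2 \<tau> * al 3 \<tau>) + 30240 * (al 2 \<tau>) ^ 3"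

definition E4C :: "complex fps"
  where "E4C = 1 - fps_const 120 * alC 2 - fps_const 1440 * alC 3 + fps_const 720 * (alC 2)\<^sup>2"

definition E6C :: "complex fps"
  where "E6C = 1 + fps_const 252 * alC 2 + fps_const 15120 * alC 3 + fps_const 90720 * alC 4 - fps_const 7560 * (alC 2)\<^sup>2
    - fps_const 90720 * (alC 2 * alC 3) + fps_const 30240 * (alC 2) ^ 3"

lemma qexp_E4: "qexp E4 E4C"
  unfolding E4_def[abs_def] E4C_def by (intro qexp_add qexp_diff qexp_1 qexp_cmult qexp_power qexp_al)

lemma qexp_E6: "qexp E6 E6C"
  unfolding E6_def[abs_def] E6C_def by (intro qexp_add qexp_diff qexp_1 qexp_cmult qexp_power qexp_mult qexp_al)

lemma cin_E4C: assumes p: "prime p" shows "cin (p_integral p) E4C"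
  unfolding E4C_def
  by (intro cin_add[OF zpmod_p_integral[OF p]] cin_diff[OF p zpmod_p_integral[OF p]] cin_1[OF p] cin_mult[OF zpmod_p_integral[OF p]]
      cin_const[OF zpmod_p_integral[OF p]] cin_power[OF p] cin_alC[OF p] p_integral_numeral[OF p])

lemma cin_E6C: assumes p: "prime p" shows "cin (p_integral p) E6C"
  unfolding E6C_def
  by (intro cin_add[OF zpmod_p_integral[OF p]] cin_diff[OF p zpmod_p_integral[OF p]] cin_1[OF p] cin_mult[OF zpmod_p_integral[OF p]]
      cin_const[OF zpmod_p_integral[OF p]] cin_power[OF p] cin_alC[OF p] p_integral_numeral[OF p])

lemma E4C_values: "fps_nth E4C 0 = 1" "fps_nth E4C 1 = 240"
  unfolding E4C_def by (simp_all add: alC_values power2_eq_square fps_mult_nth)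

lemma E6C_values: "fps_nth E6C 0 = 1" "fps_nth E6C 1 = - 504"
  unfolding E6C_def by (simp_all add: alC_values power2_eq_square power3_eq_cube fps_mult_nth)

lemma MF_E4: "MF 4 E4"
proof (rule MF_of_qexp[OF qexp_E4])
  \<comment> \<open>The bracket is the u^4 coefficient of the logarithm of \<open>aa\<close> / u^2.
    A Gaussian factor changes only the u^2 coefficient of that logarithm, so this one is modular;
    -1440 makes its constant term 1.\<close>
  have E: "E4 \<tau> = - 1440 * (A4 \<tau> - (A2 \<tau>)\<^sup>2 / 2)" for \<tau>
    unfolding E4_def A4_def A2_def by (simp add: field_simps power2_eq_square)
  fix \<tau> :: complex assume \<tau>: "Im \<tau> > 0"
  show "E4 (- 1 / \<tau>) = \<tau> powi 4 * E4 \<tau>"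
    unfolding E A_S[OF \<tau>] by (simp add: field_simps power2_eq_square) (simp add: eval_nat_numeral algebra_simps)
qed

lemma MF_E6: "MF 6 E6"
proof (rule MF_of_qexp[OF qexp_E6])
  \<comment> \<open>Likewise the u^6 coefficient of the logarithm, scaled to constant term
    1.\<close>
  have E: "E6 \<tau> = 90720 * (A6 \<tau> - A2 \<tau> * A4 \<tau> + (A2 \<tau>) ^ 3 / 3)" for \<tau>
    unfolding E6_def A6_def A4_def A2_def by (simp add: field_simps power2_eq_square power3_eq_cube)
  fix \<tau> :: complex assume \<tau>: "Im \<tau> > 0"
  define \<gamma> where "\<gamma> = 1 / (cc * \<tau>)"
  show "E6 (- 1 / \<tau>) = \<tau> powi 6 * E6 \<tau>"
    unfolding E A_S[OF \<tau>] \<gamma>_def[symmetric] by (simp add: field_simps) (simp add: eval_nat_numeral algebra_simps)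
qed


section \<open>The generator of weight 0 and index 1\<close>

definition b1 :: "complex \<Rightarrow> complex \<Rightarrow> complex"
  where "b1 \<tau> \<sigma> = inverse (ah \<tau> (- 4)) * ah \<tau> (- 4 - \<sigma>)"

definition B1Q :: "complex poly fps"
  where "B1Q = cp (inverse (ev (- 4) AQ)) * Abs_fps (\<lambda>n. pcompose (fps_nth AQ n) [:- 4, - 1:])"

text \<open>Shifting z by 1/2 acts on \<sigma> as an affine map. Hence \<open>b1\<close> at
  \<open>ss z\<close> is the quotient of \<open>aa\<close> at z + 1/2 by its value at 1/2: a
  function of index 1 with value 1 at z = 0 and polynomial q-coefficients.\<close>

lemma ah_half: "ah \<tau> (- 4 - ss z) = aa \<tau> (z + 1 / 2)"
  by (simp add: aa_def ss_half)

lemma ah_m4_nonzero: assumes "Im \<tau> > 0" shows "ah \<tau> (- 4) \<noteq> 0"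
proof -
  have "aa \<tau> (1 / 2) \<noteq> 0"
  proof (rule aa_nonzero[OF assms])
    fix m n :: int
    show "1 / 2 \<noteq> of_int m * \<tau> + of_int n"
    proof
      assume e: "1 / 2 = of_int m * \<tau> + of_int n"
      from arg_cong[OF e, of Im] have "m = 0" using assms by simp
      then have "(1 / 2 :: complex) = of_int n" using e by simp
      then have "of_int (2 * n) = (1 :: complex)" by (simp add: field_simps)
      then have "2 * n = 1" by (metis of_int_1 of_int_eq_iff)
      then show False by presburger
    qed
  qed
  then show ?thesis using ah_half[of \<tau> 0] by simp
qed

lemma jh_b1: "jh b1 B1Q"
proof -
  have 1: "continuous_on (uhp \<times> UNIV) (\<lambda>(\<tau>, \<sigma>). b1 \<tau> \<sigma>)"
    unfolding b1_def split_beta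
    by (intro continuous_intros continuous_on_compose2[OF continuous_ah, where f="\<lambda>x. (fst x, - 4)", simplified]
         continuous_on_compose2[OF continuous_ah, where f="\<lambda>x. (fst x, - 4 - snd x)", simplified])
       (use ah_m4_nonzero in auto)
  have 2: "b1 \<tau> holomorphic_on UNIV" if "Im \<tau> > 0" for \<tau>
    unfolding b1_def[abs_def] by (intro holomorphic_intros holomorphic_ah) (use that in auto)
  have 3: "qexp (\<lambda>\<tau>. b1 \<tau> \<sigma>) (ev \<sigma> B1Q)" for \<sigma>
  proof -
    have "ev \<sigma> (Abs_fps (\<lambda>n. pcompose (fps_nth AQ n) [:- 4, - 1:])) = ev (- 4 - \<sigma>) AQ"
      by (simp add: fps_eq_iff poly_pcompose)
    then show ?thesis
      unfolding b1_def B1Q_def ev_mult ev_cp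
      by (auto intro!: qexp_mult qexp_inverse qexp_ah ah_m4_nonzero simp: AQ_0)
  qed
  show ?thesis unfolding jh_def using 1 2 3 by blast
qed

definition be :: "complex \<Rightarrow> complex"
  where "be \<tau> = fps_nth (ex (b1 \<tau>)) 1"

definition beC :: "complex fps"
  where "beC = Abs_fps (\<lambda>n. coeff (fps_nth B1Q n) 1)"

lemma qexp_be: "qexp be beC"
  using jh_taylor[OF jh_b1, of 1] unfolding be_def[abs_def] beC_def .

text \<open>The shift by 1/2 destroys invariance under the full modular group. Adding a multiple of
  \<open>aa\<close> keeps the index and the value at 0, and makes the u^2 coefficient equal to
  \<open>A2\<close>, as the inversion formula demands in weight 0. The result is phi_{0,1} /
  12.\<close>

definition bh :: "complex \<Rightarrow> complex \<Rightarrow> complex"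
  where "bh \<tau> \<sigma> = b1 \<tau> \<sigma> + (A2 \<tau> - be \<tau>) * ah \<tau> \<sigma>"

definition bb :: "complex \<Rightarrow> complex \<Rightarrow> complex"
  where "bb \<tau> z = bh \<tau> (ss z)"

definition BQ :: "complex poly fps"
  where "BQ = B1Q + cp (fps_const (1 / 12) + alC 2 - beC) * AQ"

lemma qexp_A2be: "qexp (\<lambda>\<tau>. A2 \<tau> - be \<tau>) (fps_const (1 / 12) + alC 2 - beC)"
  unfolding A2_def by (intro qexp_diff qexp_add qexp_const qexp_al qexp_be)

lemma jh_bh: "jh bh BQ"
proof -
  have 1: "continuous_on (uhp \<times> UNIV) (\<lambda>(\<tau>, \<sigma>). bh \<tau> \<sigma>)"
  proof -
    have "continuous_on (uhp \<times> (UNIV::complex set)) (\<lambda>x. A2 (fst x) - be (fst x))"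
      by (rule continuous_on_compose2[OF holomorphic_on_imp_continuous_on[OF qexp_holomorphic[OF qexp_A2be]]])
         (auto intro!: continuous_intros)
    then show ?thesis
      using jh_b1 continuous_ah unfolding bh_def split_beta jh_def by (intro continuous_on_add continuous_on_mult) auto
  qed
  have 2: "bh \<tau> holomorphic_on UNIV" if "Im \<tau> > 0" for \<tau>
    using jh_b1 entire_ah[OF that] that unfolding bh_def[abs_def] jh_def by (auto intro!: holomorphic_intros)
  have 3: "qexp (\<lambda>\<tau>. bh \<tau> \<sigma>) (ev \<sigma> BQ)" for \<sigma>
    using jh_b1 unfolding bh_def BQ_def ev_add ev_mult ev_cp jh_def
    by (intro qexp_add qexp_mult qexp_A2be qexp_ah) auto
  show ?thesis unfolding jh_def using 1 2 3 by blast
qed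

lemma p_integral_inverse_numeral:
  assumes "prime p" "p \<ge> 5" shows "1 / 2 \<in> p_integral p" "1 / 3 \<in> p_integral p"
proof -
  have "\<not> int p dvd 2" "\<not> int p dvd 3" using assms zdvd_imp_le[of "int p" 2] zdvd_imp_le[of "int p" 3] by auto
  then show "1 / 2 \<in> p_integral p" "1 / 3 \<in> p_integral p"
    using p_integral_frac[of p 2 1] p_integral_frac[of p 3 1] by auto
qed

lemma pcompose_in:
  assumes p: "prime p" and "\<And>j. coeff f j \<in> p_integral p" "\<And>j. coeff g j \<in> p_integral p"
  shows "coeff (pcompose f g) j \<in> p_integral p"
  using assms(2)
proof (induction f arbitrary: j rule: pCons_induct)
  case 0 then show ?case using p_integral_0[OF p] by simp
next
  case (pCons a f)
  have "coeff f j \<in> p_integral p" for j using pCons.prems[of "Suc j"] by simp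
  then have "coeff (pcompose f g) j \<in> p_integral p" for j by (rule pCons.IH)
  then have "coeff (g * pcompose f g) j \<in> p_integral p"
    by (intro coeff_mult_in[OF zpmod_p_integral[OF p]] assms(3))
  moreover have "coeff [:a:] j \<in> p_integral p"
    using pCons.prems[of 0] p_integral_0[OF p] by (auto simp: coeff_pCons split: nat.splits)
  ultimately show ?case by (simp add: pcompose_pCons p_integral_add[OF p])
qed

lemma poly_in:
  assumes p: "prime p" and "\<And>j. coeff f j \<in> p_integral p" "x \<in> p_integral p"
  shows "poly f x \<in> p_integral p"
  using assms(2)
proof (induction f rule: pCons_induct)
  case 0 then show ?case using p_integral_0[OF p] by simp
next
  case (pCons a f)
  have "coeff f j \<in> p_integral p" for j using pCons.prems[of "Suc j"] by simp
  then show ?case using pCons.IH pCons.prems[of 0] assms(3) by (auto intro: p_integral_add[OF p] p_integral_mult[OF p])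
qed

text \<open>The series to be inverted, \<open>aa\<close> at z = 1/2, has constant term -4, a unit
  for odd p.\<close>

lemma pin_B1Q: assumes p: "prime p" "p \<ge> 5" shows "pin (p_integral p) B1Q"
proof -
  note z = zpmod_p_integral[OF p(1)]
  have m4: "- 4 \<in> p_integral p" using p_integral_of_int[OF p(1), of "-4"] by simp
  have "cin (p_integral p) (ev (- 4) AQ)"
    unfolding cin_def ev_nth using pin_AQ[OF p(1)] m4 by (auto intro!: poly_in[OF p(1)] simp: pin_def)
  moreover have "inverse (fps_nth (ev (- 4) AQ) 0) \<in> p_integral p"
  proof -
    have "- (1 / 2 * (1 / 2)) \<in> p_integral p"
      by (intro p_integral_minus[OF p(1)] p_integral_mult[OF p(1)] p_integral_inverse_numeral[OF p])
    then show ?thesis by (simp add: AQ_0)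
  qed
  ultimately have i: "cin (p_integral p) (inverse (ev (- 4) AQ))" by (rule cin_inverse[OF p(1)]) (simp add: AQ_0)
  have "coeff [:- 4, - 1 :: complex:] j \<in> p_integral p" for j
    using m4 p_integral_of_int[OF p(1), of "-1"] p_integral_0[OF p(1)] by (auto simp: coeff_pCons split: nat.splits)
  then have "pin (p_integral p) (Abs_fps (\<lambda>n. pcompose (fps_nth AQ n) [:- 4, - 1:]))"
    unfolding pin_def using pin_AQ[OF p(1)] by (auto intro!: pcompose_in[OF p(1)] simp: pin_def)
  then show ?thesis unfolding B1Q_def by (intro pin_mult[OF z] pin_cp[OF z] i)
qed

lemma pin_BQ: assumes p: "prime p" "p \<ge> 5" shows "pin (p_integral p) BQ"
proof -
  note z = zpmod_p_integral[OF p(1)]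
  have "(1 / 2 * (1 / 2)) * (1 / 3) \<in> p_integral p"
    by (intro p_integral_mult[OF p(1)] p_integral_inverse_numeral[OF p])
  then have "1 / 12 \<in> p_integral p" by simp
  moreover have "cin (p_integral p) beC" using pin_B1Q[OF p] by (simp add: cin_def pin_def beC_def)
  ultimately show ?thesis unfolding BQ_def
    by (intro pin_add[OF z] pin_B1Q[OF p] pin_mult[OF z] pin_cp[OF z] cin_diff[OF p(1) z] cin_add[OF z] cin_const[OF z] cin_alC[OF p(1)] pin_AQ[OF p(1)])
qed

text \<open>At q = 0 the generators reduce to \<sigma> and 1 + \<sigma>/12. This is what makes the
  comparison of coefficients in index m a triangular system.\<close>

lemma BQ_0: "fps_nth BQ 0 = [:1, 1 / 12:]"
proof -
  have 1: "fps_nth B1Q 0 = [:1, 1 / 4:]"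
    unfolding B1Q_def by (simp add: AQ_0 pcompose_pCons)
  then have "fps_nth beC 0 = 1 / 4" by (simp add: beC_def)
  then show ?thesis unfolding BQ_def using 1 by (simp add: AQ_0 alC_values field_simps)
qed

lemma ex_bb:
  assumes "Im \<tau> > 0"
  shows "bb \<tau> holomorphic_on UNIV" "fps_nth (ex (bb \<tau>)) 0 = 1" "fps_nth (ex (bb \<tau>)) 1 = 0"
    "fps_nth (ex (bb \<tau>)) 2 = cc ^ 2 * A2 \<tau>" "fps_nth (ex (bb \<tau>)) 3 = 0"
proof -
  have h: "bh \<tau> holomorphic_on UNIV" "b1 \<tau> holomorphic_on UNIV" using jh_bh jh_b1 assms by (auto simp: jh_def)
  have "ex (bh \<tau>) = ex (b1 \<tau>) + fps_const (A2 \<tau> - be \<tau>) * ex (ah \<tau>)"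
    unfolding bh_def[abs_def] using h entire_ah[OF assms] by (simp add: ex_add ex_mult ex_const holomorphic_intros)
  then have "fps_nth (ex (bh \<tau>)) 1 = be \<tau> + (A2 \<tau> - be \<tau>) * al 1 \<tau>" by (simp add: be_def al_def)
  then have 1: "fps_nth (ex (bh \<tau>)) 1 = A2 \<tau>" unfolding al_1[OF assms] by simp
  have 0: "fps_nth (ex (bh \<tau>)) 0 = 1" using ah_m4_nonzero[OF assms] by (simp add: ex_0 bh_def b1_def ah_def)
  show "bb \<tau> holomorphic_on UNIV" "fps_nth (ex (bb \<tau>)) 0 = 1" "fps_nth (ex (bb \<tau>)) 1 = 0"
    "fps_nth (ex (bb \<tau>)) 2 = cc ^ 2 * A2 \<tau>" "fps_nth (ex (bb \<tau>)) 3 = 0"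
    unfolding bb_def[abs_def] using ex_comp_ss[OF h(1)] 0 1 by simp_all
qed

lemma bb_minus [simp]: "bb \<tau> (- z) = bb \<tau> z"
  by (simp add: bb_def)

lemma bb_idx: assumes "Im \<tau> > 0" shows "idx \<tau> 1 (bb \<tau>)"
proof -
  have e: "bb \<tau> z = inverse (ah \<tau> (- 4)) * aa \<tau> (z + 1 / 2) + (A2 \<tau> - be \<tau>) * aa \<tau> z" for z
    by (simp add: bb_def bh_def b1_def ah_half aa_def)
  have "ee (- (2 * (z + 1 / 2) + \<tau>)) = ee (- (2 * z + \<tau>))" for z
  proof -
    have "- (2 * (z + 1 / 2) + \<tau>) = - (2 * z + \<tau>) - 1" by (simp add: field_simps)
    then have "ee (- (2 * (z + 1 / 2) + \<tau>)) = ee (- (2 * z + \<tau>) - 1)" by (rule arg_cong)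
    then show ?thesis by (simp only: ee_diff ee_1 div_by_1)
  qed
  then have "aa \<tau> (z + \<tau> + 1 / 2) = ee (- (2 * z + \<tau>)) * aa \<tau> (z + 1 / 2)" for z
    using aa_shift[OF assms, of "z + 1 / 2"] by (simp add: add_ac)
  moreover have "aa \<tau> (z + 1 + 1 / 2) = aa \<tau> (z + 1 / 2)" for z
    using aa_periodic[of \<tau> "z + 1 / 2"] by (simp only: add_ac)
  ultimately show ?thesis using ex_bb(1)[OF assms] aa_shift[OF assms] unfolding idx_def e[abs_def]
    by (simp add: distrib_left mult.left_commute)
qed

text \<open>With the Gaussian moved to the left, the difference of the two sides has index 1 and
  Taylor coefficients vanishing through z^2: in degree 0 by normalisation, in degree 2 by the
  quasimodular law of \<open>A2\<close>. In index 1 only 0 has this property.\<close>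

lemma bb_S:
  assumes \<tau>: "Im \<tau> > 0"
  shows "bb (- 1 / \<tau>) (z / \<tau>) = ee (z\<^sup>2 / \<tau>) * bb \<tau> z"
proof -
  have \<tau>': "Im (- 1 / \<tau>) > 0" by (rule Im_neg_inverse_pos[OF \<tau>])
  have \<tau>0: "\<tau> \<noteq> 0" using \<tau> by auto
  define g where "g = - cc / \<tau>"
  have g: "ee (- z\<^sup>2 / \<tau>) = exp (g * z\<^sup>2)" for z
    unfolding ee_def g_def by (intro arg_cong[of _ _ exp]) (simp add: field_simps)
  define G where "G = (\<lambda>z. bb (- 1 / \<tau>) (1 / \<tau> * z) * exp (g * z\<^sup>2) - bb \<tau> z)"
  have h1: "(\<lambda>z. bb (- 1 / \<tau>) (1 / \<tau> * z)) holomorphic_on UNIV"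
    by (rule holomorphic_on_compose_gen[OF _ ex_bb(1)[OF \<tau>'], of "\<lambda>z. 1 / \<tau> * z" UNIV, unfolded o_def]) (auto intro!: holomorphic_intros)
  have idxG: "idx \<tau> 1 G"
    using idx_diff[OF idx_S[OF \<tau> bb_idx[OF \<tau>']] bb_idx[OF \<tau>]] unfolding G_def g[symmetric] by simp
  then have hG: "G holomorphic_on UNIV" by (simp add: idx_def)
  have eG: "ex G = ex (\<lambda>z. bb (- 1 / \<tau>) (1 / \<tau> * z)) * ex (\<lambda>z. exp (g * z\<^sup>2)) - ex (bb \<tau>)"
    unfolding G_def by (simp only: ex_diff ex_mult h1 ex_gauss(1) ex_bb(1)[OF \<tau>] holomorphic_on_mult)
  note vals = fps_mult_nths ex_bb[OF \<tau>] ex_bb[OF \<tau>'] ex_gauss ex_scale[OF ex_bb(1)[OF \<tau>']] fps_mult_nth_0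
  have G0: "fps_nth (ex G) 0 = 0" unfolding eG fps_sub_nth vals by simp
  have G1: "fps_nth (ex G) 1 = 0" unfolding eG fps_sub_nth vals by simp
  have G2: "fps_nth (ex G) 2 = 0"
  proof -
    have "fps_nth (ex G) 2 = g + (1 / \<tau>) ^ 2 * (cc ^ 2 * A2 (- 1 / \<tau>)) - cc ^ 2 * A2 \<tau>"
      unfolding eG fps_sub_nth vals by simp
    also have "(1 / \<tau>) ^ 2 * (cc ^ 2 * A2 (- 1 / \<tau>)) = cc ^ 2 * (A2 \<tau> + 1 / (cc * \<tau>))"
      unfolding A_S(1)[OF \<tau>] using \<tau>0 by (simp add: power_divide)
    also have "g + cc ^ 2 * (A2 \<tau> + 1 / (cc * \<tau>)) - cc ^ 2 * A2 \<tau> = 0"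
      using \<tau>0 cc_nz unfolding g_def by (simp add: field_simps power2_eq_square)
    finally show ?thesis .
  qed
  have "fps_nth (ex G) i = 0" if "i < 2 * 1 + 1" for i
  proof -
    have "i = 0 \<or> i = 1 \<or> i = 2" using that by auto
    then show ?thesis using G0 G1 G2 by blast
  qed
  then have "vo (2 * 1 + 1) G" by (rule vo_ex[OF hG])
  then have "G z = 0" by (rule idx_vanishing_0[OF \<tau> idxG])
  then have "bb (- 1 / \<tau>) (z / \<tau>) * ee (- z\<^sup>2 / \<tau>) = bb \<tau> z" unfolding g by (simp add: G_def)
  moreover have "ee (- z\<^sup>2 / \<tau>) = inverse (ee (z\<^sup>2 / \<tau>))" by (simp add: ee_minus[symmetric])
  ultimately have "bb (- 1 / \<tau>) (z / \<tau>) / ee (z\<^sup>2 / \<tau>) = bb \<tau> z" by (simp only: divide_inverse)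
  then show ?thesis by (simp add: divide_eq_eq mult_ac)
qed

section \<open>Division by the discriminant and the Sturm bound for elliptic modular forms\<close>

lemma MF_mult: assumes "MF v f" "MF w g" shows "MF (v + w) (\<lambda>t. f t * g t)"
proof -
  obtain B where B: "\<And>t. Im t \<ge> 1 \<Longrightarrow> norm (f t) \<le> B" using assms(1) by (auto simp: MF_def)
  obtain B' where B': "\<And>t. Im t \<ge> 1 \<Longrightarrow> norm (g t) \<le> B'" using assms(2) by (auto simp: MF_def)
  have "norm (f t * g t) \<le> B * B'" if "Im t \<ge> 1" for t
    unfolding norm_mult using B[OF that] B'[OF that] by (intro mult_mono) (auto intro: order_trans[OF norm_ge_zero])
  moreover have "t powi (v + w) = t powi v * t powi w" if "Im t > 0" for t
    using that by (intro power_int_add) auto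
  ultimately show ?thesis using assms unfolding MF_def by (auto intro!: holomorphic_intros)
qed

lemma MF_diff: assumes "MF w f" "MF w g" shows "MF w (\<lambda>t. f t - g t)"
proof -
  obtain B where B: "\<And>t. Im t \<ge> 1 \<Longrightarrow> norm (f t) \<le> B" using assms(1) by (auto simp: MF_def)
  obtain B' where B': "\<And>t. Im t \<ge> 1 \<Longrightarrow> norm (g t) \<le> B'" using assms(2) by (auto simp: MF_def)
  have "norm (f t - g t) \<le> B + B'" if "Im t \<ge> 1" for t
    using B[OF that] B'[OF that] norm_triangle_ineq4[of "f t" "g t"] by linarith
  then show ?thesis using assms unfolding MF_def by (auto intro!: holomorphic_intros simp: right_diff_distrib)
qed

lemma MF_const: "MF 0 (\<lambda>_. c)"
  unfolding MF_def by auto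

lemma MF_cmult: "MF w f \<Longrightarrow> MF w (\<lambda>t. c * f t)"
  using MF_mult[OF MF_const[of c], of w f] by simp

lemma MF_power: "MF w f \<Longrightarrow> MF (int n * w) (\<lambda>t. f t ^ n)"
proof (induction n)
  case 0 show ?case using MF_const[of 1] by simp
next
  case (Suc n)
  then show ?case using MF_mult[of w f "int n * w" "\<lambda>t. f t ^ n"] by (simp add: algebra_simps)
qed

section \<open>A form of weight -12 without zeros\<close>

definition X2 :: "complex \<Rightarrow> complex" where "X2 \<tau> = ee (\<tau> / 4) * aa \<tau> (\<tau> / 2)"
definition X3 :: "complex \<Rightarrow> complex" where "X3 \<tau> = ee (\<tau> / 4) * aa \<tau> (\<tau> / 2 + 1 / 2)"
text \<open>The values of \<open>aa\<close> at the three points of order 2, scaled by e(\<tau>/4)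
  where needed, are permuted by translation and inversion up to roots of unity and powers of \<tau>.
  Squaring their product removes the remaining sign; the outcome is a constant multiple of
  1/Delta.\<close>

definition YY :: "complex \<Rightarrow> complex" where "YY \<tau> = (aa \<tau> (1 / 2) * (X2 \<tau> * X3 \<tau>))\<^sup>2"

lemma YY_holomorphic: "YY holomorphic_on uhp"
proof -
  have a: "(\<lambda>\<tau>. aa \<tau> (g \<tau>)) holomorphic_on uhp" if "g holomorphic_on uhp" for g
    unfolding aa_def by (rule holomorphic_ah) (use that in \<open>auto intro!: holomorphic_intros\<close>)
  show ?thesis unfolding YY_def[abs_def] X2_def X3_def by (intro holomorphic_intros a) auto
qed

lemma YY_T: "YY (\<tau> + 1) = YY \<tau>"
proof -
  have 2: "X2 (\<tau> + 1) = ee (1 / 4) * X3 \<tau>"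
    unfolding X2_def X3_def add_divide_distrib ee_add by simp
  have "aa \<tau> ((\<tau> + 1) / 2 + 1 / 2) = aa \<tau> (\<tau> / 2 + 1)" by (simp add: field_simps)
  then have 3: "X3 (\<tau> + 1) = ee (1 / 4) * X2 \<tau>"
    unfolding X2_def X3_def by (simp add: add_divide_distrib ee_add)
  have "ee (1 / 4) * ee (1 / 4) = - 1" unfolding ee_add[symmetric] using ee_half by simp
  then have "X2 (\<tau> + 1) * X3 (\<tau> + 1) = - (X2 \<tau> * X3 \<tau>)"
    unfolding 2 3 by (simp add: mult.left_commute mult.assoc[symmetric])
  then show ?thesis by (simp add: YY_def power2_eq_square)
qed

lemma YY_S: assumes \<tau>: "Im \<tau> > 0" shows "YY (- 1 / \<tau>) = \<tau> powi (- 12) * YY \<tau>"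
proof -
  have \<tau>0: "\<tau> \<noteq> 0" using \<tau> by auto
  have 1: "aa (- 1 / \<tau>) (1 / 2) = X2 \<tau> / \<tau>\<^sup>2"
  proof -
    have e: "(\<tau> / 2)\<^sup>2 / \<tau> = \<tau> / 4" using \<tau>0 by (simp add: field_simps power2_eq_square)
    show ?thesis using aa_S[OF \<tau>, of "\<tau> / 2"] \<tau>0 unfolding e by (simp add: X2_def)
  qed
  have 2: "X2 (- 1 / \<tau>) = aa \<tau> (1 / 2) / \<tau>\<^sup>2"
  proof -
    have "(- 1 / 2)\<^sup>2 / \<tau> = 1 / (4 * \<tau>)" by (simp add: field_simps power2_eq_square)
    then have "aa (- 1 / \<tau>) ((- 1 / 2) / \<tau>) = ee (1 / (4 * \<tau>)) * aa \<tau> (1 / 2) / \<tau>\<^sup>2"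
      using aa_S[OF \<tau>, of "- 1 / 2"] aa_minus[of \<tau> "1 / 2"] by simp
    moreover have e: "(- 1 / \<tau>) / 2 = (- 1 / 2) / \<tau>" by simp
    moreover have "ee ((- 1 / \<tau>) / 4) * ee (1 / (4 * \<tau>)) = 1"
      unfolding ee_add[symmetric] by (simp add: mult.commute)
    ultimately show ?thesis unfolding X2_def e by (simp only: mult.assoc[symmetric] times_divide_eq_right mult_1_left)
  qed
  have 3: "X3 (- 1 / \<tau>) = - (X3 \<tau> / \<tau>\<^sup>2)"
  proof -
    have e: "((\<tau> - 1) / 2)\<^sup>2 / \<tau> = \<tau> / 4 + 1 / (4 * \<tau>) - 1 / 2" using \<tau>0 by (simp add: field_simps power2_eq_square)
    have "((\<tau> - 1) / 2) / \<tau> = (- 1 / \<tau>) / 2 + 1 / 2" using \<tau>0 by (simp add: field_simps)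
    then have "X3 (- 1 / \<tau>) = ee ((- 1 / \<tau>) / 4) * (ee (\<tau> / 4 + 1 / (4 * \<tau>) - 1 / 2) * aa \<tau> ((\<tau> - 1) / 2) / \<tau>\<^sup>2)"
      unfolding X3_def using aa_S[OF \<tau>, of "(\<tau> - 1) / 2"] e by simp
    also have "aa \<tau> ((\<tau> - 1) / 2) = aa \<tau> (\<tau> / 2 + 1 / 2)"
      using aa_periodic[of \<tau> "(\<tau> - 1) / 2"] by (simp add: field_simps)
    also have "ee (\<tau> / 4 + 1 / (4 * \<tau>) - 1 / 2) = - (ee (\<tau> / 4) * ee (1 / (4 * \<tau>)))"
      by (simp add: ee_diff ee_add ee_half)
    also have "ee ((- 1 / \<tau>) / 4) * (- (ee (\<tau> / 4) * ee (1 / (4 * \<tau>))) * aa \<tau> (\<tau> / 2 + 1 / 2) / \<tau>\<^sup>2) =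
        - ((ee ((- 1 / \<tau>) / 4) * ee (1 / (4 * \<tau>))) * X3 \<tau> / \<tau>\<^sup>2)"
      unfolding X3_def by simp
    also have "ee ((- 1 / \<tau>) / 4) * ee (1 / (4 * \<tau>)) = 1"
      unfolding ee_add[symmetric] by (simp add: mult.commute)
    finally show ?thesis by simp
  qed
  have "YY (- 1 / \<tau>) = YY \<tau> / (\<tau>\<^sup>2 * (\<tau>\<^sup>2 * \<tau>\<^sup>2))\<^sup>2"
    unfolding YY_def 1 2 3 by (simp add: power_divide power_mult_distrib mult_ac)
  also have "(\<tau>\<^sup>2 * (\<tau>\<^sup>2 * \<tau>\<^sup>2))\<^sup>2 = \<tau> ^ 12" by (simp add: power_mult_distrib power_mult[symmetric] power_add[symmetric])
  finally show ?thesis by (simp add: power_int_minus field_simps)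
qed

text \<open>At most a simple pole at the cusp. Where |e(z)| = |q|^(1/2) = r, \<open>ss z\<close> is
  at most 4/r and the product stays bounded. The two such values, together with the factor r from
  the two e(\<tau>/4), give a bound of order 1/r, and the square is of order 1/|q|.\<close>

lemma YY_bound: obtains B where "\<And>\<tau>. Im \<tau> \<ge> 1 \<Longrightarrow> norm (YY \<tau>) \<le> B / norm (ee \<tau>)"
proof -
  obtain B1 where B1: "\<And>\<tau>. Im \<tau> \<ge> 1 \<Longrightarrow> norm (ah \<tau> (- 4)) \<le> B1"
    using qexp_bounded[OF qexp_ah, of 1 "- 4"] by auto
  define C where "C = 4 * exp (64::real)"
  have main: "norm (aa \<tau> z) \<le> C / norm (ee (\<tau> / 2))" if \<tau>: "Im \<tau> \<ge> 1" and z: "norm (ee z) = norm (ee (\<tau> / 2))" for \<tau> z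
  proof -
    define r where "r = norm (ee (\<tau> / 2))"
    have r0: "r > 0" by (simp add: r_def)
    have q: "norm (ee \<tau>) = r\<^sup>2"
      unfolding r_def power2_eq_square norm_mult[symmetric] ee_add[symmetric] by simp
    have r2: "r \<le> 1 / 2"
    proof -
      have "r = exp (- (pi * Im \<tau>))" by (simp add: r_def norm_ee)
      also have "\<dots> \<le> exp (- 1)" using \<tau> pi_ge_two mult_mono[of 1 pi 1 "Im \<tau>"] by simp
      also have "\<dots> \<le> 1 / 2" using exp_ge_add_one_self[of 1] by (simp add: exp_minus field_simps)
      finally show ?thesis .
    qed
    have "r\<^sup>2 \<le> (1 / 2)\<^sup>2" using r0 r2 by (intro power_mono) auto
    then have r4: "r\<^sup>2 \<le> 1 / 2" by (simp add: power2_eq_square)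
    have "norm (ss z) \<le> norm (ee z) + 2 + norm (ee (- z))"
      unfolding ss_def using norm_triangle_ineq[of "ee z - 2" "ee (- z)"] norm_triangle_ineq4[of "ee z" 2] by simp
    also have "norm (ee (- z)) = inverse (norm (ee z))" by (simp only: ee_minus norm_inverse)
    also have "norm (ee z) + 2 + inverse (norm (ee z)) = r + 2 + 1 / r"
      unfolding z r_def[symmetric] by (simp only: inverse_eq_divide)
    also have "\<dots> \<le> 4 / r"
    proof -
      have "r * r \<le> 1" using r0 r2 by (simp add: mult_le_one)
      then have "r * r + 2 * r + 1 \<le> 4" using r2 by linarith
      moreover have "r + 2 + 1 / r = (r * r + 2 * r + 1) / r" using r0 by (simp add: field_simps)
      ultimately show ?thesis using r0 by (simp add: divide_right_mono)
    qed
    finally have s: "norm (ss z) \<le> 4 / r" .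
    have "norm (kap (ee \<tau>) (ss z)) \<le> exp (norm (ss z) * norm (ee \<tau>) / (1 - norm (ee \<tau>)) ^ 3)"
      by (rule norm_kap_le) (use r4 q in auto)
    also have "\<dots> \<le> exp ((4 / r) * r\<^sup>2 / (1 / 2) ^ 3)"
      unfolding exp_le_cancel_iff q by (intro frac_le mult_mono power_mono s) (use r0 r4 in auto)
    also have "\<dots> \<le> exp 32"
      unfolding exp_le_cancel_iff using r0 r2 by (simp add: power2_eq_square power3_eq_cube)
    finally have k: "norm (kap (ee \<tau>) (ss z)) \<le> exp 32" .
    have "norm (aa \<tau> z) \<le> 4 / r * (exp 32)\<^sup>2"
      unfolding aa_def ah_def norm_mult norm_power by (intro mult_mono s power_mono k) (use r0 in auto)
    also have "(exp 32)\<^sup>2 = exp (64::real)" by (simp add: exp_of_nat_mult[symmetric])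
    finally show ?thesis by (simp add: C_def r_def mult_ac)
  qed
  have "norm (YY \<tau>) \<le> (B1\<^sup>2 * C ^ 4) / norm (ee \<tau>)" if \<tau>: "Im \<tau> \<ge> 1" for \<tau>
  proof -
    define r where "r = norm (ee (\<tau> / 2))"
    have r0: "r > 0" by (simp add: r_def)
    have q: "norm (ee \<tau>) = r\<^sup>2"
      unfolding r_def power2_eq_square norm_mult[symmetric] ee_add[symmetric] by simp
    have h: "norm (ee (\<tau> / 2 + 1 / 2)) = norm (ee (\<tau> / 2))" by (simp add: norm_ee)
    have "norm (ee (\<tau> / 4)) * norm (ee (\<tau> / 4)) = r"
      unfolding norm_mult[symmetric] ee_add[symmetric] r_def by simp
    then have "norm (X2 \<tau> * X3 \<tau>) = r * (norm (aa \<tau> (\<tau> / 2)) * norm (aa \<tau> (\<tau> / 2 + 1 / 2)))"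
      unfolding X2_def X3_def norm_mult by (simp add: mult_ac)
    also have "\<dots> \<le> r * ((C / r) * (C / r))"
      using main[OF \<tau> refl] main[OF \<tau> h] r0 unfolding r_def[symmetric]
      by (intro mult_left_mono mult_mono) (auto simp: C_def)
    also have "\<dots> = C\<^sup>2 / r" using r0 by (simp add: power2_eq_square)
    finally have x: "norm (X2 \<tau> * X3 \<tau>) \<le> C\<^sup>2 / r" .
    have a: "norm (aa \<tau> (1 / 2)) \<le> B1" using B1[OF \<tau>] ah_half[of \<tau> 0] by simp
    have "norm (YY \<tau>) \<le> (B1 * (C\<^sup>2 / r))\<^sup>2"
      unfolding YY_def norm_power norm_mult[of "aa \<tau> (1 / 2)"]
      by (intro power_mono mult_mono a x) (use order_trans[OF norm_ge_zero a] in auto)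
    also have "\<dots> = (B1\<^sup>2 * C ^ 4) / norm (ee \<tau>)"
      unfolding q by (simp add: power_mult_distrib power_divide power_mult[symmetric])
    finally show ?thesis .
  qed
  then show ?thesis by (rule that)
qed

lemma qexp_shift:
  assumes f: "qexp f C" and C0: "fps_nth C 0 = 0"
  shows "qexp (\<lambda>\<tau>. f \<tau> / ee \<tau>) (fps_shift 1 C)"
proof (rule qexpI_sums)
  fix \<tau> :: complex assume "Im \<tau> > 0"
  from qexp_sums[OF f this] have "(\<lambda>n. fps_nth C (Suc n) * ee (of_nat (Suc n) * \<tau>)) sums f \<tau>"
    using sums_Suc_iff[of "\<lambda>n. fps_nth C n * ee (of_nat n * \<tau>)" "f \<tau>"] C0 by simp
  then have "(\<lambda>n. fps_nth C (Suc n) * ee (of_nat (Suc n) * \<tau>) / ee \<tau>) sums (f \<tau> / ee \<tau>)" by (rule sums_divide)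
  then show "(\<lambda>n. fps_nth (fps_shift 1 C) n * ee (of_nat n * \<tau>)) sums (f \<tau> / ee \<tau>)"
    unfolding ee_of_nat_mult by simp
qed

text \<open>The zero of f at the cusp absorbs the pole of \<open>YY\<close>.\<close>

lemma MF_times_YY:
  assumes f: "MF w f" "qexp f C" and C0: "fps_nth C 0 = 0"
  shows "MF (w - 12) (\<lambda>\<tau>. f \<tau> * YY \<tau>)"
proof -
  obtain B where B: "\<And>\<tau>. Im \<tau> \<ge> 1 \<Longrightarrow> norm (YY \<tau>) \<le> B / norm (ee \<tau>)" using YY_bound by blast
  obtain B' where B': "\<And>\<tau>. Im \<tau> \<ge> 1 \<Longrightarrow> norm (f \<tau> / ee \<tau>) \<le> B'"
    using qexp_bounded[OF qexp_shift[OF f(2) C0], of 1] by auto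
  have "norm (f \<tau> * YY \<tau>) \<le> B' * B" if "Im \<tau> \<ge> 1" for \<tau>
  proof -
    have "norm (f \<tau> * YY \<tau>) \<le> norm (f \<tau>) * (B / norm (ee \<tau>))"
      unfolding norm_mult using B[OF that] by (intro mult_left_mono) auto
    also have "\<dots> = norm (f \<tau> / ee \<tau>) * B" by (simp add: norm_divide)
    also have "\<dots> \<le> B' * B"
    proof (rule mult_right_mono[OF B'[OF that]])
      have "0 \<le> B / norm (ee \<tau>)" using order_trans[OF norm_ge_zero B[OF that]] .
      then show "0 \<le> B" by (simp add: zero_le_divide_iff)
    qed
    finally show ?thesis .
  qed
  moreover have "f (- 1 / t) * YY (- 1 / t) = t powi (w - 12) * (f t * YY t)" if "Im t > 0" for t
  proof -
    have "t \<noteq> 0" using that by auto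
    then have "t powi (w - 12) = t powi w * t powi (- 12)" using power_int_add[of t w "- 12"] by simp
    then show ?thesis using f(1) YY_S[OF that] that by (simp add: MF_def)
  qed
  ultimately show ?thesis
    using f(1) YY_holomorphic YY_T unfolding MF_def by (auto intro!: holomorphic_intros)
qed

text \<open>Subtracting the constant term and multiplying by \<open>YY\<close> leads to weight -12,
  where every form vanishes.\<close>

lemma MF_0_const:
  assumes f: "MF 0 f" "qexp f C" and \<tau>: "Im \<tau> > 0" and nz: "\<And>\<tau>. Im \<tau> > 0 \<Longrightarrow> YY \<tau> \<noteq> 0"
  shows "f \<tau> = fps_nth C 0"
proof -
  have "MF 0 (\<lambda>t. f t - fps_nth C 0)" by (rule MF_diff[OF f(1) MF_const])
  moreover have "qexp (\<lambda>t. f t - fps_nth C 0) (C - fps_const (fps_nth C 0))" by (rule qexp_diff[OF f(2) qexp_const])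
  ultimately have "MF (0 - 12) (\<lambda>t. (f t - fps_nth C 0) * YY t)" by (rule MF_times_YY) simp
  then have "(f \<tau> - fps_nth C 0) * YY \<tau> = 0" by (rule MF_neg[OF _ _ \<tau>]) simp
  then show ?thesis using nz[OF \<tau>] by simp
qed

lemma YY_nonzero: assumes \<tau>: "Im \<tau> > 0" shows "YY \<tau> \<noteq> 0"
proof -
  have *: "aa \<tau> (of_real x * \<tau> + of_real y) \<noteq> 0" if xy: "x = 0 \<or> x = 1 / 2" "y = 0 \<or> y = 1 / 2" "x \<noteq> 0 \<or> y \<noteq> 0" for x y :: real
  proof (rule aa_nonzero[OF \<tau>])
    fix m n :: int
    show "of_real x * \<tau> + of_real y \<noteq> of_int m * \<tau> + of_int n"
    proof
      assume e: "of_real x * \<tau> + of_real y = of_int m * \<tau> + of_int n"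
      from arg_cong[OF e, of Im] have x: "x = of_int m" using \<tau> by simp
      with arg_cong[OF e, of Re] have y: "y = of_int n" by simp
      have h: "of_int k \<noteq> (1 / 2 :: real)" for k :: int
      proof
        assume "of_int k = (1 / 2 :: real)"
        then have "of_int (2 * k) = (1 :: real)" by simp
        then have "2 * k = 1" by (metis of_int_1 of_int_eq_iff)
        then show False by presburger
      qed
      show False using xy h[of m] h[of n] x y by auto
    qed
  qed
  show ?thesis using *[of 0 "1/2"] *[of "1/2" 0] *[of "1/2" "1/2"]
    by (auto simp: YY_def X2_def X3_def)
qed

section \<open>The discriminant\<close>

definition Dl :: "complex \<Rightarrow> complex" where "Dl \<tau> = (E4 \<tau> ^ 3 - E6 \<tau> ^ 2) / 1728"
definition DlC :: "complex fps" where "DlC = fps_const (1 / 1728) * (E4C ^ 3 - E6C ^ 2)"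

lemma qexp_Dl: "qexp Dl DlC"
proof -
  have "qexp (\<lambda>\<tau>. 1 / 1728 * (E4 \<tau> ^ 3 - E6 \<tau> ^ 2)) DlC"
    unfolding DlC_def by (intro qexp_cmult qexp_diff qexp_power qexp_E4 qexp_E6)
  then show ?thesis by (simp add: Dl_def[abs_def])
qed

lemma MF_Dl: "MF 12 Dl"
proof -
  have "MF 12 (\<lambda>\<tau>. 1 / 1728 * (E4 \<tau> ^ 3 - E6 \<tau> ^ 2))"
    using MF_cmult[OF MF_diff[of 12 "\<lambda>\<tau>. E4 \<tau> ^ 3" "\<lambda>\<tau>. E6 \<tau> ^ 2"], of "1 / 1728"]
      MF_power[OF MF_E4, of 3] MF_power[OF MF_E6, of 2] by simp
  then show ?thesis by (simp add: Dl_def[abs_def])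
qed

lemma DlC_values: "fps_nth DlC 0 = 0" "fps_nth DlC 1 = 1"
  using E4C_values E6C_values by (simp_all add: DlC_def power2_eq_square power3_eq_cube fps_mult_nth)

lemma cin_DlC: assumes p: "prime p" "p \<ge> 5" shows "cin (p_integral p) DlC"
proof -
  note z = zpmod_p_integral[OF p(1)] and i = p_integral_inverse_numeral[OF p]
  have pw: "x ^ k \<in> p_integral p" if "x \<in> p_integral p" for x k
    using that by (induction k) (auto intro: p_integral_1[OF p(1)] p_integral_mult[OF p(1)])
  have "(1 / 2) ^ 6 * (1 / 3) ^ 3 \<in> p_integral p"
    by (intro p_integral_mult[OF p(1)] pw i)
  then have "1 / 1728 \<in> p_integral p" by (simp add: power_divide)
  then show ?thesis unfolding DlC_def
    by (intro cin_mult[OF z] cin_const[OF z] cin_diff[OF p(1) z] cin_power[OF p(1)] cin_E4C[OF p(1)] cin_E6C[OF p(1)])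
qed

text \<open>A form of weight 0 is constant, and the constant is nonzero because \<open>Dl\<close>
  has q-coefficient 1. Thus \<open>Dl\<close> has no zeros and can be divided out.\<close>

lemma Dl_YY: obtains c where "c \<noteq> 0" "\<And>\<tau>. Im \<tau> > 0 \<Longrightarrow> Dl \<tau> * YY \<tau> = c"
proof -
  have m: "MF 0 (\<lambda>\<tau>. Dl \<tau> * YY \<tau>)" using MF_times_YY[OF MF_Dl qexp_Dl DlC_values(1)] by simp
  then obtain C where "qexp (\<lambda>\<tau>. Dl \<tau> * YY \<tau>) C" using MF_qexp by blast
  then have c: "Dl \<tau> * YY \<tau> = fps_nth C 0" if "Im \<tau> > 0" for \<tau> using MF_0_const[OF m _ that] YY_nonzero by blast
  have "fps_nth C 0 \<noteq> 0"
  proof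
    assume "fps_nth C 0 = 0"
    then have "Dl \<tau> = 0" if "Im \<tau> > 0" for \<tau> using c[OF that] YY_nonzero[OF that] by simp
    then have "qexp (\<lambda>_. 0) DlC" using qexp_Dl qexp_cong[of Dl "\<lambda>_. 0"] by simp
    then have "DlC = fps_const 0" using qexp_const qexp_unique by blast
    then show False using DlC_values(2) by simp
  qed
  then show ?thesis using that c by blast
qed

lemma MF_div_Dl:
  assumes f: "MF w f" "qexp f C" and C0: "fps_nth C 0 = 0"
  obtains g D where "MF (w - 12) g" "qexp g D" "C = DlC * D" "\<And>\<tau>. Im \<tau> > 0 \<Longrightarrow> f \<tau> = Dl \<tau> * g \<tau>"
proof -
  obtain c where c: "c \<noteq> 0" "\<And>\<tau>. Im \<tau> > 0 \<Longrightarrow> Dl \<tau> * YY \<tau> = c" using Dl_YY by metis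
  define g where "g = (\<lambda>\<tau>. 1 / c * (f \<tau> * YY \<tau>))"
  have g: "MF (w - 12) g" unfolding g_def by (intro MF_cmult MF_times_YY[OF f C0])
  then obtain D where D: "qexp g D" using MF_qexp by blast
  have fg: "f \<tau> = Dl \<tau> * g \<tau>" if "Im \<tau> > 0" for \<tau>
    using c(2)[OF that] c(1) unfolding g_def by (simp add: field_simps)
  have "qexp (\<lambda>\<tau>. Dl \<tau> * g \<tau>) (DlC * D)" by (rule qexp_mult[OF qexp_Dl D])
  also have "?this \<longleftrightarrow> qexp f (DlC * D)" by (rule qexp_cong) (use fg in auto)
  finally have "C = DlC * D" using f(2) qexp_unique by blast
  then show ?thesis using that g D fg by blast
qed

lemma MF_small:
  assumes f: "MF w f" "qexp f C" and C0: "fps_nth C 0 = 0" and w: "w < 12" and \<tau>: "Im \<tau> > 0"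
  shows "f \<tau> = 0"
proof -
  obtain g D where "MF (w - 12) g" "\<And>\<tau>. Im \<tau> > 0 \<Longrightarrow> f \<tau> = Dl \<tau> * g \<tau>" using MF_div_Dl[OF f C0] by metis
  then show ?thesis using MF_neg[of "w - 12" g \<tau>] w \<tau> by simp
qed

text \<open>Cusp forms of weight below 12 vanish, so with constant term a one has f^2 = a^2 E_4 and
  f^3 = a^3 E_6. Then 1728 a^6 Delta = f^6 - f^6 = 0, which forces a = 0.\<close>

lemma MF_2_zero:
  assumes f: "MF 2 f" and \<tau>: "Im \<tau> > 0" shows "f \<tau> = 0"
proof -
  obtain C where C: "qexp f C" using MF_qexp[OF f] .
  define a where "a = fps_nth C 0"
  have 2: "f t ^ 2 = a ^ 2 * E4 t" if t: "Im t > 0" for t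
  proof -
    have "f t ^ 2 - a ^ 2 * E4 t = 0"
    proof (rule MF_small[OF _ _ _ _ t])
      show "MF 4 (\<lambda>t. f t ^ 2 - a ^ 2 * E4 t)" using MF_diff[OF MF_power[OF f, of 2, simplified] MF_cmult[OF MF_E4]] .
      show "qexp (\<lambda>t. f t ^ 2 - a ^ 2 * E4 t) (C ^ 2 - fps_const (a ^ 2) * E4C)"
        by (intro qexp_diff qexp_power C qexp_cmult qexp_E4)
    qed (simp_all add: a_def E4C_values power2_eq_square)
    then show ?thesis by simp
  qed
  have 3: "f t ^ 3 = a ^ 3 * E6 t" if t: "Im t > 0" for t
  proof -
    have "f t ^ 3 - a ^ 3 * E6 t = 0"
    proof (rule MF_small[OF _ _ _ _ t])
      show "MF 6 (\<lambda>t. f t ^ 3 - a ^ 3 * E6 t)" using MF_diff[OF MF_power[OF f, of 3, simplified] MF_cmult[OF MF_E6]] .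
      show "qexp (\<lambda>t. f t ^ 3 - a ^ 3 * E6 t) (C ^ 3 - fps_const (a ^ 3) * E6C)"
        by (intro qexp_diff qexp_power C qexp_cmult qexp_E6)
    qed (simp_all add: a_def E6C_values power3_eq_cube)
    then show ?thesis by simp
  qed
  have "a ^ 6 * Dl \<tau> = ((a ^ 2 * E4 \<tau>) ^ 3 - (a ^ 3 * E6 \<tau>) ^ 2) / 1728"
    by (simp add: Dl_def power_mult_distrib power_mult[symmetric] right_diff_distrib)
  also have "\<dots> = ((f \<tau> ^ 2) ^ 3 - (f \<tau> ^ 3) ^ 2) / 1728" by (simp only: 2[OF \<tau>] 3[OF \<tau>])
  also have "\<dots> = 0" by (simp add: power_mult[symmetric])
  finally have "a ^ 6 * Dl \<tau> = 0" .
  moreover obtain c where "c \<noteq> 0" "Dl \<tau> * YY \<tau> = c" using Dl_YY \<tau> by metis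
  then have "Dl \<tau> \<noteq> 0" by auto
  ultimately have "a = 0" by simp
  then show ?thesis using 2[OF \<tau>] by simp
qed

lemma four_six:
  assumes "even w" "w \<ge> 0" "w \<noteq> (2::int)" obtains i j :: nat where "w = int i * 4 + int j * 6"
proof -
  obtain u where u: "w = 2 * u" using assms(1) by auto
  show ?thesis
  proof (cases "even u")
    case True
    then obtain v where "u = 2 * v" by auto
    then show ?thesis using that[of "nat v" 0] u assms by auto
  next
    case False
    then obtain v where "u = 2 * v + 1" by (auto elim: oddE)
    then show ?thesis using that[of "nat (v - 1)" 1] u assms by auto
  qed
qed

text \<open>Subtract a multiple of E_4^i E_6^j to kill the constant term and divide by Delta: the
  weight drops by 12 and indices by 1, so the condition 12 n <= w is preserved. Weight 2 is the one
  nonnegative even weight without such a monomial, and it carries no form.\<close>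

theorem MF_sturm:
  assumes p: "prime p" "p \<ge> 5" and L: "zpmod p L" and "even w" "MF w f" "qexp f C"
    and "\<And>n. 12 * int n \<le> w \<Longrightarrow> fps_nth C n \<in> L"
  shows "cin L C"
  using assms(4-)
proof (induction "nat w" arbitrary: w f C rule: less_induct)
  case less
  have zero: "cin L C" if "\<And>\<tau>. Im \<tau> > 0 \<Longrightarrow> f \<tau> = 0"
  proof -
    have "qexp (\<lambda>_. 0) C" using less.prems(3) that qexp_cong[of f "\<lambda>_. 0"] by simp
    then have "C = fps_const 0" using qexp_const qexp_unique by blast
    then show ?thesis using L by (simp add: cin_def zpmod_def)
  qed
  show ?case
  proof (cases "w < 0 \<or> w = 2")
    case True
    then show ?thesis using zero MF_neg[OF less.prems(2)] MF_2_zero less.prems(2) by blast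
  next
    case False
    then obtain i j where ij: "w = int i * 4 + int j * 6" using four_six[of w] less.prems(1) by auto
    define E where "E = E4C ^ i * E6C ^ j"
    have E: "MF w (\<lambda>\<tau>. E4 \<tau> ^ i * E6 \<tau> ^ j)" "qexp (\<lambda>\<tau>. E4 \<tau> ^ i * E6 \<tau> ^ j) E"
      unfolding ij E_def by (intro MF_mult MF_power MF_E4 MF_E6) (intro qexp_mult qexp_power qexp_E4 qexp_E6)
    have E0: "fps_nth E 0 = 1" by (simp add: E_def E4C_values E6C_values fps_nth_power_0)
    have cE: "cin (p_integral p) E"
      unfolding E_def by (intro cin_mult[OF zpmod_p_integral[OF p(1)]] cin_power[OF p(1)] cin_E4C[OF p(1)] cin_E6C[OF p(1)])
    define a where "a = fps_nth C 0"
    have aL: "a \<in> L" using less.prems(4)[of 0] False by (simp add: a_def)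
    have aE: "cin L (fps_const a * E)" using cin_mult[OF L cE cin_const[OF L aL]] by (simp add: mult.commute)
    have 1: "MF w (\<lambda>\<tau>. f \<tau> - a * (E4 \<tau> ^ i * E6 \<tau> ^ j))"
      by (rule MF_diff[OF less.prems(2) MF_cmult[OF E(1)]])
    have 2: "qexp (\<lambda>\<tau>. f \<tau> - a * (E4 \<tau> ^ i * E6 \<tau> ^ j)) (C - fps_const a * E)"
      by (rule qexp_diff[OF less.prems(3) qexp_cmult[OF E(2)]])
    obtain g D where gD: "MF (w - 12) g" "qexp g D" "C - fps_const a * E = DlC * D"
      by (rule MF_div_Dl[OF 1 2]) (simp_all add: a_def E0)
    \<comment> \<open>Delta starts with q and coefficient 1, so the coefficients of D are obtained
      recursively with no division.\<close>
    have low: "fps_nth D n \<in> L" if "12 * int n \<le> w - 12" for n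
      using that
    proof (induction n rule: less_induct)
      case (less n)
      have "fps_nth (DlC * D) (Suc n) = fps_nth D n + (\<Sum>k=2..Suc n. fps_nth DlC k * fps_nth D (Suc n - k))"
        unfolding fps_mult_nth using DlC_values
        by (simp add: sum.atLeast_Suc_atMost numeral_2_eq_2)
      then have "fps_nth D n = (fps_nth C (Suc n) - fps_nth (fps_const a * E) (Suc n)) - (\<Sum>k=2..Suc n. fps_nth DlC k * fps_nth D (Suc n - k))"
        using gD(3) by (metis (no_types, lifting) add_diff_cancel_right' fps_sub_nth)
      moreover have "fps_nth C (Suc n) \<in> L" using \<open>\<And>n. 12 * int n \<le> w \<Longrightarrow> fps_nth C n \<in> L\<close> less.prems by simp
      moreover have "fps_nth (fps_const a * E) (Suc n) \<in> L" using aE unfolding cin_def by blast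
      moreover have "(\<Sum>k=2..Suc n. fps_nth DlC k * fps_nth D (Suc n - k)) \<in> L"
      proof (rule zpmod_sum[OF L])
        fix k assume k: "k \<in> {2..Suc n}"
        then have "fps_nth D (Suc n - k) \<in> L" using less by (intro less.IH) auto
        then show "fps_nth DlC k * fps_nth D (Suc n - k) \<in> L"
          using cin_DlC[OF p] L by (auto simp: cin_def zpmod_def)
      qed
      ultimately show ?case using zpmod_diff[OF p(1) L] by metis
    qed
    have "cin L D"
    proof (cases "w - 12 < 0")
      case True
      have "qexp (\<lambda>_. 0) D" using gD(2) MF_neg[OF gD(1) True] qexp_cong[of g "\<lambda>_. 0"] by simp
      then have "D = fps_const 0" using qexp_const qexp_unique by blast
      then show ?thesis using L by (simp add: cin_def zpmod_def)
    next
      case False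
      show ?thesis by (rule less.hyps[of "w - 12" g D]) (use False less.prems(1) gD low in auto)
    qed
    then have "cin L (DlC * D + fps_const a * E)" by (intro cin_add[OF L] cin_mult[OF L] cin_DlC[OF p] aE)
    then show ?thesis using gD(3) by (simp add: algebra_simps)
  qed
qed

section \<open>The Sturm bound for Jacobi forms\<close>

text \<open>Even weak Jacobi forms: only nonnegative powers of q occur, and each q-coefficient is an
  even Laurent polynomial in e(z), recorded as a polynomial in \<open>ss z\<close>.\<close>

definition JF :: "int \<Rightarrow> nat \<Rightarrow> (complex \<Rightarrow> complex \<Rightarrow> complex) \<Rightarrow> complex poly fps \<Rightarrow> bool"
  where "JF w m \<phi> Q \<longleftrightarrow>
    continuous_on (uhp \<times> UNIV) (\<lambda>(\<tau>, z). \<phi> \<tau> z) \<and>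
    (\<forall>\<tau>. Im \<tau> > 0 \<longrightarrow> idx \<tau> m (\<phi> \<tau>)) \<and>
    (\<forall>\<tau> z. Im \<tau> > 0 \<longrightarrow> \<phi> \<tau> (- z) = \<phi> \<tau> z) \<and>
    (\<forall>\<tau> z. Im \<tau> > 0 \<longrightarrow> \<phi> (- 1 / \<tau>) (z / \<tau>) = \<tau> powi w * ee (of_nat m * z\<^sup>2 / \<tau>) * \<phi> \<tau> z) \<and>
    (\<forall>z. qexp (\<lambda>\<tau>. \<phi> \<tau> z) (ev (ss z) Q))"

lemma continuous_comp_ss:
  assumes "continuous_on (uhp \<times> UNIV) (\<lambda>(\<tau>, \<sigma>). \<Phi> \<tau> \<sigma>)"
  shows "continuous_on (uhp \<times> UNIV) (\<lambda>(\<tau>, z). \<Phi> \<tau> (ss z))"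
  unfolding split_beta
  by (rule continuous_on_compose2[OF assms, where f="\<lambda>x. (fst x, ss (snd x))", simplified]) (auto intro!: continuous_intros)

lemma JF_aa: "JF (- 2) 1 aa AQ"
proof -
  have "aa (- 1 / \<tau>) (z / \<tau>) = \<tau> powi (- 2) * ee (of_nat 1 * z\<^sup>2 / \<tau>) * aa \<tau> z" if "Im \<tau> > 0" for \<tau> z
    using aa_S[OF that] by (simp add: power_int_minus divide_inverse)
  moreover have "continuous_on (uhp \<times> UNIV) (\<lambda>(\<tau>, z). aa \<tau> z)"
    unfolding aa_def by (rule continuous_comp_ss[OF continuous_ah])
  moreover have "qexp (\<lambda>\<tau>. aa \<tau> z) (ev (ss z) AQ)" for z unfolding aa_def by (rule qexp_ah)
  ultimately show ?thesis unfolding JF_def using aa_idx by simp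
qed

lemma JF_bb: "JF 0 1 bb BQ"
proof -
  have "continuous_on (uhp \<times> UNIV) (\<lambda>(\<tau>, z). bb \<tau> z)"
    unfolding bb_def using jh_bh by (intro continuous_comp_ss) (simp add: jh_def)
  moreover have "qexp (\<lambda>\<tau>. bb \<tau> z) (ev (ss z) BQ)" for z unfolding bb_def using jh_bh by (simp add: jh_def)
  ultimately show ?thesis unfolding JF_def using bb_idx bb_S by simp
qed

lemma JF_mult:
  assumes "JF v m \<phi> P" "JF w n \<psi> Q" shows "JF (v + w) (m + n) (\<lambda>\<tau> z. \<phi> \<tau> z * \<psi> \<tau> z) (P * Q)"
proof -
  have "ee (of_nat (m + n) * z\<^sup>2 / \<tau>) = ee (of_nat m * z\<^sup>2 / \<tau>) * ee (of_nat n * z\<^sup>2 / \<tau>)" for \<tau> z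
    unfolding ee_add[symmetric] by (simp add: ring_distribs add_divide_distrib)
  moreover have "\<tau> powi (v + w) = \<tau> powi v * \<tau> powi w" if "Im \<tau> > 0" for \<tau>
    using that by (intro power_int_add) auto
  ultimately show ?thesis
    using assms unfolding JF_def split_beta ev_mult
    by (auto intro!: continuous_intros idx_mult qexp_mult)
qed

lemma JF_1: "JF 0 0 (\<lambda>_ _. 1) 1"
  unfolding JF_def by (auto simp: idx_def qexp_1)

lemma JF_power: "JF w m \<phi> Q \<Longrightarrow> JF (int n * w) (n * m) (\<lambda>\<tau> z. \<phi> \<tau> z ^ n) (Q ^ n)"
proof (induction n)
  case 0 show ?case using JF_1 by simp
next
  case (Suc n)
  from JF_mult[OF Suc.prems Suc.IH[OF Suc.prems]] show ?case by (simp add: algebra_simps)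
qed

lemma JF_MF:
  assumes "MF w f" "qexp f C" shows "JF w 0 (\<lambda>\<tau> z. f \<tau>) (cp C)"
proof -
  have "continuous_on (uhp \<times> (UNIV::complex set)) (\<lambda>x. f (fst x))"
    by (rule continuous_on_compose2[OF holomorphic_on_imp_continuous_on[OF qexp_holomorphic[OF assms(2)]]]) (auto intro!: continuous_intros)
  then show ?thesis using assms unfolding JF_def idx_def MF_def by (auto simp: split_beta)
qed

lemma JF_diff:
  assumes "JF w m \<phi> P" "JF w m \<psi> Q" shows "JF w m (\<lambda>\<tau> z. \<phi> \<tau> z - \<psi> \<tau> z) (P - Q)"
  using assms unfolding JF_def split_beta ev_diff
  by (auto intro!: continuous_intros idx_diff qexp_diff simp: right_diff_distrib)

lemma JF_term:
  assumes f: "MF (w + 2 * int j) f" "qexp f C" and j: "j \<le> m"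
  shows "JF w m (\<lambda>\<tau> z. f \<tau> * (aa \<tau> z ^ j * bb \<tau> z ^ (m - j))) (cp C * (AQ ^ j * BQ ^ (m - j)))"
  using JF_mult[OF JF_MF[OF f] JF_mult[OF JF_power[OF JF_aa, of j] JF_power[OF JF_bb, of "m - j"]]] j by simp

lemma circle_mean:
  assumes "h holomorphic_on UNIV" shows "h 0 = integral {0..1} (\<lambda>t::real. h (ee (of_real t)))"
  using ex_integral[OF assms, of 0] by (simp add: ex_0)

text \<open>The leading Taylor coefficient gains weight 2j from z^(2j), and the Gaussian factor is 1
  at z = 0. Writing it as a mean over the unit circle yields holomorphy and boundedness in
  \<tau>.\<close>

lemma JF_leading:
  assumes \<eta>: "JF w m \<eta> Q" and v: "\<And>\<tau>. Im \<tau> > 0 \<Longrightarrow> vo (2 * j) (\<eta> \<tau>)"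
  obtains f where "MF (w + 2 * int j) f"
    "\<And>\<tau> h. Im \<tau> > 0 \<Longrightarrow> h holomorphic_on UNIV \<Longrightarrow> (\<And>z. \<eta> \<tau> z = z ^ (2 * j) * h z) \<Longrightarrow> h 0 = cc ^ (2 * j) * f \<tau>"
proof -
  have cont: "continuous_on (uhp \<times> UNIV) (\<lambda>(\<tau>, z). \<eta> \<tau> z)" and q: "\<And>z. qexp (\<lambda>\<tau>. \<eta> \<tau> z) (ev (ss z) Q)"
    and S: "\<And>\<tau> z. Im \<tau> > 0 \<Longrightarrow> \<eta> (- 1 / \<tau>) (z / \<tau>) = \<tau> powi w * ee (of_nat m * z\<^sup>2 / \<tau>) * \<eta> \<tau> z"
    using \<eta> by (auto simp: JF_def)
  define f where "f = (\<lambda>\<tau>. integral {0..1} (\<lambda>t::real. \<eta> \<tau> (ee (of_real t)) * ee (- of_nat (2 * j) * of_real t)) / cc ^ (2 * j))"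
  have f: "h 0 = cc ^ (2 * j) * f \<tau>" if "Im \<tau> > 0" "h holomorphic_on UNIV" "\<And>z. \<eta> \<tau> z = z ^ (2 * j) * h z" for \<tau> h
  proof -
    have "ee (of_real t) ^ (2 * j) * ee (- of_nat (2 * j) * of_real t) = 1" for t :: real
      unfolding ee_of_nat_mult[symmetric] ee_add[symmetric] by simp
    then have "\<eta> \<tau> (ee (of_real t)) * ee (- of_nat (2 * j) * of_real t) = h (ee (of_real t))" for t :: real
      unfolding that(3) by (metis (no_types, lifting) mult.assoc mult.commute mult_1_left)
    then show ?thesis using circle_mean[OF that(2)] cc_nz by (simp add: f_def)
  qed
  have c2: "continuous_on (uhp \<times> {0..1}) (\<lambda>(\<tau>, t::real). \<eta> \<tau> (ee (of_real t)) * ee (- of_nat (2 * j) * of_real t))"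
    unfolding split_beta
    by (intro continuous_intros continuous_on_compose2[OF cont, where f="\<lambda>u. (fst u, ee (of_real (snd u)))", simplified]) auto
  have hol: "f holomorphic_on uhp"
    unfolding f_def
    by (intro holomorphic_on_divide holomorphic_on_const holomorphic_integral[OF open_upper c2] holomorphic_on_mult qexp_holomorphic[OF q]) simp
  obtain B where B: "\<And>\<tau> y. Im \<tau> \<ge> 1 \<Longrightarrow> y \<in> cball 0 1 \<Longrightarrow> norm (\<eta> \<tau> y) \<le> B"
    using qexp_family_bounded[OF cont q compact_cball[of 0 1]] by blast
  have bd: "norm (f \<tau>) \<le> B / norm (cc ^ (2 * j))" if "Im \<tau> \<ge> 1" for \<tau>
  proof -
    have "norm (integral {0..1} (\<lambda>t::real. \<eta> \<tau> (ee (of_real t)) * ee (- of_nat (2 * j) * of_real t))) \<le> B * (1 - 0)"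
    proof (rule integral_bound)
      have "continuous_on {0..1} (\<lambda>x. case (\<tau>, x) of (\<tau>, t::real) \<Rightarrow> \<eta> \<tau> (ee (of_real t)) * ee (- of_nat (2 * j) * of_real t))"
        by (rule continuous_on_compose2[OF c2]) (use that in \<open>auto intro!: continuous_intros\<close>)
      then show "continuous_on {0..1} (\<lambda>t::real. \<eta> \<tau> (ee (of_real t)) * ee (- of_nat (2 * j) * of_real t))" by simp
      fix t :: real
      show "norm (\<eta> \<tau> (ee (of_real t)) * ee (- of_nat (2 * j) * of_real t)) \<le> B"
        using B[OF that, of "ee (of_real t)"] by (simp add: norm_mult norm_ee)
    qed simp
    then show ?thesis unfolding f_def norm_divide by (intro divide_right_mono) auto
  qed
  have "MF (w + 2 * int j) f"
    unfolding MF_def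
  proof (intro conjI allI impI)
    show "f holomorphic_on uhp" by (rule hol)
    show "f (t + 1) = f t" if "Im t > 0" for t
      using qexp_periodic[OF q that] by (simp add: f_def)
    show "\<exists>B. \<forall>t. Im t \<ge> 1 \<longrightarrow> norm (f t) \<le> B" using bd by blast
    fix \<tau> :: complex assume \<tau>: "Im \<tau> > 0"
    then have \<tau>0: "\<tau> \<noteq> 0" and \<tau>': "Im (- 1 / \<tau>) > 0" using Im_neg_inverse_pos by auto
    obtain h where h: "h holomorphic_on UNIV" "\<And>z. \<eta> \<tau> z = z ^ (2 * j) * h z" using v[OF \<tau>] by (auto simp: vo_def)
    obtain k where k: "k holomorphic_on UNIV" "\<And>z. \<eta> (- 1 / \<tau>) z = z ^ (2 * j) * k z" using v[OF \<tau>'] by (auto simp: vo_def)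
    have kh: "(\<lambda>z. k (z / \<tau>) / \<tau> ^ (2 * j)) holomorphic_on UNIV"
    proof -
      have "(\<lambda>z. k (z / \<tau>)) holomorphic_on UNIV"
        by (rule holomorphic_on_compose_gen[OF _ k(1), of "\<lambda>z. z / \<tau>" UNIV, unfolded o_def])
           (use \<tau>0 in \<open>auto intro!: holomorphic_intros\<close>)
      then show ?thesis using \<tau>0 by (intro holomorphic_intros) auto
    qed
    have "z ^ (2 * j) * (k (z / \<tau>) / \<tau> ^ (2 * j)) = z ^ (2 * j) * (\<tau> powi w * ee (of_nat m * z\<^sup>2 / \<tau>) * h z)" for z
      using S[OF \<tau>, of z] unfolding h(2) k(2) by (simp add: power_divide mult_ac)
    then have "k (0 / \<tau>) / \<tau> ^ (2 * j) = \<tau> powi w * ee (of_nat m * 0\<^sup>2 / \<tau>) * h 0"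
      by (rule entire_eq_of_mult_power[OF kh, rotated]) (use h(1) \<tau>0 in \<open>auto intro!: holomorphic_intros\<close>)
    then have "k 0 = \<tau> powi w * \<tau> ^ (2 * j) * h 0" using \<tau>0 by (simp add: field_simps)
    also have "\<tau> powi w * \<tau> ^ (2 * j) = \<tau> powi (w + 2 * int j)"
      using \<tau>0 by (simp add: power_int_add flip: power_int_of_nat)
    finally show "f (- 1 / \<tau>) = \<tau> powi (w + 2 * int j) * f \<tau>"
      using f[OF \<tau> h] f[OF \<tau>' k] cc_nz by simp
  qed
  then show ?thesis using that f by blast
qed

lemma power_factor:
  assumes "Im \<tau> > 0"
  obtains k where "k holomorphic_on UNIV" "\<And>z. aa \<tau> z ^ j * bb \<tau> z ^ l = z ^ (2 * j) * k z" "k 0 = cc ^ (2 * j)" "\<And>z. k (- z) = k z"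
proof -
  obtain A where A: "A holomorphic_on UNIV" "A 0 = cc\<^sup>2" "\<And>z. aa \<tau> z = z\<^sup>2 * A z" using aa_factor[OF assms] by metis
  have "z\<^sup>2 * A (- z) = z\<^sup>2 * A z" for z using A(3)[of z] A(3)[of "- z"] by auto
  then have ev: "A (- z) = A z" for z
    by (rule entire_eq_of_mult_power[rotated 2])
       (use A(1) holomorphic_on_compose_gen[OF holomorphic_on_minus[OF holomorphic_on_ident] A(1), of UNIV] in \<open>auto simp: o_def\<close>)
  have b0: "bb \<tau> 0 = 1" using ex_bb(2)[OF assms] by (simp add: ex_0)
  have pm: "z ^ (2 * j) = (z\<^sup>2) ^ j" for z :: complex by (rule power_mult)
  show ?thesis
  proof (rule that[of "\<lambda>z. A z ^ j * bb \<tau> z ^ l"])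
    show "(\<lambda>z. A z ^ j * bb \<tau> z ^ l) holomorphic_on UNIV" by (intro holomorphic_intros A(1) ex_bb(1)[OF assms])
    show "aa \<tau> z ^ j * bb \<tau> z ^ l = z ^ (2 * j) * (A z ^ j * bb \<tau> z ^ l)" for z
      unfolding A(3) pm power_mult_distrib by simp
    show "A 0 ^ j * bb \<tau> 0 ^ l = cc ^ (2 * j)" unfolding A(2) b0 power_mult by simp
    show "A (- z) ^ j * bb \<tau> (- z) ^ l = A z ^ j * bb \<tau> z ^ l" for z by (simp add: ev)
  qed
qed

text \<open>Subtracting the next term cancels the leading Taylor coefficient, and evenness in z then
  raises the order of vanishing by 2. At j = m + 1 the order exceeds what index m allows.\<close>

lemma JF_expand_step:
  assumes \<phi>: "JF w m \<phi> Q" and j: "j \<le> Suc m"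
  shows "\<exists>f C R. (\<forall>i<j. MF (w + 2 * int i) (f i) \<and> qexp (f i) (C i)) \<and>
     JF w m (\<lambda>\<tau> z. \<phi> \<tau> z - (\<Sum>i<j. f i \<tau> * (aa \<tau> z ^ i * bb \<tau> z ^ (m - i)))) R \<and>
     (\<forall>\<tau>. Im \<tau> > 0 \<longrightarrow> vo (2 * j) (\<lambda>z. \<phi> \<tau> z - (\<Sum>i<j. f i \<tau> * (aa \<tau> z ^ i * bb \<tau> z ^ (m - i)))))"
  using j
proof (induction j)
  case 0
  have "vo 0 (\<phi> \<tau>)" if "Im \<tau> > 0" for \<tau> using \<phi> that by (auto simp: JF_def idx_def vo_def)
  then show ?case using \<phi> by auto
next
  case (Suc j)
  then obtain f C R where f: "\<And>i. i < j \<Longrightarrow> MF (w + 2 * int i) (f i) \<and> qexp (f i) (C i)"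
    and R: "JF w m (\<lambda>\<tau> z. \<phi> \<tau> z - (\<Sum>i<j. f i \<tau> * (aa \<tau> z ^ i * bb \<tau> z ^ (m - i)))) R"
    and v: "\<And>\<tau>. Im \<tau> > 0 \<Longrightarrow> vo (2 * j) (\<lambda>z. \<phi> \<tau> z - (\<Sum>i<j. f i \<tau> * (aa \<tau> z ^ i * bb \<tau> z ^ (m - i))))"
    by auto
  define \<eta> where "\<eta> = (\<lambda>\<tau> z. \<phi> \<tau> z - (\<Sum>i<j. f i \<tau> * (aa \<tau> z ^ i * bb \<tau> z ^ (m - i))))"
  obtain g where g: "MF (w + 2 * int j) g"
    "\<And>\<tau> h. Im \<tau> > 0 \<Longrightarrow> h holomorphic_on UNIV \<Longrightarrow> (\<And>z. \<eta> \<tau> z = z ^ (2 * j) * h z) \<Longrightarrow> h 0 = cc ^ (2 * j) * g \<tau>"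
    using JF_leading[OF R v] unfolding \<eta>_def by blast
  obtain D where D: "qexp g D" using MF_qexp[OF g(1)] .
  define f' where "f' = f(j := g)"
  define C' where "C' = C(j := D)"
  have eq: "\<phi> \<tau> z - (\<Sum>i<Suc j. f' i \<tau> * (aa \<tau> z ^ i * bb \<tau> z ^ (m - i))) = \<eta> \<tau> z - g \<tau> * (aa \<tau> z ^ j * bb \<tau> z ^ (m - j))" for \<tau> z
    by (simp add: \<eta>_def f'_def)
  have J: "JF w m (\<lambda>\<tau> z. \<eta> \<tau> z - g \<tau> * (aa \<tau> z ^ j * bb \<tau> z ^ (m - j))) (R - cp D * (AQ ^ j * BQ ^ (m - j)))"
    by (rule JF_diff[OF R[folded \<eta>_def] JF_term[OF g(1) D]]) (use Suc.prems in simp)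
  have "vo (2 * Suc j) (\<lambda>z. \<eta> \<tau> z - g \<tau> * (aa \<tau> z ^ j * bb \<tau> z ^ (m - j)))" if \<tau>: "Im \<tau> > 0" for \<tau>
  proof -
    obtain h where h: "h holomorphic_on UNIV" "\<And>z. \<eta> \<tau> z = z ^ (2 * j) * h z" using v[OF \<tau>] by (auto simp: vo_def \<eta>_def)
    obtain k where k: "k holomorphic_on UNIV" "\<And>z. aa \<tau> z ^ j * bb \<tau> z ^ (m - j) = z ^ (2 * j) * k z" "k 0 = cc ^ (2 * j)" "\<And>z. k (- z) = k z"
      using power_factor[OF \<tau>] by metis
    have hev: "h (- z) = h z" for z
    proof (rule entire_eq_of_mult_power[of "\<lambda>z. h (- z)" h "2 * j"])
      show "(\<lambda>z. h (- z)) holomorphic_on UNIV"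
        using holomorphic_on_compose_gen[OF holomorphic_on_minus[OF holomorphic_on_ident] h(1), of UNIV] by (simp add: o_def)
      show "z ^ (2 * j) * h (- z) = z ^ (2 * j) * h z" for z
        using R[folded \<eta>_def] \<tau> h(2)[of z] h(2)[of "- z"] by (auto simp: JF_def)
    qed (rule h(1))
    have "(\<lambda>z. h z - g \<tau> * k z) holomorphic_on UNIV" by (intro holomorphic_intros h(1) k(1))
    moreover have "h 0 - g \<tau> * k 0 = 0" using g(2)[OF \<tau> h] k(3) by simp
    moreover have "h (- z) - g \<tau> * k (- z) = h z - g \<tau> * k z" for z by (simp add: hev k(4))
    ultimately obtain l where l: "l holomorphic_on UNIV" "\<And>z. h z - g \<tau> * k z = z\<^sup>2 * l z"
      using entire_even_div[of "\<lambda>z. h z - g \<tau> * k z"] by metis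
    have "\<eta> \<tau> z - g \<tau> * (aa \<tau> z ^ j * bb \<tau> z ^ (m - j)) = z ^ (2 * Suc j) * l z" for z
    proof -
      have "\<eta> \<tau> z - g \<tau> * (aa \<tau> z ^ j * bb \<tau> z ^ (m - j)) = z ^ (2 * j) * (h z - g \<tau> * k z)"
        unfolding h(2) k(2) by (simp add: algebra_simps)
      also have "\<dots> = z ^ (2 * Suc j) * l z" unfolding l(2) by (simp add: power_add power2_eq_square)
      finally show ?thesis .
    qed
    then show ?thesis unfolding vo_def using l(1) by blast
  qed
  then have "(\<forall>i<Suc j. MF (w + 2 * int i) (f' i) \<and> qexp (f' i) (C' i)) \<and>
     JF w m (\<lambda>\<tau> z. \<phi> \<tau> z - (\<Sum>i<Suc j. f' i \<tau> * (aa \<tau> z ^ i * bb \<tau> z ^ (m - i)))) (R - cp D * (AQ ^ j * BQ ^ (m - j))) \<and>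
     (\<forall>\<tau>. Im \<tau> > 0 \<longrightarrow> vo (2 * Suc j) (\<lambda>z. \<phi> \<tau> z - (\<Sum>i<Suc j. f' i \<tau> * (aa \<tau> z ^ i * bb \<tau> z ^ (m - i)))))"
    unfolding eq using J f g(1) D by (auto simp: f'_def C'_def less_Suc_eq)
  then show ?case by blast
qed

lemma JF_expand:
  assumes \<phi>: "JF w m \<phi> Q"
  obtains f C where "\<And>i. i \<le> m \<Longrightarrow> MF (w + 2 * int i) (f i)" "\<And>i. i \<le> m \<Longrightarrow> qexp (f i) (C i)"
    "Q = (\<Sum>i\<le>m. cp (C i) * (AQ ^ i * BQ ^ (m - i)))"
proof -
  obtain f C R where f: "\<And>i. i < Suc m \<Longrightarrow> MF (w + 2 * int i) (f i) \<and> qexp (f i) (C i)"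
    and R: "JF w m (\<lambda>\<tau> z. \<phi> \<tau> z - (\<Sum>i<Suc m. f i \<tau> * (aa \<tau> z ^ i * bb \<tau> z ^ (m - i)))) R"
    and v: "\<And>\<tau>. Im \<tau> > 0 \<Longrightarrow> vo (2 * Suc m) (\<lambda>z. \<phi> \<tau> z - (\<Sum>i<Suc m. f i \<tau> * (aa \<tau> z ^ i * bb \<tau> z ^ (m - i))))"
    using JF_expand_step[OF \<phi>, of "Suc m"] by blast
  have z: "\<phi> \<tau> z = (\<Sum>i<Suc m. f i \<tau> * (aa \<tau> z ^ i * bb \<tau> z ^ (m - i)))" if \<tau>: "Im \<tau> > 0" for \<tau> z
  proof -
    have "vo (2 * m + 1) (\<lambda>z. \<phi> \<tau> z - (\<Sum>i<Suc m. f i \<tau> * (aa \<tau> z ^ i * bb \<tau> z ^ (m - i))))"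
    proof -
      obtain h where h: "h holomorphic_on UNIV" "\<And>z. \<phi> \<tau> z - (\<Sum>i<Suc m. f i \<tau> * (aa \<tau> z ^ i * bb \<tau> z ^ (m - i))) = z ^ (2 * Suc m) * h z"
        using v[OF \<tau>] unfolding vo_def by blast
      show ?thesis unfolding vo_def h(2)
        by (rule exI[of _ "\<lambda>z. z * h z"]) (use h(1) in \<open>auto intro!: holomorphic_intros\<close>)
    qed
    moreover have "idx \<tau> m (\<lambda>z. \<phi> \<tau> z - (\<Sum>i<Suc m. f i \<tau> * (aa \<tau> z ^ i * bb \<tau> z ^ (m - i))))"
      using R \<tau> unfolding JF_def by blast
    ultimately have "\<phi> \<tau> z - (\<Sum>i<Suc m. f i \<tau> * (aa \<tau> z ^ i * bb \<tau> z ^ (m - i))) = 0"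
      using idx_vanishing_0[OF \<tau>] by blast
    then show ?thesis by simp
  qed
  have "ev \<sigma> Q = ev \<sigma> (\<Sum>i<Suc m. cp (C i) * (AQ ^ i * BQ ^ (m - i)))" for \<sigma>
  proof -
    obtain z where s: "ss z = \<sigma>" using ss_surj by blast
    have "qexp (\<lambda>\<tau>. \<Sum>i<Suc m. f i \<tau> * (aa \<tau> z ^ i * bb \<tau> z ^ (m - i))) (ev \<sigma> (\<Sum>i<Suc m. cp (C i) * (AQ ^ i * BQ ^ (m - i))))"
      unfolding ev_sum ev_mult ev_cp ev_power
      using f JF_aa JF_bb unfolding JF_def s[symmetric] by (intro qexp_sum qexp_mult qexp_power) auto
    moreover have "qexp (\<lambda>\<tau>. \<Sum>i<Suc m. f i \<tau> * (aa \<tau> z ^ i * bb \<tau> z ^ (m - i))) (ev \<sigma> Q)"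
    proof -
      have "qexp (\<lambda>\<tau>. \<phi> \<tau> z) (ev \<sigma> Q)" using \<phi> unfolding JF_def s[symmetric] by blast
      then show ?thesis using qexp_cong[of "\<lambda>\<tau>. \<phi> \<tau> z" "\<lambda>\<tau>. \<Sum>i<Suc m. f i \<tau> * (aa \<tau> z ^ i * bb \<tau> z ^ (m - i))"] z by simp
    qed
    ultimately show ?thesis using qexp_unique by blast
  qed
  then have "Q = (\<Sum>i<Suc m. cp (C i) * (AQ ^ i * BQ ^ (m - i)))" by (rule ev_eqD)
  then show ?thesis using that[of f C] f by (simp add: lessThan_Suc_atMost less_Suc_eq_le)
qed

text \<open>As b has constant term 1, \<sigma>^i b^(m - i) starts with \<sigma>^i; the system for
  the \<open>c i\<close> is unitriangular over the p-integral rationals.\<close>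

lemma triangular_coeffs:
  assumes p: "prime p" and L: "zpmod p L" and b: "\<And>j. coeff b j \<in> p_integral p" and b0: "coeff b 0 = 1"
    and s: "\<And>j. coeff (\<Sum>i\<le>m. smult (c i) ([:0, 1:] ^ i * b ^ (m - i))) j \<in> L"
  shows "i \<le> m \<Longrightarrow> c i \<in> (L :: complex set)"
proof (induction i rule: less_induct)
  case (less i)
  have bp: "coeff (b ^ k) j \<in> p_integral p" for k j
  proof (induction k arbitrary: j)
    case 0 then show ?case using p_integral_0[OF p] p_integral_1[OF p] by (simp add: coeff_pCons split: nat.splits)
  next
    case (Suc k) then show ?case using coeff_mult_in[OF zpmod_p_integral[OF p] b] by simp
  qed
  have bp0: "coeff (b ^ k) 0 = 1" for k by (induction k) (auto simp: coeff_mult b0)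
  have X: "[:0, 1::complex:] ^ l = monom 1 l" for l by (simp add: monom_altdef)
  have t: "coeff (smult (c l) ([:0, 1:] ^ l * b ^ (m - l))) i = (if l \<le> i then c l * coeff (b ^ (m - l)) (i - l) else 0)" for l
    unfolding X by (simp add: coeff_monom_mult)
  have "coeff (\<Sum>l\<le>m. smult (c l) ([:0, 1:] ^ l * b ^ (m - l))) i = (\<Sum>l\<in>{..m}. if l \<le> i then c l * coeff (b ^ (m - l)) (i - l) else 0)"
    unfolding coeff_sum t ..
  also have "\<dots> = (\<Sum>l\<le>i. c l * coeff (b ^ (m - l)) (i - l))"
    using less.prems by (intro sum.mono_neutral_cong_right) auto
  also have "\<dots> = c i + (\<Sum>l<i. c l * coeff (b ^ (m - l)) (i - l))"
    by (simp add: lessThan_Suc_atMost[symmetric] bp0)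
  finally have e: "c i = coeff (\<Sum>l\<le>m. smult (c l) ([:0, 1:] ^ l * b ^ (m - l))) i - (\<Sum>l<i. c l * coeff (b ^ (m - l)) (i - l))"
    by simp
  have "(\<Sum>l<i. c l * coeff (b ^ (m - l)) (i - l)) \<in> L"
  proof (rule zpmod_sum[OF L])
    fix l assume "l \<in> {..<i}"
    then have "c l \<in> L" using less by auto
    then have "coeff (b ^ (m - l)) (i - l) * c l \<in> L" using bp L by (auto simp: zpmod_def)
    then show "c l * coeff (b ^ (m - l)) (i - l) \<in> L" by (simp add: mult.commute)
  qed
  then show ?case by (subst e) (rule zpmod_diff[OF p L s])
qed

text \<open>The largest weight among the f_i is w + 2m, whence the bound. Below it, compare
  q-coefficients one at a time: earlier ones contribute elements of L, and the q^0 terms of the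
  products of generators give a unitriangular system. The elliptic bound then takes over for each
  f_i.\<close>

theorem JF_sturm:
  assumes p: "prime p" "p \<ge> 5" and L: "zpmod p L" and w: "even w" and \<phi>: "JF w m \<phi> Q"
    and low: "\<And>n j. 12 * int n \<le> w + 2 * int m \<Longrightarrow> coeff (fps_nth Q n) j \<in> L"
  shows "pin L Q"
proof -
  obtain f C where f: "\<And>i. i \<le> m \<Longrightarrow> MF (w + 2 * int i) (f i)" "\<And>i. i \<le> m \<Longrightarrow> qexp (f i) (C i)"
    and Q: "Q = (\<Sum>i\<le>m. cp (C i) * (AQ ^ i * BQ ^ (m - i)))"
    by (rule JF_expand[OF \<phi>]) blast
  define T where "T = (\<lambda>i. AQ ^ i * BQ ^ (m - i))"
  have T: "pin (p_integral p) (T i)" for i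
    unfolding T_def by (intro pin_mult[OF zpmod_p_integral[OF p(1)]] pin_power[OF p(1)] pin_AQ[OF p(1)] pin_BQ[OF p])
  have T0: "fps_nth (T i) 0 = [:0, 1:] ^ i * [:1, 1 / 12:] ^ (m - i)" for i
    unfolding T_def by (simp add: fps_nth_power_0 AQ_0 BQ_0)
  have QT: "Q = (\<Sum>i\<le>m. cp (C i) * T i)" unfolding Q T_def ..
  have Qn: "fps_nth Q n = (\<Sum>i\<le>m. \<Sum>k\<le>n. smult (fps_nth (C i) k) (fps_nth (T i) (n - k)))" for n
    unfolding QT fps_sum_nth fps_mult_nth[of "cp _"] by (simp add: atLeast0AtMost)
  have Cn: "\<forall>i\<le>m. fps_nth (C i) n \<in> L" if "12 * int n \<le> w + 2 * int m" for n
    using that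
  proof (induction n rule: less_induct)
    case (less n)
    have "fps_nth Q n = (\<Sum>i\<le>m. smult (fps_nth (C i) n) ([:0, 1:] ^ i * [:1, 1 / 12:] ^ (m - i)))
        + (\<Sum>i\<le>m. \<Sum>k<n. smult (fps_nth (C i) k) (fps_nth (T i) (n - k)))"
    proof -
      have "(\<Sum>k\<le>n. smult (fps_nth (C i) k) (fps_nth (T i) (n - k))) =
          smult (fps_nth (C i) n) ([:0, 1:] ^ i * [:1, 1 / 12:] ^ (m - i)) + (\<Sum>k<n. smult (fps_nth (C i) k) (fps_nth (T i) (n - k)))" for i
        unfolding lessThan_Suc_atMost[symmetric] sum.lessThan_Suc by (simp add: T0 add.commute)
      then show ?thesis unfolding Qn by (simp only: sum.distrib)
    qed
    then have e: "coeff (\<Sum>i\<le>m. smult (fps_nth (C i) n) ([:0, 1:] ^ i * [:1, 1 / 12:] ^ (m - i))) j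
       = coeff (fps_nth Q n) j - coeff (\<Sum>i\<le>m. \<Sum>k<n. smult (fps_nth (C i) k) (fps_nth (T i) (n - k))) j" for j
      by simp
    have "coeff (\<Sum>i\<le>m. \<Sum>k<n. smult (fps_nth (C i) k) (fps_nth (T i) (n - k))) j \<in> L" for j
      unfolding coeff_sum
    proof (intro zpmod_sum[OF L])
      fix i k assume ik: "i \<in> {..m}" "k \<in> {..<n}"
      then have "fps_nth (C i) k \<in> L" using less.IH[of k] less.prems by auto
      moreover have "coeff (fps_nth (T i) (n - k)) j \<in> p_integral p" using T by (simp add: pin_def)
      ultimately have "coeff (fps_nth (T i) (n - k)) j * fps_nth (C i) k \<in> L" using L by (auto simp: zpmod_def)
      then show "coeff (smult (fps_nth (C i) k) (fps_nth (T i) (n - k))) j \<in> L" by (simp add: mult.commute)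
    qed
    then have s: "coeff (\<Sum>i\<le>m. smult (fps_nth (C i) n) ([:0, 1:] ^ i * [:1, 1 / 12:] ^ (m - i))) j \<in> L" for j
      unfolding e using low[OF less.prems] by (intro zpmod_diff[OF p(1) L])
    have "1 / 2 * (1 / 2) * (1 / 3) \<in> p_integral p" by (intro p_integral_mult[OF p(1)] p_integral_inverse_numeral[OF p])
    then have b: "coeff [:1, 1 / 12:] j \<in> p_integral p" for j
      using p_integral_0[OF p(1)] p_integral_1[OF p(1)] by (auto simp: coeff_pCons split: nat.splits)
    show ?case using triangular_coeffs[OF p(1) L b _ s] by simp
  qed
  have C: "cin L (C i)" if i: "i \<le> m" for i
  proof (rule MF_sturm[OF p L _ f(1)[OF i] f(2)[OF i]])
    show "even (w + 2 * int i)" using w by simp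
    show "fps_nth (C i) n \<in> L" if "12 * int n \<le> w + 2 * int i" for n
      using Cn[of n] that i by simp
  qed
  have "pin L (cp (C i) * T i)" if "i \<le> m" for i
    using pin_mult[OF L T pin_cp[OF L C[OF that]]] by (simp add: mult.commute)
  then show ?thesis unfolding QT pin_def fps_sum_nth coeff_sum by (auto intro!: zpmod_sum[OF L])
qed

section \<open>Siegel modular forms of level one\<close>

definition D3 :: "(complex \<times> complex \<times> complex) set"
  where "D3 = {(\<tau>, z, t). Im \<tau> > 0 \<and> (Im z)\<^sup>2 < Im \<tau> * Im t}"

text \<open>The symmetries listed are those that act on Fourier-Jacobi expansions: three
  translations, exchange of \<tau> and t, a sign, a shear, and the inversion embedded in the first
  variable.\<close>

definition lev1 :: "nat \<Rightarrow> (complex \<Rightarrow> complex \<Rightarrow> complex \<Rightarrow> complex) \<Rightarrow> bool"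
  where "lev1 w G \<longleftrightarrow> continuous_on D3 (\<lambda>(\<tau>, z, t). G \<tau> z t) \<and>
    (\<forall>z t. (\<lambda>\<tau>. G \<tau> z t) holomorphic_on {\<tau>. (\<tau>, z, t) \<in> D3}) \<and>
    (\<forall>\<tau> t. (\<lambda>z. G \<tau> z t) holomorphic_on {z. (\<tau>, z, t) \<in> D3}) \<and>
    (\<forall>\<tau> z. (\<lambda>t. G \<tau> z t) holomorphic_on {t. (\<tau>, z, t) \<in> D3}) \<and>
    (\<forall>\<tau> z t. (\<tau>, z, t) \<in> D3 \<longrightarrow>
      G (\<tau> + 1) z t = G \<tau> z t \<and> G \<tau> (z + 1) t = G \<tau> z t \<and> G \<tau> z (t + 1) = G \<tau> z t \<and>
      G t z \<tau> = G \<tau> z t \<and> G \<tau> (- z) t = G \<tau> z t \<and> G \<tau> (z + \<tau>) (t + 2 * z + \<tau>) = G \<tau> z t \<and>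
      G (- 1 / \<tau>) (z / \<tau>) (t - z\<^sup>2 / \<tau>) = \<tau> ^ w * G \<tau> z t)"

lemma D3_iff: "Im \<tau> > 0 \<Longrightarrow> (\<tau>, z, t) \<in> D3 \<longleftrightarrow> Im t > (Im z)\<^sup>2 / Im \<tau>"
  by (auto simp: D3_def pos_divide_less_eq mult.commute)

lemma D3_shear: "(\<tau>, z, t) \<in> D3 \<Longrightarrow> (\<tau>, z + \<tau>, t + 2 * z + \<tau>) \<in> D3"
  by (auto simp: D3_def power2_eq_square algebra_simps)

text \<open>The determinant of the imaginary part gets divided by |\<tau>|^2.\<close>

lemma D3_S:
  assumes "(\<tau>, z, t) \<in> D3" shows "(- 1 / \<tau>, z / \<tau>, t - z\<^sup>2 / \<tau>) \<in> D3"
proof -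
  define a b c d where "a = Re z" and "b = Im z" and "c = Re \<tau>" and "d = Im \<tau>"
  have d: "d > 0" and h: "b\<^sup>2 < d * Im t" using assms by (auto simp: D3_def b_def d_def)
  have n: "c\<^sup>2 + d\<^sup>2 > 0" using d by (simp add: sum_power2_gt_zero_iff)
  have 1: "Im (- 1 / \<tau>) = d / (c\<^sup>2 + d\<^sup>2)" by (simp add: Im_divide c_def d_def)
  have 2: "Im (z / \<tau>) = (b * c - a * d) / (c\<^sup>2 + d\<^sup>2)" by (simp add: Im_divide a_def b_def c_def d_def)
  have 3: "Im (z\<^sup>2 / \<tau>) = (2 * a * b * c - (a\<^sup>2 - b\<^sup>2) * d) / (c\<^sup>2 + d\<^sup>2)"
    by (simp add: Im_divide a_def b_def c_def d_def power2_eq_square algebra_simps)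
  have "(Im (z / \<tau>))\<^sup>2 < Im (- 1 / \<tau>) * Im (t - z\<^sup>2 / \<tau>)"
  proof -
    have "Im (- 1 / \<tau>) * Im (t - z\<^sup>2 / \<tau>) - (Im (z / \<tau>))\<^sup>2
      = (d * Im t * (c\<^sup>2 + d\<^sup>2) - d * (2 * a * b * c - (a\<^sup>2 - b\<^sup>2) * d) - (b * c - a * d)\<^sup>2) / (c\<^sup>2 + d\<^sup>2)\<^sup>2"
    proof -
      have *: "d / N * (T - X / N) - (Y / N)\<^sup>2 = (d * T * N - d * X - Y\<^sup>2) / N\<^sup>2" if "N \<noteq> 0" for N T X Y :: real
        using that by (simp add: field_simps power2_eq_square)
      show ?thesis unfolding minus_complex.sel 1 2 3 by (rule *[OF less_imp_neq[OF n, symmetric]])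
    qed
    also have "d * Im t * (c\<^sup>2 + d\<^sup>2) - d * (2 * a * b * c - (a\<^sup>2 - b\<^sup>2) * d) - (b * c - a * d)\<^sup>2 = (d * Im t - b\<^sup>2) * (c\<^sup>2 + d\<^sup>2)"
      by (simp add: power2_eq_square algebra_simps)
    finally have e: "Im (- 1 / \<tau>) * Im (t - z\<^sup>2 / \<tau>) - (Im (z / \<tau>))\<^sup>2 = (d * Im t - b\<^sup>2) * (c\<^sup>2 + d\<^sup>2) / (c\<^sup>2 + d\<^sup>2)\<^sup>2" .
    have "(d * Im t - b\<^sup>2) * (c\<^sup>2 + d\<^sup>2) / (c\<^sup>2 + d\<^sup>2)\<^sup>2 > 0"
      by (intro divide_pos_pos mult_pos_pos zero_less_power n) (use h in simp)
    then show ?thesis using e by linarith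
  qed
  moreover have "Im (- 1 / \<tau>) > 0" unfolding 1 using d n by simp
  ultimately show ?thesis by (simp add: D3_def)
qed

locale level_one =
  fixes w :: nat and G :: "complex \<Rightarrow> complex \<Rightarrow> complex \<Rightarrow> complex"
  assumes G: "lev1 w G"
begin

lemma cont: "continuous_on D3 (\<lambda>(\<tau>, z, t). G \<tau> z t)"
  and hol1: "(\<lambda>\<tau>. G \<tau> z t) holomorphic_on {\<tau>. (\<tau>, z, t) \<in> D3}"
  and hol2: "(\<lambda>z. G \<tau> z t) holomorphic_on {z. (\<tau>, z, t) \<in> D3}"
  and hol3: "(\<lambda>t. G \<tau> z t) holomorphic_on {t. (\<tau>, z, t) \<in> D3}"
  using G by (auto simp: lev1_def)

lemma law:
  assumes "(\<tau>, z, t) \<in> D3"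
  shows "G (\<tau> + 1) z t = G \<tau> z t" "G \<tau> (z + 1) t = G \<tau> z t" "G \<tau> z (t + 1) = G \<tau> z t"
      "G t z \<tau> = G \<tau> z t" "G \<tau> (- z) t = G \<tau> z t" "G \<tau> (z + \<tau>) (t + 2 * z + \<tau>) = G \<tau> z t"
      "G (- 1 / \<tau>) (z / \<tau>) (t - z\<^sup>2 / \<tau>) = \<tau> ^ w * G \<tau> z t"
  using G assms by (auto simp: lev1_def)

text \<open>The m-th Fourier-Jacobi coefficient, with e(m t) split off. The height (Im z)^2 / Im
  \<tau> + 1 is admissible for every (\<tau>, z), and any other admissible height gives the same
  value.\<close>

definition ph :: "int \<Rightarrow> complex \<Rightarrow> complex \<Rightarrow> complex"
  where "ph m \<tau> z = fc (Complex 0 ((Im z)\<^sup>2 / Im \<tau> + 1)) m (G \<tau> z)"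

lemma ph_eq:
  assumes "(\<tau>, z, v) \<in> D3" shows "ph m \<tau> z = fc v m (G \<tau> z)"
proof -
  have \<tau>: "Im \<tau> > 0" using assms by (simp add: D3_def)
  have s: "{t. (\<tau>, z, t) \<in> D3} = {t. Im t > (Im z)\<^sup>2 / Im \<tau>}" using D3_iff[OF \<tau>] by simp
  show ?thesis unfolding ph_def
    by (rule fc_indep[OF hol3[of \<tau> z, unfolded s]]) (use law(3) D3_iff[OF \<tau>] assms in auto)
qed

lemma cont_ph_integrand:
  "continuous_on ({x. (fst x, snd x, v) \<in> D3} \<times> {0..1}) (\<lambda>(x, u::real). G (fst x) (snd x) (v + of_real u) * ee (- of_int m * (v + of_real u)))"
  unfolding split_beta
  by (intro continuous_intros continuous_on_compose2[OF cont, where f="\<lambda>x. (fst (fst x), snd (fst x), v + of_real (snd x))", simplified])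
     (auto simp: D3_def)

text \<open>The height in \<open>ph\<close> moves with (\<tau>, z). Near a given point it can be
  frozen, and then the integrand is continuous on a fixed segment; the two holomorphy statements
  rest on the same device.\<close>

lemma cont_ph: "continuous_on (uhp \<times> UNIV) (\<lambda>(\<tau>, z). ph m \<tau> z)"
proof (rule continuous_at_imp_continuous_on, rule ballI)
  fix x :: "complex \<times> complex" assume x: "x \<in> uhp \<times> UNIV"
  define v where "v = Complex 0 ((Im (snd x))\<^sup>2 / Im (fst x) + 1)"
  define U where "U = {x. (fst x, snd x, v) \<in> D3}"
  have U: "open U"
    unfolding U_def D3_def by (auto intro!: open_Collect_conj open_Collect_less continuous_intros)
  have xU: "x \<in> U" using x D3_iff[of "fst x" "snd x" v] by (auto simp: U_def v_def)
  have "continuous_on U (\<lambda>x. integral {0..1} (\<lambda>u::real. G (fst x) (snd x) (v + of_real u) * ee (- of_int m * (v + of_real u))))"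
    unfolding U_def by (rule continuous_on_integral_param[OF cont_ph_integrand])
  also have "?this \<longleftrightarrow> continuous_on U (\<lambda>(\<tau>, z). ph m \<tau> z)"
    by (rule continuous_on_cong) (auto simp: U_def ph_eq fc_def)
  finally show "isCont (\<lambda>(\<tau>, z). ph m \<tau> z) x" using U xU continuous_on_eq_continuous_at by blast
qed

lemma hol_ph_z: assumes \<tau>: "Im \<tau> > 0" shows "ph m \<tau> holomorphic_on UNIV"
proof -
  have "ph m \<tau> field_differentiable at z" for z
  proof -
    define v where "v = Complex 0 ((Im z)\<^sup>2 / Im \<tau> + 1)"
    define U where "U = {z. (\<tau>, z, v) \<in> D3}"
    have U: "open U"
      unfolding U_def D3_def by (auto intro!: open_Collect_conj open_Collect_less continuous_intros)
    have zU: "z \<in> U" using D3_iff[OF \<tau>, of z v] by (auto simp: U_def v_def)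
    have "(\<lambda>z. integral {0..1} (\<lambda>u::real. G \<tau> z (v + of_real u) * ee (- of_int m * (v + of_real u)))) holomorphic_on U"
    proof (rule holomorphic_integral[OF U])
      have "continuous_on (U \<times> {0..1}) (\<lambda>x. (\<lambda>(x, u::real). G (fst x) (snd x) (v + of_real u) * ee (- of_int m * (v + of_real u))) ((\<tau>, fst x), snd x))"
        by (rule continuous_on_compose2[OF cont_ph_integrand]) (auto intro!: continuous_intros simp: U_def)
      then show "continuous_on (U \<times> {0..1}) (\<lambda>(z, u::real). G \<tau> z (v + of_real u) * ee (- of_int m * (v + of_real u)))"
        by (simp add: split_beta)
      fix u :: real
      show "(\<lambda>z. G \<tau> z (v + of_real u) * ee (- of_int m * (v + of_real u))) holomorphic_on U"
        by (intro holomorphic_on_mult holomorphic_on_const holomorphic_on_subset[OF hol2]) (auto simp: U_def D3_def)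
    qed
    then have "ph m \<tau> holomorphic_on U"
      by (rule holomorphic_transform) (auto simp: U_def ph_eq fc_def)
    then show ?thesis using U zU holomorphic_on_imp_differentiable_at by blast
  qed
  then show ?thesis by (simp add: holomorphic_on_def field_differentiable_at_within)
qed

lemma hol_ph_\<tau>: "(\<lambda>\<tau>. ph m \<tau> z) holomorphic_on uhp"
proof -
  have "(\<lambda>\<tau>. ph m \<tau> z) field_differentiable at \<tau>" if \<tau>: "Im \<tau> > 0" for \<tau>
  proof -
    define v where "v = Complex 0 ((Im z)\<^sup>2 / Im \<tau> + 1)"
    define U where "U = {\<tau>. (\<tau>, z, v) \<in> D3}"
    have U: "open U"
      unfolding U_def D3_def by (auto intro!: open_Collect_conj open_Collect_less continuous_intros)
    have zU: "\<tau> \<in> U" using D3_iff[OF \<tau>, of z v] by (auto simp: U_def v_def)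
    have "(\<lambda>\<tau>. integral {0..1} (\<lambda>u::real. G \<tau> z (v + of_real u) * ee (- of_int m * (v + of_real u)))) holomorphic_on U"
    proof (rule holomorphic_integral[OF U])
      have "continuous_on (U \<times> {0..1}) (\<lambda>x. (\<lambda>(x, u::real). G (fst x) (snd x) (v + of_real u) * ee (- of_int m * (v + of_real u))) ((fst x, z), snd x))"
        by (rule continuous_on_compose2[OF cont_ph_integrand]) (auto intro!: continuous_intros simp: U_def)
      then show "continuous_on (U \<times> {0..1}) (\<lambda>(\<tau>, u::real). G \<tau> z (v + of_real u) * ee (- of_int m * (v + of_real u)))"
        by (simp add: split_beta)
      fix u :: real
      show "(\<lambda>\<tau>. G \<tau> z (v + of_real u) * ee (- of_int m * (v + of_real u))) holomorphic_on U"
        by (intro holomorphic_on_mult holomorphic_on_const holomorphic_on_subset[OF hol1]) (auto simp: U_def D3_def)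
    qed
    then have "(\<lambda>\<tau>. ph m \<tau> z) holomorphic_on U"
      by (rule holomorphic_transform) (auto simp: U_def ph_eq fc_def)
    then show ?thesis using U zU holomorphic_on_imp_differentiable_at by blast
  qed
  then show ?thesis by (simp add: holomorphic_on_def field_differentiable_at_within)
qed

lemma exists_height: assumes "Im \<tau> > 0" obtains v where "(\<tau>, z, v) \<in> D3"
  using D3_iff[OF assms, of z "Complex 0 ((Im z)\<^sup>2 / Im \<tau> + 1)"] that by auto

lemma ph_laws:
  assumes \<tau>: "Im \<tau> > 0"
  shows "ph m (\<tau> + 1) z = ph m \<tau> z" "ph m \<tau> (z + 1) = ph m \<tau> z" "ph m \<tau> (- z) = ph m \<tau> z"
    "ph m \<tau> (z + \<tau>) = ee (- of_int m * (2 * z + \<tau>)) * ph m \<tau> z"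
    "ph m (- 1 / \<tau>) (z / \<tau>) = \<tau> ^ w * ee (of_int m * z\<^sup>2 / \<tau>) * ph m \<tau> z"
proof -
  obtain v where v: "(\<tau>, z, v) \<in> D3" using exists_height[OF \<tau>] .
  have vx: "(\<tau>, z, v + of_real x) \<in> D3" for x :: real using v by (simp add: D3_def)
  have v1: "(\<tau> + 1, z, v) \<in> D3" "(\<tau>, z + 1, v) \<in> D3" "(\<tau>, - z, v) \<in> D3" using v by (auto simp: D3_def)
  show "ph m (\<tau> + 1) z = ph m \<tau> z" "ph m \<tau> (z + 1) = ph m \<tau> z" "ph m \<tau> (- z) = ph m \<tau> z"
    unfolding ph_eq[OF v] ph_eq[OF v1(1)] ph_eq[OF v1(2)] ph_eq[OF v1(3)] fc_def by (simp_all only: law[OF vx])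
  show "ph m \<tau> (z + \<tau>) = ee (- of_int m * (2 * z + \<tau>)) * ph m \<tau> z"
    unfolding ph_eq[OF v] ph_eq[OF D3_shear[OF v]] fc_def integral_mult_right[symmetric]
  proof (rule integral_cong)
    fix x :: real
    have "v + 2 * z + \<tau> + of_real x = (v + of_real x) + 2 * z + \<tau>" by simp
    then have "G \<tau> (z + \<tau>) (v + 2 * z + \<tau> + of_real x) = G \<tau> z (v + of_real x)" by (simp only: law(6)[OF vx])
    moreover have "ee (- of_int m * (v + 2 * z + \<tau> + of_real x)) = ee (- of_int m * (2 * z + \<tau>)) * ee (- of_int m * (v + of_real x))"
      unfolding ee_add[symmetric] by (intro arg_cong[of _ _ ee]) (simp add: algebra_simps)
    ultimately show "G \<tau> (z + \<tau>) (v + 2 * z + \<tau> + of_real x) * ee (- of_int m * (v + 2 * z + \<tau> + of_real x)) =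
        ee (- of_int m * (2 * z + \<tau>)) * (G \<tau> z (v + of_real x) * ee (- of_int m * (v + of_real x)))" by simp
  qed
  show "ph m (- 1 / \<tau>) (z / \<tau>) = \<tau> ^ w * ee (of_int m * z\<^sup>2 / \<tau>) * ph m \<tau> z"
    unfolding ph_eq[OF v] ph_eq[OF D3_S[OF v]] fc_def integral_mult_right[symmetric]
  proof (rule integral_cong)
    fix x :: real
    have "v - z\<^sup>2 / \<tau> + of_real x = (v + of_real x) - z\<^sup>2 / \<tau>" by simp
    then have "G (- 1 / \<tau>) (z / \<tau>) (v - z\<^sup>2 / \<tau> + of_real x) = \<tau> ^ w * G \<tau> z (v + of_real x)" by (simp only: law(7)[OF vx])
    moreover have "ee (- of_int m * (v - z\<^sup>2 / \<tau> + of_real x)) = ee (of_int m * z\<^sup>2 / \<tau>) * ee (- of_int m * (v + of_real x))"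
      unfolding ee_add[symmetric] by (intro arg_cong[of _ _ ee]) (simp add: algebra_simps)
    ultimately show "G (- 1 / \<tau>) (z / \<tau>) (v - z\<^sup>2 / \<tau> + of_real x) * ee (- of_int m * (v - z\<^sup>2 / \<tau> + of_real x)) =
        \<tau> ^ w * ee (of_int m * z\<^sup>2 / \<tau>) * (G \<tau> z (v + of_real x) * ee (- of_int m * (v + of_real x)))" by simp
  qed
qed

section \<open>Fourier coefficients in three variables and their symmetries\<close>

definition PP :: "int \<Rightarrow> int \<Rightarrow> complex \<Rightarrow> complex"
  where "PP m n z = fc \<i> n (\<lambda>\<tau>. ph m \<tau> z)"

definition A :: "int \<Rightarrow> int \<Rightarrow> int \<Rightarrow> complex"
  where "A n r m = fc 0 r (PP m n)"

lemma cont_PP_integrand: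
  "continuous_on (UNIV \<times> {0..1}) (\<lambda>(z, x::real). ph m (\<i> + of_real x) z * ee (- of_int n * (\<i> + of_real x)))"
  unfolding split_beta
  by (intro continuous_intros continuous_on_compose2[OF cont_ph, where f="\<lambda>u. (\<i> + of_real (snd u), fst u)", simplified]) auto

lemma hol_PP: "PP m n holomorphic_on UNIV"
  unfolding PP_def[abs_def] fc_def
  by (rule holomorphic_integral[OF open_UNIV cont_PP_integrand]) (intro holomorphic_intros hol_ph_z, simp)

lemma PP_periodic: "PP m n (z + 1) = PP m n z"
  unfolding PP_def fc_def by (simp add: ph_laws)

lemma ph_real: "Im \<tau> > 0 \<Longrightarrow> ph m \<tau> (of_real y) = fc \<i> m (G \<tau> (of_real y))"
  by (rule ph_eq) (simp add: D3_def)

text \<open>On real z the integrals over \<tau> and t run along the same segment and can be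
  exchanged, and G is symmetric in these variables.\<close>

lemma A_sym: "A n r m = A m r n"
proof -
  have "PP m n (of_real y) = PP n m (of_real y)" for y :: real
  proof -
    define H where "H = (\<lambda>x u :: real. G (\<i> + of_real x) (of_real y) (\<i> + of_real u) * ee (- of_int m * (\<i> + of_real u)) * ee (- of_int n * (\<i> + of_real x)))"
    have c: "continuous_on (cbox (0, 0) (1, 1)) (\<lambda>(x, u). H x u)"
      unfolding H_def split_beta
      by (intro continuous_intros continuous_on_compose2[OF cont, where f="\<lambda>x. (\<i> + of_real (fst x), of_real y, \<i> + of_real (snd x))", simplified])
         (auto simp: D3_def)
    have "PP m n (of_real y) = integral (cbox 0 1) (\<lambda>x. integral (cbox 0 1) (H x))"
      unfolding PP_def fc_def[of \<i> n] H_def by (simp add: ph_real fc_def integral_mult_left)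
    also have "\<dots> = integral (cbox 0 1) (\<lambda>u. integral (cbox 0 1) (\<lambda>x. H x u))"
      by (rule integral_swap_continuous[OF c])
    also have "\<dots> = PP n m (of_real y)"
    proof -
      have "H x u = G (\<i> + of_real u) (of_real y) (\<i> + of_real x) * ee (- of_int n * (\<i> + of_real x)) * ee (- of_int m * (\<i> + of_real u))" for x u
        unfolding H_def using law(4)[of "\<i> + of_real u" "of_real y" "\<i> + of_real x"] by (simp add: D3_def)
      then show ?thesis unfolding PP_def fc_def[of \<i> m] by (simp add: ph_real fc_def integral_mult_left)
    qed
    finally show ?thesis .
  qed
  then show ?thesis by (simp add: A_def fc_def)
qed

lemma A_alt: "A n r m = fc \<i> n (\<lambda>\<tau>. fc 0 r (ph m \<tau>))"
proof -
  have c: "continuous_on (cbox (0, 0) (1, 1)) (\<lambda>(y::real, x::real). ph m (\<i> + of_real x) (0 + of_real y) * ee (- of_int n * (\<i> + of_real x)) * ee (- of_int r * (0 + of_real y)))"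
    unfolding split_beta
    unfolding add_0_left
    by (intro continuous_intros continuous_on_compose2[OF cont_ph, where f="\<lambda>u. (\<i> + of_real (snd u), of_real (fst u))", simplified]) auto
  have "A n r m = integral (cbox 0 1) (\<lambda>y::real. integral (cbox 0 1) (\<lambda>x::real. ph m (\<i> + of_real x) (0 + of_real y) * ee (- of_int n * (\<i> + of_real x)) * ee (- of_int r * (0 + of_real y))))"
    unfolding A_def PP_def fc_def by (simp add: integral_mult_left)
  also have "\<dots> = integral (cbox 0 1) (\<lambda>x::real. integral (cbox 0 1) (\<lambda>y::real. ph m (\<i> + of_real x) (0 + of_real y) * ee (- of_int n * (\<i> + of_real x)) * ee (- of_int r * (0 + of_real y))))"
    by (rule integral_swap_continuous[OF c])
  also have "\<dots> = integral (cbox 0 1) (\<lambda>x::real. integral (cbox 0 1) (\<lambda>y::real. ph m (\<i> + of_real x) (0 + of_real y) * ee (- of_int r * (0 + of_real y))) * ee (- of_int n * (\<i> + of_real x)))"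
    unfolding integral_mult_left[symmetric] by (simp add: mult_ac)
  finally show ?thesis unfolding fc_def by simp
qed

lemma fc_0_indep: "Im \<tau> > 0 \<Longrightarrow> fc v r (ph m \<tau>) = fc 0 r (ph m \<tau>)"
  by (rule fc_indep[where h="min (Im v) 0 - 1"]) (auto intro: holomorphic_on_subset[OF hol_ph_z] simp: ph_laws)

text \<open>Move the line of integration in z from 0 to \<tau>; the law for z + \<tau> turns the
  shift into a change of indices.\<close>

lemma A_shear1: "A n r m = A (n + r + m) (r + 2 * m) m"
proof -
  have R: "fc 0 r (ph m \<tau>) = ee (- of_int (m + r) * \<tau>) * fc 0 (r + 2 * m) (ph m \<tau>)" if \<tau>: "Im \<tau> > 0" for \<tau>
  proof -
    have "fc 0 r (ph m \<tau>) = fc \<tau> r (ph m \<tau>)" by (rule fc_0_indep[OF \<tau>, symmetric])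
    also have "\<dots> = integral {0..1} (\<lambda>y::real. ee (- of_int (m + r) * \<tau>) * (ph m \<tau> (of_real y) * ee (- of_int (r + 2 * m) * of_real y)))"
      unfolding fc_def
    proof (rule integral_cong)
      fix y :: real
      have "ph m \<tau> (\<tau> + of_real y) = ee (- of_int m * (2 * of_real y + \<tau>)) * ph m \<tau> (of_real y)"
        using ph_laws(4)[OF \<tau>, of m "of_real y"] by (simp add: add.commute)
      moreover have "ee (- of_int m * (2 * of_real y + \<tau>)) * ee (- of_int r * (\<tau> + of_real y)) =
         ee (- of_int (m + r) * \<tau>) * ee (- of_int (r + 2 * m) * of_real y)"
        unfolding ee_add[symmetric] by (intro arg_cong[of _ _ ee]) (simp add: algebra_simps)
      ultimately show "ph m \<tau> (\<tau> + of_real y) * ee (- of_int r * (\<tau> + of_real y)) =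
         ee (- of_int (m + r) * \<tau>) * (ph m \<tau> (of_real y) * ee (- of_int (r + 2 * m) * of_real y))" by (simp add: mult_ac)
    qed
    finally show ?thesis unfolding fc_def integral_mult_right by simp
  qed
  have "A n r m = integral {0..1} (\<lambda>x::real. fc 0 r (ph m (\<i> + of_real x)) * ee (- of_int n * (\<i> + of_real x)))"
    unfolding A_alt fc_def[of \<i>] ..
  also have "\<dots> = integral {0..1} (\<lambda>x::real. fc 0 (r + 2 * m) (ph m (\<i> + of_real x)) * ee (- of_int (n + r + m) * (\<i> + of_real x)))"
  proof (rule integral_cong)
    fix x :: real
    have "ee (- of_int (m + r) * (\<i> + of_real x)) * ee (- of_int n * (\<i> + of_real x)) = ee (- of_int (n + r + m) * (\<i> + of_real x))"
      unfolding ee_add[symmetric] by (intro arg_cong[of _ _ ee]) (simp add: algebra_simps)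
    then show "fc 0 r (ph m (\<i> + of_real x)) * ee (- of_int n * (\<i> + of_real x)) =
      fc 0 (r + 2 * m) (ph m (\<i> + of_real x)) * ee (- of_int (n + r + m) * (\<i> + of_real x))"
      using R[of "\<i> + of_real x"] by (simp add: mult_ac)
  qed
  finally show ?thesis unfolding A_alt[of "n + r + m"] fc_def[of \<i>] .
qed

lemma A_shear: "A n r m = A (n + int l * r + int l ^ 2 * m) (r + 2 * int l * m) m"
proof (induction l)
  case (Suc l)
  note Suc
  also have "A (n + int l * r + int l ^ 2 * m) (r + 2 * int l * m) m =
      A ((n + int l * r + int l ^ 2 * m) + (r + 2 * int l * m) + m) ((r + 2 * int l * m) + 2 * m) m" by (rule A_shear1)
  also have "(n + int l * r + int l ^ 2 * m) + (r + 2 * int l * m) + m = n + int (Suc l) * r + int (Suc l) ^ 2 * m"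
    by (simp add: power2_eq_square algebra_simps)
  also have "(r + 2 * int l * m) + 2 * m = r + 2 * int (Suc l) * m" by (simp add: algebra_simps)
  finally show ?case .
qed simp

lemma A_neg_r: "A n (- r) m = A n r m"
proof -
  have "fc 0 (- r) (ph m \<tau>) = fc 0 r (ph m \<tau>)" if \<tau>: "Im \<tau> > 0" for \<tau>
  proof -
    have "fc 0 r (ph m \<tau>) = fc (- 1) r (ph m \<tau>)" by (rule fc_0_indep[OF \<tau>, symmetric])
    also have "\<dots> = integral {0..1} (\<lambda>y. ph m \<tau> (of_real (1 - y)) * ee (of_int r * of_real (1 - y)))"
      unfolding fc_def
    proof (rule integral_cong)
      fix y :: real
      have "ph m \<tau> (- 1 + of_real y) = ph m \<tau> (of_real (1 - y))"
        using ph_laws(3)[OF \<tau>, of m "of_real (1 - y)"] by (simp add: algebra_simps)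
      then show "ph m \<tau> (- 1 + of_real y) * ee (- of_int r * (- 1 + of_real y)) = ph m \<tau> (of_real (1 - y)) * ee (of_int r * of_real (1 - y))"
        by (simp add: algebra_simps)
    qed
    also have "\<dots> = integral {0..1} (\<lambda>y::real. ph m \<tau> (of_real y) * ee (of_int r * of_real y))"
    proof -
      have i: "(\<lambda>y::real. ph m \<tau> (of_real y) * ee (of_int r * of_real y)) integrable_on {0..1}"
        by (intro integrable_continuous_interval continuous_intros
            continuous_on_compose2[OF holomorphic_on_imp_continuous_on[OF hol_ph_z[OF \<tau>]]]) auto
      have "((\<lambda>y::real. ph m \<tau> (of_real y) * ee (of_int r * of_real y)) has_integral integral {0..1} (\<lambda>y::real. ph m \<tau> (of_real y) * ee (of_int r * of_real y))) (cbox 0 1)"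
        using i by (simp add: integrable_integral)
      from has_integral_affinity[OF this, of "- 1" 1] show ?thesis
        by (simp add: integral_unique algebra_simps)
    qed
    finally show ?thesis unfolding fc_def by simp
  qed
  then show ?thesis unfolding A_alt fc_def[of \<i>] by simp
qed

text \<open>The three integrals run at heights 1, 0 and 1, so the bound is uniform in r. This
  uniformity is what the shears exploit.\<close>

lemma A_bound: obtains B where "\<And>n r m. norm (A n r m) \<le> B * exp (2 * pi * of_int (n + m))" "B \<ge> 0"
proof -
  have "continuous_on ({0..1} \<times> {0..1} \<times> {0..1}) (\<lambda>(x::real, y::real, u::real). G (\<i> + of_real x) (of_real y) (\<i> + of_real u))"
    unfolding split_beta
    by (intro continuous_intros continuous_on_compose2[OF cont, where f="\<lambda>x. (\<i> + of_real (fst x), of_real (fst (snd x)), \<i> + of_real (snd (snd x)))", simplified])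
       (auto simp: D3_def)
  then have "bounded ((\<lambda>(x::real, y::real, u::real). G (\<i> + of_real x) (of_real y) (\<i> + of_real u)) ` ({0..1} \<times> {0..1} \<times> {0..1}))"
    by (intro compact_imp_bounded compact_continuous_image compact_Times) auto
  then obtain B where B: "\<And>x y u. x \<in> {0..1} \<Longrightarrow> y \<in> {0..1} \<Longrightarrow> u \<in> {0..1} \<Longrightarrow> norm (G (\<i> + of_real x) (of_real y) (\<i> + of_real u)) \<le> B"
    unfolding bounded_iff by force
  have b1: "norm (ph m (\<i> + of_real x) (of_real y)) \<le> B * exp (2 * pi * of_int m)" if "x \<in> {0..1}" "y \<in> {0..1}" for x y :: real and m
  proof -
    have "continuous_on {0..1} (\<lambda>u::real. G (\<i> + of_real x) (of_real y) (\<i> + of_real u))"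
      by (intro continuous_on_compose2[OF cont, where f="\<lambda>u. (\<i> + of_real x, of_real y, \<i> + of_real u)", simplified])
         (auto intro!: continuous_intros simp: D3_def)
    then have "norm (fc \<i> m (G (\<i> + of_real x) (of_real y))) \<le> B * exp (2 * pi * of_int m * Im \<i>)"
      by (rule fc_bound) (use B that in auto)
    then show ?thesis by (simp add: ph_real)
  qed
  have b2: "norm (PP m n (of_real y)) \<le> B * exp (2 * pi * of_int m) * exp (2 * pi * of_int n)" if "y \<in> {0..1}" for y :: real and m n
  proof -
    have "norm (PP m n (of_real y)) \<le> B * exp (2 * pi * of_int m) * exp (2 * pi * of_int n * Im \<i>)"
      unfolding PP_def
      by (rule fc_bound) (use b1 that in \<open>auto intro!: continuous_on_hline[OF holomorphic_on_imp_continuous_on[OF hol_ph_\<tau>]]\<close>)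
    then show ?thesis by simp
  qed
  have "norm (A n r m) \<le> B * exp (2 * pi * of_int (n + m))" for n r m
  proof -
    have "norm (fc 0 r (PP m n)) \<le> B * exp (2 * pi * of_int m) * exp (2 * pi * of_int n) * exp (2 * pi * of_int r * Im 0)"
      by (rule fc_bound) (use b2 in \<open>auto intro!: continuous_on_compose2[OF holomorphic_on_imp_continuous_on[OF hol_PP]] continuous_intros\<close>)
    then show ?thesis by (simp add: A_def mult.assoc exp_add[symmetric] algebra_simps)
  qed
  moreover have "B \<ge> 0" using order_trans[OF norm_ge_zero B[of 0 0 0]] by simp
  ultimately show ?thesis using that by blast
qed

text \<open>Koecher's principle: an unbounded orbit of a negative index forces the coefficient to vanish.\<close>

lemma A_neg_m: assumes "m < 0" shows "A n r m = 0"
proof -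
  obtain B where B: "\<And>n r m. norm (A n r m) \<le> B * exp (2 * pi * of_int (n + m))" "B \<ge> 0" using A_bound by blast
  have le: "norm (A n r m) \<le> B * exp (2 * pi * of_int (n + m)) * exp (- 2 * pi) ^ l" if l: "l \<ge> nat \<bar>r\<bar> + 1" for l
  proof -
    \<comment> \<open>Once l exceeds |r|, the first sheared index n + l r + l^2 m is at most n -
      l.\<close>
    have lm: "int l * m \<le> int l * (- 1)" using assms by (intro mult_left_mono) auto
    have "r + int l * m \<le> - 1" using l lm by linarith
    then have "int l * (r + int l * m) \<le> int l * (- 1)" by (intro mult_left_mono) auto
    then have "n + int l * r + int l ^ 2 * m + m \<le> (n + m) - int l" by (simp add: power2_eq_square algebra_simps)
    then have "real_of_int (n + int l * r + int l ^ 2 * m + m) \<le> real_of_int ((n + m) - int l)" by (simp only: of_int_le_iff)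
    then have e: "exp (2 * pi * of_int (n + int l * r + int l ^ 2 * m + m)) \<le> exp (2 * pi * of_int ((n + m) - int l))"
      unfolding exp_le_cancel_iff by (rule mult_left_mono) simp
    have "norm (A n r m) \<le> B * exp (2 * pi * of_int (n + int l * r + int l ^ 2 * m + m))"
      using B(1)[of "n + int l * r + int l ^ 2 * m" "r + 2 * int l * m" m] by (simp only: A_shear[of n r m l, symmetric])
    also have "\<dots> \<le> B * exp (2 * pi * of_int ((n + m) - int l))" by (intro mult_left_mono e B(2))
    also have "exp (2 * pi * of_int ((n + m) - int l)) = exp (2 * pi * of_int (n + m)) * exp (- 2 * pi) ^ l"
      by (simp add: exp_of_nat_mult[symmetric] exp_add[symmetric] algebra_simps)
    finally show ?thesis by simp
  qed
  have "(\<lambda>l. B * exp (2 * pi * of_int (n + m)) * exp (- 2 * pi) ^ l) \<longlonglongrightarrow> B * exp (2 * pi * of_int (n + m)) * 0"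
    by (intro tendsto_mult_left LIMSEQ_realpow_zero) auto
  then have "norm (A n r m) \<le> B * exp (2 * pi * of_int (n + m)) * 0"
    by (rule tendsto_lowerbound) (use le in \<open>auto intro!: eventually_sequentiallyI[of "nat \<bar>r\<bar> + 1"]\<close>)
  then show ?thesis by simp
qed

lemma A_neg_n: "n < 0 \<Longrightarrow> A n r m = 0"
  using A_neg_m A_sym by metis

text \<open>One shear turns r < -(n + m) into a negative first index, and r may change sign. The
  linear cone is coarser than r^2 <= 4nm, but it is closed under addition and bounds r.\<close>

lemma A_supp: assumes "\<bar>r\<bar> > n + m" shows "A n r m = 0"
proof -
  have 1: "A n r m = 0" if "r < 0" "- r > n + m" for r using A_shear1[of n r m] A_neg_n[of "n + r + m"] that by simp
  show ?thesis
  proof (cases "n < 0 \<or> m < 0")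
    case True then show ?thesis using A_neg_n A_neg_m by blast
  next
    case False
    then show ?thesis using 1[of r] 1[of "- r"] A_neg_r[of n r m] assms by (cases "r < 0") auto
  qed
qed

end

section \<open>Even trigonometric polynomials\<close>

text \<open>Chebyshev's recursion for e(rz) + e(-rz), in the variable \<sigma> with 2 + \<sigma> =
  e(z) + e(-z). The integer coefficients transfer integrality from powers of e(z) to powers of
  \<sigma>.\<close>

fun tp :: "nat \<Rightarrow> complex poly" where
  "tp 0 = [:2:]"
| "tp (Suc 0) = [:2, 1:]"
| "tp (Suc (Suc r)) = [:2, 1:] * tp (Suc r) - tp r"

lemma poly_tp: "poly (tp r) (ss z) = ee (of_nat r * z) + ee (- of_nat r * z)"
proof (induction r rule: tp.induct)
  case 2
  show ?case by (simp add: ss_def)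
next
  case (3 r)
  have "poly (tp (Suc (Suc r))) (ss z) = (ee z + ee (- z)) * (ee (of_nat (Suc r) * z) + ee (- of_nat (Suc r) * z)) - (ee (of_nat r * z) + ee (- of_nat r * z))"
  proof -
    have "poly [:2, 1:] (ss z) = ee z + ee (- z)" by (simp add: ss_def)
    then show ?thesis unfolding tp.simps poly_diff poly_mult 3 by (simp only:)
  qed
  also have "\<dots> = ee (of_nat (Suc (Suc r)) * z) + ee (- of_nat (Suc (Suc r)) * z)"
  proof -
    have "ee z * ee (of_nat (Suc r) * z) = ee (of_nat (Suc (Suc r)) * z)" "ee (- z) * ee (of_nat (Suc r) * z) = ee (of_nat r * z)"
      "ee z * ee (- of_nat (Suc r) * z) = ee (- of_nat r * z)" "ee (- z) * ee (- of_nat (Suc r) * z) = ee (- of_nat (Suc (Suc r)) * z)"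
      unfolding ee_add[symmetric] by (auto intro!: arg_cong[of _ _ ee] simp: algebra_simps)
    then show ?thesis unfolding distrib_left distrib_right by simp
  qed
  finally show ?case .
qed simp

lemma tp_int: "coeff (tp r) j \<in> \<int>"
proof (induction r arbitrary: j rule: tp.induct)
  case 1 show ?case by (auto simp: coeff_pCons split: nat.splits)
next
  case 2 show ?case by (auto simp: coeff_pCons split: nat.splits)
next
  case (3 r)
  have "coeff ([:2, 1:] * tp (Suc r)) j \<in> \<int>" unfolding coeff_mult
    using 3 by (auto intro!: Ints_sum Ints_mult simp: coeff_pCons split: nat.splits)
  then show ?case using 3 by auto
qed

text \<open>On Fourier coefficients, multiplication by \<open>ss\<close> is a second difference;
  hence the passage from powers of \<sigma> back to powers of e(z) is integral as well.\<close>

lemma fc_ss_mult: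
  assumes "h holomorphic_on UNIV"
  shows "fc 0 r (\<lambda>z. ss z * h z) = fc 0 (r - 1) h - 2 * fc 0 r h + fc 0 (r + 1) h"
proof -
  have i: "(\<lambda>x::real. h (of_real x) * ee (c * of_real x)) integrable_on {0..1}" for c
    by (intro integrable_continuous_interval continuous_intros continuous_on_compose2[OF holomorphic_on_imp_continuous_on[OF assms]]) auto
  have "fc 0 r (\<lambda>z. ss z * h z) = integral {0..1} (\<lambda>x::real. (h (of_real x) * ee (- of_int (r - 1) * of_real x)
      - 2 * (h (of_real x) * ee (- of_int r * of_real x))) + h (of_real x) * ee (- of_int (r + 1) * of_real x))"
    unfolding fc_def
  proof (rule integral_cong)
    fix x :: real
    have "ee (of_real x) * ee (- of_int r * of_real x) = ee (- of_int (r - 1) * of_real x)"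
      "ee (- of_real x) * ee (- of_int r * of_real x) = ee (- of_int (r + 1) * of_real x)"
      unfolding ee_add[symmetric] by (auto intro!: arg_cong[of _ _ ee] simp: algebra_simps)
    show "ss (0 + of_real x) * h (0 + of_real x) * ee (- of_int r * (0 + of_real x)) =
       (h (of_real x) * ee (- of_int (r - 1) * of_real x) - 2 * (h (of_real x) * ee (- of_int r * of_real x))) + h (of_real x) * ee (- of_int (r + 1) * of_real x)"
    proof -
      have "(a - 2 + b) * k * e = (k * (a * e) - 2 * (k * e)) + k * (b * e)" for a b k e :: complex
        by (simp add: algebra_simps)
      then show ?thesis unfolding ss_def add_0_left using \<open>ee (of_real x) * _ = _\<close> \<open>ee (- of_real x) * _ = _\<close> by (simp only:)
    qed
  qed
  also have "\<dots> = fc 0 (r - 1) h - 2 * fc 0 r h + fc 0 (r + 1) h"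
    unfolding fc_def add_0_left
    unfolding integral_mult_right[symmetric]
    by (simp only: integral_add integral_diff integrable_diff integrable_on_mult_right i)
  finally show ?thesis .
qed

lemma fc_poly_ss_in:
  assumes p: "prime p" and L: "zpmod p L" and "\<And>j. coeff q j \<in> L"
  shows "fc 0 r (\<lambda>z. poly q (ss z)) \<in> L"
  using assms(3)
proof (induction q arbitrary: r rule: pCons_induct)
  case 0 then show ?case using L by (simp add: fc_const zpmod_def)
next
  case (pCons a q)
  have h: "(\<lambda>z. poly q (ss z)) holomorphic_on UNIV" "(\<lambda>z. ss z * poly q (ss z)) holomorphic_on UNIV"
    by (intro holomorphic_intros)+
  have IH: "fc 0 r (\<lambda>z. poly q (ss z)) \<in> L" for r
    by (rule pCons.IH) (use pCons.prems[of "Suc j" for j] in simp)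
  have "2 * fc 0 r (\<lambda>z. poly q (ss z)) \<in> L" using L IH p_integral_numeral[OF p] by (auto simp: zpmod_def)
  then have 1: "fc 0 r (\<lambda>z. ss z * poly q (ss z)) \<in> L"
    unfolding fc_ss_mult[OF h(1)] using IH zpmod_diff[OF p L] L by (auto simp: zpmod_def)
  have "fc 0 r (\<lambda>z. poly (pCons a q) (ss z)) = fc 0 r (\<lambda>z. a) + fc 0 r (\<lambda>z. ss z * poly q (ss z))"
    unfolding fc_def poly_pCons distrib_right
    by (rule integral_add; rule integrable_continuous_interval)
       (intro continuous_intros continuous_on_compose2[OF holomorphic_on_imp_continuous_on[OF h(1)]], auto)+
  moreover have "fc 0 r (\<lambda>z. a) \<in> L" using pCons.prems[of 0] L by (simp add: fc_const zpmod_def)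
  ultimately show ?case using 1 L by (auto simp: zpmod_def)
qed

text \<open>Multiplying by e(Rz) makes all frequencies nonnegative, so the expansion of periodic
  functions applies and becomes a finite sum; evenness pairs r with -r.\<close>

lemma even_trig_poly:
  assumes h: "g holomorphic_on UNIV" and per: "\<And>z. g (z + 1) = g z" and ev: "\<And>r. fc 0 (- r) g = fc 0 r g"
    and supp: "\<And>r. r > int R \<Longrightarrow> fc 0 r g = 0"
  shows "g z = poly ([:fc 0 0 g:] + (\<Sum>r=1..R. smult (fc 0 (int r) g) (tp r))) (ss z)"
proof -
  define h where "h = min (Im z) 0 - 1"
  let ?f = "\<lambda>z. g z * ee (of_nat R * z)"
  have fcf: "fc 0 n ?f = fc 0 (n - int R) g" for n
    unfolding fc_def
  proof (rule integral_cong)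
    fix x :: real
    have "ee (of_nat R * (0 + of_real x)) * ee (- of_int n * (0 + of_real x)) = ee (- of_int (n - int R) * (0 + of_real x))"
      unfolding ee_add[symmetric] by (auto intro!: arg_cong[of _ _ ee] simp: algebra_simps)
    then show "g (0 + of_real x) * ee (of_nat R * (0 + of_real x)) * ee (- of_int n * (0 + of_real x)) =
        g (0 + of_real x) * ee (- of_int (n - int R) * (0 + of_real x))" by (simp only: mult.assoc)
  qed
  have z0: "fc 0 r g = 0" if "\<bar>r\<bar> > int R" for r using supp[of r] supp[of "- r"] ev[of r] that by (cases "r > 0") auto
  have "(\<lambda>n. fc 0 (int n) ?f * ee (of_nat n * z)) sums ?f z"
  proof (rule periodic_power_series[where h=h])
    show "?f holomorphic_on {t. Im t > h}" by (intro holomorphic_intros holomorphic_on_subset[OF \<open>g holomorphic_on UNIV\<close>]) auto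
    show "?f (t + 1) = ?f t" for t by (simp add: per ring_distribs ee_add)
    show "fc 0 n ?f = 0" if "n < 0" for n unfolding fcf using that by (intro z0) auto
  qed (auto simp: h_def)
  moreover have "(\<lambda>n. fc 0 (int n) ?f * ee (of_nat n * z)) sums (\<Sum>n\<le>2 * R. fc 0 (int n) ?f * ee (of_nat n * z))"
    by (rule sums_finite) (auto simp: fcf intro!: z0)
  ultimately have "?f z = (\<Sum>n\<le>2 * R. fc 0 (int n) ?f * ee (of_nat n * z))" by (rule sums_unique2)
  also have "\<dots> = (\<Sum>n\<in>{- int R..int R}. fc 0 n g * ee (of_int n * z) * ee (of_nat R * z))"
  proof -
    define k where "k = (\<lambda>n. fc 0 n g * ee (of_int n * z) * ee (of_nat R * z))"
    have "fc 0 (int n) ?f * ee (of_nat n * z) = k (int n - int R)" for n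
    proof -
      have "ee (of_int (int n - int R) * z) * ee (of_nat R * z) = ee (of_nat n * z)"
        unfolding ee_add[symmetric] by (intro arg_cong[of _ _ ee]) (simp add: algebra_simps)
      then show ?thesis unfolding k_def fcf by (simp only: mult.assoc)
    qed
    then have "(\<Sum>n\<le>2 * R. fc 0 (int n) ?f * ee (of_nat n * z)) = (\<Sum>n\<le>2 * R. k (int n - int R))" by simp
    also have "\<dots> = (\<Sum>n\<in>{- int R..int R}. k n)"
      by (rule sum.reindex_bij_witness[of _ "\<lambda>n. nat (n + int R)" "\<lambda>n. int n - int R"]) auto
    finally show ?thesis unfolding k_def .
  qed
  also have "\<dots> = (\<Sum>n\<in>{- int R..int R}. fc 0 n g * ee (of_int n * z)) * ee (of_nat R * z)" by (simp add: sum_distrib_right)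
  finally have "g z = (\<Sum>n\<in>{- int R..int R}. fc 0 n g * ee (of_int n * z))" by simp
  also have "{- int R..int R} = ({- int R..-1} \<union> {0}) \<union> {1..int R}" by auto
  also have "(\<Sum>n\<in>({- int R..-1} \<union> {0}) \<union> {1..int R}. fc 0 n g * ee (of_int n * z))
     = (\<Sum>n\<in>{- int R..-1}. fc 0 n g * ee (of_int n * z)) + fc 0 0 g + (\<Sum>n\<in>{1..int R}. fc 0 n g * ee (of_int n * z))"
    by (subst sum.union_disjoint; (subst sum.union_disjoint)?) auto
  also have "(\<Sum>n\<in>{- int R..-1}. fc 0 n g * ee (of_int n * z)) = (\<Sum>r=1..R. fc 0 (int r) g * ee (- of_nat r * z))"
    by (rule sum.reindex_bij_witness[of _ "\<lambda>r. - int r" "\<lambda>n. nat (- n)"]) (auto simp: ev)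
  also have "(\<Sum>n\<in>{1..int R}. fc 0 n g * ee (of_int n * z)) = (\<Sum>r=1..R. fc 0 (int r) g * ee (of_nat r * z))"
    by (rule sum.reindex_bij_witness[of _ "\<lambda>r. int r" "\<lambda>n. nat n"]) auto
  finally show ?thesis by (simp add: poly_sum poly_tp sum.distrib distrib_left)
qed

section \<open>Fourier-Jacobi coefficients as Jacobi forms\<close>

context level_one
begin

text \<open>The range of r comes from \<open>A_supp\<close>. The term r = 0 stands apart because
  \<open>tp 0\<close> is 2.\<close>

definition QQ :: "nat \<Rightarrow> complex poly fps"
  where "QQ m = Abs_fps (\<lambda>n. [:A (int n) 0 (int m):] + (\<Sum>r=1..n+m. smult (A (int n) (int r) (int m)) (tp r)))"

lemma PP_poly: "PP (int m) (int n) z = poly (fps_nth (QQ m) n) (ss z)"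
  using even_trig_poly[OF hol_PP PP_periodic, of "int m" "int n" "n + m" z] A_neg_r A_supp
  unfolding A_def[symmetric] QQ_def by simp

lemma PP_neg: assumes "n < 0" shows "PP m n z = 0"
  using even_trig_poly[OF hol_PP PP_periodic, of m n 0 z] A_neg_n[OF assms] unfolding A_def[symmetric] by simp

lemma JF_ph: "JF (int w) m (ph (int m)) (QQ m)"
proof -
  have "qexp (\<lambda>\<tau>. ph (int m) \<tau> z) (ev (ss z) (QQ m))" for z
  proof (rule qexpI_sums)
    fix \<tau> :: complex assume \<tau>: "Im \<tau> > 0"
    have "(\<lambda>n. fc \<i> (int n) (\<lambda>\<tau>. ph (int m) \<tau> z) * ee (of_nat n * \<tau>)) sums ph (int m) \<tau> z"
      by (rule periodic_power_series[OF hol_ph_\<tau>]) (use \<tau> PP_neg in \<open>auto simp: ph_laws PP_def\<close>)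
    then show "(\<lambda>n. fps_nth (ev (ss z) (QQ m)) n * ee (of_nat n * \<tau>)) sums ph (int m) \<tau> z"
      using PP_poly unfolding PP_def by simp
  qed
  then show ?thesis unfolding JF_def idx_def using cont_ph hol_ph_z ph_laws by simp
qed

theorem lev1_sturm:
  assumes p: "prime p" "p \<ge> 5" and L: "zpmod p L" and w: "even w"
    and box: "\<And>n r m. 0 \<le> n \<Longrightarrow> 0 \<le> m \<Longrightarrow> 10 * n \<le> int w \<Longrightarrow> 10 * m \<le> int w \<Longrightarrow> A n r m \<in> L"
  shows "A n r m \<in> L"
proof -
  have QA: "coeff (fps_nth (QQ m) n) j \<in> L" if "\<And>r. A (int n) r (int m) \<in> L" for n m j
  proof -
    have "coeff (tp r) j * A (int n) (int r) (int m) \<in> L" for r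
      using tp_int[of r j] L that[of "int r"] p_integral_of_int[OF p(1)] by (auto simp: zpmod_def elim!: Ints_cases)
    then have "(\<Sum>r=1..n+m. coeff (smult (A (int n) (int r) (int m)) (tp r)) j) \<in> L"
      by (intro zpmod_sum[OF L]) (simp add: mult.commute)
    moreover have "coeff [:A (int n) 0 (int m):] j \<in> L" using that L by (auto simp: coeff_pCons zpmod_def split: nat.splits)
    ultimately show ?thesis using L unfolding QQ_def fps_nth_Abs_fps coeff_add coeff_sum by (auto simp: zpmod_def)
  qed
  have AQ': "A (int n) r (int m) \<in> L" if "pin L (QQ m)" for n r m
  proof -
    have "PP (int m) (int n) = (\<lambda>z. poly (fps_nth (QQ m) n) (ss z))" by (rule ext) (rule PP_poly)
    then show ?thesis unfolding A_def using fc_poly_ss_in[OF p(1) L] that by (simp add: pin_def)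
  qed
  have main: "pin L (QQ m)" for m
  proof (induction m rule: less_induct)
    case (less m)
    show ?case
    proof (rule JF_sturm[OF p L _ JF_ph])
      show "even (int w)" using w by simp
      fix n j assume n: "12 * int n \<le> int w + 2 * int m"
      show "coeff (fps_nth (QQ m) n) j \<in> L"
      proof (rule QA)
        fix r
        show "A (int n) r (int m) \<in> L"
        proof (cases "n < m")
          case True
          then show ?thesis using AQ'[OF less.IH[OF True], of m r] A_sym by simp
        next
          case False
          \<comment> \<open>Here m <= n, so 12 m <= w + 2 m gives 10 m <= w; then 60 n <= 5 w + 10 m
            <= 6 w puts n into the box too.\<close>
          then have "10 * int m \<le> int w" using n by linarith
          moreover from this have "10 * int n \<le> int w" using n by linarith
          ultimately show ?thesis by (intro box) auto
        qed
      qed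
    qed
  qed
  show ?thesis
  proof (cases "n < 0 \<or> m < 0")
    case True then show ?thesis using A_neg_n A_neg_m L by (auto simp: zpmod_def)
  next
    case False
    then show ?thesis using AQ'[OF main, of "nat n" r "nat m"] by simp
  qed
qed

end

section \<open>The action of the symplectic group\<close>

\<comment> \<open>This notation, left over from the import of Laurent series, makes parsing of matrix entries exponentially ambiguous.\<close>
no_notation fps_nth (infixl \<open>$\<close> 75)

text \<open>The pairing is bilinear, and conjugation enters separately through \<open>cj\<close>; so
  one symplectic identity yields both symmetry and positivity of the transformed point.\<close>

definition dt :: "complex ^ 2 \<Rightarrow> complex ^ 2 \<Rightarrow> complex"
  where "dt x y = (\<Sum>k\<in>UNIV. x $ k * y $ k)"

definition cj :: "complex ^ 2 \<Rightarrow> complex ^ 2"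
  where "cj x = (\<chi> i. cnj (x $ i))"

definition Pm :: "mat4 \<Rightarrow> complex ^ 2 ^ 2 \<Rightarrow> complex ^ 2 ^ 2"
  where "Pm M Z = block_A M ** Z + block_B M"

definition Qm :: "mat4 \<Rightarrow> complex ^ 2 ^ 2 \<Rightarrow> complex ^ 2 ^ 2"
  where "Qm M Z = block_C M ** Z + block_D M"

lemma siegel_action_PQ: "siegel_action M Z = Pm M Z ** matrix_inv (Qm M Z)"
  by (simp add: siegel_action_def Pm_def Qm_def)

lemma dt_add: "dt (x + x') y = dt x y + dt x' y" "dt x (y + y') = dt x y + dt x y'"
  by (simp_all add: dt_def sum.distrib algebra_simps)

lemma dt_commute: "dt x y = dt y x"
  by (simp add: dt_def mult.commute)

lemma dt_mult:
  fixes A B :: "complex ^ 2 ^ 2"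
  shows "dt (A *v x) (B *v y) = dt x ((transpose A ** B) *v y)"
  by (simp add: dt_def matrix_vector_mult_def matrix_matrix_mult_def transpose_def sum_2 algebra_simps)

lemma cj_mult: "cj (A *v x) = (\<chi> i j. cnj (A $ i $ j)) *v cj x"
  by (simp add: vec_eq_iff cj_def matrix_vector_mult_def sum_2)

lemma cj_add: "cj (x + y) = cj x + cj y"
  by (simp add: vec_eq_iff cj_def)

lemma cj_cj: "cj (cj x) = x"
  by (simp add: vec_eq_iff cj_def)

lemma cnj_dt: "cnj (dt x y) = dt (cj x) (cj y)"
  by (simp add: dt_def cj_def)

lemma block_cnj:
  "(\<chi> i j. cnj (block_A M $ i $ j)) = block_A M" "(\<chi> i j. cnj (block_B M $ i $ j)) = block_B M"
  "(\<chi> i j. cnj (block_C M $ i $ j)) = block_C M" "(\<chi> i j. cnj (block_D M $ i $ j)) = block_D M"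
  by (simp_all add: vec_eq_iff block_A_def block_B_def block_C_def block_D_def)

section \<open>Block relations of a symplectic matrix\<close>

lemma symplectic_entries:
  "(transpose M ** symp_J ** M) $ x $ y = (\<Sum>k\<in>UNIV. M $ Inl k $ x * M $ Inr k $ y - M $ Inr k $ x * M $ Inl k $ y)"
proof -
  have "(transpose M ** symp_J) $ x $ Inl k = - (M $ Inr k $ x)" "(transpose M ** symp_J) $ x $ Inr k = M $ Inl k $ x" for k
    using exhaust_2[of k] by (auto simp: matrix_matrix_mult_def transpose_def sum_UNIV_Plus symp_J_nth sum_2)
  then have "(\<Sum>k\<in>UNIV. (transpose M ** symp_J) $ x $ k * M $ k $ y) = (\<Sum>k\<in>UNIV. M $ Inl k $ x * M $ Inr k $ y - M $ Inr k $ x * M $ Inl k $ y)"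
    by (simp add: sum_UNIV_Plus sum_2)
  then show ?thesis by (simp add: matrix_matrix_mult_def[of "transpose M ** symp_J"])
qed

lemma block_relations:
  assumes "M \<in> carrier Sp2Z"
  shows "transpose (block_A M) ** block_C M = transpose (block_C M) ** block_A M"
    "transpose (block_B M) ** block_D M = transpose (block_D M) ** block_B M"
    "transpose (block_A M) ** block_D M = mat 1 + transpose (block_C M) ** block_B M"
    "transpose (block_D M) ** block_A M = mat 1 + transpose (block_B M) ** block_C M"
proof -
  have "(\<Sum>k\<in>UNIV. M $ Inl k $ x * M $ Inr k $ y - M $ Inr k $ x * M $ Inl k $ y) = symp_J $ x $ y" for x y
    using assms symplectic_entries[of M x y] by (simp add: Sp2Z_def)
  then have e: "of_int (\<Sum>k\<in>UNIV. M $ Inl k $ x * M $ Inr k $ y - M $ Inr k $ x * M $ Inl k $ y) = (of_int (symp_J $ x $ y) :: complex)" for x y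
    by simp
  show "transpose (block_A M) ** block_C M = transpose (block_C M) ** block_A M"
    using e[of "Inl i" "Inl j" for i j]
    by (simp add: vec_eq_iff matrix_matrix_mult_def transpose_def sum_2 block_A_def block_C_def symp_J_nth algebra_simps)
  show "transpose (block_B M) ** block_D M = transpose (block_D M) ** block_B M"
    using e[of "Inr i" "Inr j" for i j]
    by (simp add: vec_eq_iff matrix_matrix_mult_def transpose_def sum_2 block_B_def block_D_def symp_J_nth algebra_simps)
  have 3: "(transpose (block_A M) ** block_D M) $ i $ j = (mat 1 + transpose (block_C M) ** block_B M) $ i $ j" for i j
    using e[of "Inl i" "Inr j"]
    by (simp add: matrix_matrix_mult_def transpose_def sum_2 block_A_def block_B_def block_C_def block_D_def symp_J_nth mat_def algebra_simps split: if_splits)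
  then show "transpose (block_A M) ** block_D M = mat 1 + transpose (block_C M) ** block_B M"
    by (simp add: vec_eq_iff)
  have 4: "(transpose (block_D M) ** block_A M) $ i $ j = (mat 1 + transpose (block_B M) ** block_C M) $ i $ j" for i j
    using 3[of j i] by (simp add: matrix_matrix_mult_def transpose_def sum_2 mat_def algebra_simps split: if_splits)
  then show "transpose (block_D M) ** block_A M = mat 1 + transpose (block_B M) ** block_C M"
    by (simp add: vec_eq_iff)
qed

lemma symplectic_form:
  assumes "M \<in> carrier Sp2Z"
  shows "dt (block_A M *v u + block_B M *v v) (block_C M *v u' + block_D M *v v')
       - dt (block_C M *v u + block_D M *v v) (block_A M *v u' + block_B M *v v') = dt u v' - dt v u'"
proof -
  note r = block_relations[OF assms]
  have m: "(X + Y) *v x = X *v x + Y *v x" for X Y :: "complex ^ 2 ^ 2" and x by (rule matrix_vector_mult_add_rdistrib)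
  show ?thesis
    unfolding dt_add dt_mult r(1) r(2) r(3) r(4) m by (simp add: dt_add)
qed

lemma siegel_point_nth [simp]:
  "siegel_point \<tau> z t $ 1 $ 1 = \<tau>" "siegel_point \<tau> z t $ 1 $ 2 = z" "siegel_point \<tau> z t $ 2 $ 1 = z" "siegel_point \<tau> z t $ 2 $ 2 = t"
  by (simp_all add: siegel_point_def)

lemma symmetric_siegel_point:
  assumes "transpose Z = Z" shows "Z = siegel_point (Z $ 1 $ 1) (Z $ 1 $ 2) (Z $ 2 $ 2)"
proof -
  have "transpose Z $ 2 $ 1 = Z $ 1 $ 2" by (simp add: transpose_def)
  then have "Z $ 2 $ 1 = Z $ 1 $ 2" using assms by simp
  then show ?thesis unfolding vec_eq_iff forall_2 siegel_point_nth by blast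
qed

text \<open>Multiply by d and complete the squares. The primed variables take the imaginary parts of
  a complex vector.\<close>

lemma quadratic_pos:
  fixes b d e x x' y y' :: real
  assumes "d > 0" "b\<^sup>2 < d * e" "x \<noteq> 0 \<or> x' \<noteq> 0 \<or> y \<noteq> 0 \<or> y' \<noteq> 0"
  shows "d * (x\<^sup>2 + x'\<^sup>2) + 2 * b * (x * y + x' * y') + e * (y\<^sup>2 + y'\<^sup>2) > 0"
proof -
  have "d * (d * (x\<^sup>2 + x'\<^sup>2) + 2 * b * (x * y + x' * y') + e * (y\<^sup>2 + y'\<^sup>2))
     = (d * x + b * y)\<^sup>2 + (d * x' + b * y')\<^sup>2 + (d * e - b\<^sup>2) * (y\<^sup>2 + y'\<^sup>2)"
    by (simp add: power2_eq_square algebra_simps)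
  also have "\<dots> > 0"
  proof (cases "y = 0 \<and> y' = 0")
    case True
    then have "(d * x)\<^sup>2 > 0 \<or> (d * x')\<^sup>2 > 0" using assms by auto
    then show ?thesis using True zero_le_power2[of "d * x"] zero_le_power2[of "d * x'"] by (auto simp: add_pos_nonneg add_nonneg_pos)
  next
    case False
    then have "y\<^sup>2 + y'\<^sup>2 > 0" by (simp add: sum_power2_gt_zero_iff)
    then have "(d * e - b\<^sup>2) * (y\<^sup>2 + y'\<^sup>2) > 0" using assms by simp
    then show ?thesis by (intro add_nonneg_pos add_nonneg_nonneg) auto
  qed
  finally show ?thesis using assms(1) by (simp add: zero_less_mult_iff)
qed

lemma siegel_point_iff: "siegel_point \<tau> z t \<in> siegel_upper_half_space \<longleftrightarrow> (\<tau>, z, t) \<in> D3"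
proof
  assume h: "siegel_point \<tau> z t \<in> siegel_upper_half_space"
  have pos: "Im \<tau> * x\<^sup>2 + 2 * Im z * (x * y) + Im t * y\<^sup>2 > 0" if "x \<noteq> 0 \<or> y \<noteq> 0" for x y :: real
  proof -
    define v :: "real ^ 2" where "v = vector [x, y]"
    have "v \<noteq> 0" using that by (auto simp: v_def vec_eq_iff forall_2)
    then have "v \<bullet> (map_matrix Im (siegel_point \<tau> z t) *v v) > 0" using h by (auto simp: siegel_upper_half_space_def)
    then show ?thesis by (simp add: inner_vec_def matrix_vector_mult_def sum_2 v_def power2_eq_square algebra_simps)
  qed
  have d: "Im \<tau> > 0" using pos[of 1 0] by simp
  have "0 < Im \<tau> * (Im z)\<^sup>2 + 2 * Im z * (- Im z * Im \<tau>) + Im t * (Im \<tau>)\<^sup>2"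
    using pos[of "- Im z" "Im \<tau>"] d by simp
  also have "\<dots> = Im \<tau> * (Im \<tau> * Im t - (Im z)\<^sup>2)" by (simp add: power2_eq_square algebra_simps)
  finally have "0 < Im \<tau> * Im t - (Im z)\<^sup>2" using d by (simp add: zero_less_mult_iff)
  then show "(\<tau>, z, t) \<in> D3" using d by (simp add: D3_def)
next
  assume D: "(\<tau>, z, t) \<in> D3"
  have "v \<bullet> (map_matrix Im (siegel_point \<tau> z t) *v v) > 0" if "v \<noteq> 0" for v :: "real ^ 2"
  proof -
    have "v $ 1 \<noteq> 0 \<or> v $ 2 \<noteq> 0" using that by (auto simp: vec_eq_iff forall_2)
    then have "Im \<tau> * ((v $ 1)\<^sup>2 + 0\<^sup>2) + 2 * Im z * (v $ 1 * v $ 2 + 0 * 0) + Im t * ((v $ 2)\<^sup>2 + 0\<^sup>2) > 0"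
      using D by (intro quadratic_pos) (auto simp: D3_def)
    then show ?thesis by (simp add: inner_vec_def matrix_vector_mult_def sum_2 power2_eq_square algebra_simps)
  qed
  then show "siegel_point \<tau> z t \<in> siegel_upper_half_space"
    by (simp add: siegel_upper_half_space_def vec_eq_iff forall_2 transpose_def)
qed

lemma siegelE:
  assumes "Z \<in> siegel_upper_half_space" obtains \<tau> z t where "Z = siegel_point \<tau> z t" "(\<tau>, z, t) \<in> D3"
  using assms symmetric_siegel_point[of Z] siegel_point_iff by (metis (mono_tags, lifting) mem_Collect_eq siegel_upper_half_space_def)

lemma siegel_form_pos:
  assumes "Z \<in> siegel_upper_half_space" "v \<noteq> 0" shows "Im (dt (cj v) (Z *v v)) > 0"
proof -
  obtain \<tau> z t where Z: "Z = siegel_point \<tau> z t" and D: "(\<tau>, z, t) \<in> D3" using siegelE[OF assms(1)] .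
  have "Re (v $ 1) \<noteq> 0 \<or> Im (v $ 1) \<noteq> 0 \<or> Re (v $ 2) \<noteq> 0 \<or> Im (v $ 2) \<noteq> 0"
    using assms(2) by (auto simp: vec_eq_iff forall_2 complex_eq_iff)
  then have "Im \<tau> * ((Re (v $ 1))\<^sup>2 + (Im (v $ 1))\<^sup>2) + 2 * Im z * (Re (v $ 1) * Re (v $ 2) + Im (v $ 1) * Im (v $ 2))
      + Im t * ((Re (v $ 2))\<^sup>2 + (Im (v $ 2))\<^sup>2) > 0"
    using D by (intro quadratic_pos) (auto simp: D3_def)
  then show ?thesis unfolding Z by (simp add: dt_def cj_def matrix_vector_mult_def sum_2 power2_eq_square algebra_simps)
qed

text \<open>Being real and symplectic, M preserves the symplectic pairing of (Zv, v) with its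
  complex conjugate, and this pairing is the imaginary part up to a constant factor.\<close>

lemma siegel_form_transform:
  assumes M: "M \<in> carrier Sp2Z"
  shows "Im (dt (cj (Qm M Z *v v)) (Pm M Z *v v)) = Im (dt (cj v) (Z *v v))"
proof -
  have P: "Pm M Z *v v = block_A M *v (Z *v v) + block_B M *v v"
    and Q: "Qm M Z *v v = block_C M *v (Z *v v) + block_D M *v v"
    by (simp_all add: Pm_def Qm_def matrix_vector_mult_add_rdistrib matrix_vector_mul_assoc)
  have cP: "cj (Pm M Z *v v) = block_A M *v cj (Z *v v) + block_B M *v cj v"
    and cQ: "cj (Qm M Z *v v) = block_C M *v cj (Z *v v) + block_D M *v cj v"
    unfolding P Q by (simp_all add: cj_add cj_mult block_cnj)
  have "dt (cj (Pm M Z *v v)) (Qm M Z *v v) - dt (cj (Qm M Z *v v)) (Pm M Z *v v) = dt (cj (Z *v v)) v - dt (cj v) (Z *v v)"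
    unfolding cP cQ unfolding P Q by (rule symplectic_form[OF M])
  moreover have "dt (cj (Pm M Z *v v)) (Qm M Z *v v) = cnj (dt (cj (Qm M Z *v v)) (Pm M Z *v v))"
    unfolding cnj_dt cj_cj by (rule dt_commute)
  moreover have "dt (cj (Z *v v)) v = cnj (dt (cj v) (Z *v v))"
    unfolding cnj_dt cj_cj by (rule dt_commute)
  ultimately have "cnj (dt (cj (Qm M Z *v v)) (Pm M Z *v v)) - dt (cj (Qm M Z *v v)) (Pm M Z *v v)
      = cnj (dt (cj v) (Z *v v)) - dt (cj v) (Z *v v)" by simp
  then have "Im (cnj (dt (cj (Qm M Z *v v)) (Pm M Z *v v)) - dt (cj (Qm M Z *v v)) (Pm M Z *v v))
      = Im (cnj (dt (cj v) (Z *v v)) - dt (cj v) (Z *v v))" by (rule arg_cong)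
  then show ?thesis by simp
qed

text \<open>A nonzero kernel vector of CZ + D would make a positive quantity vanish.\<close>

lemma Qm_invertible:
  assumes M: "M \<in> carrier Sp2Z" and Z: "Z \<in> siegel_upper_half_space"
  shows "invertible (Qm M Z)"
proof -
  have "v = 0" if "Qm M Z *v v = 0" for v
  proof (rule ccontr)
    assume "v \<noteq> 0"
    then have "Im (dt (cj (Qm M Z *v v)) (Pm M Z *v v)) > 0"
      using siegel_form_transform[OF M] siegel_form_pos[OF Z] by simp
    moreover have "dt (cj 0) (Pm M Z *v v) = 0" by (simp add: dt_def cj_def)
    ultimately show False using that by simp
  qed
  then have "\<exists>B. B ** Qm M Z = mat 1" using matrix_left_invertible_ker by blast
  then show ?thesis by (simp add: invertible_left_inverse)
qed

lemma matrix_inv_cancel: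
  fixes Q :: "complex ^ 2 ^ 2"
  assumes "invertible Q" shows "matrix_inv Q ** Q = mat 1" "Q ** matrix_inv Q = mat 1"
  using someI_ex[OF assms[unfolded invertible_def]] unfolding matrix_inv_def by blast+

lemma siegel_action_eq:
  assumes "invertible (Qm M Z)" "X ** Qm M Z = Pm M Z" shows "siegel_action M Z = X"
  unfolding siegel_action_PQ assms(2)[symmetric] using matrix_inv_cancel[OF assms(1)]
  by (metis matrix_mul_assoc matrix_mul_rid)

lemma siegel_action_mult:
  assumes "invertible (Qm M Z)" shows "siegel_action M Z ** Qm M Z = Pm M Z"
  unfolding siegel_action_PQ using matrix_inv_cancel[OF assms] by (metis matrix_mul_assoc matrix_mul_rid)

text \<open>Every vector has the form (CZ + D) v, so the image point can be tested on such vectors: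
  symmetry follows from the bilinear invariance, positivity from the Hermitian one.\<close>

lemma siegel_action_in:
  assumes M: "M \<in> carrier Sp2Z" and Z: "Z \<in> siegel_upper_half_space"
  shows "siegel_action M Z \<in> siegel_upper_half_space"
proof -
  define W where "W = siegel_action M Z"
  have inv: "invertible (Qm M Z)" by (rule Qm_invertible[OF M Z])
  have WQ: "W ** Qm M Z = Pm M Z" unfolding W_def by (rule siegel_action_mult[OF inv])
  have WQv: "W *v (Qm M Z *v v) = Pm M Z *v v" for v by (simp add: matrix_vector_mul_assoc WQ)
  have surj: "\<exists>v. x = Qm M Z *v v" for x
    by (rule exI[of _ "matrix_inv (Qm M Z) *v x"]) (simp add: matrix_vector_mul_assoc matrix_inv_cancel[OF inv])
  have tZ: "transpose Z = Z" using Z by (simp add: siegel_upper_half_space_def)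
  have sym: "dt x (W *v y) = dt (W *v x) y" for x y
  proof -
    obtain v v' where v: "x = Qm M Z *v v" "y = Qm M Z *v v'" using surj by metis
    have P: "Pm M Z *v v = block_A M *v (Z *v v) + block_B M *v v"
      and Q: "Qm M Z *v v = block_C M *v (Z *v v) + block_D M *v v" for v
      by (simp_all add: Pm_def Qm_def matrix_vector_mult_add_rdistrib matrix_vector_mul_assoc)
    have "dt (Pm M Z *v v) (Qm M Z *v v') - dt (Qm M Z *v v) (Pm M Z *v v') = dt (Z *v v) v' - dt v (Z *v v')"
      unfolding P Q by (rule symplectic_form[OF M])
    also have "dt (Z *v v) v' = dt v (Z *v v')"
      using dt_mult[of Z v "mat 1" v'] tZ by simp
    finally show ?thesis unfolding v WQv by simp
  qed
  have W21: "W $ 2 $ 1 = W $ 1 $ 2"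
    using sym[of "axis 2 1" "axis 1 1"] by (simp add: dt_def matrix_vector_mult_def sum_2 axis_def)
  have tW: "transpose W = W" using W21 by (simp add: vec_eq_iff forall_2 transpose_def)
  have "x \<bullet> (map_matrix Im W *v x) > 0" if "x \<noteq> 0" for x :: "real ^ 2"
  proof -
    define y :: "complex ^ 2" where "y = (\<chi> i. of_real (x $ i))"
    have cy: "cj y = y" by (simp add: vec_eq_iff y_def cj_def)
    obtain v where v: "y = Qm M Z *v v" using surj by blast
    have "v \<noteq> 0"
    proof
      assume "v = 0"
      then have "y = 0" using v by simp
      then show False using that by (auto simp: y_def vec_eq_iff)
    qed
    then have "Im (dt (cj y) (W *v y)) > 0"
      using siegel_form_transform[OF M, of Z v] siegel_form_pos[OF Z, of v] WQv[of v] v by simp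
    then show ?thesis unfolding cy
      by (simp add: y_def dt_def matrix_vector_mult_def sum_2 inner_vec_def)
  qed
  then show ?thesis unfolding W_def[symmetric] siegel_upper_half_space_def using tW by simp
qed

section \<open>The cocycle relation\<close>

lemma block_mult:
  "block_A (M ** N) = block_A M ** block_A N + block_B M ** block_C N"
  "block_B (M ** N) = block_A M ** block_B N + block_B M ** block_D N"
  "block_C (M ** N) = block_C M ** block_A N + block_D M ** block_C N"
  "block_D (M ** N) = block_C M ** block_B N + block_D M ** block_D N"
  by (simp_all add: vec_eq_iff block_A_def block_B_def block_C_def block_D_def matrix_matrix_mult_def sum_UNIV_Plus sum_2)

lemma matrix_add_rdistrib:
  fixes X Y Z :: "complex ^ 2 ^ 2"
  shows "(X + Y) ** Z = X ** Z + Y ** Z"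
  by (simp add: vec_eq_iff matrix_matrix_mult_def sum.distrib algebra_simps)

lemma PQ_mult: "Pm (M ** N) Z = block_A M ** Pm N Z + block_B M ** Qm N Z" "Qm (M ** N) Z = block_C M ** Pm N Z + block_D M ** Qm N Z"
  unfolding Pm_def Qm_def block_mult by (simp_all add: matrix_add_ldistrib matrix_add_rdistrib matrix_mul_assoc algebra_simps)

lemma cocycle:
  assumes M: "M \<in> carrier Sp2Z" and N: "N \<in> carrier Sp2Z" and Z: "Z \<in> siegel_upper_half_space"
  shows "Qm (M ** N) Z = Qm M (siegel_action N Z) ** Qm N Z"
    and "siegel_action (M ** N) Z = siegel_action M (siegel_action N Z)"
proof -
  define W where "W = siegel_action N Z"
  have iN: "invertible (Qm N Z)" by (rule Qm_invertible[OF N Z])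
  have W: "W \<in> siegel_upper_half_space" unfolding W_def by (rule siegel_action_in[OF N Z])
  have iM: "invertible (Qm M W)" by (rule Qm_invertible[OF M W])
  have WQ: "W ** Qm N Z = Pm N Z" unfolding W_def by (rule siegel_action_mult[OF iN])
  have P: "Pm (M ** N) Z = Pm M W ** Qm N Z" and Q: "Qm (M ** N) Z = Qm M W ** Qm N Z"
    unfolding PQ_mult WQ[symmetric] unfolding Pm_def[of M] Qm_def[of M] by (simp_all add: matrix_add_rdistrib matrix_mul_assoc)
  show "Qm (M ** N) Z = Qm M (siegel_action N Z) ** Qm N Z" using Q by (simp add: W_def)
  show "siegel_action (M ** N) Z = siegel_action M (siegel_action N Z)"
    unfolding W_def[symmetric]
  proof (rule siegel_action_eq)
    show "invertible (Qm (M ** N) Z)" unfolding Q by (rule invertible_mult[OF iM iN])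
    show "siegel_action M W ** Qm (M ** N) Z = Pm (M ** N) Z"
      unfolding Q P matrix_mul_assoc siegel_action_mult[OF iM] ..
  qed
qed

lemma det_Qm_nz: "M \<in> carrier Sp2Z \<Longrightarrow> Z \<in> siegel_upper_half_space \<Longrightarrow> det (Qm M Z) \<noteq> 0"
  using Qm_invertible invertible_det_nz by blast

section \<open>Complex differentiability in three variables\<close>

text \<open>The condition inside \<open>siegel_holomorphic\<close> at a single point, isolated so
  that closure under algebraic operations and composition can be used.\<close>

definition cdiff :: "(complex \<times> complex \<times> complex \<Rightarrow> complex) \<Rightarrow> complex \<times> complex \<times> complex \<Rightarrow> bool"
  where "cdiff f x \<longleftrightarrow> (\<exists>a b c. (f has_derivative (\<lambda>(u, v, w). a * u + b * v + c * w)) (at x))"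

lemma cdiffI: "(f has_derivative f') (at x) \<Longrightarrow> (\<And>u v w. f' (u, v, w) = a * u + b * v + c * w) \<Longrightarrow> cdiff f x"
proof -
  assume h: "(f has_derivative f') (at x)" "\<And>u v w. f' (u, v, w) = a * u + b * v + c * w"
  have "f' = (\<lambda>(u, v, w). a * u + b * v + c * w)" using h(2) by auto
  then show ?thesis using h(1) unfolding cdiff_def by blast
qed

lemma cdiff_const: "cdiff (\<lambda>_. k) x"
  by (rule cdiffI[OF has_derivative_const, where a = 0 and b = 0 and c = 0]) simp

lemma cdiff_proj: "cdiff fst x" "cdiff (\<lambda>x. fst (snd x)) x" "cdiff (\<lambda>x. snd (snd x)) x"
proof -
  show "cdiff fst x"
    by (rule cdiffI[OF has_derivative_fst[OF has_derivative_ident], where a = 1 and b = 0 and c = 0]) simp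
  show "cdiff (\<lambda>x. fst (snd x)) x"
    by (rule cdiffI[OF has_derivative_fst[OF has_derivative_snd[OF has_derivative_ident]], where a = 0 and b = 1 and c = 0]) simp
  show "cdiff (\<lambda>x. snd (snd x)) x"
    by (rule cdiffI[OF has_derivative_snd[OF has_derivative_snd[OF has_derivative_ident]], where a = 0 and b = 0 and c = 1]) simp
qed

lemma cdiff_add:
  assumes "cdiff f x" "cdiff g x" shows "cdiff (\<lambda>x. f x + g x) x"
proof -
  obtain a b c where f: "(f has_derivative (\<lambda>(u, v, w). a * u + b * v + c * w)) (at x)" using assms by (auto simp: cdiff_def)
  obtain a' b' c' where g: "(g has_derivative (\<lambda>(u, v, w). a' * u + b' * v + c' * w)) (at x)" using assms by (auto simp: cdiff_def)
  show ?thesis by (rule cdiffI[OF has_derivative_add[OF f g], of "a + a'" "b + b'" "c + c'"]) (simp add: algebra_simps)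
qed

lemma cdiff_mult:
  assumes "cdiff f x" "cdiff g x" shows "cdiff (\<lambda>x. f x * g x) x"
proof -
  obtain a b c where f: "(f has_derivative (\<lambda>(u, v, w). a * u + b * v + c * w)) (at x)" using assms by (auto simp: cdiff_def)
  obtain a' b' c' where g: "(g has_derivative (\<lambda>(u, v, w). a' * u + b' * v + c' * w)) (at x)" using assms by (auto simp: cdiff_def)
  show ?thesis by (rule cdiffI[OF has_derivative_mult[OF f g], of "f x * a' + a * g x" "f x * b' + b * g x" "f x * c' + c * g x"]) (simp add: algebra_simps)
qed

lemma cdiff_minus: "cdiff f x \<Longrightarrow> cdiff (\<lambda>x. - f x) x"
  using cdiff_mult[OF cdiff_const[where k = "-1"], of f x] by simp

lemma cdiff_diff: "cdiff f x \<Longrightarrow> cdiff g x \<Longrightarrow> cdiff (\<lambda>x. f x - g x) x"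
  using cdiff_add[of f x "\<lambda>x. - g x"] cdiff_minus[of g x] by simp

lemma cdiff_inverse:
  assumes "cdiff f x" "f x \<noteq> 0" shows "cdiff (\<lambda>x. inverse (f x)) x"
proof -
  obtain a b c where f: "(f has_derivative (\<lambda>(u, v, w). a * u + b * v + c * w)) (at x)" using assms by (auto simp: cdiff_def)
  show ?thesis
    by (rule cdiffI[OF Deriv.has_derivative_inverse[OF assms(2) f], where a = "- inverse (f x) * a * inverse (f x)" and b = "- inverse (f x) * b * inverse (f x)" and c = "- inverse (f x) * c * inverse (f x)"])
       (simp add: algebra_simps)
qed

lemma cdiff_power: "cdiff f x \<Longrightarrow> cdiff (\<lambda>x. f x ^ n) x"
  by (induction n) (auto intro: cdiff_const cdiff_mult)

lemma cdiff_sum: "(\<And>i. i \<in> I \<Longrightarrow> cdiff (f i) x) \<Longrightarrow> cdiff (\<lambda>x. \<Sum>i\<in>I. f i x) x"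
  by (induction I rule: infinite_finite_induct) (auto intro: cdiff_const cdiff_add)

lemma cdiff_prod: "(\<And>i. i \<in> I \<Longrightarrow> cdiff (f i) x) \<Longrightarrow> cdiff (\<lambda>x. \<Prod>i\<in>I. f i x) x"
  by (induction I rule: infinite_finite_induct) (auto intro: cdiff_const cdiff_mult)

lemma cdiff_compose:
  assumes "cdiff f1 x" "cdiff f2 x" "cdiff f3 x" "cdiff g (f1 x, f2 x, f3 x)"
  shows "cdiff (\<lambda>x. g (f1 x, f2 x, f3 x)) x"
proof -
  obtain a1 b1 c1 where 1: "(f1 has_derivative (\<lambda>(u, v, w). a1 * u + b1 * v + c1 * w)) (at x)" using assms by (auto simp: cdiff_def)
  obtain a2 b2 c2 where 2: "(f2 has_derivative (\<lambda>(u, v, w). a2 * u + b2 * v + c2 * w)) (at x)" using assms by (auto simp: cdiff_def)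
  obtain a3 b3 c3 where 3: "(f3 has_derivative (\<lambda>(u, v, w). a3 * u + b3 * v + c3 * w)) (at x)" using assms by (auto simp: cdiff_def)
  obtain a b c where g: "(g has_derivative (\<lambda>(u, v, w). a * u + b * v + c * w)) (at (f1 x, f2 x, f3 x))" using assms by (auto simp: cdiff_def)
  show ?thesis
    by (rule cdiffI[OF has_derivative_compose[OF has_derivative_Pair[OF 1 has_derivative_Pair[OF 2 3]] g],
          of "a * a1 + b * a2 + c * a3" "a * b1 + b * b2 + c * b3" "a * c1 + b * c2 + c * c3"])
       (simp add: algebra_simps)
qed

lemma cdiff_continuous: "cdiff f x \<Longrightarrow> isCont f x"
  by (auto simp: cdiff_def intro: has_derivative_continuous)

lemma cdiff_partial:
  assumes "cdiff f (p, q, r)"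
  shows "(\<lambda>s. f (s, q, r)) field_differentiable at p" "(\<lambda>s. f (p, s, r)) field_differentiable at q" "(\<lambda>s. f (p, q, s)) field_differentiable at r"
proof -
  obtain a b c where f: "(f has_derivative (\<lambda>(u, v, w). a * u + b * v + c * w)) (at (p, q, r))" using assms by (auto simp: cdiff_def)
  have "((\<lambda>s. f (s, q, r)) has_derivative (\<lambda>h. a * h)) (at p)"
    using has_derivative_compose[OF has_derivative_Pair[OF has_derivative_ident has_derivative_Pair[OF has_derivative_const has_derivative_const]] f] by simp
  then show "(\<lambda>s. f (s, q, r)) field_differentiable at p" unfolding field_differentiable_def has_field_derivative_def by blast
  have "((\<lambda>s. f (p, s, r)) has_derivative (\<lambda>h. b * h)) (at q)"
    using has_derivative_compose[OF has_derivative_Pair[OF has_derivative_const has_derivative_Pair[OF has_derivative_ident has_derivative_const]] f] by simp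
  then show "(\<lambda>s. f (p, s, r)) field_differentiable at q" unfolding field_differentiable_def has_field_derivative_def by blast
  have "((\<lambda>s. f (p, q, s)) has_derivative (\<lambda>h. c * h)) (at r)"
    using has_derivative_compose[OF has_derivative_Pair[OF has_derivative_const has_derivative_Pair[OF has_derivative_const has_derivative_ident]] f] by simp
  then show "(\<lambda>s. f (p, q, s)) field_differentiable at r" unfolding field_differentiable_def has_field_derivative_def by blast
qed

abbreviation spt :: "complex \<times> complex \<times> complex \<Rightarrow> complex ^ 2 ^ 2"
  where "spt x \<equiv> siegel_point (fst x) (fst (snd x)) (snd (snd x))"

lemma cdiff_spt: "cdiff (\<lambda>x. spt x $ i $ j) x"
  using cdiff_proj[of x] exhaust_2[of i] exhaust_2[of j] by auto

lemma cdiff_PQ: "cdiff (\<lambda>x. Pm M (spt x) $ i $ j) x" "cdiff (\<lambda>x. Qm M (spt x) $ i $ j) x"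
  unfolding Pm_def Qm_def vector_add_component matrix_matrix_mult_def vec_lambda_beta
  by (intro cdiff_add cdiff_sum cdiff_mult cdiff_const cdiff_spt)+

lemma det_2x2: "det (Q :: complex ^ 2 ^ 2) = Q $ 1 $ 1 * Q $ 2 $ 2 - Q $ 1 $ 2 * Q $ 2 $ 1"
  by (rule det_2)

lemma cdiff_det: "cdiff (\<lambda>x. det (Qm M (spt x))) x"
  unfolding det_2x2 by (intro cdiff_diff cdiff_mult cdiff_PQ)

text \<open>Cramer's rule; it exhibits the entries of the action as rational functions of the
  coordinates.\<close>

lemma matrix_right_solve:
  fixes W Q P :: "complex ^ 2 ^ 2"
  assumes "W ** Q = P" "det Q \<noteq> 0"
  shows "W $ i $ 1 = (P $ i $ 1 * Q $ 2 $ 2 - P $ i $ 2 * Q $ 2 $ 1) * inverse (det Q)"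
    "W $ i $ 2 = (P $ i $ 2 * Q $ 1 $ 1 - P $ i $ 1 * Q $ 1 $ 2) * inverse (det Q)"
proof -
  have p: "P $ i $ j = W $ i $ 1 * Q $ 1 $ j + W $ i $ 2 * Q $ 2 $ j" for j
    using assms(1)[symmetric] by (simp add: matrix_matrix_mult_def sum_2)
  have "(P $ i $ 1 * Q $ 2 $ 2 - P $ i $ 2 * Q $ 2 $ 1) = W $ i $ 1 * det Q"
    "(P $ i $ 2 * Q $ 1 $ 1 - P $ i $ 1 * Q $ 1 $ 2) = W $ i $ 2 * det Q"
    unfolding p det_2x2 by (simp_all add: algebra_simps)
  then show "W $ i $ 1 = (P $ i $ 1 * Q $ 2 $ 2 - P $ i $ 2 * Q $ 2 $ 1) * inverse (det Q)"
    "W $ i $ 2 = (P $ i $ 2 * Q $ 1 $ 1 - P $ i $ 1 * Q $ 1 $ 2) * inverse (det Q)"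
    using assms(2) by simp_all
qed

lemma open_D3: "open D3"
proof -
  have e: "D3 = {x. Im (fst x) > 0 \<and> (Im (fst (snd x)))\<^sup>2 < Im (fst x) * Im (snd (snd x))}" by (auto simp: D3_def)
  show ?thesis by (subst e) (intro open_Collect_conj open_Collect_less continuous_intros)
qed

lemma cdiff_cong:
  assumes "cdiff f x" "open U" "x \<in> U" "\<And>y. y \<in> U \<Longrightarrow> f y = g y" shows "cdiff g x"
  using assms has_derivative_transform_within_open[of f _ x UNIV U g] unfolding cdiff_def by blast

lemma cdiff_action:
  assumes M: "M \<in> carrier Sp2Z" and x: "x \<in> D3"
  shows "cdiff (\<lambda>x. siegel_action M (spt x) $ i $ j) x"
proof -
  have nz: "det (Qm M (spt y)) \<noteq> 0" and eq: "siegel_action M (spt y) ** Qm M (spt y) = Pm M (spt y)" if "y \<in> D3" for y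
  proof -
    have "spt y \<in> siegel_upper_half_space" using that siegel_point_iff by (metis prod.collapse)
    then show "det (Qm M (spt y)) \<noteq> 0" "siegel_action M (spt y) ** Qm M (spt y) = Pm M (spt y)"
      using det_Qm_nz[OF M] siegel_action_mult Qm_invertible[OF M] by auto
  qed
  have "cdiff (\<lambda>x. siegel_action M (spt x) $ i $ 1) x"
    by (rule cdiff_cong[OF _ open_D3 x matrix_right_solve(1)[OF eq nz, symmetric]])
       (intro cdiff_mult cdiff_diff cdiff_PQ cdiff_inverse cdiff_det nz[OF x])
  moreover have "cdiff (\<lambda>x. siegel_action M (spt x) $ i $ 2) x"
    by (rule cdiff_cong[OF _ open_D3 x matrix_right_solve(2)[OF eq nz, symmetric]])
       (intro cdiff_mult cdiff_diff cdiff_PQ cdiff_inverse cdiff_det nz[OF x])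
  ultimately show ?thesis using exhaust_2[of j] by auto
qed

section \<open>Conjugates of a modular form and their elementary symmetric functions\<close>

interpretation Sp: group Sp2Z by (rule group_Sp2Z)

lemma Sp2Z_simps [simp]: "mult Sp2Z = (**)" "one Sp2Z = mat 1"
  by (simp_all add: Sp2Z_def)

lemma finite_int_matrices: "finite {M :: int ^ 'a::finite ^ 'b::finite. \<forall>i j. M $ i $ j \<in> {0..<n}}"
proof (rule finite_subset)
  show "{M :: int ^ 'a ^ 'b. \<forall>i j. M $ i $ j \<in> {0..<n}} \<subseteq> (\<lambda>f. \<chi> i j. f (i, j)) ` (PiE UNIV (\<lambda>_. {0..<n}))"
  proof
    fix M :: "int ^ 'a ^ 'b" assume "M \<in> {M. \<forall>i j. M $ i $ j \<in> {0..<n}}"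
    then show "M \<in> (\<lambda>f. \<chi> i j. f (i, j)) ` (PiE UNIV (\<lambda>_. {0..<n}))"
      by (intro image_eqI[of _ _ "\<lambda>(i, j). M $ i $ j"]) (auto simp: vec_eq_iff PiE_def Pi_def extensional_def)
  qed
  show "finite ((\<lambda>f. (\<chi> i j. f (i, j)) :: int ^ 'a ^ 'b) ` (PiE UNIV (\<lambda>_. {0..<n})))"
    by (intro finite_imageI finite_PiE) auto
qed

text \<open>Matrices congruent modulo N differ by an element of the principal congruence subgroup,
  hence lie in one coset, and there are finitely many residues.\<close>

lemma finite_rcosets:
  assumes "congruence_subgroup \<Gamma> N" shows "finite (rcosets\<^bsub>Sp2Z\<^esub> \<Gamma>)"
proof -
  have N: "N > 0" and sub: "subgroup \<Gamma> Sp2Z" and pr: "principal_congruence_subgroup N \<subseteq> \<Gamma>"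
    using assms by (auto simp: congruence_subgroup_def)
  define red :: "mat4 \<Rightarrow> mat4" where "red a = (\<chi> i j. a $ i $ j mod int N)" for a
  have eq: "\<Gamma> #>\<^bsub>Sp2Z\<^esub> a = \<Gamma> #>\<^bsub>Sp2Z\<^esub> b" if a: "a \<in> carrier Sp2Z" and b: "b \<in> carrier Sp2Z" and r: "red a = red b" for a b
  proof -
    define c where "c = inv\<^bsub>Sp2Z\<^esub> b"
    have c: "c \<in> carrier Sp2Z" "b ** c = mat 1" using b Sp.r_inv[OF b] by (auto simp: c_def)
    have ac: "a ** c \<in> carrier Sp2Z" using Sp.m_closed[OF a c(1)] by simp
    have "int N dvd a $ i $ j - b $ i $ j" for i j
      using r by (simp add: red_def vec_eq_iff mod_eq_dvd_iff)
    then have "int N dvd (\<Sum>k\<in>UNIV. (a $ i $ k - b $ i $ k) * c $ k $ j)" for i j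
      by (intro dvd_sum) simp
    moreover have "(\<Sum>k\<in>UNIV. (a $ i $ k - b $ i $ k) * c $ k $ j) = (a ** c) $ i $ j - (b ** c) $ i $ j" for i j
      by (simp add: matrix_matrix_mult_def sum_subtractf left_diff_distrib)
    ultimately have "a ** c \<in> principal_congruence_subgroup N"
      using ac c(2) by (simp add: principal_congruence_subgroup_def)
    then have "a ** c \<in> \<Gamma>" using pr by auto
    then have "\<Gamma> #>\<^bsub>Sp2Z\<^esub> (a ** c) = \<Gamma>" using Sp.coset_join2[OF ac sub] by simp
    then show ?thesis using Sp.coset_mult_inv1[of \<Gamma> a b] a b subgroup.subset[OF sub] by (simp add: c_def)
  qed
  define rep where "rep r = (SOME a. a \<in> carrier Sp2Z \<and> red a = r)" for r
  have "rcosets\<^bsub>Sp2Z\<^esub> \<Gamma> \<subseteq> (\<lambda>r. \<Gamma> #>\<^bsub>Sp2Z\<^esub> rep r) ` {M. \<forall>i j. M $ i $ j \<in> {0..<int N}}"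
  proof
    fix C assume "C \<in> rcosets\<^bsub>Sp2Z\<^esub> \<Gamma>"
    then obtain a where a: "a \<in> carrier Sp2Z" "C = \<Gamma> #>\<^bsub>Sp2Z\<^esub> a" by (auto simp: RCOSETS_def)
    have "rep (red a) \<in> carrier Sp2Z \<and> red (rep (red a)) = red a"
      unfolding rep_def by (rule someI[of _ a]) (use a in simp)
    then have "C = \<Gamma> #>\<^bsub>Sp2Z\<^esub> rep (red a)" using eq a by metis
    moreover have "red a \<in> {M. \<forall>i j. M $ i $ j \<in> {0..<int N}}" using N by (simp add: red_def)
    ultimately show "C \<in> (\<lambda>r. \<Gamma> #>\<^bsub>Sp2Z\<^esub> rep r) ` {M. \<forall>i j. M $ i $ j \<in> {0..<int N}}" by blast
  qed
  then show ?thesis by (rule finite_subset) (intro finite_imageI finite_int_matrices)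
qed

definition slash :: "nat \<Rightarrow> (complex ^ 2 ^ 2 \<Rightarrow> complex) \<Rightarrow> mat4 \<Rightarrow> complex ^ 2 ^ 2 \<Rightarrow> complex"
  where "slash k F M Z = F (siegel_action M Z) / det (Qm M Z) ^ k"

lemma slash_mult:
  assumes "M \<in> carrier Sp2Z" "L \<in> carrier Sp2Z" "Z \<in> siegel_upper_half_space"
  shows "slash k F (M ** L) Z = slash k F M (siegel_action L Z) / det (Qm L Z) ^ k"
  by (simp add: slash_def cocycle[OF assms] det_mul power_mult_distrib)

lemma siegel_action_one:
  "siegel_action (mat 1) Z = Z" "Qm (mat 1) Z = mat 1"
proof -
  have b: "block_A (mat 1) = mat 1" "block_B (mat 1) = 0" "block_C (mat 1) = 0" "block_D (mat 1) = mat 1"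
    by (simp_all add: vec_eq_iff block_A_def block_B_def block_C_def block_D_def mat_def)
  have z: "(0 :: complex ^ 2 ^ 2) ** Z = 0" by (simp add: vec_eq_iff matrix_matrix_mult_def)
  show Q: "Qm (mat 1) Z = mat 1" by (simp add: Qm_def b z)
  have "invertible (mat 1 :: complex ^ 2 ^ 2)" by (simp add: invertible_def)
  then show "siegel_action (mat 1) Z = Z"
    by (intro siegel_action_eq) (simp_all add: Q Pm_def b)
qed

section \<open>Building symplectic matrices from blocks\<close>

lemma forall_sum: "(\<forall>x :: 'a + 'b. P x) \<longleftrightarrow> (\<forall>a. P (Inl a)) \<and> (\<forall>b. P (Inr b))"
  by (metis sum.exhaust)

definition mk :: "int ^ 2 ^ 2 \<Rightarrow> int ^ 2 ^ 2 \<Rightarrow> int ^ 2 ^ 2 \<Rightarrow> int ^ 2 ^ 2 \<Rightarrow> mat4"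
  where "mk a b c d = (\<chi> i j. case i of
     Inl i' \<Rightarrow> (case j of Inl j' \<Rightarrow> a $ i' $ j' | Inr j' \<Rightarrow> b $ i' $ j')
   | Inr i' \<Rightarrow> (case j of Inl j' \<Rightarrow> c $ i' $ j' | Inr j' \<Rightarrow> d $ i' $ j'))"

lemma mk_nth:
  "mk a b c d $ Inl i $ Inl j = a $ i $ j" "mk a b c d $ Inl i $ Inr j = b $ i $ j"
  "mk a b c d $ Inr i $ Inl j = c $ i $ j" "mk a b c d $ Inr i $ Inr j = d $ i $ j"
  by (simp_all add: mk_def)

definition m2 :: "'a \<Rightarrow> 'a \<Rightarrow> 'a \<Rightarrow> 'a \<Rightarrow> 'a::zero ^ 2 ^ 2"
  where "m2 x y z w = vector [vector [x, y], vector [z, w]]"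

lemma m2_nth [simp]: "m2 x y z w $ 1 $ 1 = x" "m2 x y z w $ 1 $ 2 = y" "m2 x y z w $ 2 $ 1 = z" "m2 x y z w $ 2 $ 2 = w"
  by (simp_all add: m2_def)

lemma mk_carrier:
  fixes a b c d :: "int ^ 2 ^ 2"
  assumes "\<forall>i j. (\<Sum>k\<in>UNIV. a $ k $ i * c $ k $ j - c $ k $ i * a $ k $ j) = 0"
    "\<forall>i j. (\<Sum>k\<in>UNIV. b $ k $ i * d $ k $ j - d $ k $ i * b $ k $ j) = 0"
    "\<forall>i j. (\<Sum>k\<in>UNIV. a $ k $ i * d $ k $ j - c $ k $ i * b $ k $ j) = (if i = j then 1 else 0)"
  shows "mk a b c d \<in> carrier Sp2Z"
proof -
  note assms = assms[rule_format]
  have 4: "(\<Sum>k\<in>UNIV. b $ k $ i * c $ k $ j - d $ k $ i * a $ k $ j) = (if i = j then - 1 else 0)" for i j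
  proof -
    have "(\<Sum>k\<in>UNIV. b $ k $ i * c $ k $ j - d $ k $ i * a $ k $ j) = - (\<Sum>k\<in>UNIV. a $ k $ j * d $ k $ i - c $ k $ j * b $ k $ i)"
      by (simp add: sum_subtractf sum_negf[symmetric] mult.commute)
    then show ?thesis using assms(3)[of j i] by auto
  qed
  show ?thesis
    unfolding Sp2Z_def
    by (simp add: vec_eq_iff forall_sum symplectic_entries mk_nth symp_J_nth assms 4)
qed

section \<open>Conjugates along the cosets\<close>

locale siegel_form =
  fixes k N :: nat and \<Gamma> :: "mat4 set" and F :: "complex ^ 2 ^ 2 \<Rightarrow> complex"
  assumes ek: "even k" and cs: "congruence_subgroup \<Gamma> N" and smf: "siegel_modular_form k \<Gamma> F"
begin

lemma sub: "subgroup \<Gamma> Sp2Z"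
  using cs by (simp add: congruence_subgroup_def)

lemma \<Gamma>_carrier: "g \<in> \<Gamma> \<Longrightarrow> g \<in> carrier Sp2Z"
  using subgroup.subset[OF sub] by auto

abbreviation RC :: "mat4 set set" where "RC \<equiv> rcosets\<^bsub>Sp2Z\<^esub> \<Gamma>"

lemma finite_RC: "finite RC"
  by (rule finite_rcosets[OF cs])

lemma slash_\<Gamma>:
  assumes g: "g \<in> \<Gamma>" and M: "M \<in> carrier Sp2Z" and Z: "Z \<in> siegel_upper_half_space"
  shows "slash k F (g ** M) Z = slash k F M Z"
proof -
  let ?W = "siegel_action M Z"
  have W: "?W \<in> siegel_upper_half_space" by (rule siegel_action_in[OF M Z])
  have "F (siegel_action g ?W) = det (Qm g ?W) ^ k * F ?W"
    using smf g W by (simp add: siegel_modular_form_def Qm_def)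
  then have "slash k F g ?W = F ?W"
    using det_Qm_nz[OF \<Gamma>_carrier[OF g] W] by (simp add: slash_def)
  then show ?thesis unfolding slash_mult[OF \<Gamma>_carrier[OF g] M Z] by (simp add: slash_def)
qed

lemma RC_carrier: "C \<in> RC \<Longrightarrow> a \<in> C \<Longrightarrow> a \<in> carrier Sp2Z"
  using subgroup.rcosets_carrier[OF sub group_Sp2Z] by blast

lemma slash_RC:
  assumes "C \<in> RC" "a \<in> C" "b \<in> C" "Z \<in> siegel_upper_half_space"
  shows "slash k F a Z = slash k F b Z"
proof -
  obtain x where x: "x \<in> carrier Sp2Z" "C = \<Gamma> #>\<^bsub>Sp2Z\<^esub> x" using assms(1) by (auto simp: RCOSETS_def)
  then obtain g h where "g \<in> \<Gamma>" "a = g ** x" "h \<in> \<Gamma>" "b = h ** x" using assms(2,3) by (auto simp: r_coset_def)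
  then show ?thesis using slash_\<Gamma>[OF _ x(1) assms(4)] by simp
qed

text \<open>On the upper half-space the choice of representative is immaterial, by
  \<open>slash_RC\<close>.\<close>

definition FC :: "mat4 set \<Rightarrow> complex ^ 2 ^ 2 \<Rightarrow> complex"
  where "FC C Z = slash k F (SOME a. a \<in> C) Z"

lemma some_RC: "C \<in> RC \<Longrightarrow> (SOME a. a \<in> C) \<in> C"
  using subgroup.rcosets_non_empty[OF sub] by (metis ex_in_conv someI_ex)

lemma FC_eq: "C \<in> RC \<Longrightarrow> a \<in> C \<Longrightarrow> Z \<in> siegel_upper_half_space \<Longrightarrow> FC C Z = slash k F a Z"
  unfolding FC_def by (rule slash_RC[OF _ some_RC])

lemma RC_translate:
  assumes "C \<in> RC" "L \<in> carrier Sp2Z" shows "C #>\<^bsub>Sp2Z\<^esub> L \<in> RC"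
proof -
  obtain x where x: "x \<in> carrier Sp2Z" "C = \<Gamma> #>\<^bsub>Sp2Z\<^esub> x" using assms(1) by (auto simp: RCOSETS_def)
  then show ?thesis
    using Sp.coset_mult_assoc[OF subgroup.subset[OF sub] x(1) assms(2)] Sp.rcosetsI[OF subgroup.subset[OF sub]] Sp.m_closed[OF x(1) assms(2)] by simp
qed

lemma RC_translate_inv:
  assumes "C \<in> RC" "L \<in> carrier Sp2Z"
  shows "(C #>\<^bsub>Sp2Z\<^esub> L) #>\<^bsub>Sp2Z\<^esub> inv\<^bsub>Sp2Z\<^esub> L = C" "(C #>\<^bsub>Sp2Z\<^esub> inv\<^bsub>Sp2Z\<^esub> L) #>\<^bsub>Sp2Z\<^esub> L = C"
proof -
  have "C \<subseteq> carrier Sp2Z" using RC_carrier[OF assms(1)] by auto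
  then show "(C #>\<^bsub>Sp2Z\<^esub> L) #>\<^bsub>Sp2Z\<^esub> inv\<^bsub>Sp2Z\<^esub> L = C" "(C #>\<^bsub>Sp2Z\<^esub> inv\<^bsub>Sp2Z\<^esub> L) #>\<^bsub>Sp2Z\<^esub> L = C"
    using assms(2) by (simp_all only: Sp.coset_mult_assoc Sp.inv_closed Sp.r_inv Sp.l_inv Sp.coset_mult_one)
qed

lemma FC_translate:
  assumes C: "C \<in> RC" and L: "L \<in> carrier Sp2Z" and Z: "Z \<in> siegel_upper_half_space"
  shows "FC C (siegel_action L Z) = det (Qm L Z) ^ k * FC (C #>\<^bsub>Sp2Z\<^esub> L) Z"
proof -
  define a where "a = (SOME a. a \<in> C)"
  have a: "a \<in> C" unfolding a_def by (rule some_RC[OF C])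
  have aL: "a ** L \<in> C #>\<^bsub>Sp2Z\<^esub> L" using a by (auto simp: r_coset_def)
  have "FC (C #>\<^bsub>Sp2Z\<^esub> L) Z = slash k F (a ** L) Z" by (rule FC_eq[OF RC_translate[OF C L] aL Z])
  also have "\<dots> = slash k F a (siegel_action L Z) / det (Qm L Z) ^ k"
    by (rule slash_mult[OF RC_carrier[OF C a] L Z])
  finally show ?thesis using det_Qm_nz[OF L Z] by (simp add: FC_def a_def)
qed

text \<open>The coefficients of the product of all X - F_C, hence the sign. At X = F the factor of
  the trivial coset vanishes, which gives \<open>GG_relation\<close>.\<close>

definition GG :: "nat \<Rightarrow> complex ^ 2 ^ 2 \<Rightarrow> complex"
  where "GG i Z = (\<Sum>U | U \<subseteq> RC \<and> card U = i. \<Prod>C\<in>U. - FC C Z)"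

text \<open>Right translation by L permutes the cosets and therefore the i-element sets of
  cosets.\<close>

lemma GG_law:
  assumes L: "L \<in> carrier Sp2Z" and Z: "Z \<in> siegel_upper_half_space"
  shows "GG i (siegel_action L Z) = det (Qm L Z) ^ (k * i) * GG i Z"
proof -
  let ?s = "\<lambda>C. C #>\<^bsub>Sp2Z\<^esub> L" and ?s' = "\<lambda>C. C #>\<^bsub>Sp2Z\<^esub> inv\<^bsub>Sp2Z\<^esub> L"
  have L': "inv\<^bsub>Sp2Z\<^esub> L \<in> carrier Sp2Z" using L by simp
  have inj: "inj_on ?s RC" by (rule inj_on_inverseI[of _ ?s']) (rule RC_translate_inv(1)[OF _ L])
  have inj': "inj_on ?s' RC" by (rule inj_on_inverseI[of _ ?s]) (rule RC_translate_inv(2)[OF _ L])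
  have "GG i (siegel_action L Z) = (\<Sum>U | U \<subseteq> RC \<and> card U = i. det (Qm L Z) ^ (k * i) * (\<Prod>C\<in>U. - FC (?s C) Z))"
    unfolding GG_def
  proof (rule sum.cong[OF refl])
    fix U assume U: "U \<in> {U. U \<subseteq> RC \<and> card U = i}"
    have "(\<Prod>C\<in>U. - FC C (siegel_action L Z)) = (\<Prod>C\<in>U. det (Qm L Z) ^ k * - FC (?s C) Z)"
      by (rule prod.cong[OF refl]) (use U FC_translate[OF _ L Z] in auto)
    also have "\<dots> = det (Qm L Z) ^ (k * i) * (\<Prod>C\<in>U. - FC (?s C) Z)"
      using U by (simp only: prod.distrib prod_constant power_mult) simp
    finally show "(\<Prod>C\<in>U. - FC C (siegel_action L Z)) = det (Qm L Z) ^ (k * i) * (\<Prod>C\<in>U. - FC (?s C) Z)" .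
  qed
  also have "\<dots> = det (Qm L Z) ^ (k * i) * (\<Sum>U | U \<subseteq> RC \<and> card U = i. \<Prod>C\<in>U. - FC (?s C) Z)"
    by (simp add: sum_distrib_left)
  also have "(\<Sum>U | U \<subseteq> RC \<and> card U = i. \<Prod>C\<in>U. - FC (?s C) Z) = GG i Z"
    unfolding GG_def
  proof (rule sum.reindex_bij_witness[of _ "(`) ?s'" "(`) ?s"])
    fix U assume U: "U \<in> {U. U \<subseteq> RC \<and> card U = i}"
    have "(\<lambda>C. ?s' (?s C)) ` U = U" "(\<lambda>C. ?s (?s' C)) ` U = U"
      using U RC_translate_inv[OF _ L] by (auto simp: image_iff subset_iff)
    then show "?s' ` ?s ` U = U" "?s ` ?s' ` U = U" by (simp_all add: image_image)
    show "?s ` U \<in> {U. U \<subseteq> RC \<and> card U = i}"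
      using U RC_translate[OF _ L] card_image[OF inj_on_subset[OF inj]] by auto
    show "?s' ` U \<in> {U. U \<subseteq> RC \<and> card U = i}"
      using U RC_translate[OF _ L'] card_image[OF inj_on_subset[OF inj']] by auto
    show "(\<Prod>C\<in>?s ` U. - FC C Z) = (\<Prod>C\<in>U. - FC (?s C) Z)"
      using U by (subst prod.reindex[OF inj_on_subset[OF inj]]) auto
  qed
  finally show ?thesis .
qed

lemma GG_relation:
  assumes Z: "Z \<in> siegel_upper_half_space"
  shows "(\<Sum>i\<le>card RC. GG i Z * F Z ^ (card RC - i)) = 0"
proof -
  have G: "\<Gamma> \<in> RC" using Sp.rcosetsI[OF subgroup.subset[OF sub] Sp.one_closed] Sp.coset_mult_one[OF subgroup.subset[OF sub]] by simp
  have "FC \<Gamma> Z = F Z"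
    using FC_eq[OF G _ Z, of "mat 1"] subgroup.one_closed[OF sub] by (simp add: slash_def siegel_action_one det_I)
  then have "0 = (\<Prod>C\<in>RC. - FC C Z + F Z)"
    using G finite_RC by (intro prod_zero[symmetric] bexI[of _ \<Gamma>]) auto
  also have "\<dots> = (\<Sum>X\<in>Pow RC. (\<Prod>C\<in>X. - FC C Z) * F Z ^ (card RC - card X))"
    unfolding prod_add[OF finite_RC] prod_constant
    by (intro sum.cong refl arg_cong2[where f = "(*)"] arg_cong2[where f = "(^)"] card_Diff_subset)
       (use finite_RC finite_subset in auto)
  also have "\<dots> = (\<Sum>i\<le>card RC. \<Sum>X | X \<in> Pow RC \<and> card X = i. (\<Prod>C\<in>X. - FC C Z) * F Z ^ (card RC - card X))"
    by (intro sum.group[symmetric]) (use finite_RC card_mono in auto)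
  also have "\<dots> = (\<Sum>i\<le>card RC. GG i Z * F Z ^ (card RC - i))"
    unfolding GG_def sum_distrib_right by (intro sum.cong) auto
  finally show ?thesis by simp
qed

lemma GG_0: "GG 0 Z = 1"
proof -
  have "{U. U \<subseteq> RC \<and> card U = 0} = {{}}" using finite_RC finite_subset by (auto simp: card_eq_0_iff)
  then show ?thesis by (simp add: GG_def)
qed

lemma cdiff_F:
  assumes "x \<in> D3" shows "cdiff (\<lambda>x. F (spt x)) x"
proof -
  obtain \<tau> z t where x: "x = (\<tau>, z, t)" by (cases x)
  have "siegel_point \<tau> z t \<in> siegel_upper_half_space" using assms x siegel_point_iff by simp
  then show ?thesis
    using smf unfolding siegel_modular_form_def siegel_holomorphic_def cdiff_def x case_prod_beta by blast
qed

lemma spt_siegel: "spt x \<in> siegel_upper_half_space \<longleftrightarrow> x \<in> D3"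
  using siegel_point_iff[of "fst x" "fst (snd x)" "snd (snd x)"] by simp

lemma cdiff_slash:
  assumes M: "M \<in> carrier Sp2Z" and x: "x \<in> D3"
  shows "cdiff (\<lambda>x. slash k F M (spt x)) x"
proof -
  let ?a = "\<lambda>i j x. siegel_action M (spt x) $ i $ j"
  have eq: "siegel_action M (spt y) = spt (?a 1 1 y, ?a 1 2 y, ?a 2 2 y)" if "y \<in> D3" for y
  proof -
    have "siegel_action M (spt y) \<in> siegel_upper_half_space" using siegel_action_in[OF M, of "spt y"] that spt_siegel by blast
    then have "transpose (siegel_action M (spt y)) = siegel_action M (spt y)" by (simp add: siegel_upper_half_space_def)
    from symmetric_siegel_point[OF this] show ?thesis by simp
  qed
  have D: "(?a 1 1 x, ?a 1 2 x, ?a 2 2 x) \<in> D3"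
    using siegel_action_in[OF M, of "spt x"] x eq[OF x] spt_siegel by metis
  have "cdiff (\<lambda>x. F (spt (?a 1 1 x, ?a 1 2 x, ?a 2 2 x)) * inverse (det (Qm M (spt x)) ^ k)) x"
    by (intro cdiff_mult cdiff_compose[where g = "\<lambda>x. F (spt x)"] cdiff_action[OF M x] cdiff_F[OF D] cdiff_inverse cdiff_power cdiff_det)
       (use det_Qm_nz[OF M] x spt_siegel in auto)
  then show ?thesis
    by (rule cdiff_cong[OF _ open_D3 x]) (use eq in \<open>simp add: slash_def divide_inverse\<close>)
qed

lemma cdiff_GG: "x \<in> D3 \<Longrightarrow> cdiff (\<lambda>x. GG i (spt x)) x"
  unfolding GG_def FC_def
  by (intro cdiff_sum cdiff_prod cdiff_minus cdiff_slash) (use RC_carrier some_RC in blast)+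

lemma lev1_GG: "lev1 (k * i) (\<lambda>\<tau> z t. GG i (siegel_point \<tau> z t))"
proof -
  let ?G = "\<lambda>\<tau> z t. GG i (siegel_point \<tau> z t)"
  let ?g = "\<lambda>x. GG i (spt x)"
  have "continuous_on D3 ?g"
    using cdiff_GG cdiff_continuous by (intro continuous_at_imp_continuous_on) blast
  then have 1: "continuous_on D3 (\<lambda>(\<tau>, z, t). ?G \<tau> z t)" by (simp add: case_prod_beta)
  have p: "(\<lambda>\<tau>. ?G \<tau> z t) field_differentiable at \<tau>" "(\<lambda>z. ?G \<tau> z t) field_differentiable at z" "(\<lambda>t. ?G \<tau> z t) field_differentiable at t"
    if "(\<tau>, z, t) \<in> D3" for \<tau> z t
    using cdiff_partial[OF cdiff_GG[OF that]] by simp_all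
  have 2: "\<forall>z t. (\<lambda>\<tau>. ?G \<tau> z t) holomorphic_on {\<tau>. (\<tau>, z, t) \<in> D3}" "\<forall>\<tau> t. (\<lambda>z. ?G \<tau> z t) holomorphic_on {z. (\<tau>, z, t) \<in> D3}"
    "\<forall>\<tau> z. (\<lambda>t. ?G \<tau> z t) holomorphic_on {t. (\<tau>, z, t) \<in> D3}"
    using p by (auto simp: holomorphic_on_def intro: field_differentiable_at_within)
  have law: "GG i X = det (Qm L Z) ^ (k * i) * GG i Z"
    if "L \<in> carrier Sp2Z" "Z \<in> siegel_upper_half_space" "X ** Qm L Z = Pm L Z" for L Z X
    using GG_law[OF that(1,2)] siegel_action_eq[OF Qm_invertible[OF that(1,2)] that(3)] by simp
  \<comment> \<open>The exchange of variables and the sign change come from matrices with det(CZ +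
    D) = -1; the even weight removes this factor.\<close>
  have one: "(- 1 :: complex) ^ (k * i) = 1" using ek by simp
  note cs = block_A_def block_B_def block_C_def block_D_def mk_nth Qm_def Pm_def matrix_matrix_mult_def vec_eq_iff forall_2 sum_2 det_2x2
  have "?G (\<tau> + 1) z t = ?G \<tau> z t \<and> ?G \<tau> (z + 1) t = ?G \<tau> z t \<and> ?G \<tau> z (t + 1) = ?G \<tau> z t \<and>
      ?G t z \<tau> = ?G \<tau> z t \<and> ?G \<tau> (- z) t = ?G \<tau> z t \<and> ?G \<tau> (z + \<tau>) (t + 2 * z + \<tau>) = ?G \<tau> z t \<and>
      ?G (- 1 / \<tau>) (z / \<tau>) (t - z\<^sup>2 / \<tau>) = \<tau> ^ (k * i) * ?G \<tau> z t" if D: "(\<tau>, z, t) \<in> D3" for \<tau> z t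
  proof -
    define Z where "Z = siegel_point \<tau> z t"
    have Z: "Z \<in> siegel_upper_half_space" using D siegel_point_iff by (simp add: Z_def)
    have "mk (m2 1 0 0 1) (m2 1 0 0 0) (m2 0 0 0 0) (m2 1 0 0 1) \<in> carrier Sp2Z" (is "?L1 \<in> _")
      by (rule mk_carrier; simp add: sum_2 forall_2)
    then have l1: "?G (\<tau> + 1) z t = ?G \<tau> z t"
      using law[of ?L1 Z "siegel_point (\<tau> + 1) z t"] Z by (simp add: cs Z_def)
    have "mk (m2 1 0 0 1) (m2 0 1 1 0) (m2 0 0 0 0) (m2 1 0 0 1) \<in> carrier Sp2Z" (is "?L2 \<in> _")
      by (rule mk_carrier; simp add: sum_2 forall_2)
    then have l2: "?G \<tau> (z + 1) t = ?G \<tau> z t"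
      using law[of ?L2 Z "siegel_point \<tau> (z + 1) t"] Z by (simp add: cs Z_def)
    have "mk (m2 1 0 0 1) (m2 0 0 0 1) (m2 0 0 0 0) (m2 1 0 0 1) \<in> carrier Sp2Z" (is "?L3 \<in> _")
      by (rule mk_carrier; simp add: sum_2 forall_2)
    then have l3: "?G \<tau> z (t + 1) = ?G \<tau> z t"
      using law[of ?L3 Z "siegel_point \<tau> z (t + 1)"] Z by (simp add: cs Z_def)
    have "mk (m2 0 1 1 0) (m2 0 0 0 0) (m2 0 0 0 0) (m2 0 1 1 0) \<in> carrier Sp2Z" (is "?L4 \<in> _")
      by (rule mk_carrier; simp add: sum_2 forall_2)
    then have l4: "?G t z \<tau> = ?G \<tau> z t"
      using law[of ?L4 Z "siegel_point t z \<tau>"] Z one by (simp add: cs Z_def)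
    have "mk (m2 1 0 0 (- 1)) (m2 0 0 0 0) (m2 0 0 0 0) (m2 1 0 0 (- 1)) \<in> carrier Sp2Z" (is "?L5 \<in> _")
      by (rule mk_carrier; simp add: sum_2 forall_2)
    then have l5: "?G \<tau> (- z) t = ?G \<tau> z t"
      using law[of ?L5 Z "siegel_point \<tau> (- z) t"] Z one by (simp add: cs Z_def)
    \<comment> \<open>The action is U Z U^T with U lower triangular; the last block is the inverse
      transpose of U.\<close>
    have "mk (m2 1 0 1 1) (m2 0 0 0 0) (m2 0 0 0 0) (m2 1 (- 1) 0 1) \<in> carrier Sp2Z" (is "?L6 \<in> _")
      by (rule mk_carrier; simp add: sum_2 forall_2)
    then have l6: "?G \<tau> (z + \<tau>) (t + 2 * z + \<tau>) = ?G \<tau> z t"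
      using law[of ?L6 Z "siegel_point \<tau> (z + \<tau>) (t + 2 * z + \<tau>)"] Z by (simp add: cs Z_def algebra_simps)
    have \<tau>: "\<tau> \<noteq> 0" using D by (auto simp: D3_def)
    \<comment> \<open>The inversion of SL_2 embedded in the first coordinate, with det(CZ + D) =
      \<tau>.\<close>
    have "mk (m2 0 0 0 1) (m2 (- 1) 0 0 0) (m2 1 0 0 0) (m2 0 0 0 1) \<in> carrier Sp2Z" (is "?L7 \<in> _")
      by (rule mk_carrier; simp add: sum_2 forall_2)
    then have l7: "?G (- 1 / \<tau>) (z / \<tau>) (t - z\<^sup>2 / \<tau>) = \<tau> ^ (k * i) * ?G \<tau> z t"
      using law[of ?L7 Z "siegel_point (- 1 / \<tau>) (z / \<tau>) (t - z\<^sup>2 / \<tau>)"] Z \<tau> by (simp add: cs Z_def field_simps power2_eq_square)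
    show ?thesis by (intro conjI l1 l2 l3 l4 l5 l6 l7)
  qed
  then show ?thesis unfolding lev1_def using 1 2 by blast
qed

end

section \<open>Reduction modulo a prime\<close>

definition mp :: "nat \<Rightarrow> complex set"
  where "mp p = {x. cong_zero_mod x p}"

lemma mp_iff: "x \<in> mp p \<longleftrightarrow> (\<exists>y\<in>p_integral p. x = of_nat p * y)"
  by (simp add: mp_def cong_zero_mod_def)

lemma zpmod_mp:
  assumes "prime p" shows "zpmod p (mp p)"
  unfolding zpmod_def
proof (intro conjI ballI)
  show "0 \<in> mp p" unfolding mp_iff using p_integral_0[OF assms] by (intro bexI[of _ 0]) auto
  fix x y assume "x \<in> mp p"
  then obtain x' where x: "x' \<in> p_integral p" "x = of_nat p * x'" by (auto simp: mp_iff)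
  show "x + y \<in> mp p" if yp: "y \<in> mp p"
  proof -
    obtain y' where y: "y' \<in> p_integral p" "y = of_nat p * y'" using yp by (auto simp: mp_iff)
    show ?thesis unfolding mp_iff by (rule bexI[of _ "x' + y'"]) (use x y p_integral_add[OF assms] in \<open>auto simp: algebra_simps\<close>)
  qed
next
  fix c x assume c: "c \<in> p_integral p" and "x \<in> mp p"
  then obtain x' where x: "x' \<in> p_integral p" "x = of_nat p * x'" by (auto simp: mp_iff)
  show "c * x \<in> mp p" unfolding mp_iff by (rule bexI[of _ "c * x'"]) (use x c p_integral_mult[OF assms] in \<open>auto simp: algebra_simps\<close>)
qed

lemma mp_frac:
  assumes "prime p" "\<not> int p dvd b" shows "of_int a / of_int b \<in> mp p \<longleftrightarrow> int p dvd a"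
proof
  assume "of_int a / of_int b \<in> mp p"
  then obtain y where "y \<in> p_integral p" "of_int a / of_int b = of_nat p * y" by (auto simp: mp_iff)
  moreover obtain c d where y: "y = of_int c / of_int d" "\<not> int p dvd d" using calculation(1) by (rule p_integralE)
  ultimately have "(of_int a / of_int b :: complex) = of_int (int p * c) / of_int d" by simp
  moreover have "b \<noteq> 0" "d \<noteq> 0" using assms y by auto
  ultimately have "(of_int (a * d) :: complex) = of_int (int p * c * b)" by (simp add: field_simps)
  then have "a * d = int p * c * b" by (simp only: of_int_eq_iff)
  then have "int p dvd a * d" by (simp add: mult.assoc)
  then show "int p dvd a" using assms(1) y(2) by (simp add: prime_dvd_mult_iff)
next
  assume "int p dvd a"
  then obtain c where "a = int p * c" by auto
  then show "of_int a / of_int b \<in> mp p"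
    unfolding mp_iff using p_integral_frac[OF assms(2), of c] by (intro bexI[of _ "of_int c / of_int b"]) auto
qed

lemma mp_prime:
  assumes p: "prime p" and x: "x \<in> p_integral p" and y: "y \<in> p_integral p" and xy: "x * y \<in> mp p"
  shows "x \<in> mp p \<or> y \<in> mp p"
proof -
  obtain a b where x: "x = of_int a / of_int b" "\<not> int p dvd b" using x by (rule p_integralE)
  obtain c d where y: "y = of_int c / of_int d" "\<not> int p dvd d" using y by (rule p_integralE)
  have bd: "\<not> int p dvd b * d" using x y p by (simp add: prime_dvd_mult_iff)
  have "of_int (a * c) / of_int (b * d) \<in> mp p" using xy by (simp add: x y)
  then have "int p dvd a * c" using mp_frac[OF p bd] by blast
  then show ?thesis using mp_frac[OF p x(2)] mp_frac[OF p y(2)] p by (simp add: x y prime_dvd_mult_iff)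
qed

lemma one_notin_mp: "prime p \<Longrightarrow> 1 \<notin> mp p"
  using mp_frac[of p 1 1] by (simp add: prime_nat_iff)

lemma Rats_p_integral:
  assumes p: "prime p" and x: "x \<in> \<rat>" obtains e where "of_nat p ^ e * x \<in> p_integral p"
proof -
  obtain a b :: int where b: "b > 0" and x: "x = of_int a / of_int b" using x by (rule Rats_cases')
  have "\<not> is_unit (int p)" using p by (simp add: prime_nat_iff)
  then obtain c where c: "b = int p ^ multiplicity (int p) b * c" "\<not> int p dvd c"
    using multiplicity_decompose'[of b "int p"] b by (metis less_irrefl)
  have "of_nat p ^ multiplicity (int p) b * x = of_int a / of_int c"
  proof -
    have "(of_int b :: complex) = of_nat p ^ multiplicity (int p) b * of_int c" by (subst c(1)) simp
    moreover have "(of_nat p :: complex) \<noteq> 0" using p by (simp add: prime_nat_iff)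
    ultimately show ?thesis by (simp add: x)
  qed
  then show ?thesis using that p_integral_frac[OF c(2), of a] by metis
qed

lemma p_integral_power_mono:
  assumes p: "prime p" and "of_nat p ^ e * x \<in> p_integral p" "e \<le> f" shows "of_nat p ^ f * x \<in> p_integral p"
proof -
  have "of_int (int p ^ (f - e)) * (of_nat p ^ e * x) \<in> p_integral p"
    by (intro p_integral_mult[OF p] p_integral_of_int[OF p] assms)
  moreover have "(of_nat p :: complex) ^ f = of_nat p ^ (f - e) * of_nat p ^ e"
    using assms(3) by (simp only: power_add[symmetric] le_add_diff_inverse2)
  ultimately show ?thesis by (simp add: mult.assoc)
qed

text \<open>A projection of \<open>\<complex>\<close> onto \<open>\<rat>\<close> reduces questions about arbitrary complex Fourier coefficients to rational ones.\<close>

lemma rational_projection: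
  obtains f :: "complex \<Rightarrow> complex"
  where "f 1 = 1" "\<And>x y. f (x + y) = f x + f y" "\<And>q x. q \<in> \<rat> \<Longrightarrow> f (q * x) = q * f x" "\<And>x. f x \<in> \<rat>"
proof -
  interpret V: vector_space "\<lambda>(q::rat) (x::complex). of_rat q * x"
    by unfold_locales (simp_all add: algebra_simps of_rat_add of_rat_mult)
  interpret W: vector_space "\<lambda>(q::rat) (x::rat). q * x"
    by unfold_locales (simp_all add: algebra_simps)
  interpret P: vector_space_pair "\<lambda>(q::rat) (x::complex). of_rat q * x" "\<lambda>(q::rat) (x::rat). q * x" ..
  have "\<not> V.dependent {1}" by (simp add: V.dependent_single)
  then obtain g where g: "Vector_Spaces.linear (\<lambda>(q::rat) (x::complex). of_rat q * x) (\<lambda>(q::rat) (x::rat). q * x) g" "g 1 = 1"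
    using P.linear_independent_extend[of "{1}" "\<lambda>_. 1"] by auto
  interpret g: Vector_Spaces.linear "\<lambda>(q::rat) (x::complex). of_rat q * x" "\<lambda>(q::rat) (x::rat). q * x" g by (rule g(1))
  show ?thesis
  proof (rule that[of "\<lambda>x. of_rat (g x)"])
    fix q x :: complex assume "q \<in> \<rat>"
    then obtain r where "q = of_rat r" by (rule Rats_cases)
    then show "of_rat (g (q * x)) = q * of_rat (g x)" using g.scale[of r x] by (simp add: of_rat_mult)
  qed (use g(2) g.add in \<open>auto simp: of_rat_add\<close>)
qed

lemma p_integral_Rats: "x \<in> p_integral p \<Longrightarrow> x \<in> \<rat>"
  by (auto simp: p_integral_def)

section \<open>Convolution with a series supported on a cone\<close>

type_synonym idx3 = "int \<times> int \<times> int"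

text \<open>A common support for the coefficients of F and of all level one forms. It is closed
  under addition, and each index splits in finitely many ways, so formal products are finite
  sums.\<close>

definition cone3 :: "idx3 set"
  where "cone3 = {(n, r, m). 0 \<le> n \<and> 0 \<le> m \<and> \<bar>r\<bar> \<le> n + m}"

definition Bx :: "idx3 \<Rightarrow> idx3 set"
  where "Bx s = {0..fst s} \<times> {- (fst s + snd (snd s))..fst s + snd (snd s)} \<times> {0..snd (snd s)}"

lemma finite_Bx [simp]: "finite (Bx s)"
  by (simp add: Bx_def)

lemma cone3_add: "s \<in> cone3 \<Longrightarrow> t \<in> cone3 \<Longrightarrow> s + t \<in> cone3"
  by (cases s; cases t) (auto simp: cone3_def)

lemma cone3_Bx: "t \<in> cone3 \<Longrightarrow> s - t \<in> cone3 \<Longrightarrow> t \<in> Bx s"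
  by (cases s; cases t) (auto simp: cone3_def Bx_def)

text \<open>Multiplication by the series with coefficients \<open>a\<close>, as an operator on
  coefficient families. \<open>Bx s\<close> contains each t for which t and s - t both lie in the
  cone.\<close>

definition Mc :: "(idx3 \<Rightarrow> complex) \<Rightarrow> (idx3 \<Rightarrow> complex) \<Rightarrow> idx3 \<Rightarrow> complex"
  where "Mc a c s = (\<Sum>t\<in>Bx s. a t * c (s - t))"

lemma Mc_sum: "Mc a (\<lambda>s. \<Sum>l\<in>I. f l s) = (\<lambda>s. \<Sum>l\<in>I. Mc a (f l) s)"
  unfolding Mc_def sum_distrib_left by (intro ext sum.swap)

lemma Mc_pow_sum: "(Mc a ^^ n) (\<lambda>s. \<Sum>l\<in>I. f l s) = (\<lambda>s. \<Sum>l\<in>I. (Mc a ^^ n) (f l) s)"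
  by (induction n) (simp_all add: Mc_sum)

lemma Mc_supp:
  assumes "\<And>s. s \<notin> cone3 \<Longrightarrow> a s = 0" "\<And>s. s \<notin> cone3 \<Longrightarrow> c s = 0" "s \<notin> cone3" shows "Mc a c s = 0"
  unfolding Mc_def
proof (rule sum.neutral, rule ballI)
  fix t
  have "t \<notin> cone3 \<or> s - t \<notin> cone3" using cone3_add[of t "s - t"] assms(3) by auto
  then show "a t * c (s - t) = 0" using assms(1)[of t] assms(2)[of "s - t"] by auto
qed

lemma Mc_pow_supp:
  assumes "\<And>s. s \<notin> cone3 \<Longrightarrow> a s = 0" "\<And>s. s \<notin> cone3 \<Longrightarrow> c s = 0" "s \<notin> cone3" shows "(Mc a ^^ n) c s = 0"
  using assms(3) by (induction n arbitrary: s) (auto intro: Mc_supp assms)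

lemma Mc_in:
  assumes "zpmod p L" "\<And>s. a s \<in> p_integral p" "\<And>s. c s \<in> L" shows "Mc a c s \<in> L"
  unfolding Mc_def using assms by (intro zpmod_sum) (auto simp: zpmod_def)

lemma Mc_pow_in:
  assumes "zpmod p L" "\<And>s. a s \<in> p_integral p" "\<And>s. c s \<in> L" shows "(Mc a ^^ n) c s \<in> L"
  by (induction n arbitrary: s) (auto intro: Mc_in assms)

text \<open>Supports in the cone are well-ordered lexicographically by \<open>(n + m, n, r + n + m)\<close>, so a product of two series nonzero modulo \<open>p\<close> has a nonzero lowest term.\<close>

definition lx :: "(idx3 \<times> idx3) set"
  where "lx = inv_image (less_than <*lex*> less_than <*lex*> less_than) (\<lambda>(n, r, m). (nat (n + m), nat n, nat (r + n + m)))"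

lemma lx_iff:
  assumes "(n, r, m) \<in> cone3" "(n', r', m') \<in> cone3"
  shows "((n, r, m), (n', r', m')) \<in> lx \<longleftrightarrow> n + m < n' + m' \<or> n + m = n' + m' \<and> (n < n' \<or> n = n' \<and> r < r')"
proof -
  have "0 \<le> n" "0 \<le> n + m" "0 \<le> r + n + m" "0 \<le> n'" "0 \<le> n' + m'" "0 \<le> r' + n' + m'"
    using assms by (auto simp: cone3_def)
  then have "nat (n + m) < nat (n' + m') \<longleftrightarrow> n + m < n' + m'" "nat (n + m) = nat (n' + m') \<longleftrightarrow> n + m = n' + m'"
    "nat n < nat n' \<longleftrightarrow> n < n'" "nat n = nat n' \<longleftrightarrow> n = n'"
    "nat (r + n + m) < nat (r' + n' + m') \<longleftrightarrow> r + n + m < r' + n' + m'" by auto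
  then have "((n, r, m), (n', r', m')) \<in> lx \<longleftrightarrow> n + m < n' + m' \<or> n + m = n' + m' \<and> (n < n' \<or> n = n' \<and> r + n + m < r' + n' + m')"
    by (simp add: lx_def)
  then show ?thesis by auto
qed

lemma lx_total:
  assumes "s \<in> cone3" "t \<in> cone3" "s \<noteq> t" shows "(s, t) \<in> lx \<or> (t, s) \<in> lx"
proof -
  obtain n r m n' r' m' where e: "s = (n, r, m)" "t = (n', r', m')" by (cases s; cases t)
  have "n \<noteq> n' \<or> r \<noteq> r' \<or> m \<noteq> m'" using assms(3) by (auto simp: e)
  then show ?thesis unfolding e lx_iff[OF assms(1,2)[unfolded e]] lx_iff[OF assms(2,1)[unfolded e]] by linarith
qed

lemma lx_diff:
  assumes "u \<in> cone3" "t \<in> cone3" "t' \<in> cone3" "u + t - t' \<in> cone3" "(t, t') \<in> lx" shows "(u + t - t', u) \<in> lx"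
proof -
  obtain n r m n' r' m' n'' r'' m'' where e: "u = (n'', r'', m'')" "t = (n, r, m)" "t' = (n', r', m')" by (cases u; cases t; cases t')
  have c: "(n'' + n - n', r'' + r - r', m'' + m - m') \<in> cone3" using assms(4) by (simp add: e)
  have "u + t - t' = (n'' + n - n', r'' + r - r', m'' + m - m')" by (simp add: e)
  then show ?thesis
    using assms(5) lx_iff[OF c assms(1)[unfolded e]] lx_iff[OF assms(2,3)[unfolded e]] unfolding e by auto
qed

text \<open>Look at the sum of the two lowest indices with coefficients nonzero modulo p. In every
  other splitting of that sum one part lies below its lowest index, so the term is divisible by
  p.\<close>

lemma Mc_mp_cancel:
  assumes p: "prime p" and a: "\<And>s. a s \<in> p_integral p" "\<And>s. s \<notin> cone3 \<Longrightarrow> a s = 0" "\<exists>s. a s \<notin> mp p"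
    and c: "\<And>s. c s \<in> p_integral p" "\<And>s. s \<notin> cone3 \<Longrightarrow> c s = 0" and M: "\<And>s. Mc a c s \<in> mp p"
  shows "c s \<in> mp p"
proof (rule ccontr)
  assume "c s \<notin> mp p"
  note Z = zpmod_mp[OF p]
  have 0: "0 \<in> mp p" using Z by (simp add: zpmod_def)
  have wf: "wf lx" unfolding lx_def by (intro wf_inv_image wf_lex_prod wf_less_than)
  obtain u where u: "c u \<notin> mp p" and umin: "\<And>v. (v, u) \<in> lx \<Longrightarrow> c v \<in> mp p"
    using wfE_min[OF wf, of s "{s. c s \<notin> mp p}"] \<open>c s \<notin> mp p\<close> by auto
  obtain s' where "a s' \<notin> mp p" using a(3) by blast
  then obtain t where t: "a t \<notin> mp p" and tmin: "\<And>v. (v, t) \<in> lx \<Longrightarrow> a v \<in> mp p"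
    using wfE_min[OF wf, of s' "{s. a s \<notin> mp p}"] by auto
  have uc: "u \<in> cone3" and tc: "t \<in> cone3" using u t c(2) a(2) 0 by metis+
  have "t \<in> Bx (u + t)" using uc tc by (intro cone3_Bx) auto
  then have "Mc a c (u + t) = a t * c u + (\<Sum>v\<in>Bx (u + t) - {t}. a v * c (u + t - v))"
    unfolding Mc_def by (subst sum.remove[of _ t]) auto
  moreover have "(\<Sum>v\<in>Bx (u + t) - {t}. a v * c (u + t - v)) \<in> mp p"
  proof (rule zpmod_sum[OF Z])
    fix v assume v: "v \<in> Bx (u + t) - {t}"
    show "a v * c (u + t - v) \<in> mp p"
    proof (cases "v \<in> cone3 \<and> u + t - v \<in> cone3")
      case False
      then have "a v = 0 \<or> c (u + t - v) = 0" using a(2) c(2) by blast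
      then show ?thesis using 0 by auto
    next
      case True
      then consider "(v, t) \<in> lx" | "(t, v) \<in> lx" using lx_total[of v t] tc v by auto
      then show ?thesis
      proof cases
        case 1
        then have "c (u + t - v) * a v \<in> mp p" using Z c(1) tmin by (auto simp: zpmod_def)
        then show ?thesis by (simp add: mult.commute)
      next
        case 2
        then have "c (u + t - v) \<in> mp p" using lx_diff[OF uc tc] True umin by blast
        then show ?thesis using Z a(1) by (auto simp: zpmod_def)
      qed
    qed
  qed
  ultimately have "a t * c u \<in> mp p" using zpmod_diff[OF p Z M[of "u + t"]] by fastforce
  then show False using mp_prime[OF p a(1) c(1)] t u by blast
qed

lemma Mc_pow_mp_cancel:
  assumes p: "prime p" and a: "\<And>s. a s \<in> p_integral p" "\<And>s. s \<notin> cone3 \<Longrightarrow> a s = 0" "\<exists>s. a s \<notin> mp p"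
    and c: "\<And>s. c s \<in> p_integral p" "\<And>s. s \<notin> cone3 \<Longrightarrow> c s = 0" and M: "\<And>s. (Mc a ^^ n) c s \<in> mp p"
  shows "c s \<in> mp p"
  using M
proof (induction n arbitrary: s)
  case (Suc n)
  have "(Mc a ^^ n) c s \<in> mp p" for s
    by (rule Mc_mp_cancel[OF p a]) (use Suc.prems Mc_pow_in[OF zpmod_p_integral[OF p] a(1) c(1)] Mc_pow_supp[OF a(2) c(2)] in auto)
  then show ?case by (rule Suc.IH)
qed simp

text \<open>Read as forms, the relation modulo p stops at l = j, and the common factor F^(n - j)
  cancels. What remains says G_j = -F Y modulo p, and its coefficient at s involves only those
  \<open>a t\<close> with t in \<open>Bx s\<close>.\<close>

lemma leading_coefficient_mp:
  assumes p: "prime p" and a: "\<And>s. a s \<in> p_integral p" "\<And>s. s \<notin> cone3 \<Longrightarrow> a s = 0" "\<exists>s. a s \<notin> mp p"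
    and d: "\<And>l s. l \<le> n \<Longrightarrow> d l s \<in> p_integral p" "\<And>l s. l \<le> n \<Longrightarrow> s \<notin> cone3 \<Longrightarrow> d l s = 0"
    and rel: "\<And>s. (\<Sum>l\<le>n. (Mc a ^^ (n - l)) (d l) s) = 0"
    and j: "j \<le> n" "\<And>l s. j < l \<Longrightarrow> l \<le> n \<Longrightarrow> d l s \<in> mp p"
    and s: "\<And>t. t \<in> Bx s \<Longrightarrow> a t \<in> mp p"
  shows "d j s \<in> mp p"
proof -
  note Z = zpmod_mp[OF p] and Zi = zpmod_p_integral[OF p]
  define X where "X = (\<lambda>s. \<Sum>l\<le>j. (Mc a ^^ (j - l)) (d l) s)"
  have "(Mc a ^^ (n - j)) X s \<in> mp p" for s
  proof -
    have "(\<Sum>l\<le>n. (Mc a ^^ (n - l)) (d l) s) = (\<Sum>l\<le>j. (Mc a ^^ (n - l)) (d l) s) + (\<Sum>l\<in>{j<..n}. (Mc a ^^ (n - l)) (d l) s)"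
      by (subst sum.union_disjoint[symmetric]) (use j(1) in \<open>auto intro!: sum.cong\<close>)
    moreover have "(\<Sum>l\<in>{j<..n}. (Mc a ^^ (n - l)) (d l) s) \<in> mp p"
      by (intro zpmod_sum[OF Z] Mc_pow_in[OF Z a(1)]) (use j(2) in auto)
    ultimately have "0 - (\<Sum>l\<in>{j<..n}. (Mc a ^^ (n - l)) (d l) s) \<in> mp p" "(\<Sum>l\<le>j. (Mc a ^^ (n - l)) (d l) s) = 0 - (\<Sum>l\<in>{j<..n}. (Mc a ^^ (n - l)) (d l) s)"
      using rel[of s] zpmod_diff[OF p Z, of 0] Z by (auto simp: zpmod_def eq_neg_iff_add_eq_0)
    moreover have "(Mc a ^^ (n - j)) X s = (\<Sum>l\<le>j. (Mc a ^^ (n - l)) (d l) s)"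
      unfolding X_def Mc_pow_sum
    proof (rule sum.cong[OF refl])
      fix l assume "l \<in> {..j}"
      then have "n - l = (n - j) + (j - l)" using j(1) by simp
      then show "(Mc a ^^ (n - j)) ((Mc a ^^ (j - l)) (d l)) s = (Mc a ^^ (n - l)) (d l) s" by (simp add: funpow_add)
    qed
    ultimately show ?thesis by simp
  qed
  moreover have "X s \<in> p_integral p" for s
    unfolding X_def by (intro zpmod_sum[OF Zi] Mc_pow_in[OF Zi a(1)] d(1)) (use j(1) in auto)
  moreover have "X s = 0" if "s \<notin> cone3" for s
    unfolding X_def by (intro sum.neutral ballI Mc_pow_supp[OF a(2) d(2) that]) (use j(1) in auto)
  ultimately have X: "X s \<in> mp p"
    using Mc_pow_mp_cancel[OF p a(1) a(2) a(3), where c = X] by blast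
  \<comment> \<open>The terms with l < j, each with one factor F taken out.\<close>
  define Y where "Y = (\<lambda>s. \<Sum>l<j. (Mc a ^^ (j - Suc l)) (d l) s)"
  have "X s = Mc a Y s + d j s"
  proof -
    have "X s = (\<Sum>l<j. (Mc a ^^ (j - l)) (d l) s) + d j s"
      unfolding X_def lessThan_Suc_atMost[symmetric] by simp
    also have "(\<Sum>l<j. (Mc a ^^ (j - l)) (d l) s) = Mc a Y s"
      unfolding Y_def Mc_sum
    proof (rule sum.cong[OF refl])
      fix l assume "l \<in> {..<j}"
      then have "j - l = Suc (j - Suc l)" by auto
      then show "(Mc a ^^ (j - l)) (d l) s = Mc a ((Mc a ^^ (j - Suc l)) (d l)) s" by simp
    qed
    finally show ?thesis .
  qed
  moreover have "Mc a Y s \<in> mp p"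
    unfolding Mc_def
  proof (rule zpmod_sum[OF Z])
    fix t assume "t \<in> Bx s"
    moreover have "Y (s - t) \<in> p_integral p"
      unfolding Y_def by (intro zpmod_sum[OF Zi] Mc_pow_in[OF Zi a(1)]) (use d j(1) in auto)
    ultimately have "Y (s - t) * a t \<in> mp p" using Z s by (auto simp: zpmod_def)
    then show "a t * Y (s - t) \<in> mp p" by (simp add: mult.commute)
  qed
  ultimately show ?thesis using zpmod_diff[OF p Z X, of "Mc a Y s"] by simp
qed

section \<open>Fourier coefficients on a torus\<close>

abbreviation ubox :: "(real \<times> real \<times> real) set" where "ubox \<equiv> cbox (0, 0, 0) (1, 1, 1)"

definition TT :: "(complex \<times> complex \<times> complex) set"
  where "TT = {(\<tau>, z, t). Im \<tau> = 1 \<and> Im z = 0 \<and> Im t = 1}"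

definition chr :: "nat \<Rightarrow> idx3 \<Rightarrow> complex \<times> complex \<times> complex \<Rightarrow> complex"
  where "chr N s w = ee ((of_int (fst s) * fst w + of_int (fst (snd s)) * fst (snd w) + of_int (snd (snd s)) * snd (snd w)) / of_nat N)"

text \<open>The real parameters come in the order z, \<tau>, t, matching the iterated integrals of
  \<open>level_one.A\<close>; \<open>j\<close> selects one of the N^3 unit cubes in a
  period.\<close>

definition pt :: "nat \<times> nat \<times> nat \<Rightarrow> real \<times> real \<times> real \<Rightarrow> complex \<times> complex \<times> complex"
  where "pt j v = (\<i> + of_nat (fst j) + of_real (fst (snd v)), of_nat (fst (snd j)) + of_real (fst v), \<i> + of_nat (snd (snd j)) + of_real (snd (snd v)))"

definition cube :: "nat \<Rightarrow> (nat \<times> nat \<times> nat) set"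
  where "cube N = {..<N} \<times> {..<N} \<times> {..<N}"

text \<open>Coefficients on a torus of side N, computed as a sum over unit cubes: for a function of
  period 1 each cube gives the same integral up to roots of unity.\<close>

definition CF :: "nat \<Rightarrow> idx3 \<Rightarrow> (complex \<times> complex \<times> complex \<Rightarrow> complex) \<Rightarrow> complex"
  where "CF N s H = (\<Sum>j\<in>cube N. integral ubox (\<lambda>v. H (pt j v) * chr N (- s) (pt j v))) / of_nat N ^ 3"

lemma TT_D3: "TT \<subseteq> D3"
  by (auto simp: TT_def D3_def)

lemma pt_TT: "pt j v \<in> TT"
  by (simp add: pt_def TT_def)

lemma chr_add: "chr N (s + t) w = chr N s w * chr N t w"
  by (simp add: chr_def ee_add[symmetric] algebra_simps add_divide_distrib)

lemma continuous_pt: "continuous_on A (pt j)"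
  unfolding pt_def by (intro continuous_intros)

lemma continuous_chr: "continuous_on A (chr N s)"
  unfolding chr_def ee_def divide_inverse by (intro continuous_intros)

lemma continuous_pt_compose: "continuous_on TT H \<Longrightarrow> continuous_on A (\<lambda>v. H (pt j v))"
  by (rule continuous_on_compose2[OF _ continuous_pt]) (auto simp: pt_TT)

lemma CF_integrable: "continuous_on TT H \<Longrightarrow> (\<lambda>v. H (pt j v) * chr N s (pt j v)) integrable_on ubox"
  by (intro integrable_continuous continuous_intros continuous_pt_compose continuous_on_subset[OF continuous_chr] subset_UNIV) auto

lemma CF_sum:
  assumes "finite I" "\<And>i. i \<in> I \<Longrightarrow> continuous_on TT (H i)"
  shows "CF N s (\<lambda>w. \<Sum>i\<in>I. H i w) = (\<Sum>i\<in>I. CF N s (H i))"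
proof -
  have "integral ubox (\<lambda>v. (\<Sum>i\<in>I. H i (pt j v)) * chr N (- s) (pt j v)) = (\<Sum>i\<in>I. integral ubox (\<lambda>v. H i (pt j v) * chr N (- s) (pt j v)))" for j
    unfolding sum_distrib_right by (rule integral_sum[OF assms(1) CF_integrable[OF assms(2)]])
  then show ?thesis unfolding CF_def by (simp add: sum_divide_distrib[symmetric] sum.swap[of _ I])
qed

lemma CF_diff:
  assumes "continuous_on TT H" "continuous_on TT H'"
  shows "CF N s (\<lambda>w. H w - H' w) = CF N s H - CF N s H'"
proof -
  have "integral ubox (\<lambda>v. (H (pt j v) - H' (pt j v)) * chr N (- s) (pt j v))
    = integral ubox (\<lambda>v. H (pt j v) * chr N (- s) (pt j v)) - integral ubox (\<lambda>v. H' (pt j v) * chr N (- s) (pt j v))" for j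
    unfolding left_diff_distrib by (rule integral_diff[OF CF_integrable[OF assms(1)] CF_integrable[OF assms(2)]])
  then show ?thesis unfolding CF_def by (simp add: sum_subtractf diff_divide_distrib)
qed

lemma CF_cmult: "CF N s (\<lambda>w. c * H w) = c * CF N s H"
  by (simp add: CF_def sum_distrib_left mult.assoc)

lemma CF_cong: "(\<And>w. w \<in> TT \<Longrightarrow> H w = H' w) \<Longrightarrow> CF N s H = CF N s H'"
  unfolding CF_def by (simp add: pt_TT)

lemma CF_chr: "CF N s (\<lambda>w. chr N t w * H w) = CF N (s - t) H"
proof -
  have "chr N t w * H w * chr N (- s) w = H w * chr N (- (s - t)) w" for w
    using chr_add[of N t "- s" w] by (simp add: algebra_simps)
  then show ?thesis unfolding CF_def by (simp only:)
qed

lemma norm_chr: "w \<in> TT \<Longrightarrow> norm (chr N (n, r, m) w) = exp (- 2 * pi * of_int (n + m) / of_nat N)"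
  by (auto simp: chr_def norm_ee TT_def)

lemma CF_bound:
  assumes H: "continuous_on TT H" and B: "\<And>j v. j \<in> cube N \<Longrightarrow> v \<in> ubox \<Longrightarrow> norm (H (pt j v)) \<le> B" and N: "N > 0" and B0: "B \<ge> 0"
  shows "norm (CF N s H) \<le> B * norm (chr N (- s) (\<i>, 0, \<i>))"
proof -
  let ?c = "norm (chr N (- s) (\<i>, 0, \<i>))"
  have c: "norm (chr N (- s) w) = ?c" if "w \<in> TT" for w
  proof -
    obtain n r m where s: "- s = (n, r, m)" by (cases "- s")
    have "(\<i>, 0, \<i>) \<in> TT" by (simp add: TT_def)
    then show ?thesis unfolding s using norm_chr[OF that] norm_chr by metis
  qed
  have "norm (integral ubox (\<lambda>v. H (pt j v) * chr N (- s) (pt j v))) \<le> B * ?c" if j: "j \<in> cube N" for j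
  proof -
    have "norm (integral ubox (\<lambda>v. H (pt j v) * chr N (- s) (pt j v))) \<le> integral ubox (\<lambda>v. B * ?c)"
      by (rule integral_norm_bound_integral[OF CF_integrable[OF H]])
         (use B[OF j] in \<open>auto simp: norm_mult c pt_TT intro!: mult_right_mono\<close>)
    also have "\<dots> = B * ?c" by (simp add: content_Pair)
    finally show ?thesis .
  qed
  then have "norm (\<Sum>j\<in>cube N. integral ubox (\<lambda>v. H (pt j v) * chr N (- s) (pt j v))) \<le> of_nat (card (cube N)) * (B * ?c)"
    by (intro order_trans[OF norm_sum] sum_bounded_above) auto
  also have "card (cube N) = N ^ 3" by (simp add: cube_def card_cartesian_product power3_eq_cube)
  finally show ?thesis using N by (simp add: CF_def norm_divide norm_power divide_le_eq mult.commute)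
qed

lemma bounded_on_cube:
  assumes H: "continuous_on TT H"
  obtains B where "B \<ge> 0" "\<And>j v. j \<in> cube N \<Longrightarrow> v \<in> ubox \<Longrightarrow> norm (H (pt j v)) \<le> B"
proof -
  have "bounded (\<Union>j\<in>cube N. (\<lambda>v. H (pt j v)) ` ubox)"
    by (intro bounded_UN ballI compact_imp_bounded compact_continuous_image continuous_pt_compose[OF H] compact_cbox) (simp add: cube_def)
  then obtain B where "\<And>x. x \<in> (\<Union>j\<in>cube N. (\<lambda>v. H (pt j v)) ` ubox) \<Longrightarrow> norm x \<le> B" unfolding bounded_iff by blast
  then show ?thesis by (intro that[of "max 0 B"]) (force simp: le_max_iff_disj)+
qed

text \<open>On \<open>TT\<close> the imaginary parts are fixed, so each term of the series has
  constant absolute value. Summability at one point is therefore uniform, and the tail changes the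
  coefficient by an arbitrarily small amount.\<close>

lemma CF_mult_series:
  assumes N: "N > 0" and F: "continuous_on TT F" and H: "continuous_on TT H"
    and sm: "\<And>w. w \<in> TT \<Longrightarrow> ((\<lambda>t. a t * chr N t w) has_sum F w) UNIV"
    and a: "\<And>t. t \<notin> cone3 \<Longrightarrow> a t = 0" and c: "\<And>t. t \<notin> cone3 \<Longrightarrow> CF N t H = 0"
  shows "CF N s (\<lambda>w. F w * H w) = Mc a (\<lambda>t. CF N t H) s"
proof -
  define w0 :: "complex \<times> complex \<times> complex" where "w0 = (\<i>, 0, \<i>)"
  have w0: "w0 \<in> TT" by (simp add: w0_def TT_def)
  define g where "g t = norm (a t * chr N t w0)" for t
  have gw: "norm (a t * chr N t w) = g t" if "w \<in> TT" for t w
    unfolding g_def norm_mult using norm_chr[OF that, of N "fst t" "fst (snd t)" "snd (snd t)"] norm_chr[OF w0, of N "fst t" "fst (snd t)" "snd (snd t)"] by simp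
  have gs: "g summable_on UNIV"
    unfolding g_def using has_sum_imp_summable[OF sm[OF w0]] by (simp add: summable_on_iff_abs_summable_on_complex[symmetric])
  obtain B where B: "B \<ge> 0" "\<And>j v. j \<in> cube N \<Longrightarrow> v \<in> ubox \<Longrightarrow> norm (H (pt j v)) \<le> B" using bounded_on_cube[OF H] by blast
  let ?k = "norm (chr N (- s) (\<i>, 0, \<i>))"
  have "norm (CF N s (\<lambda>w. F w * H w) - Mc a (\<lambda>t. CF N t H) s) \<le> e * (B * ?k)" if e: "e > 0" for e
  proof -
    have "\<forall>\<^sub>F Q in finite_subsets_at_top UNIV. dist (sum g Q) (infsum g UNIV) < e"
      using has_sum_infsum[OF gs] e unfolding has_sum_def by (rule tendstoD)
    then obtain P where P: "finite P" "\<And>Q. finite Q \<Longrightarrow> P \<subseteq> Q \<Longrightarrow> dist (sum g Q) (infsum g UNIV) < e"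
      unfolding eventually_finite_subsets_at_top by auto
    \<comment> \<open>The finite set is enlarged to contain every t that contributes to the
      convolution at s.\<close>
    define Q where "Q = P \<union> Bx s"
    have Q: "finite Q" "P \<subseteq> Q" "Bx s \<subseteq> Q" using P by (auto simp: Q_def)
    define E where "E w = F w - (\<Sum>t\<in>Q. a t * chr N t w)" for w
    have tail: "norm (E w) \<le> e" if w: "w \<in> TT" for w
    proof -
      have "((\<lambda>t. a t * chr N t w) has_sum E w) (UNIV - Q)"
        unfolding E_def by (intro has_sum_Diff sm[OF w] has_sum_finite Q) auto
      moreover have "(g has_sum (infsum g UNIV - sum g Q)) (UNIV - Q)"
        by (intro has_sum_Diff has_sum_infsum gs has_sum_finite Q) auto
      then have "((\<lambda>t. norm (a t * chr N t w)) has_sum (infsum g UNIV - sum g Q)) (UNIV - Q)" by (simp only: gw[OF w])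
      ultimately have "norm (E w) \<le> infsum g UNIV - sum g Q" by (rule norm_has_sum_bound[rotated])
      also have "\<dots> \<le> e" using P(2)[OF Q(1,2)] by (simp add: dist_real_def)
      finally show ?thesis .
    qed
    have contE: "continuous_on TT (\<lambda>w. E w * H w)"
      unfolding E_def by (intro continuous_intros F H continuous_chr)
    have "CF N s (\<lambda>w. F w * H w) - CF N s (\<lambda>w. E w * H w) = CF N s (\<lambda>w. F w * H w - E w * H w)"
      by (intro CF_diff[symmetric] contE continuous_intros F H)
    also have "\<dots> = CF N s (\<lambda>w. \<Sum>t\<in>Q. a t * (chr N t w * H w))"
      by (rule CF_cong) (simp add: E_def left_diff_distrib sum_distrib_right mult.assoc)
    also have "\<dots> = (\<Sum>t\<in>Q. a t * CF N (s - t) H)"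
      by (subst CF_sum[OF Q(1)]) (auto intro!: continuous_intros H continuous_chr simp: CF_cmult CF_chr)
    also have "\<dots> = Mc a (\<lambda>t. CF N t H) s"
      unfolding Mc_def
    proof (rule sum.mono_neutral_right[OF Q(1,3)], rule ballI)
      fix t assume "t \<in> Q - Bx s"
      then have "t \<notin> cone3 \<or> s - t \<notin> cone3" using cone3_Bx by blast
      then show "a t * CF N (s - t) H = 0" using a[of t] c[of "s - t"] by auto
    qed
    finally have "CF N s (\<lambda>w. F w * H w) - Mc a (\<lambda>t. CF N t H) s = CF N s (\<lambda>w. E w * H w)"
      by (simp only: diff_eq_eq) (simp only: add.commute)
    also have "norm \<dots> \<le> (e * B) * ?k"
      by (rule CF_bound[OF contE _ N]) (use B tail[OF pt_TT] e in \<open>auto simp: norm_mult intro!: mult_mono\<close>)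
    finally show ?thesis by (simp add: mult.assoc)
  qed
  note h = this
  have "norm (CF N s (\<lambda>w. F w * H w) - Mc a (\<lambda>t. CF N t H) s) \<le> 0"
  proof (rule field_le_epsilon)
    fix e :: real assume e: "0 < e"
    have k: "B * ?k \<ge> 0" using B by simp
    have "norm (CF N s (\<lambda>w. F w * H w) - Mc a (\<lambda>t. CF N t H) s) \<le> e / (B * ?k + 1) * (B * ?k)"
      by (rule h) (use e k in simp)
    also have "\<dots> \<le> e" using e k by (simp add: field_simps)
    finally show "norm (CF N s (\<lambda>w. F w * H w) - Mc a (\<lambda>t. CF N t H) s) \<le> 0 + e" by simp
  qed
  then show ?thesis by simp
qed

lemma CF_pow_series:
  assumes N: "N > 0" and F: "continuous_on TT F" and H: "continuous_on TT H"
    and sm: "\<And>w. w \<in> TT \<Longrightarrow> ((\<lambda>t. a t * chr N t w) has_sum F w) UNIV"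
    and a: "\<And>t. t \<notin> cone3 \<Longrightarrow> a t = 0" and c: "\<And>t. t \<notin> cone3 \<Longrightarrow> CF N t H = 0"
  shows "(\<lambda>s. CF N s (\<lambda>w. F w ^ i * H w)) = (Mc a ^^ i) (\<lambda>t. CF N t H)"
proof (induction i)
  case (Suc i)
  have "CF N s (\<lambda>w. F w ^ Suc i * H w) = Mc a (\<lambda>t. CF N t (\<lambda>w. F w ^ i * H w)) s" for s
  proof -
    have "CF N s (\<lambda>w. F w * (F w ^ i * H w)) = Mc a (\<lambda>t. CF N t (\<lambda>w. F w ^ i * H w)) s"
      using fun_cong[OF Suc] Mc_pow_supp[OF a c]
      by (intro CF_mult_series[OF N F _ sm a] continuous_intros F H) auto
    then show ?thesis by (simp add: mult.assoc)
  qed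
  then show ?case unfolding Suc by simp
qed simp

lemma roots_sum:
  assumes "N > 0" shows "(\<Sum>a<N. ee (- (of_int n * of_nat a) / of_nat N)) = (if int N dvd n then of_nat N else 0)"
proof -
  define x where "x = ee (- (of_int n / of_nat N))"
  have e: "ee (- (of_int n * of_nat a) / of_nat N) = x ^ a" for a
    unfolding x_def ee_of_nat_mult[symmetric] by (simp add: mult.commute)
  have x1: "x = 1 \<longleftrightarrow> int N dvd n"
  proof
    assume "x = 1"
    then obtain l :: int where "- (of_int n / of_nat N) = (of_int l :: complex)" unfolding x_def ee_eq_1_iff by blast
    then have "- (of_int n :: complex) = of_int l * of_nat N" using assms by (simp add: field_simps)
    then have "(of_int (- n) :: complex) = of_int (l * int N)" by simp
    then have "- n = l * int N" by (simp only: of_int_eq_iff)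
    then have "n = int N * (- l)" by (simp add: algebra_simps)
    then show "int N dvd n" by simp
  next
    assume "int N dvd n"
    then obtain l where "n = int N * l" by auto
    then have "- (of_int n / of_nat N) = (of_int (- l) :: complex)" using assms by simp
    then show "x = 1" unfolding x_def by (metis ee_of_int)
  qed
  have xN: "x ^ N = 1"
    unfolding x_def ee_of_nat_mult[symmetric] using assms ee_of_int[of "- n"] by simp
  show ?thesis unfolding e using x1 xN geometric_sum[of x N] by auto
qed

section \<open>Coefficients of a level one form on the torus of side N\<close>

context level_one
begin

lemma periods:
  assumes "(\<tau>, z, t) \<in> D3" shows "G (\<tau> + of_nat a) (z + of_nat b) (t + of_nat c) = G \<tau> z t"
proof -
  have 1: "G (\<tau> + of_nat a) z t = G \<tau> z t" if "(\<tau>, z, t) \<in> D3" for \<tau> z t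
  proof (induction a)
    case (Suc a)
    have "(\<tau> + of_nat a, z, t) \<in> D3" using that by (simp add: D3_def)
    from law(1)[OF this] Suc show ?case by (simp add: add_ac)
  qed simp
  have 2: "G \<tau> (z + of_nat b) t = G \<tau> z t" if "(\<tau>, z, t) \<in> D3" for \<tau> z t
  proof (induction b)
    case (Suc b)
    have "(\<tau>, z + of_nat b, t) \<in> D3" using that by (simp add: D3_def)
    from law(2)[OF this] Suc show ?case by (simp add: add_ac)
  qed simp
  have 3: "G \<tau> z (t + of_nat c) = G \<tau> z t" if "(\<tau>, z, t) \<in> D3" for \<tau> z t
  proof (induction c)
    case (Suc c)
    have "(\<tau>, z, t + of_nat c) \<in> D3" using that by (simp add: D3_def)
    from law(3)[OF this] Suc show ?case by (simp add: add_ac)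
  qed simp
  have "(\<tau>, z + of_nat b, t + of_nat c) \<in> D3" "(\<tau>, z, t + of_nat c) \<in> D3" using assms by (auto simp: D3_def)
  then show ?thesis using 1 2 3[OF assms] by simp
qed

definition GT :: "complex \<times> complex \<times> complex \<Rightarrow> complex"
  where "GT x = G (fst x) (fst (snd x)) (snd (snd x))"

lemma continuous_GT: "continuous_on D3 GT"
  using cont by (simp add: GT_def[abs_def] case_prod_beta)

lemma A_triple:
  "A n r m = integral ubox (\<lambda>v. GT (pt 0 v) * chr 1 (- (n, r, m)) (pt 0 v))"
proof -
  let ?f = "\<lambda>v. GT (pt 0 v) * chr 1 (- (n, r, m)) (pt 0 v)"
  have c: "continuous_on UNIV ?f"
    by (intro continuous_intros continuous_pt_compose continuous_on_subset[OF continuous_GT TT_D3] continuous_chr)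
  have "integral ubox ?f = integral (cbox 0 1) (\<lambda>y. integral (cbox (0, 0) (1, 1)) (\<lambda>xu. ?f (y, xu)))"
    by (rule integral_prod_continuous[OF continuous_on_subset[OF c subset_UNIV]])
  also have "\<dots> = integral (cbox 0 1) (\<lambda>y. integral (cbox 0 1) (\<lambda>x. integral (cbox 0 1) (\<lambda>u. ?f (y, x, u))))"
    by (intro integral_cong integral_prod_continuous continuous_on_compose2[OF c] continuous_intros) auto
  also have "\<dots> = A n r m"
  proof -
    have f: "?f (y, x, u) = G (\<i> + of_real x) (of_real y) (\<i> + of_real u) * ee (- of_int m * (\<i> + of_real u)) * ee (- of_int n * (\<i> + of_real x)) * ee (- of_int r * of_real y)" for x y u
      by (simp add: GT_def pt_def chr_def ee_add[symmetric] algebra_simps zero_prod_def)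
    show ?thesis unfolding f A_def PP_def fc_def by (simp add: ph_real fc_def integral_mult_left)
  qed
  finally show ?thesis by simp
qed

text \<open>Moving between unit cubes multiplies the character by N-th roots of unity; their sums
  vanish unless N divides all three indices.\<close>

lemma CF_GT:
  assumes N: "N > 0"
  shows "CF N (n, r, m) GT = (if int N dvd n \<and> int N dvd r \<and> int N dvd m then A (n div int N) (r div int N) (m div int N) else 0)"
proof -
  define J where "J = integral ubox (\<lambda>v. GT (pt 0 v) * chr N (- (n, r, m)) (pt 0 v))"
  let ?e = "\<lambda>n a. ee (- (of_int n * of_nat a) / of_nat N)"
  have j: "integral ubox (\<lambda>v. GT (pt j v) * chr N (- (n, r, m)) (pt j v)) = ?e n (fst j) * ?e r (fst (snd j)) * ?e m (snd (snd j)) * J" for j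
  proof -
    have "GT (pt j v) = GT (pt 0 v)" for v
    proof -
      have "pt 0 v \<in> D3" using pt_TT TT_D3 by blast
      from periods[of "fst (pt 0 v)" "fst (snd (pt 0 v))" "snd (snd (pt 0 v))" "fst j" "fst (snd j)" "snd (snd j)"] this
      show ?thesis by (simp add: GT_def pt_def zero_prod_def add_ac)
    qed
    moreover have "chr N (- (n, r, m)) (pt j v) = ?e n (fst j) * ?e r (fst (snd j)) * ?e m (snd (snd j)) * chr N (- (n, r, m)) (pt 0 v)" for v
      unfolding chr_def ee_add[symmetric] by (rule arg_cong[where f = ee]) (simp add: pt_def zero_prod_def algebra_simps add_divide_distrib diff_divide_distrib)
    ultimately have "(\<lambda>v. GT (pt j v) * chr N (- (n, r, m)) (pt j v)) = (\<lambda>v. ?e n (fst j) * ?e r (fst (snd j)) * ?e m (snd (snd j)) * (GT (pt 0 v) * chr N (- (n, r, m)) (pt 0 v)))"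
      by (simp add: mult_ac)
    then show ?thesis by (simp only: integral_mult_right J_def)
  qed
  have "(\<Sum>j\<in>cube N. ?e n (fst j) * ?e r (fst (snd j)) * ?e m (snd (snd j)) * J) = (\<Sum>a<N. ?e n a) * (\<Sum>a<N. ?e r a) * (\<Sum>a<N. ?e m a) * J"
  proof -
    have "(\<Sum>j\<in>cube N. ?e n (fst j) * ?e r (fst (snd j)) * ?e m (snd (snd j)) * J) = (\<Sum>a<N. \<Sum>b<N. \<Sum>c<N. ?e n a * ?e r b * ?e m c * J)"
      unfolding cube_def sum.cartesian_product by (simp add: case_prod_beta)
    also have "\<dots> = (\<Sum>a<N. ?e n a) * (\<Sum>a<N. ?e r a) * (\<Sum>a<N. ?e m a) * J"
      by (simp only: sum_distrib_left[symmetric] sum_distrib_right[symmetric])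
    finally show ?thesis .
  qed
  then have CF: "CF N (n, r, m) GT = (\<Sum>a<N. ?e n a) * (\<Sum>a<N. ?e r a) * (\<Sum>a<N. ?e m a) * J / of_nat N ^ 3"
    unfolding CF_def j by simp
  show ?thesis
  proof (cases "int N dvd n \<and> int N dvd r \<and> int N dvd m")
    case True
    have "chr N (- (n, r, m)) x = chr 1 (- (n div int N, r div int N, m div int N)) x" for x
    proof -
      obtain n' r' m' where "n = int N * n'" "r = int N * r'" "m = int N * m'" using True by (elim conjE dvdE)
      then show ?thesis using N by (simp add: chr_def add_divide_distrib diff_divide_distrib)
    qed
    then have "J = A (n div int N) (r div int N) (m div int N)" unfolding J_def A_triple by simp
    then show ?thesis unfolding CF roots_sum[OF N] using True N by (simp add: power3_eq_cube)
  next
    case False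
    then show ?thesis unfolding CF roots_sum[OF N] by auto
  qed
qed

lemma CF_GT_supp: assumes "N > 0" "s \<notin> cone3" shows "CF N s GT = 0"
proof -
  obtain n r m where s: "s = (n, r, m)" by (cases s)
  show ?thesis
  proof (cases "int N dvd n \<and> int N dvd r \<and> int N dvd m")
    case True
    then obtain n' r' m' where e: "n = int N * n'" "r = int N * r'" "m = int N * m'" by (elim conjE dvdE)
    have "n' < 0 \<or> m' < 0 \<or> \<bar>r'\<bar> > n' + m'"
    proof (rule ccontr)
      assume h: "\<not> (n' < 0 \<or> m' < 0 \<or> \<bar>r'\<bar> > n' + m')"
      then have "int N * \<bar>r'\<bar> \<le> int N * (n' + m')" by (intro mult_left_mono) auto
      then have "s \<in> cone3" using h by (auto simp: cone3_def s e abs_mult algebra_simps)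
      then show False using assms by simp
    qed
    then show ?thesis unfolding s CF_GT[OF assms(1)] using A_neg_n A_neg_m A_supp assms(1) by (auto simp: e)
  next
    case False then show ?thesis unfolding s CF_GT[OF assms(1)] by auto
  qed
qed

end

section \<open>The Sturm bound\<close>

lemma finite_uniform_exponent:
  fixes P :: "nat \<Rightarrow> 'a \<Rightarrow> bool"
  assumes "finite S" "\<And>x. x \<in> S \<Longrightarrow> \<exists>e. P e x" "\<And>e f x. P e x \<Longrightarrow> e \<le> f \<Longrightarrow> P f x"
  shows "\<exists>e. \<forall>x\<in>S. P e x"
  using assms(1,2)
proof (induction S rule: finite_induct)
  case (insert x S)
  then obtain e where "\<forall>x\<in>S. P e x" by auto
  moreover obtain e' where "P e' x" using insert.prems by auto
  ultimately have "\<forall>y\<in>insert x S. P (max e e') y" using assms(3) by (metis insert_iff max.cobounded1 max.cobounded2)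
  then show ?case by blast
qed simp

text \<open>Supplies the modules to which the level one bound is applied: preimages under p-power
  multiples of the projection onto \<rat>.\<close>

lemma zpmod_preimage:
  assumes "zpmod p L" "\<And>x y. g (x + y) = g x + g y" "\<And>c x. c \<in> p_integral p \<Longrightarrow> g (c * x) = c * g x"
  shows "zpmod p {x. g x \<in> L}"
proof -
  have "g 0 = 0" using assms(2)[of 0 0] by simp
  then show ?thesis using assms by (simp add: zpmod_def)
qed

text \<open>In the application g is linear over \<rat> and the coefficients of F are rational, so
  projecting commutes with multiplication by F and the relation between the forms survives.\<close>

lemma Mc_pow_map:
  assumes g: "\<And>x y. g (x + y) = g x + g y" and ga: "\<And>t x. g (a t * x) = a t * g x"
  shows "(Mc a ^^ i) (\<lambda>s. g (c s)) = (\<lambda>s. g ((Mc a ^^ i) c s))"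
proof -
  have g0: "g 0 = 0" using g[of 0 0] by simp
  have gs: "g (\<Sum>t\<in>S. f t) = (\<Sum>t\<in>S. g (f t))" if "finite S" for f :: "idx3 \<Rightarrow> complex" and S
    using that by (induction S rule: finite_induct) (simp_all add: g g0)
  show ?thesis by (induction i) (simp_all add: Mc_def[abs_def] gs ga)
qed

lemma (in level_one) CF_GT_in:
  assumes "N > 0" "\<And>n r m. A n r m \<in> L" "0 \<in> L" shows "CF N s GT \<in> L"
  using assms CF_GT[OF assms(1), of "fst s" "fst (snd s)" "snd (snd s)"] by auto

context siegel_form
begin

abbreviation GP :: "nat \<Rightarrow> complex \<Rightarrow> complex \<Rightarrow> complex \<Rightarrow> complex"
  where "GP i \<equiv> (\<lambda>\<tau> z t. GG i (siegel_point \<tau> z t))"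

abbreviation GC :: "nat \<Rightarrow> idx3 \<Rightarrow> complex"
  where "GC i s \<equiv> CF N s (level_one.GT (GP i))"

lemma level_one_GP: "level_one (k * i) (GP i)"
  by (rule level_one.intro[OF lev1_GG])

lemma N_pos: "N > 0"
  using cs by (simp add: congruence_subgroup_def)

lemma continuous_F: "continuous_on TT (\<lambda>w. F (spt w))"
  using cdiff_F cdiff_continuous TT_D3 by (intro continuous_at_imp_continuous_on) blast

lemma GC_supp: "s \<notin> cone3 \<Longrightarrow> GC i s = 0"
  by (rule level_one.CF_GT_supp[OF level_one_GP N_pos])

lemma GC_0: "GC 0 0 = 1"
proof -
  interpret level_one "k * 0" "GP 0" by (rule level_one_GP)
  have "A 0 0 0 = 1"
    unfolding A_def PP_def ph_def by (simp add: GG_0 fc_const)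
  then show ?thesis using CF_GT[OF N_pos, of 0 0 0] by (simp add: zero_prod_def)
qed

lemma GC_relation:
  assumes sm: "\<And>w. w \<in> TT \<Longrightarrow> ((\<lambda>t. a t * chr N t w) has_sum F (spt w)) UNIV" and a: "\<And>t. t \<notin> cone3 \<Longrightarrow> a t = 0"
  shows "(\<Sum>l\<le>card RC. (Mc a ^^ (card RC - l)) (GC l) s) = 0"
proof -
  have cG: "continuous_on TT (level_one.GT (GP l))" for l
    by (rule continuous_on_subset[OF level_one.continuous_GT[OF level_one_GP] TT_D3])
  have "(\<Sum>l\<le>card RC. (Mc a ^^ (card RC - l)) (GC l) s) = (\<Sum>l\<le>card RC. CF N s (\<lambda>w. F (spt w) ^ (card RC - l) * level_one.GT (GP l) w))"
    using fun_cong[OF CF_pow_series[OF N_pos continuous_F cG sm a GC_supp]] by simp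
  also have "\<dots> = CF N s (\<lambda>w. \<Sum>l\<le>card RC. F (spt w) ^ (card RC - l) * level_one.GT (GP l) w)"
    by (intro CF_sum[symmetric] continuous_intros continuous_F cG) auto
  also have "\<dots> = CF N s (\<lambda>w. 0)"
  proof (rule CF_cong)
    fix w assume "w \<in> TT"
    then have "spt w \<in> siegel_upper_half_space" using TT_D3 spt_siegel by blast
    from GG_relation[OF this] show "(\<Sum>l\<le>card RC. F (spt w) ^ (card RC - l) * level_one.GT (GP l) w) = 0"
      by (simp add: level_one.GT_def[OF level_one_GP] mult.commute)
  qed
  also have "\<dots> = 0" by (simp add: CF_def)
  finally show ?thesis .
qed

text \<open>Finitely many coefficients have a common exponent e, and the level one bound for the
  module of x with p^e f(x) p-integral extends it to all of them.\<close>

lemma GC_bounded_denominators: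
  fixes f :: "complex \<Rightarrow> complex"
  assumes p: "prime p" "p \<ge> 5"
    and f: "\<And>x y. f (x + y) = f x + f y" "\<And>q x. q \<in> \<rat> \<Longrightarrow> f (q * x) = q * f x" "\<And>x. f x \<in> \<rat>"
  shows "\<exists>e. \<forall>s. of_nat p ^ e * f (GC l s) \<in> p_integral p"
proof -
  interpret level_one "k * l" "GP l" by (rule level_one_GP)
  \<comment> \<open>By \<open>A_supp\<close> nonzero coefficients satisfy |r| <= n + m, so this box
    holds all those within the level one bound.\<close>
  define S where "S = {0..int (k * l)} \<times> {- 2 * int (k * l)..2 * int (k * l)} \<times> {0..int (k * l)}"
  have "\<exists>e. \<forall>x\<in>S. of_nat p ^ e * f (A (fst x) (fst (snd x)) (snd (snd x))) \<in> p_integral p"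
  proof (rule finite_uniform_exponent)
    show "\<exists>e. of_nat p ^ e * f (A (fst x) (fst (snd x)) (snd (snd x))) \<in> p_integral p" for x
      using Rats_p_integral[OF p(1) f(3)] by blast
  qed (use p_integral_power_mono[OF p(1)] in \<open>simp_all add: S_def\<close>)
  then obtain e where e: "\<And>x. x \<in> S \<Longrightarrow> of_nat p ^ e * f (A (fst x) (fst (snd x)) (snd (snd x))) \<in> p_integral p" by blast
  define L where "L = {x. of_nat p ^ e * f x \<in> p_integral p}"
  have L: "zpmod p L"
    unfolding L_def
  proof (rule zpmod_preimage[OF zpmod_p_integral[OF p(1)]])
    show "of_nat p ^ e * f (c * x) = c * (of_nat p ^ e * f x)" if "c \<in> p_integral p" for c x
      by (simp add: f(2)[OF p_integral_Rats[OF that]])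
  qed (simp add: f(1) distrib_left)
  have "A n r m \<in> L" for n r m
  proof (rule lev1_sturm[OF p L])
    show "even (k * l)" using ek by simp
    fix n r m :: int assume h: "0 \<le> n" "0 \<le> m" "10 * n \<le> int (k * l)" "10 * m \<le> int (k * l)"
    show "A n r m \<in> L"
    proof (cases "\<bar>r\<bar> \<le> n + m")
      case True
      then have "(n, r, m) \<in> S" unfolding S_def using h by auto
      from e[OF this] show ?thesis by (simp add: L_def)
    next
      case False
      then show ?thesis using A_supp[of n m r] L by (auto simp: zpmod_def)
    qed
  qed
  then have "GC l s \<in> L" for s
    using CF_GT_in[OF N_pos] L by (auto simp: zpmod_def)
  then show ?thesis unfolding L_def by blast
qed

lemma sturm:
  assumes p: "prime p" "p \<ge> 5"
    and a: "\<And>t. a t \<in> p_integral p" "\<And>t. t \<notin> cone3 \<Longrightarrow> a t = 0"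
    and sm: "\<And>w. w \<in> TT \<Longrightarrow> ((\<lambda>t. a t * chr N t w) has_sum F (spt w)) UNIV"
    and box: "\<And>n r m. 10 * n \<le> int N * int k * int (card RC) \<Longrightarrow> 10 * m \<le> int N * int k * int (card RC) \<Longrightarrow> a (n, r, m) \<in> mp p"
  shows "a t \<in> mp p"
proof (rule ccontr)
  assume "a t \<notin> mp p"
  then have anz: "\<exists>t. a t \<notin> mp p" by blast
  obtain f :: "complex \<Rightarrow> complex" where f: "f 1 = 1" "\<And>x y. f (x + y) = f x + f y" "\<And>q x. q \<in> \<rat> \<Longrightarrow> f (q * x) = q * f x" "\<And>x. f x \<in> \<rat>"
    using rational_projection by blast
  have f0: "f 0 = 0" using f(2)[of 0 0] by simp
  define n where "n = card RC"
  define d where "d e l s = of_nat p ^ e * f (GC l s)" for e l s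
  define P where "P e \<longleftrightarrow> (\<forall>l\<le>n. \<forall>s. d e l s \<in> p_integral p)" for e
  have "\<exists>e. \<forall>l\<in>{..n}. \<forall>s. of_nat p ^ e * f (GC l s) \<in> p_integral p"
  proof (rule finite_uniform_exponent)
    show "\<exists>e. \<forall>s. of_nat p ^ e * f (GC l s) \<in> p_integral p" for l
      by (rule GC_bounded_denominators[OF p f(2,3,4)])
  qed (use p_integral_power_mono[OF p(1)] in blast)+
  then have "\<exists>e. P e" unfolding P_def d_def atMost_iff Ball_def by blast
  \<comment> \<open>Minimality gives a coefficient not divisible by p: otherwise e could be lowered,
    or e = 0 and the coefficient f(1) = 1 of G_0 would be divisible by p.\<close>
  define e where "e = (LEAST e. P e)"
  have Pe: "P e" unfolding e_def by (rule LeastI_ex) fact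
  have p0: "(of_nat p :: complex) \<noteq> 0" using p(1) by (simp add: prime_nat_iff)
  have ex: "\<exists>l\<le>n. \<exists>s. d e l s \<notin> mp p"
  proof (rule ccontr)
    assume "\<not> ?thesis"
    then have all: "d e l s \<in> mp p" if "l \<le> n" for l s using that by blast
    show False
    proof (cases e)
      case 0
      then show False using all[of 0 0] one_notin_mp[OF p(1)] by (simp add: d_def GC_0 f(1))
    next
      case (Suc e')
      have "P e'" unfolding P_def
      proof (intro allI impI)
        fix l s assume "l \<le> n"
        from all[OF this, of s] obtain y where "y \<in> p_integral p" "d e l s = of_nat p * y" by (auto simp: mp_iff)
        then show "d e' l s \<in> p_integral p" using p0 by (simp add: d_def Suc mult.assoc)
      qed
      then have "e \<le> e'" unfolding e_def by (rule Least_le)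
      then show False using Suc by simp
    qed
  qed
  define j where "j = Max {l. l \<le> n \<and> (\<exists>s. d e l s \<notin> mp p)}"
  have fin: "finite {l. l \<le> n \<and> (\<exists>s. d e l s \<notin> mp p)}" by simp
  have "j \<in> {l. l \<le> n \<and> (\<exists>s. d e l s \<notin> mp p)}" unfolding j_def by (rule Max_in[OF fin]) (use ex in blast)
  then have j: "j \<le> n" "\<exists>s. d e j s \<notin> mp p" by auto
  have jmax: "d e l s \<in> mp p" if "j < l" "l \<le> n" for l s
    using Max_ge[OF fin, of l] that unfolding j_def[symmetric] by (metis (mono_tags, lifting) mem_Collect_eq not_le)
  define g where "g x = of_nat p ^ e * f x" for x
  have g: "g (x + y) = g x + g y" "g (a t * x) = a t * g x" for x y t
    unfolding g_def using f(2) f(3)[OF p_integral_Rats[OF a(1)]] by (simp_all add: algebra_simps)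
  have gsum: "g (\<Sum>l\<le>m. h l) = (\<Sum>l\<le>m. g (h l))" for h :: "nat \<Rightarrow> complex" and m
    by (induction m) (simp_all add: g(1))
  have d: "d e l = (\<lambda>s. g (GC l s))" for l by (auto simp: d_def g_def)
  have rel: "(\<Sum>l\<le>n. (Mc a ^^ (n - l)) (d e l) s) = 0" for s
  proof -
    have "(\<Sum>l\<le>n. (Mc a ^^ (n - l)) (d e l) s) = g (\<Sum>l\<le>n. (Mc a ^^ (n - l)) (GC l) s)"
      unfolding d gsum Mc_pow_map[of g a, OF g] ..
    also have "(\<Sum>l\<le>n. (Mc a ^^ (n - l)) (GC l) s) = 0" unfolding n_def by (rule GC_relation[OF sm a(2)])
    also have "g 0 = 0" by (simp add: g_def f0)
    finally show ?thesis .
  qed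
  interpret level_one "k * j" "GP j" by (rule level_one_GP)
  define L where "L = {x. g x \<in> mp p}"
  have L: "zpmod p L"
    unfolding L_def
  proof (rule zpmod_preimage[OF zpmod_mp[OF p(1)] g(1)])
    show "g (c * x) = c * g x" if "c \<in> p_integral p" for c x
      by (simp add: g_def f(3)[OF p_integral_Rats[OF that]])
  qed
  have "A x r m \<in> L" for x r m
  proof (rule lev1_sturm[OF p L])
    show "even (k * j)" using ek by simp
    fix x r m :: int assume h: "0 \<le> x" "0 \<le> m" "10 * x \<le> int (k * j)" "10 * m \<le> int (k * j)"
    \<comment> \<open>Indices of F are scaled by N, those of level one forms are not. The weight k j
      is at most k times the number of cosets, so the box assumed for F covers the box required for
      G_j.\<close>
    have bound: "10 * y' \<le> int N * int k * int (card RC)" if "y' \<le> int N * y" "10 * y \<le> int (k * j)" for y y'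
    proof -
      have "10 * y' \<le> int N * (10 * y)" using that(1) by simp
      also have "\<dots> \<le> int N * int (k * j)" by (rule mult_left_mono[OF that(2)]) simp
      also have "\<dots> \<le> int N * int (k * n)" using j(1) by (intro mult_left_mono) (auto intro: mult_left_mono)
      finally show ?thesis by (simp add: n_def mult.assoc)
    qed
    have "d e j (int N * x, int N * r, int N * m) \<in> mp p"
    proof (rule leading_coefficient_mp[OF p(1) a(1) a(2) anz _ _ rel j(1) jmax])
      fix t assume t: "t \<in> Bx (int N * x, int N * r, int N * m)"
      then have "fst t \<le> int N * x" "snd (snd t) \<le> int N * m" by (auto simp: Bx_def)
      then have "a (fst t, fst (snd t), snd (snd t)) \<in> mp p" using bound h by (intro box) auto
      then show "a t \<in> mp p" by simp
    next
      fix l s assume "l \<le> n" then show "d e l s \<in> p_integral p" using Pe unfolding P_def by blast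
    next
      fix l s assume "s \<notin> cone3" then show "d e l s = 0" by (simp add: d_def GC_supp f0)
    qed
    then show "A x r m \<in> L" using CF_GT[OF N_pos, of "int N * x" "int N * r" "int N * m"] N_pos by (simp add: d L_def)
  qed
  then have "GC j s \<in> L" for s
    using CF_GT_in[OF N_pos] L by (auto simp: zpmod_def)
  then show False using j(2) by (auto simp: L_def d)
qed

end

section \<open>Passage from Fourier indices to integer triples\<close>

definition icone :: "idx3 set"
  where "icone = {(n, r, m). 0 \<le> n \<and> 0 \<le> m \<and> r\<^sup>2 \<le> 4 * n * m}"

text \<open>Because 4nm <= (n + m)^2.\<close>

lemma icone_cone3: "icone \<subseteq> cone3"
proof
  fix s assume "s \<in> icone"
  then obtain n r m where s: "s = (n, r, m)" "0 \<le> n" "0 \<le> m" "r\<^sup>2 \<le> 4 * n * m" by (auto simp: icone_def)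
  have "(n + m)\<^sup>2 - 4 * n * m = (n - m)\<^sup>2" by (simp add: power2_eq_square algebra_simps)
  then have "r\<^sup>2 \<le> (n + m)\<^sup>2" using s(4) zero_le_power2[of "n - m"] by linarith
  then have "\<bar>r\<bar> \<le> n + m" using s(2,3) by (simp add: abs_le_square_iff[symmetric])
  then show "s \<in> cone3" using s by (simp add: cone3_def)
qed

lemma fourier_index_bij:
  assumes N: "N > 0"
  shows "bij_betw (\<lambda>(n, r, m). (of_int n / of_nat N, of_int r / of_nat N, of_int m / of_nat N)) icone (fourier_index N)"
proof (rule bij_betwI[where g = "\<lambda>(n, r, m). (\<lfloor>real N * n\<rfloor>, \<lfloor>real N * r\<rfloor>, \<lfloor>real N * m\<rfloor>)"])
  have iff: "(real_of_int r / real N)\<^sup>2 \<le> 4 * (of_int n / real N) * (of_int m / real N) \<longleftrightarrow> r\<^sup>2 \<le> 4 * n * m" for n r m :: int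
  proof -
    have "(real_of_int r / real N)\<^sup>2 \<le> 4 * (of_int n / real N) * (of_int m / real N) \<longleftrightarrow> (real_of_int r)\<^sup>2 \<le> 4 * of_int n * of_int m"
      using N by (simp add: power_divide power2_eq_square divide_le_cancel)
    also have "\<dots> \<longleftrightarrow> real_of_int (r\<^sup>2) \<le> real_of_int (4 * n * m)" by simp
    finally show ?thesis by (simp only: of_int_le_iff)
  qed
  show "(\<lambda>(n, r, m). (of_int n / of_nat N, of_int r / of_nat N, of_int m / of_nat N)) \<in> icone \<rightarrow> fourier_index N"
    using N iff by (auto simp: icone_def fourier_index_def)
  show "(\<lambda>(n, r, m). (\<lfloor>real N * n\<rfloor>, \<lfloor>real N * r\<rfloor>, \<lfloor>real N * m\<rfloor>)) \<in> fourier_index N \<rightarrow> icone"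
  proof
    fix x assume "x \<in> fourier_index N"
    then obtain n r m where x: "x = (n, r, m)" "real N * n \<in> \<int>" "real N * r \<in> \<int>" "real N * m \<in> \<int>" "0 \<le> n" "0 \<le> m" "r\<^sup>2 \<le> 4 * n * m"
      by (auto simp: fourier_index_def)
    have e: "real N * y \<in> \<int> \<Longrightarrow> of_int \<lfloor>real N * y\<rfloor> / real N = y" for y using N by (simp add: of_int_floor)
    have "\<lfloor>real N * r\<rfloor>\<^sup>2 \<le> 4 * \<lfloor>real N * n\<rfloor> * \<lfloor>real N * m\<rfloor>"
      using iff[of "\<lfloor>real N * r\<rfloor>" "\<lfloor>real N * n\<rfloor>" "\<lfloor>real N * m\<rfloor>"] x e by simp
    then show "(case x of (n, r, m) \<Rightarrow> (\<lfloor>real N * n\<rfloor>, \<lfloor>real N * r\<rfloor>, \<lfloor>real N * m\<rfloor>)) \<in> icone"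
      using x by (simp add: icone_def)
  qed
qed (use N in \<open>auto simp: fourier_index_def of_int_floor\<close>)

theorem theorem1p1:
  fixes k p N :: nat
    and \<Gamma> :: "mat4 set"
    and F :: "complex ^ 2 ^ 2 \<Rightarrow> complex"
    and A :: "real \<Rightarrow> real \<Rightarrow> real \<Rightarrow> complex"
  assumes "even k" and "k > 0"
    and "prime p" and "p \<ge> 5"
    and "congruence_subgroup \<Gamma> N"
    and "siegel_modular_form k \<Gamma> F"
    and "has_fourier_expansion F N A"
    and "\<And>n r m. (n, r, m) \<in> fourier_index N \<Longrightarrow> A n r m \<in> p_integral p"
    and "\<And>n r m. (n, r, m) \<in> fourier_index N \<Longrightarrow>
           0 \<le> n \<Longrightarrow> n \<le> real k / 10 * real (Sp2Z_index \<Gamma>) \<Longrightarrow>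
           0 \<le> m \<Longrightarrow> m \<le> real k / 10 * real (Sp2Z_index \<Gamma>) \<Longrightarrow>
           cong_zero_mod (A n r m) p"
  shows "\<forall>n r m. (n, r, m) \<in> fourier_index N \<longrightarrow> cong_zero_mod (A n r m) p"
proof -
  interpret siegel_form k N \<Gamma> F by unfold_locales (fact assms)+
  define h :: "idx3 \<Rightarrow> real \<times> real \<times> real" where "h = (\<lambda>(n, r, m). (of_int n / of_nat N, of_int r / of_nat N, of_int m / of_nat N))"
  define A3 where "A3 = (\<lambda>(n, r, m). A n r m)"
  define a where "a t = (if t \<in> icone then A3 (h t) else 0)" for t
  have bij: "bij_betw h icone (fourier_index N)" unfolding h_def by (rule fourier_index_bij[OF N_pos])
  have hin: "h t \<in> fourier_index N" if "t \<in> icone" for t using bij that by (auto simp: bij_betw_def)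
  have Z: "zpmod p (mp p)" by (rule zpmod_mp[OF assms(3)])
  have "a t \<in> mp p" for t
  proof (rule sturm[OF assms(3,4)])
    show "a t \<in> p_integral p" for t
      using assms(8) hin[of t] p_integral_0[OF assms(3)] by (cases "h t") (auto simp: a_def A3_def)
    show "a t = 0" if "t \<notin> cone3" for t
      using that icone_cone3 by (auto simp: a_def)
    show "((\<lambda>t. a t * chr N t w) has_sum F (spt w)) UNIV" if w: "w \<in> TT" for w
    proof -
      let ?E = "\<lambda>(n, r, m). A n r m * exp (2 * of_real pi * \<i> * (of_real n * fst w + of_real r * fst (snd w) + of_real m * snd (snd w)))"
      have "spt w \<in> siegel_upper_half_space" using w TT_D3 spt_siegel by blast
      then have "(?E has_sum F (spt w)) (fourier_index N)"
        using assms(7) by (simp add: has_fourier_expansion_def)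
      then have "((\<lambda>t. ?E (h t)) has_sum F (spt w)) icone"
        using has_sum_reindex_bij_betw[OF bij] by blast
      then show ?thesis
      proof (rule has_sum_cong_neutral[THEN iffD1, rotated -1])
        fix t assume "t \<in> icone \<inter> UNIV"
        moreover obtain n r m where t: "t = (n, r, m)" by (cases t)
        ultimately show "?E (h t) = a t * chr N t w"
          by (simp add: a_def A3_def h_def chr_def ee_def add_divide_distrib)
      qed (auto simp: a_def)
    qed
    fix n r m :: int
    assume b: "10 * n \<le> int N * int k * int (card RC)" "10 * m \<le> int N * int k * int (card RC)"
    show "a (n, r, m) \<in> mp p"
    proof (cases "(n, r, m) \<in> icone")
      case False then show ?thesis using Z by (simp add: a_def zpmod_def)
    next
      case True
      have q: "real_of_int y / real N \<le> real k / 10 * real (Sp2Z_index \<Gamma>)" if "10 * y \<le> int N * int k * int (card RC)" for y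
      proof -
        have "real_of_int (10 * y) \<le> real_of_int (int N * int k * int (card RC))" using that by (simp only: of_int_le_iff)
        then show ?thesis using N_pos by (simp add: Sp2Z_index_def field_simps)
      qed
      have "cong_zero_mod (A (of_int n / of_nat N) (of_int r / of_nat N) (of_int m / of_nat N)) p"
        by (rule assms(9)) (use hin[OF True] q[OF b(1)] q[OF b(2)] True in \<open>auto simp: h_def icone_def\<close>)
      then show ?thesis using True by (simp add: a_def A3_def h_def mp_def)
    qed
  qed
  then have "A3 x \<in> mp p" if "x \<in> fourier_index N" for x
    using that bij unfolding bij_betw_def a_def by (metis imageE)
  then show ?thesis by (auto simp: A3_def mp_def)
qed

end
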